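(* Assume the Riemann Hypothesis. Let $a,c$ be two fixed integers such that $1\le a<c\le \frac{9a}{2}$. Then for every $\varepsilon>0$, $$\Delta_2(a;c;x)\ll x^{\frac{7}{8c+6a}+\varepsilon}.$$
   Context: $\zeta$ is the Riemann zeta-function and $\mu_2$ is defined by $\sum_{n\ge1}\mu_2(n)n^{-s}=\zeta(s)^{-2}$ for $\Re s>1$. Put $u_2(a;c;n)=\sum_{l^ad^c=n}\mu_2(d)$ (sum over positive integers $l,d$), and $$\Delta_2(a;c;x)=\sum_{n\le x}u_2(a;c;n)-\frac{x^{1/a}}{\zeta^2(c/a)},\qquad x\ge2.$$ Implied constants depend only on $a,c,\varepsilon$. *)

theory Defs
  imports "HOL-Complex_Analysis.Complex_Analysis"
begin

(* The meromorphic continuation of the Dirichlet series to the whole plane.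
   It is unique on the connected open set - {1}; the clause f 1 = 0 only fixes a
   dummy value at the pole, so that f is determined as a total function. *)
definition zeta :: "complex \<Rightarrow> complex" where
  "zeta = (THE f. f holomorphic_on (- {1}) \<and>
                  (\<forall>s. Re s > 1 \<longrightarrow> (\<lambda>n. of_nat (Suc n) powr (- s)) sums f s) \<and>
                  f 1 = 0)"

definition riemann_hypothesis :: bool where
  "riemann_hypothesis \<longleftrightarrow> (\<forall>s. 0 < Re s \<and> Re s < 1 \<and> zeta s = 0 \<longrightarrow> Re s = 1 / 2)"

(* The coefficients of the Dirichlet series of zeta^(-2), uniquely determined for n \<ge> 1;
   m 0 = 0 is the usual dummy value of an arithmetical function at 0. *)
definition mu2 :: "nat \<Rightarrow> complex" where
  "mu2 = (THE m. m 0 = 0 \<and>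
                 (\<forall>s. Re s > 1 \<longrightarrow>
                    (\<lambda>n. m (Suc n) * of_nat (Suc n) powr (- s)) sums (1 / zeta s ^ 2)))"

definition u2 :: "nat \<Rightarrow> nat \<Rightarrow> nat \<Rightarrow> complex" where
  "u2 a c n = (\<Sum>(l, d) \<in> {(l, d). l > 0 \<and> d > 0 \<and> l ^ a * d ^ c = n}. mu2 d)"

definition Delta2 :: "nat \<Rightarrow> nat \<Rightarrow> real \<Rightarrow> complex" where
  "Delta2 a c x = (\<Sum>n \<in> {n. 1 \<le> n \<and> real n \<le> x}. u2 a c n)
                  - of_real (x powr (1 / real a)) / zeta (of_real (real c / real a)) ^ 2"

end

theory Submission
  imports Defs "HOL-Computational_Algebra.Squarefree" "HOL-Number_Theory.Prime_Powers"
begin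

text \<open>
  Put \<open>X = x\<^bsup>1/a\<^esup>\<close>, \<open>\<kappa> = c/a\<close> and \<open>y = x\<^bsup>8/(8c+6a)\<^esup>\<close>, so that \<open>X = y\<^bsup>\<kappa>+3/4\<^esup>\<close>, and split the sum of \<open>mu2 d\<close> over
  \<open>l\<^bsup>a\<^esup> d\<^bsup>c\<^esup> \<le> x\<close> by a piecewise linear weight which is 1 for \<open>d \<le> y\<close> and 0 for \<open>d \<ge> 2y\<close>. Under the Riemann
  Hypothesis \<open>zeta\<close> and \<open>1/zeta\<close> are \<open>O(|t|\<^bsup>\<epsilon>\<^esup>)\<close> to the right of the critical line, so a Perron formula with a
  Riesz kernel shows that the difference between \<open>1/zeta\<^sup>2\<close> and its weighted partial sum is
  \<open>O(y\<^bsup>1/2-\<sigma>+\<epsilon>\<^esup>)\<close>; a second application of the formula to \<open>zeta(a w)\<close> times this difference at \<open>c w\<close>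
  handles the large \<open>d\<close>. For the small \<open>d\<close>, counting \<open>l\<close> exactly leaves the sum of
  \<open>mu2 d (\<lfloor>X d\<^bsup>-\<kappa>\<^esup>\<rfloor> - X d\<^bsup>-\<kappa>\<^esup> + 1/2)\<close>, which is \<open>O(y\<^bsup>7/8+\<epsilon>\<^esup>)\<close>: the sawtooth function is approximated by
  exponentials, and a Vaughan-type identity for \<open>1/zeta\<^sup>2\<close> produces type I sums, treated by the second derivative
  test, and type II sums. In the latter the frequency \<open>h\<close> is grouped with the short variable \<open>n\<close>, and the pairs
  \<open>(h, n)\<close> are compared after Cauchy--Schwarz only when the values \<open>h n\<^bsup>-\<kappa>\<^esup>\<close> are close. The choice of \<open>y\<close>
  balances the two contributions.
\<close>


text \<open>With X = x^(1/a), the divisors up to 2y cost y^(7/8) and the larger ones X^(1/2) y^(1/2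
  - \<kappa>/2), up to factors x^\<epsilon>. The two agree exactly for X = y^(\<kappa> + 3/4), and
  then y^(7/8) = x^(7/(8c + 6a)). The cutoff is piecewise linear because its Perron kernel decays
  quadratically: bounds of size |t|^\<epsilon> then give absolutely convergent integrals on the
  shifted lines. The weight is monotone, so partial summation removes it again from the floor sum,
  where exponential sums over plain intervals are wanted. The restriction c <= 9a/2 is what lets the
  type I and type II sums reach y^(7/8) in every block (D, 2D] with y^(7/8) <= D <= 2y. Both
  \<open>zeta\<close> and \<open>mu2\<close> are given by definite descriptions, so the continuation
  and the coefficients of zeta^(-2) have to be constructed, with uniqueness, before anything can be
  said about them. The bound |t|^\<epsilon> under the Riemann Hypothesis is likewise derived from
  the start: polynomial growth, a logarithm of (s - 1) zeta s in the half plane Re s > 1/2, and an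
  interpolation between two circles.\<close>

abbreviation "ecis x \<equiv> cis (2 * pi * x)"
abbreviation "ht s \<equiv> 1 + \<bar>Im s\<bar>"
abbreviation sawt :: "real => real" where "sawt t \<equiv> of_int \<lfloor>t\<rfloor> - t + 1/2"
abbreviation "cof D E n \<equiv> {m::nat. D < real m * real (n::nat) \<and> real m * real n <= E}"
abbreviation "segc a b c d \<equiv> closed_segment (Complex a b) (Complex c d)"
abbreviation "linc a b c d \<equiv> linepath (Complex a b) (Complex c d)"
abbreviation "rpath a b T \<equiv> rectpath (Complex a (-T)) (Complex b T)"

section \<open>Exponential sums\<close>

lemma sin_pi_lower:
 assumes "0 <= (x::real)" "x <= 1/2" shows "2 * x <= sin (pi * x)"
proof -
 have "concave_on {0..pi} sin"
  unfolding concave_on_def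
 proof (rule f''_ge0_imp_convex)
  show "convex {0..pi}" by simp
  show "DERIV (%x. - sin x) x :> - cos x" for x :: real
   by (auto intro!: derivative_eq_intros)
  show "DERIV (%x. - cos x) x :> sin x" for x :: real
   by (auto intro!: derivative_eq_intros)
  show "x \<in> {0..pi} ==> 0 <= sin x" for x by (simp add: sin_ge_zero)
 qed
 from concave_onD[OF this, of "2 * x" 0 "pi/2"] assms
 show ?thesis by (simp add: mult.commute)
qed

text \<open>The reciprocal of 1 - e^(it) has constant real part 1/2, and its imaginary part is half
  a cotangent. Its variation along a sequence is therefore that of one real function.\<close>

lemma one_div_one_minus_cis:
 assumes "sin (t/2) ~= 0"
 shows "(1 - cis t) * Complex (1/2) (cos (t/2) / sin (t/2) / 2) = 1"
proof -
 define a where "a = t/2"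
 have t: "t = 2 * a" by (simp add: a_def)
 have s: "sin a ~= 0" using assms by (simp add: a_def)
 have c2: "cos a * cos a = 1 - sin a * sin a"
  using sin_cos_squared_add[of a] by (simp add: power2_eq_square)
 have cis: "1 - cis (2 * a) = Complex (2 * sin a * sin a) (- (2 * sin a * cos a))"
  by (simp add: complex_eq_iff cos_double sin_double power2_eq_square c2)
 have "Complex (2 * sin a * sin a) (- (2 * sin a * cos a)) * Complex (1/2) (cos a / sin a / 2)
   = Complex (sin a * sin a + cos a * cos a) 0"
  using s by (simp add: complex_eq_iff field_simps)
 also have "... = 1" using c2 by (simp add: complex_eq_iff)
 finally show ?thesis unfolding t cis by simp
qed

text \<open>Each term is a difference with a factor, e(f n) = c_n (e(f n) - e(f(n+1))) where c_n =
  1/(1 - e(g n)). Partial summation leaves two boundary terms and the total variation of c_n. Only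
  the cotangent in c_n varies, and it is monotone because \<open>g\<close> is, so the variation
  telescopes. The distance of \<open>g\<close> from the integers bounds the cotangent.\<close>

theorem kusmin_landau:
 fixes f :: "nat => real"
 defines "g \<equiv> %n. f (Suc n) - f n"
 assumes th: "0 < \<theta>" and k: "k \<in> \<int>"
  and lo: "!!n. a <= n ==> n < b ==> k + \<theta> <= g n"
  and hi: "!!n. a <= n ==> n < b ==> g n <= k + 1 - \<theta>"
  and mono: "!!n. a <= n ==> Suc n < b ==> g n <= g (Suc n)"
 shows "cmod (\<Sum>n\<in>{a..<b}. ecis (f n)) <= 1 / \<theta>"
proof (cases "a < b")
 case False
 then show ?thesis using th by simp
next
 case True
 define E where "E n = ecis (f n)" for n
 define C where "C n = cot (pi * (g n - k))" for n
 define c where "c n = Complex (1/2) (C n / 2)" for n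
 obtain k' :: int where k': "k = of_int k'" using k by (auto elim: Ints_cases)
 have sinlow: "2 * \<theta> <= sin (pi * (g n - k))" if "a <= n" "n < b" for n
 proof -
  define u where "u = g n - k"
  have u: "\<theta> <= u" "u <= 1 - \<theta>" using lo[OF that] hi[OF that] by (auto simp: u_def)
  have "2 * \<theta> <= sin (pi * u)"
  proof (cases "u <= 1/2")
   case True
   then have "2 * u <= sin (pi * u)" using sin_pi_lower[of u] u th by auto
   then show ?thesis using u by linarith
  next
   case False
   then have "2 * (1 - u) <= sin (pi * (1 - u))" using sin_pi_lower[of "1 - u"] u th by auto
   moreover have "sin (pi * (1 - u)) = sin (pi * u)"
    by (simp add: right_diff_distrib sin_diff)
   ultimately have "2 * (1 - u) <= sin (pi * u)" by (simp only:)
   moreover have "2 * \<theta> <= 2 * (1 - u)" using u by simp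
   ultimately show ?thesis by (rule order_trans[rotated])
  qed
  then show ?thesis by (simp add: u_def)
 qed
 have cb: "cmod (c n) <= 1 / (4 * \<theta>)" and Cb: "\<bar>C n\<bar> <= 1 / (2 * \<theta>)"
  and rel: "E n = c n * (E n - E (Suc n))" if "a <= n" "n < b" for n
 proof -
  let ?u = "pi * (g n - k)"
  have s: "2 * \<theta> <= sin ?u" by (rule sinlow[OF that])
  then have s0: "sin ?u > 0" using th by linarith
  have "cis (2 * ?u) = ecis (g n) * cis (- (2 * pi * k))"
   by (simp add: cis_mult algebra_simps)
  moreover have "cis (- (2 * pi * k)) = 1"
  proof -
   have "cis (2 * pi * of_int (- k')) = 1" by (rule cis_multiple_2pi) auto
   then show ?thesis by (simp add: k')
  qed
  ultimately have e1: "cis (2 * ?u) = ecis (g n)" by simp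
  have e2: "E (Suc n) = E n * ecis (g n)"
   by (simp add: E_def cis_mult g_def algebra_simps)
  have "(1 - cis (2 * ?u)) * Complex (1/2) (cos ?u / sin ?u / 2) = 1"
   using one_div_one_minus_cis[of "2 * ?u"] s0 by simp
  then have one: "(1 - ecis (g n)) * c n = 1"
   unfolding e1 c_def C_def cot_def .
  then have "E n = E n * ((1 - ecis (g n)) * c n)" by simp
  then show "E n = c n * (E n - E (Suc n))" by (simp add: e2 algebra_simps)
  have cn: "(cmod (c n))^2 = 1 / (4 * (sin ?u)^2)"
  proof -
   have "(cmod (c n))^2 = (1 + (C n)^2) / 4"
    by (simp add: c_def cmod_power2 power_divide add_divide_distrib)
   also have "1 + (C n)^2 = 1 / (sin ?u)^2"
    using s0 sin_cos_squared_add[of ?u] unfolding C_def cot_def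
    by (simp add: power_divide field_simps)
   finally show ?thesis by simp
  qed
  then have "(cmod (c n))^2 = (1 / (2 * sin ?u))^2" by (simp add: power_divide power_mult_distrib)
  then have "cmod (c n) = 1 / (2 * sin ?u)"
   using s0 by (subst (asm) power2_eq_iff_nonneg) auto
  also have "... <= 1 / (4 * \<theta>)" using s s0 th by (auto simp: field_simps)
  finally show cc: "cmod (c n) <= 1 / (4 * \<theta>)" .
  have "\<bar>Im (c n)\<bar> <= 1 / (4 * \<theta>)" using abs_Im_le_cmod[of "c n"] cc by linarith
  then show "\<bar>C n\<bar> <= 1 / (2 * \<theta>)" by (simp add: c_def field_simps)
 qed
 have Cmono: "C (Suc n) <= C n" if "a <= n" "Suc n < b" for n
 proof -
  have g1: "\<theta> <= g n - k" "g n <= g (Suc n)" "g (Suc n) - k <= 1 - \<theta>"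
   using lo[of n] hi[of "Suc n"] mono[of n] that by auto
  define u v where "u = pi * (g n - k)" and "v = pi * (g (Suc n) - k)"
  have su: "sin u > 0" "sin v > 0" using sinlow[of n] sinlow[of "Suc n"] that th by (auto simp: u_def v_def)
  have "0 <= v - u" using g1 by (simp add: u_def v_def)
  moreover have "v - u <= pi"
  proof -
   have "g (Suc n) - g n <= 1" using g1 th by linarith
   then have "pi * (g (Suc n) - g n) <= pi * 1" by (intro mult_left_mono) auto
   then show ?thesis by (simp add: u_def v_def algebra_simps)
  qed
  ultimately have "0 <= sin (v - u)" by (rule sin_ge_zero)
  then have "sin u * cos v <= cos u * sin v" by (simp add: sin_diff algebra_simps)
  then show ?thesis unfolding C_def cot_def u_def[symmetric] v_def[symmetric] using su by (simp add: field_simps)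
 qed
 \<comment> \<open>Abel summation. For \<open>Suc m = b\<close> the boundary value
   \<open>E (Suc m)\<close> lies just outside the range of summation.\<close>
 have main: "(\<Sum>n\<in>{a..<Suc m}. E n) = c a * E a - c m * E (Suc m) + (\<Sum>n\<in>{a..<m}. (c (Suc n) - c n) * E (Suc n))"
  if "a <= m" "m < b" for m
  using that
 proof (induction m rule: nat_induct_at_least)
  case base
  then show ?case using rel[of a] by (simp add: algebra_simps)
 next
  case (Suc m)
  then have "(\<Sum>n\<in>{a..<Suc m}. E n) = c a * E a - c m * E (Suc m) + (\<Sum>n\<in>{a..<m}. (c (Suc n) - c n) * E (Suc n))"
   by auto
  moreover have "E (Suc m) = c (Suc m) * (E (Suc m) - E (Suc (Suc m)))" using rel[of "Suc m"] Suc by auto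
  moreover have "(\<Sum>n\<in>{a..<Suc (Suc m)}. E n) = (\<Sum>n\<in>{a..<Suc m}. E n) + E (Suc m)"
   "(\<Sum>n\<in>{a..<Suc m}. (c (Suc n) - c n) * E (Suc n)) = (\<Sum>n\<in>{a..<m}. (c (Suc n) - c n) * E (Suc n)) + (c (Suc m) - c m) * E (Suc m)"
   using Suc.hyps by (subst sum.atLeastLessThan_Suc; simp)+
  ultimately show ?case by (simp only:) (simp only: left_diff_distrib right_diff_distrib, simp)
 qed
 have tel: "(\<Sum>n\<in>{a..<m}. cmod ((c (Suc n) - c n) * E (Suc n))) <= (C a - C m) / 2"
  if "a <= m" "m < b" for m
  using that
 proof (induction m rule: nat_induct_at_least)
  case (Suc m)
  have "c (Suc m) - c m = \<i> * of_real ((C (Suc m) - C m) / 2)"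
   by (simp add: c_def complex_eq_iff diff_divide_distrib)
  then have "cmod (c (Suc m) - c m) = \<bar>(C (Suc m) - C m) / 2\<bar>" by (metis cmod_unit_one mult_1 norm_ii norm_mult norm_of_real)
  also have "... = (C m - C (Suc m)) / 2" using Cmono[of m] Suc by auto
  finally have "cmod ((c (Suc m) - c m) * E (Suc m)) = (C m - C (Suc m)) / 2"
   by (simp add: E_def norm_mult)
  then show ?case using Suc by (simp add: field_simps)
 qed simp
 obtain m where m: "b = Suc m" "a <= m" using True by (cases b) auto
 have "cmod (\<Sum>n\<in>{a..<b}. E n) <= cmod (c a * E a) + cmod (c m * E (Suc m)) + cmod (\<Sum>n\<in>{a..<m}. (c (Suc n) - c n) * E (Suc n))"
  unfolding m(1) main[OF m(2) lessI[of m, folded m(1)]]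
  by (intro order_trans[OF norm_triangle_ineq] add_mono norm_triangle_ineq4 order_refl)
 also have "... <= 1 / (4*\<theta>) + 1 / (4*\<theta>) + (C a - C m) / 2"
  using cb[of a] cb[of m] m tel[of m] norm_sum[of "%n. (c (Suc n) - c n) * E (Suc n)" "{a..<m}"]
  by (intro add_mono) (auto simp: norm_mult E_def)
 also have "... <= 1 / (4*\<theta>) + 1 / (4*\<theta>) + (1/(2*\<theta>) + 1/(2*\<theta>)) / 2"
 proof -
  have "C a <= 1/(2*\<theta>)" "- C m <= 1/(2*\<theta>)" using Cb[of a] Cb[of m] m by (auto simp: abs_le_iff)
  then have "(C a - C m) / 2 <= (1/(2*\<theta>) + 1/(2*\<theta>)) / 2" by (intro divide_right_mono) linarith+
  then show ?thesis by (rule add_left_mono)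
 qed
 also have "... = 1 / \<theta>" using th by (simp add: field_simps)
 finally show ?thesis by (simp add: E_def)
qed

lemma card_growth:
 fixes g :: "nat => real"
 assumes l: "0 < l" and gr: "!!m n. m \<in> S ==> n \<in> S ==> m < n ==> l * real (n - m) <= g n - g m"
  and S: "finite S" and b: "!!n. n \<in> S ==> p <= g n \<and> g n <= p + w" and w: "0 <= w"
 shows "real (card S) <= w / l + 1"
proof (cases "S = {}")
 case True
 then show ?thesis using l w by simp
next
 case False
 define m n where "m = Min S" and "n = Max S"
 have mn: "m \<in> S" "n \<in> S" "m <= n" using S False by (auto simp: m_def n_def)
 have "S \<subseteq> {m..n}" using S by (auto simp: m_def n_def)
 then have "card S <= card {m..n}" by (intro card_mono) auto
 then have c: "card S <= Suc n - m" by simp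
 have "l * real (n - m) <= w"
 proof (cases "m = n")
  case False
  then have "l * real (n - m) <= g n - g m" using gr mn by auto
  then show ?thesis using b[OF mn(1)] b[OF mn(2)] by linarith
 qed (use w in simp)
 then have "real (n - m) <= w / l" using l by (simp add: field_simps)
 then show ?thesis using c mn by linarith
qed

lemma mono_interval:
 fixes g :: "nat => real"
 assumes mono: "!!m n. a <= m ==> m <= n ==> n < b ==> g m <= g n"
 obtains a' b' where "{n\<in>{a..<b}. p <= g n \<and> g n <= q} = {a'..<b'}" "a <= a'" "b' <= b \<or> a' = b'"
proof (cases "{n\<in>{a..<b}. p <= g n \<and> g n <= q} = {}")
 case True
 then show ?thesis using that[of a a] by auto
next
 case False
 let ?S = "{n\<in>{a..<b}. p <= g n \<and> g n <= q}"
 have fin: "finite ?S" by simp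
 define m n where "m = Min ?S" and "n = Max ?S"
 have m: "m \<in> ?S" unfolding m_def by (rule Min_in[OF fin False])
 have n: "n \<in> ?S" unfolding n_def by (rule Max_in[OF fin False])
 have "?S = {m..<Suc n}"
 proof (intro equalityI subsetI)
  fix i assume i: "i \<in> ?S"
  then have "m <= i" "i <= n" unfolding m_def n_def using fin by (auto intro!: Min_le Max_ge)
  then show "i \<in> {m..<Suc n}" by auto
 next
  fix i assume "i \<in> {m..<Suc n}"
  then have "g m <= g i" "g i <= g n" "a <= i" "i < b" using m n mono[of m i] mono[of i n] by auto
  then show "i \<in> ?S" using m n by auto
 qed
 then show ?thesis by (rule that) (use m n in auto)
qed

text \<open>Van der Corput's argument. The range is cut according to the integer part k of the first
  difference g, which gives at most C l (b - a) + 2 pieces. In a piece, few terms have g within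
  \<theta> of k or k + 1, because g grows by at least l per step; the others form an interval to
  which the Kusmin-Landau inequality applies with bound 1/\<theta>. The choice \<theta> = sqrt l
  makes \<theta>/l and 1/\<theta> equal.\<close>

theorem second_difference_test:
 fixes f :: "nat => real"
 assumes l: "0 < l" and C: "1 <= C"
  and lo: "!!n. a <= n ==> Suc n < b ==> l <= f (n+2) - 2 * f (n+1) + f n"
  and hi: "!!n. a <= n ==> Suc n < b ==> f (n+2) - 2 * f (n+1) + f n <= C * l"
 shows "cmod (\<Sum>n\<in>{a..<b}. ecis (f n)) <= 10 * C * (real (b - a) * sqrt l + 1 / sqrt l)"
proof -
 let ?S = "\<Sum>n\<in>{a..<b}. ecis (f n)"
 have triv: "cmod ?S <= real (b - a)"
  using norm_sum[of "%n. ecis (f n)" "{a..<b}"] by simp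
 show ?thesis
 \<comment> \<open>For l > 1/4 the trivial bound is already smaller than the right-hand side.
   Otherwise \<theta> = sqrt l is at most 1/2, so that the two boundary strips of a piece do not
   overlap.\<close>
 proof (cases "l <= 1/4 \<and> a < b")
  case False
  then consider "l > 1/4" | "b <= a" by linarith
  then show ?thesis
  proof cases
   case 1
   have "sqrt (1/4) <= sqrt l" using 1 by (intro real_sqrt_le_mono) auto
   then have h: "1/2 <= sqrt l" by (simp add: real_sqrt_divide)
   have "real (b - a) * 1 <= real (b - a) * (10 * C * sqrt l)"
    by (intro mult_left_mono) (use C h mult_mono[of 1 C "1/2" "sqrt l"] in auto)
   also have "... <= 10 * C * (real (b - a) * sqrt l + 1 / sqrt l)"
    using C l by (simp add: algebra_simps)
   finally show ?thesis using triv by linarith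
  next
   case 2
   then show ?thesis using C l by simp
  qed
 next
  case True
  then have l4: "l <= 1/4" and ab: "a < b" by auto
  define th where "th = sqrt l"
  have th: "0 < th" "th * th = l" using l by (auto simp: th_def)
  have th2: "th <= 1/2"
   using real_sqrt_le_mono[OF l4] by (simp add: th_def real_sqrt_divide)
  define g where "g n = f (Suc n) - f n" for n
  have inc: "l * real (n - m) <= g n - g m \<and> g n - g m <= C * l * real (n - m)" if "a <= m" "m <= n" "n < b" for m n
   using that(2,1,3)
  proof (induction n rule: nat_induct_at_least)
   case (Suc n)
   have "l <= g (Suc n) - g n" "g (Suc n) - g n <= C * l"
    using lo[of n] hi[of n] Suc by (auto simp: g_def)
   moreover have "real (Suc n - m) = real (n - m) + 1" using Suc by auto
   ultimately show ?case using Suc by (simp add: algebra_simps)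
  qed simp
  have gm: "g m <= g n" if "a <= m" "m <= n" "n < b" for m n
   using inc[OF that] l by (smt (verit) mult_nonneg_nonneg of_nat_0_le_iff)
  define J where "J k = {n\<in>{a..<b}. \<lfloor>g n\<rfloor> = k}" for k
  have blk: "cmod (\<Sum>n\<in>J k. ecis (f n)) <= 2 * (th / l + 1) + 1 / th" for k
  proof -
   let ?A = "{n\<in>{a..<b}. of_int k <= g n \<and> g n < of_int k + th}"
   let ?B = "{n\<in>{a..<b}. of_int k + th <= g n \<and> g n <= of_int k + 1 - th}"
   let ?C = "{n\<in>{a..<b}. of_int k + 1 - th < g n \<and> g n < of_int k + 1}"
   have J: "J k = ?A \<union> (?B \<union> ?C)" using th th2 by (auto simp: J_def floor_eq_iff)
   have dis: "?A \<inter> (?B \<union> ?C) = {}" "?B \<inter> ?C = {}" using th2 by auto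
   have cA: "real (card ?A) <= th / l + 1"
    by (rule card_growth[where g = g and p = "of_int k"]) (use l th inc in auto)
   have cC: "real (card ?C) <= th / l + 1"
    by (rule card_growth[where g = g and p = "of_int k + 1 - th"]) (use l th inc in auto)
   have nA: "cmod (\<Sum>n\<in>?A. ecis (f n)) <= th / l + 1"
    using norm_sum[of "%n. ecis (f n)" ?A] cA by simp
   have nC: "cmod (\<Sum>n\<in>?C. ecis (f n)) <= th / l + 1"
    using norm_sum[of "%n. ecis (f n)" ?C] cC by simp
   obtain a' b' where B: "?B = {a'..<b'}" "a <= a'" "b' <= b \<or> a' = b'"
    by (rule mono_interval[of a b g "of_int k + th" "of_int k + 1 - th"]) (use gm in blast)+
   have nB: "cmod (\<Sum>n\<in>?B. ecis (f n)) <= 1 / th"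
    unfolding B(1)
   proof (rule kusmin_landau[where k = "of_int k"])
    fix n assume "a' <= n" "n < b'"
    then have "n \<in> ?B" using B by auto
    then show "of_int k + th <= f (Suc n) - f n" "f (Suc n) - f n <= of_int k + 1 - th"
     by (auto simp: g_def)
   next
    fix n assume "a' <= n" "Suc n < b'"
    then show "f (Suc n) - f n <= f (Suc (Suc n)) - f (Suc n)"
     using gm[of n "Suc n"] B by (auto simp: g_def)
   qed (use th in auto)
   have "(\<Sum>n\<in>J k. ecis (f n)) = (\<Sum>n\<in>?A. ecis (f n)) + ((\<Sum>n\<in>?B. ecis (f n)) + (\<Sum>n\<in>?C. ecis (f n)))"
    unfolding J by (subst sum.union_disjoint, simp, simp, use dis in blast, subst sum.union_disjoint) (use dis in auto)
   also have "cmod ... <= (th / l + 1) + (1 / th + (th / l + 1))"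
    by (intro order_trans[OF norm_triangle_ineq] add_mono nA nB nC)
   finally show ?thesis by simp
  qed
  define K where "K = {\<lfloor>g a\<rfloor>..\<lfloor>g (b - 1)\<rfloor>}"
  have "?S = (\<Sum>k\<in>K. \<Sum>n\<in>J k. ecis (f n))"
   unfolding J_def
  proof (rule sum.group[symmetric])
   show "(%n. \<lfloor>g n\<rfloor>) ` {a..<b} \<subseteq> K"
    unfolding K_def using gm by (auto intro!: floor_mono)
  qed (auto simp: K_def)
  then have c1: "cmod ?S <= (\<Sum>k\<in>K. 2 * (th / l + 1) + 1 / th)"
   by (simp only:) (intro sum_norm_le blk)
  have c2: "(\<Sum>k\<in>K. 2 * (th / l + 1) + 1 / th) = real (card K) * (2 * (th / l + 1) + 1 / th)" by simp
  have c3: "real (card K) * (2 * (th / l + 1) + 1 / th) <= (C * l * real (b - a) + 2) * (5 / th)"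
  proof (intro mult_mono)
   have "g (b - 1) - g a <= C * l * real (b - 1 - a)" using inc[of a "b - 1"] ab by auto
   also have "... <= C * l * real (b - a)" using C l by (intro mult_left_mono) auto
   finally have *: "g (b - 1) - g a <= C * l * real (b - a)" .
   have "\<lfloor>g a\<rfloor> <= \<lfloor>g (b - 1)\<rfloor>" using gm[of a "b - 1"] ab by (auto intro!: floor_mono)
   then have "real (card K) = of_int \<lfloor>g (b - 1)\<rfloor> - of_int \<lfloor>g a\<rfloor> + 1" by (simp add: K_def)
   then show "real (card K) <= C * l * real (b - a) + 2" using * by linarith
   have "th / l = 1 / th" using th l by (simp add: field_simps)
   moreover have "2 <= 1 / th" using th th2 by (simp add: field_simps)
   ultimately show "2 * (th / l + 1) + 1 / th <= 5 / th" by simp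
  qed (use th l C in auto)
  have c4: "(C * l * real (b - a) + 2) * (5 / th) = 5 * C * real (b - a) * th + 10 / th"
   using th by (simp add: field_simps)
  have c5: "5 * C * real (b - a) * th + 10 / th <= 10 * C * (real (b - a) * th + 1 / th)"
  proof -
   have "10 / th <= 10 * C / th" using C th by (intro divide_right_mono) auto
   moreover have "0 <= C * real (b-a) * th" using C th by auto
   ultimately show ?thesis by (simp add: algebra_simps)
  qed
  show ?thesis unfolding th_def[symmetric] using c1 c3 c5 unfolding c2 c4 by (intro order_trans[OF c1[unfolded c2]] order_trans[OF c3[unfolded c4]] c5)
 qed
qed

lemma powr_second_difference:
 fixes kp :: real and n :: nat
 assumes k: "kp > 0" and n: "n > 0"
 obtains t where "real n < t" "t < real n + 2"
  "real (n+2) powr -kp - 2 * real (n+1) powr -kp + real n powr -kp = kp * (kp + 1) * t powr (-kp - 2)"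
proof -
 have d1: "DERIV (%x. (x + 1) powr -kp - x powr -kp) x :> (- kp * (x + 1) powr (-kp - 1) - (- kp * x powr (-kp - 1)))"
  if "x > 0" for x :: real
  by (rule derivative_eq_intros refl | (use that in simp))+
 obtain z where z: "real n < z" "z < real n + 1"
  "((real n + 1) + 1) powr -kp - (real n + 1) powr -kp - ((real n + 1) powr -kp - real n powr -kp)
   = ((real n + 1) - real n) * (- kp * (z + 1) powr (-kp - 1) - (- kp * z powr (-kp - 1)))"
  using MVT2[of "real n" "real n + 1", OF _ d1] n by auto
 have d2: "DERIV (%x. - kp * x powr (-kp - 1)) x :> kp * (kp + 1) * x powr (-kp - 2)"
  if "x > 0" for x :: real
  by (rule derivative_eq_intros refl | (use that in \<open>simp add: algebra_simps\<close>))+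
 obtain t where t: "z < t" "t < z + 1"
  "- kp * (z + 1) powr (-kp - 1) - (- kp * z powr (-kp - 1)) = (z + 1 - z) * (kp * (kp + 1) * t powr (-kp - 2))"
  using MVT2[of z "z + 1", OF _ d2] z n by auto
 show ?thesis
 proof (rule that[of t])
  have e: "real (n + 2) = real n + 1 + 1" "real (n + 1) = real n + 1" by auto
  show "real (n+2) powr -kp - 2 * real (n+1) powr -kp + real n powr -kp = kp * (kp + 1) * t powr (-kp - 2)"
   using z(3) t(3) unfolding e by simp
 qed (use z t in auto)
qed

text \<open>Between M and 6M the second difference of B n^(-kp) has the constant order P/M^2 with P
  = B M^(-kp), so the second derivative test gives sqrt P + M/sqrt P. The factor 6 leaves room for
  rounding the end points of intervals inside (M, 4M].\<close>

theorem power_phase_bound_pos: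
 fixes kp :: real
 assumes k: "kp > 0"
 obtains C where "C > 0" "!!B M a b. B > 0 ==> M > 0 ==> M <= real a ==> real b <= 6 * M ==>
  cmod (\<Sum>n\<in>{a..<b}. ecis (B * real n powr -kp))
   <= C * (sqrt (B * M powr -kp) + M / sqrt (B * M powr -kp))"
proof -
 define c where "c = kp * (kp + 1) * 6 powr (-kp - 2)"
 have c: "c > 0" using k by (simp add: c_def)
 define C0 where "C0 = (6::real) powr (kp + 2)"
 have C0: "C0 >= 1" using k by (simp add: C0_def ge_one_powr_ge_zero)
 define C where "C = 10 * C0 * (6 * sqrt c + 1 / sqrt c)"
 have bound: "cmod (\<Sum>n\<in>{a..<b}. ecis (B * real n powr -kp))
   <= C * (sqrt (B * M powr -kp) + M / sqrt (B * M powr -kp))"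
  if B: "B > 0" and M: "M > 0" and a: "M <= real a" and b: "real b <= 6 * M" for B M :: real and a b :: nat
 proof -
  define P where "P = B * M powr -kp"
  have P: "P > 0" using B M by (simp add: P_def)
  define l where "l = c * P / M^2"
  have l: "l > 0" using c P M by (simp add: l_def)
  have Mk: "M powr (-kp - 2) = M powr -kp / M^2"
   using M by (simp add: powr_diff powr_numeral)
  have lB: "l = B * (kp * (kp + 1) * (6 * M) powr (-kp - 2))"
   using M by (simp add: l_def P_def c_def powr_mult Mk)
  have CB: "C0 * l = B * (kp * (kp + 1) * M powr (-kp - 2))"
  proof -
   have "C0 * 6 powr (-kp - 2) = 1" by (simp add: C0_def powr_add[symmetric])
   then show ?thesis using M by (simp add: lB powr_mult mult_ac)
  qed
  have sec: "l <= B * real (n+2) powr -kp - 2 * (B * real (n+1) powr -kp) + B * real n powr -kp \<and>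
    B * real (n+2) powr -kp - 2 * (B * real (n+1) powr -kp) + B * real n powr -kp <= C0 * l"
   if n: "a <= n" "Suc n < b" for n
  proof -
   have "n > 0" using a M n by (cases n) auto
   then obtain t where t: "real n < t" "t < real n + 2"
    "real (n+2) powr -kp - 2 * real (n+1) powr -kp + real n powr -kp = kp * (kp + 1) * t powr (-kp - 2)"
    using powr_second_difference[OF k, of n] by blast
   have eq: "B * real (n+2) powr -kp - 2 * (B * real (n+1) powr -kp) + B * real n powr -kp = B * (kp * (kp + 1) * t powr (-kp - 2))"
    unfolding t(3)[symmetric] by (simp add: algebra_simps)
   have "M <= t" "t <= 6 * M" using t n a b by auto
   then have "(6 * M) powr (-kp - 2) <= t powr (-kp - 2)" "t powr (-kp - 2) <= M powr (-kp - 2)"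
    using k M by (auto intro!: powr_mono2')
   moreover have "0 <= B" "0 <= kp * (kp + 1)" using B k by auto
   ultimately have "l <= B * (kp * (kp + 1) * t powr (-kp - 2))"
    "B * (kp * (kp + 1) * t powr (-kp - 2)) <= C0 * l"
    unfolding CB unfolding lB by (auto intro!: mult_left_mono)
   then show ?thesis unfolding eq by blast
  qed
  have s1: "cmod (\<Sum>n\<in>{a..<b}. ecis (B * real n powr -kp)) <= 10 * C0 * (real (b - a) * sqrt l + 1 / sqrt l)"
   by (rule second_difference_test[where f = "%n. B * real n powr -kp", OF l C0]) (use sec in blast)+
  have s2: "10 * C0 * (real (b - a) * sqrt l + 1 / sqrt l) <= 10 * C0 * ((6 * M) * sqrt l + 1 / sqrt l)"
   using C0 b l M by (intro mult_left_mono add_mono mult_right_mono) auto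
  have sl: "sqrt l = sqrt c * sqrt P / M"
   using M by (simp add: l_def real_sqrt_mult real_sqrt_divide)
  have s3: "10 * C0 * ((6 * M) * sqrt l + 1 / sqrt l) = 10 * C0 * (6 * sqrt c * sqrt P + (1 / sqrt c) * (M / sqrt P))"
   unfolding sl using M by (simp add: field_simps)
  have "6 * sqrt c * sqrt P + (1 / sqrt c) * (M / sqrt P) <= (6 * sqrt c + 1 / sqrt c) * sqrt P + (6 * sqrt c + 1 / sqrt c) * (M / sqrt P)"
   using c P M by (intro add_mono mult_right_mono) auto
  then have "10 * C0 * (6 * sqrt c * sqrt P + (1 / sqrt c) * (M / sqrt P)) <= 10 * C0 * ((6 * sqrt c + 1 / sqrt c) * (sqrt P + M / sqrt P))"
   using C0 by (intro mult_left_mono) (auto simp: algebra_simps)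
  then have "10 * C0 * (6 * sqrt c * sqrt P + (1 / sqrt c) * (M / sqrt P)) <= C * (sqrt P + M / sqrt P)" by (simp add: C_def mult.assoc)
  then show ?thesis unfolding P_def[symmetric] using order_trans[OF s1 s2] s3 by linarith
 qed
 have "C > 0" using C0 c by (auto simp: C_def intro!: mult_pos_pos add_pos_pos)
 then show ?thesis using bound that by blast
qed

section \<open>Near coincidences among the points h n^(-\<kappa>)\<close>

lemma card_separated:
 fixes f :: "'a => real"
 assumes s: "0 < s" and w: "0 <= w"
  and sep: "!!x y. x \<in> S ==> y \<in> S ==> x ~= y ==> s <= \<bar>f x - f y\<bar>"
  and rng: "!!x. x \<in> S ==> p <= f x \<and> f x <= p + w"
 shows "real (card S) <= w / s + 1"
proof -
 define h where "h x = \<lfloor>(f x - p) / s\<rfloor>" for x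
 have inj: "inj_on h S"
 proof (rule inj_onI, rule ccontr)
  fix x y assume xy: "x \<in> S" "y \<in> S" "h x = h y" "x ~= y"
  have "\<bar>(f x - p) / s - (f y - p) / s\<bar> < 1"
   using xy(3) unfolding h_def by linarith
  moreover have "(f x - p) / s - (f y - p) / s = (f x - f y) / s" by (simp add: diff_divide_distrib)
  ultimately have "\<bar>f x - f y\<bar> < s" using s by (simp add: abs_divide)
  then show False using sep[OF xy(1,2,4)] by linarith
 qed
 have "h ` S \<subseteq> {0..\<lfloor>w / s\<rfloor>}"
 proof
  fix z assume "z \<in> h ` S"
  then obtain x where x: "x \<in> S" "z = h x" by auto
  have "0 <= (f x - p) / s" "(f x - p) / s <= w / s"
   using rng[OF x(1)] s by (auto intro!: divide_right_mono)
  then show "z \<in> {0..\<lfloor>w / s\<rfloor>}" unfolding x(2) h_def by (auto intro: floor_mono)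
 qed
 then have "card (h ` S) <= card {0..\<lfloor>w / s\<rfloor>}" by (intro card_mono) auto
 then have "card S <= nat (\<lfloor>w / s\<rfloor> + 1)" using card_image[OF inj] by simp
 moreover have "0 <= \<lfloor>w / s\<rfloor>" using s w by simp
 ultimately have "int (card S) <= \<lfloor>w / s\<rfloor> + 1" by linarith
 then show ?thesis by linarith
qed

text \<open>Pairs are sorted by their gcd because those with the same gcd give distinct, hence well
  spaced, fractions m/n.\<close>

definition gpairs :: "real => nat => (nat \<times> nat) set" where
 "gpairs N g = {(m, n). N <= real m \<and> real m <= 2 * N \<and> N <= real n \<and> real n <= 2 * N \<and> gcd m n = g}"

lemma finite_real_le: "finite {n::nat. real n <= x}"
 by (rule finite_subset[of _ "{..nat \<lfloor>x\<rfloor>}"]) (auto simp: le_nat_floor)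

lemma finite_gpairs: "finite (gpairs N g)"
 by (rule finite_subset[of _ "{n::nat. real n <= 2 * N} \<times> {n::nat. real n <= 2 * N}"])
  (auto simp: gpairs_def finite_real_le)

lemma card_gpairs:
 assumes N: "0 < N" and g: "0 < g"
 shows "real (card (gpairs N g)) <= (2 * N / real g)^2"
proof -
 let ?k = "nat \<lfloor>2 * N / real g\<rfloor>"
 have "gpairs N g \<subseteq> (%(a,b). (g * a, g * b)) ` ({1..?k} \<times> {1..?k})"
 proof
  fix x assume "x \<in> gpairs N g"
  then obtain m n where x: "x = (m, n)" "N <= real m" "real m <= 2 * N" "N <= real n" "real n <= 2 * N" "gcd m n = g"
   by (auto simp: gpairs_def)
  obtain a b where ab: "m = g * a" "n = g * b" using x(6) by (metis gcd_dvd1 gcd_dvd2 dvdE)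
  have "real a <= 2 * N / real g" "real b <= 2 * N / real g"
   using x g by (auto simp: ab field_simps)
  moreover have "a > 0" "b > 0" using x N by (auto simp: ab intro!: Nat.gr0I)
  ultimately have "(a, b) \<in> {1..?k} \<times> {1..?k}" by (auto simp: le_nat_floor)
  then show "x \<in> (%(a,b). (g * a, g * b)) ` ({1..?k} \<times> {1..?k})" using ab x(1) by force
 qed
 then have "card (gpairs N g) <= card ({1..?k} \<times> {1..?k})"
  by (rule surj_card_le[rotated]) auto
 then have "real (card (gpairs N g)) <= (real ?k)^2" by (simp add: power2_eq_square flip: of_nat_mult)
 also have "... <= (2 * N / real g)^2" using N g by (intro power_mono) auto
 finally show ?thesis .
qed

text \<open>Two different pairs with gcd g reduce to different fractions in lowest terms with
  denominators at most 2N/g, so these differ by at least (g/2N)^2. An interval of length 2L contains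
  a correspondingly small number of them.\<close>

lemma card_gpairs_near:
 assumes N: "0 < N" and g: "0 < g" and L: "0 <= L"
  and S: "S \<subseteq> gpairs N g" "!!m n. (m, n) \<in> S ==> \<bar>real m / real n - t\<bar> <= L"
 shows "real (card S) <= 1 + 2 * L * (2 * N / real g)^2"
proof -
 define s where "s = (real g / (2 * N))^2"
 have s: "0 < s" using N g by (auto simp: s_def)
 have "real (card S) <= (2 * L) / s + 1"
 proof (rule card_separated[where f = "%(m,n). real m / real n" and p = "t - L"])
  fix x y assume xy: "x \<in> S" "y \<in> S" "x ~= y"
  obtain m n m' n' where e: "x = (m, n)" "y = (m', n')" by (cases x, cases y)
  have x: "N <= real n" "real n <= 2 * N" "N <= real n'" "real n' <= 2 * N" "gcd m n = g" "gcd m' n' = g"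
   using xy S(1) unfolding e by (auto simp: gpairs_def)
  have n: "n > 0" "n' > 0" using x N by (auto intro!: Nat.gr0I)
  obtain a b where ab: "m = a * g" "n = b * g" "coprime a b"
   using gcd_coprime_exists[of m n] x(5) g by auto
  obtain a' b' where ab': "m' = a' * g" "n' = b' * g" "coprime a' b'"
   using gcd_coprime_exists[of m' n'] x(6) g by auto
  have b: "b > 0" "b' > 0" using n ab ab' by auto
  have ne: "a * b' ~= a' * b"
  proof
   assume h: "a * b' = a' * b"
   have "b dvd a * b'" using h by simp
   then have "b dvd b'" using ab(3) by (simp add: coprime_commute coprime_dvd_mult_right_iff)
   moreover have "b' dvd a' * b" using h by (metis dvd_triv_right)
   then have "b' dvd b" using ab'(3) by (simp add: coprime_commute coprime_dvd_mult_right_iff)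
   ultimately have "b = b'" by (simp add: dvd_antisym)
   then have "x = y" using h b ab ab' e by simp
   then show False using xy by simp
  qed
  have "real m / real n - real m' / real n' = (real a * real b' - real a' * real b) / (real b * real b')"
   using b g by (simp add: ab ab' field_simps)
  moreover have "1 <= \<bar>real a * real b' - real a' * real b\<bar>"
  proof -
   have "int a * int b' - int a' * int b ~= 0" using ne by (metis eq_iff_diff_eq_0 of_nat_eq_iff of_nat_mult)
   then have "1 <= \<bar>int a * int b' - int a' * int b\<bar>" by linarith
   then have "real_of_int 1 <= real_of_int \<bar>int a * int b' - int a' * int b\<bar>" by (simp only: of_int_le_iff)
   then show ?thesis by simp
  qed
  ultimately have "1 / (real b * real b') <= \<bar>real m / real n - real m' / real n'\<bar>"
   using b by (simp add: abs_divide divide_right_mono)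
  moreover have "s <= 1 / (real b * real b')"
  proof -
   have "real b <= 2 * N / real g" "real b' <= 2 * N / real g"
    using x g by (auto simp: ab ab' field_simps)
   then have "real b * real b' <= (2 * N / real g) * (2 * N / real g)"
    using b N by (intro mult_mono) auto
   moreover have "0 < real b * real b'" using b by simp
   ultimately have "1 / ((2 * N / real g) * (2 * N / real g)) <= 1 / (real b * real b')"
    by (intro frac_le) auto
   then show ?thesis by (simp add: s_def power2_eq_square)
  qed
  ultimately show "s <= \<bar>(case x of (m, n) => real m / real n) - (case y of (m, n) => real m / real n)\<bar>"
   unfolding e by simp
 next
  fix x assume x: "x \<in> S"
  obtain m n where e: "x = (m, n)" by (cases x)
  have "\<bar>real m / real n - t\<bar> <= L" using S(2) x e by simp
  then show "t - L <= (case x of (m, n) => real m / real n) \<and> (case x of (m, n) => real m / real n) <= t - L + 2 * L"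
   unfolding e by (simp add: abs_le_iff)
 qed (use s L in auto)
 also have "(2 * L) / s + 1 = 1 + 2 * L * (2 * N / real g)^2"
  by (simp add: s_def power_divide)
 finally show ?thesis .
qed

lemma sum_inverse_squares_le: "(\<Sum>g\<in>{1..m}. 1 / (real g)^2) <= 2"
proof (cases m)
 case (Suc k)
 have "(\<Sum>g\<in>{1..Suc k}. 1 / (real g)^2) <= 2 - 1 / real (Suc k)"
 proof (induction k)
  case (Suc k)
  define x where "x = real (Suc k)"
  have x: "x > 0" "real (Suc (Suc k)) = x + 1" by (auto simp: x_def)
  have "1 / (x + 1)^2 <= 1 / (x * (x + 1))"
   using x by (intro frac_le) (auto simp: power2_eq_square)
  also have "... = 1 / x - 1 / (x + 1)" using x by (simp add: field_simps)
  finally show ?case using Suc x by (simp add: x_def)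
 qed simp
 moreover have "2 - 1 / real (Suc k) <= 2" by simp
 ultimately show ?thesis unfolding Suc by linarith
qed simp

lemma sum_inverse_le_ln:
 assumes "x >= 1" "real m <= x"
 shows "(\<Sum>g\<in>{1..m}. 1 / real g) <= 1 + ln x"
proof (cases m)
 case 0
 then show ?thesis using assms by simp
next
 case (Suc k)
 have "(\<Sum>g\<in>{1..Suc k}. 1 / real g) <= 1 + ln (real (Suc k))"
 proof (induction k)
  case (Suc k)
  define y where "y = real (Suc k)"
  have y: "y > 0" "real (Suc (Suc k)) = y + 1" by (auto simp: y_def)
  have "ln (y / (y + 1)) <= y / (y + 1) - 1"
   using y by (intro ln_le_minus_one) auto
  moreover have "ln (y / (y + 1)) = ln y - ln (y + 1)" using y by (simp add: ln_div)
  moreover have "y / (y + 1) - 1 = - (1 / (y + 1))" using y by (simp add: field_simps)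
  ultimately have "1 / (y + 1) <= ln (y + 1) - ln y" by linarith
  then show ?case using Suc y by (simp add: y_def)
 qed simp
 also have "... <= 1 + ln x" using assms Suc by simp
 finally show ?thesis unfolding Suc .
qed

text \<open>An inverse Lipschitz bound from the mean value theorem. It transfers closeness of kp-th
  powers to closeness of the ratios n/n' and (h/h')^(1/kp), which are at least 1/2 for dyadic
  variables.\<close>

lemma powr_diff_lower:
 fixes u w kp :: real
 assumes k: "1 <= kp" and u: "1/2 <= u" and w: "1/2 <= w"
 shows "\<bar>u - w\<bar> <= 2 powr kp * \<bar>u powr kp - w powr kp\<bar>"
 using u w
proof (induction u w rule: linorder_wlog)
 case (sym a b)
 then show ?case by (simp add: abs_minus_commute)
next
 case (le a b)
 show ?case
 proof (cases "a = b")
  case False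
  then have ab: "a < b" using le by simp
  have d: "DERIV (%x. x powr kp) x :> kp * x powr (kp - 1)" if "x > 0" for x
   by (rule derivative_eq_intros refl | (use that in simp))+
  obtain z where z: "a < z" "z < b" "b powr kp - a powr kp = (b - a) * (kp * z powr (kp - 1))"
   using MVT2[OF ab d] le by auto
  have "(1/2) powr (kp - 1) <= z powr (kp - 1)" using z le k by (intro powr_mono2) auto
  moreover have "(1/2::real) powr kp <= (1/2) powr (kp - 1)" by (intro powr_mono') auto
  ultimately have "(1/2) powr kp <= kp * z powr (kp - 1)"
   using k mult_mono[of 1 kp "(1/2) powr kp" "z powr (kp - 1)"] by simp
  then have "(b - a) * (1/2) powr kp <= b powr kp - a powr kp"
   unfolding z(3) using ab by (intro mult_left_mono) auto
  then have "2 powr kp * ((b - a) * (1/2) powr kp) <= 2 powr kp * (b powr kp - a powr kp)"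
   by (intro mult_left_mono) auto
  then have "b - a <= 2 powr kp * (b powr kp - a powr kp)"
   by (simp add: powr_divide)
  moreover have "a powr kp <= b powr kp" using ab le k by (intro powr_mono2) auto
  ultimately show ?thesis using ab by simp
 qed simp
qed

text \<open>The four variables are grouped as (h, h') and (n, n'), so that each group can be sorted
  by its own gcd.\<close>

definition near_quads :: "real => real => real => real => ((nat \<times> nat) \<times> (nat \<times> nat)) set" where
 "near_quads kp H N et = {((h, h'), (n, n')). H <= real h \<and> real h <= 2 * H \<and> H <= real h' \<and> real h' <= 2 * H
   \<and> N <= real n \<and> real n <= 2 * N \<and> N <= real n' \<and> real n' <= 2 * N
   \<and> \<bar>real h * real n powr -kp - real h' * real n' powr -kp\<bar> <= et}"

lemma finite_near_quads: "finite (near_quads kp H N et)"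
 by (rule finite_subset[of _ "({n::nat. real n <= 2 * H} \<times> {n::nat. real n <= 2 * H}) \<times> ({n::nat. real n <= 2 * N} \<times> {n::nat. real n <= 2 * N})"])
  (auto simp: near_quads_def finite_real_le)

text \<open>The condition forces h/h' to lie within L of (n/n')^kp, and also n/n' within L of
  (h/h')^(1/kp). For fixed gcds g and g' the quadruples are counted twice, once with (h, h') fixed
  and once with (n, n') fixed. With a and b bounding the numbers of pairs, this gives a(1 + 2Lb) and
  b(1 + 2La). The smaller of the two has the diagonal term min a b <= sqrt(a b), which is
  proportional to 1/(g g'), so that the sum over all gcds costs only two logarithms.\<close>

theorem card_near_quads:
 assumes k: "1 <= kp" and H: "1 <= H" and N: "1 <= N" and eta: "0 <= et"
 shows "real (card (near_quads kp H N et))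
   <= 4 * H * N * (1 + ln (2 * H)) * (1 + ln (2 * N)) + 128 * 4 powr kp * (et * N powr kp / H) * (H * N)^2"
proof -
 define L where "L = 4 powr kp * (et * N powr kp / H)"
 have L0: "0 <= L" using eta H by (simp add: L_def)
 have near: "\<bar>real h / real h' - (real n / real n') powr kp\<bar> <= L"
  "\<bar>real n / real n' - (real h / real h') powr (1 / kp)\<bar> <= L"
  if q: "((h, h'), (n, n')) \<in> near_quads kp H N et" for h h' n n'
 proof -
  have q: "H <= real h" "real h <= 2 * H" "H <= real h'" "real h' <= 2 * H"
   "N <= real n" "real n <= 2 * N" "N <= real n'" "real n' <= 2 * N"
   "\<bar>real h * real n powr -kp - real h' * real n' powr -kp\<bar> <= et"
   using that by (auto simp: near_quads_def)
  have pos: "0 < real h" "0 < real h'" "0 < real n" "0 < real n'" using q H N by linarith+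
  have "real h / real h' - (real n / real n') powr kp
    = (real h * real n powr -kp - real h' * real n' powr -kp) * (real n powr kp / real h')"
   using pos by (simp add: powr_minus powr_divide field_simps)
  then have "\<bar>real h / real h' - (real n / real n') powr kp\<bar>
    = \<bar>real h * real n powr -kp - real h' * real n' powr -kp\<bar> * (real n powr kp / real h')"
   by (simp add: abs_mult)
  also have "... <= et * ((2 * N) powr kp / H)"
   using q pos k H N eta by (intro mult_mono frac_le powr_mono2) auto
  finally have 1: "\<bar>real h / real h' - (real n / real n') powr kp\<bar> <= et * ((2 * N) powr kp / H)" .
  have e: "2 powr kp * (et * ((2 * N) powr kp / H)) = L"
  proof -
   have "(4::real) powr kp = 2 powr kp * 2 powr kp" by (subst powr_mult[symmetric]) auto
   then show ?thesis using N by (simp add: L_def powr_mult)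
  qed
  have "et * ((2 * N) powr kp / H) * 1 <= 2 powr kp * (et * ((2 * N) powr kp / H))"
   using eta H k by (subst mult.commute, intro mult_right_mono) (auto intro!: ge_one_powr_ge_zero)
  then show "\<bar>real h / real h' - (real n / real n') powr kp\<bar> <= L" using 1 e by linarith
  define w where "w = (real h / real h') powr (1 / kp)"
  have wk: "w powr kp = real h / real h'" using pos k by (simp add: w_def powr_powr)
  have hh: "1/2 <= real h / real h'" "1/2 <= real n / real n'" using q pos by (auto simp: field_simps)
  have "1/2 <= w"
  proof -
   have "(1/2::real) <= (1/2) powr (1/kp)" using k powr_mono'[of "1/kp" 1 "1/2"] by simp
   also have "... <= w" unfolding w_def using hh k by (intro powr_mono2) auto
   finally show ?thesis .
  qed
  from powr_diff_lower[OF k hh(2) this] have "\<bar>real n / real n' - w\<bar> <= 2 powr kp * \<bar>(real n / real n') powr kp - real h / real h'\<bar>"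
   by (simp add: wk)
  also have "... <= 2 powr kp * (et * ((2 * N) powr kp / H))"
   using 1 by (intro mult_left_mono) (auto simp: abs_minus_commute)
  finally show "\<bar>real n / real n' - (real h / real h') powr (1 / kp)\<bar> <= L" unfolding w_def e .
 qed
 define Q where "Q g g' = {x \<in> near_quads kp H N et. fst x \<in> gpairs H g \<and> snd x \<in> gpairs N g'}" for g g'
 have finQ: "finite (Q g g')" for g g' by (simp add: Q_def finite_near_quads)
 have Qb: "real (card (Q g g')) <= 4 * H * N * (1 / real g) * (1 / real g') + 32 * L * (H * N)^2 * (1 / (real g)^2) * (1 / (real g')^2)"
  if g: "0 < g" "0 < g'" for g g'
 proof -
  define a b where "a = (2 * H / real g)^2" and "b = (2 * N / real g')^2"
  have ab0: "0 <= a" "0 <= b" by (auto simp: a_def b_def)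
  have A: "real (card (Q g g')) <= a * (1 + 2 * L * b)"
  proof -
   define R where "R p = {q \<in> gpairs N g'. (p, q) \<in> near_quads kp H N et}" for p
   have "Q g g' \<subseteq> Sigma (gpairs H g) R" by (auto simp: Q_def R_def)
   then have "card (Q g g') <= card (Sigma (gpairs H g) R)"
    by (intro card_mono finite_SigmaI finite_gpairs) (auto simp: R_def finite_gpairs)
   also have "... = (\<Sum>p\<in>gpairs H g. card (R p))"
    by (rule card_SigmaI) (auto simp: finite_gpairs R_def)
   finally have "real (card (Q g g')) <= (\<Sum>p\<in>gpairs H g. real (card (R p)))" by (simp flip: of_nat_sum)
   also have "... <= (\<Sum>p\<in>gpairs H g. 1 + 2 * L * b)"
   proof (rule sum_mono)
    fix p assume "p \<in> gpairs H g"
    obtain h h' where p: "p = (h, h')" by (cases p)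
    show "real (card (R p)) <= 1 + 2 * L * b"
     unfolding b_def
     by (rule card_gpairs_near[where t = "(real h / real h') powr (1 / kp)"])
      (use N g L0 near(2) in \<open>auto simp: R_def p\<close>)
   qed
   also have "... = real (card (gpairs H g)) * (1 + 2 * L * b)" by simp
   also have "... <= a * (1 + 2 * L * b)"
    unfolding a_def using card_gpairs[of H g] H g L0 ab0 by (intro mult_right_mono) auto
   finally show ?thesis .
  qed
  have B: "real (card (Q g g')) <= b * (1 + 2 * L * a)"
  proof -
   define R where "R q = {p \<in> gpairs H g. (p, q) \<in> near_quads kp H N et}" for q
   have "prod.swap ` Q g g' \<subseteq> Sigma (gpairs N g') R" by (auto simp: Q_def R_def)
   then have "card (prod.swap ` Q g g') <= card (Sigma (gpairs N g') R)"
    by (intro card_mono finite_SigmaI finite_gpairs) (auto simp: R_def finite_gpairs)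
   also have "card (prod.swap ` Q g g') = card (Q g g')" by (rule card_image) simp
   also have "card (Sigma (gpairs N g') R) = (\<Sum>p\<in>gpairs N g'. card (R p))"
    by (rule card_SigmaI) (auto simp: finite_gpairs R_def)
   finally have "real (card (Q g g')) <= (\<Sum>p\<in>gpairs N g'. real (card (R p)))" by (simp flip: of_nat_sum)
   also have "... <= (\<Sum>p\<in>gpairs N g'. 1 + 2 * L * a)"
   proof (rule sum_mono)
    fix p assume "p \<in> gpairs N g'"
    obtain n n' where p: "p = (n, n')" by (cases p)
    show "real (card (R p)) <= 1 + 2 * L * a"
     unfolding a_def
     by (rule card_gpairs_near[where t = "(real n / real n') powr kp"])
      (use H g L0 near(1) in \<open>auto simp: R_def p\<close>)
   qed
   also have "... = real (card (gpairs N g')) * (1 + 2 * L * a)" by simp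
   also have "... <= b * (1 + 2 * L * a)"
    unfolding b_def using card_gpairs[of N g'] N g L0 ab0 by (intro mult_right_mono) auto
   finally show ?thesis .
  qed
  \<comment> \<open>The geometric mean turns the weights 1/g^2 and 1/g'^2 into 1/(g g') and the size
    into H N, which is the expected number of diagonal solutions.\<close>
  have "min a b <= sqrt (a * b)"
   by (rule real_le_rsqrt) (use ab0 in \<open>auto simp: min_def power2_eq_square intro!: mult_mono\<close>)
  also have "sqrt (a * b) = (2 * H / real g) * (2 * N / real g')"
   using H N by (simp add: a_def b_def real_sqrt_mult)
  finally have m: "min a b <= 4 * H * N * (1 / real g) * (1 / real g')" by simp
  have "real (card (Q g g')) <= min a b + 2 * L * (a * b)"
   using A B by (simp add: min_def algebra_simps)
  moreover have "2 * L * (a * b) = 32 * L * (H * N)^2 * (1 / (real g)^2) * (1 / (real g')^2)"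
   by (simp add: a_def b_def power_divide power_mult_distrib)
  ultimately show ?thesis using m by linarith
 qed
 define mH mN where "mH = nat \<lfloor>2 * H\<rfloor>" and "mN = nat \<lfloor>2 * N\<rfloor>"
 have mm: "real mH <= 2 * H" "real mN <= 2 * N" using H N by (auto simp: mH_def mN_def)
 have "near_quads kp H N et \<subseteq> (\<Union>z\<in>{1..mH}\<times>{1..mN}. Q (fst z) (snd z))"
 proof
  fix x assume x: "x \<in> near_quads kp H N et"
  obtain h h' n n' where e: "x = ((h, h'), (n, n'))" by (metis prod.collapse)
  have q: "H <= real h" "real h <= 2 * H" "H <= real h'" "real h' <= 2 * H"
   "N <= real n" "real n <= 2 * N" "N <= real n'" "real n' <= 2 * N"
   using x unfolding e by (auto simp: near_quads_def)
  have p: "h > 0" "n > 0" using q H N by (auto intro!: Nat.gr0I)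
  have "gcd h h' <= h" "gcd n n' <= n" using p by (auto intro!: gcd_le1_nat)
  then have "gcd h h' \<in> {1..mH}" "gcd n n' \<in> {1..mN}"
  proof -
   have "real (gcd h h') <= 2 * H" "real (gcd n n') <= 2 * N"
    using \<open>gcd h h' <= h\<close> \<open>gcd n n' <= n\<close> q by linarith+
   moreover have "gcd h h' > 0" "gcd n n' > 0" using p by auto
   ultimately show "gcd h h' \<in> {1..mH}" "gcd n n' \<in> {1..mN}"
    by (auto simp: mH_def mN_def le_nat_floor Suc_le_eq)
  qed
  moreover have "x \<in> Q (gcd h h') (gcd n n')" using x q by (auto simp: Q_def e gpairs_def)
  ultimately show "x \<in> (\<Union>z\<in>{1..mH}\<times>{1..mN}. Q (fst z) (snd z))" by force
 qed
 then have "card (near_quads kp H N et) <= card (\<Union>z\<in>{1..mH}\<times>{1..mN}. Q (fst z) (snd z))"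
  by (intro card_mono) (auto simp: finQ)
 also have "... <= (\<Sum>z\<in>{1..mH}\<times>{1..mN}. card (Q (fst z) (snd z)))" by (intro card_UN_le) auto
 finally have "real (card (near_quads kp H N et)) <= (\<Sum>z\<in>{1..mH}\<times>{1..mN}. real (card (Q (fst z) (snd z))))"
  by (simp flip: of_nat_sum)
 also have "... <= (\<Sum>z\<in>{1..mH}\<times>{1..mN}. 4 * H * N * ((1 / real (fst z)) * (1 / real (snd z)))
   + 32 * L * (H * N)^2 * ((1 / (real (fst z))^2) * (1 / (real (snd z))^2)))"
  by (intro sum_mono order_trans[OF Qb]) auto
 also have "... = 4 * H * N * ((\<Sum>g\<in>{1..mH}. 1 / real g) * (\<Sum>g\<in>{1..mN}. 1 / real g))
   + 32 * L * (H * N)^2 * ((\<Sum>g\<in>{1..mH}. 1 / (real g)^2) * (\<Sum>g\<in>{1..mN}. 1 / (real g)^2))"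
 proof -
  have "(\<Sum>z\<in>{1..mH}\<times>{1..mN}. f (fst z) * g (snd z)) = (\<Sum>x\<in>{1..mH}. f x) * (\<Sum>y\<in>{1..mN}. g y)"
   for f g :: "nat => real"
   by (simp add: sum_product sum.cartesian_product case_prod_beta)
  note A = this
  show ?thesis
   by (simp only: sum.distrib sum_distrib_left[symmetric]
    A[of "%g. 1 / real g" "%g. 1 / real g"] A[of "%g. 1 / (real g)^2" "%g. 1 / (real g)^2"])
 qed
 also have "... <= 4 * H * N * ((1 + ln (2 * H)) * (1 + ln (2 * N))) + 32 * L * (H * N)^2 * (2 * 2)"
  using H N L0 mm
  by (intro add_mono mult_left_mono mult_mono sum_inverse_le_ln sum_inverse_squares_le) (auto intro!: sum_nonneg)
 also have "... = 4 * H * N * (1 + ln (2 * H)) * (1 + ln (2 * N)) + 128 * 4 powr kp * (et * N powr kp / H) * (H * N)^2"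
  by (simp add: L_def)
 finally show ?thesis .
qed

section \<open>Bilinear exponential sums\<close>

lemma power_phase_interval_bound:
 fixes kp :: real
 assumes k: "kp > 0"
 obtains C where "C > 0" "!!B M lo hi. B ~= 0 ==> 1/2 <= M ==> M <= lo ==> hi <= 4 * M ==>
  cmod (\<Sum>m\<in>{m::nat. lo < real m \<and> real m <= hi}. ecis (B * real m powr -kp))
   <= C * (sqrt (\<bar>B\<bar> * M powr -kp) + M / sqrt (\<bar>B\<bar> * M powr -kp))"
proof -
 obtain C where C: "C > 0" and b: "!!B M a b. B > 0 ==> M > 0 ==> M <= real a ==> real b <= 6 * M ==>
  cmod (\<Sum>n\<in>{a..<b}. ecis (B * real n powr -kp))
   <= C * (sqrt (B * M powr -kp) + M / sqrt (B * M powr -kp))"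
  using power_phase_bound_pos[OF k] by blast
 have "cmod (\<Sum>m\<in>{m::nat. lo < real m \<and> real m <= hi}. ecis (B * real m powr -kp))
   <= C * (sqrt (\<bar>B\<bar> * M powr -kp) + M / sqrt (\<bar>B\<bar> * M powr -kp))"
  if B: "B ~= 0" and M: "1/2 <= M" "M <= lo" "hi <= 4 * M" for B M lo hi
 proof (cases "hi < 0")
  case True
  then have e: "{m::nat. lo < real m \<and> real m <= hi} = {}" by auto
  show ?thesis unfolding e using C M by simp
 next
  case False
  let ?I = "{nat \<lfloor>lo\<rfloor> + 1..<nat \<lfloor>hi\<rfloor> + 1}"
  have e: "{m::nat. lo < real m \<and> real m <= hi} = ?I"
  proof -
   have "(real m <= hi) = (int m <= \<lfloor>hi\<rfloor>)" "(lo < real m) = (\<lfloor>lo\<rfloor> < int m)" for m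
    by (simp_all add: le_floor_iff floor_less_iff)
   moreover have "0 <= \<lfloor>lo\<rfloor>" "0 <= \<lfloor>hi\<rfloor>" using False M by auto
   ultimately show ?thesis by (auto simp: Suc_le_eq nat_less_iff less_Suc_eq_le le_nat_iff)
  qed
  have ab: "M <= real (nat \<lfloor>lo\<rfloor> + 1)" "real (nat \<lfloor>hi\<rfloor> + 1) <= 6 * M"
   using False M by linarith+
  have pos: "cmod (\<Sum>m\<in>?I. ecis (\<bar>B\<bar> * real m powr -kp))
   <= C * (sqrt (\<bar>B\<bar> * M powr -kp) + M / sqrt (\<bar>B\<bar> * M powr -kp))"
   by (rule b) (use B M ab in auto)
  show ?thesis
  proof (cases "B > 0")
   case True
   then show ?thesis using pos unfolding e by simp
  next
   case False
   then have "ecis (B * real m powr -kp) = cnj (ecis (\<bar>B\<bar> * real m powr -kp))" for m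
    by (simp add: cis_cnj)
   then have "(\<Sum>m\<in>?I. ecis (B * real m powr -kp)) = cnj (\<Sum>m\<in>?I. ecis (\<bar>B\<bar> * real m powr -kp))"
    by (simp only: cnj_sum)
   then show ?thesis using pos unfolding e by (simp only: complex_mod_cnj)
  qed
 qed
 then show ?thesis using C that by blast
qed

definition hn_set :: "real => real => (nat \<times> nat) set" where
 "hn_set H N = {(h, n). H <= real h \<and> real h <= 2 * H \<and> N < real n \<and> real n <= 2 * N}"

definition hn_pt :: "real => nat \<times> nat => real" where
 "hn_pt kp j = real (fst j) * real (snd j) powr -kp"

definition hn_near :: "real => real => real => real => ((nat \<times> nat) \<times> (nat \<times> nat)) set" where
 "hn_near kp H N et = {p \<in> hn_set H N \<times> hn_set H N. \<bar>hn_pt kp (fst p) - hn_pt kp (snd p)\<bar> <= et}"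

lemma finite_hn_set [simp]: "finite (hn_set H N)"
 by (rule finite_subset[of _ "{n::nat. real n <= 2 * H} \<times> {n::nat. real n <= 2 * N}"])
  (auto simp: hn_set_def finite_real_le)

lemma finite_hn_near [simp]: "finite (hn_near kp H N et)"
 by (simp add: hn_near_def)

text \<open>The points number about H N and lie in an interval of length 2 H N^(-kp), so
  \<open>et0\<close> is their mean spacing. Up to this distance the count is of diagonal size;
  beyond it the count grows linearly with \<open>et\<close>.\<close>

lemma card_hn_near:
 assumes k: "1 <= kp" and H: "1 <= H" and N: "1 <= N" and eta: "0 <= et"
 defines "et0 \<equiv> 2 * H * N powr -kp / (H * N)"
 shows "real (card (hn_near kp H N et))
   <= 256 * 4 powr kp * (H * N * ((1 + ln (2 * H)) * (1 + ln (2 * N)))) * (1 + et / et0)"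
proof -
 let ?f = "%((h, n), (h', n')). ((h, h'), (n::nat, n'::nat))"
 let ?l = "(1 + ln (2 * H)) * (1 + ln (2 * N))"
 have l: "1 <= ?l" using H N mult_mono[of 1 "1 + ln (2 * H)" 1 "1 + ln (2 * N)"] by simp
 have "inj_on ?f (hn_near kp H N et)" by (auto simp: inj_on_def)
 moreover have "?f ` hn_near kp H N et \<subseteq> near_quads kp H N et"
  by (auto simp: hn_near_def hn_set_def hn_pt_def near_quads_def)
 ultimately have "card (hn_near kp H N et) <= card (near_quads kp H N et)"
  by (rule card_inj_on_le) (rule finite_near_quads)
 then have "real (card (hn_near kp H N et)) <= 4 * H * N * (1 + ln (2 * H)) * (1 + ln (2 * N)) + 128 * 4 powr kp * (et * N powr kp / H) * (H * N)^2"
  using card_near_quads[OF k H N eta] by linarith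
 also have "... = 4 * (H * N) * ?l + 256 * 4 powr kp * (et / et0) * (H * N)"
 proof -
  have "et / et0 * 2 = et * N powr kp / H * (H * N)"
   using H N by (simp add: et0_def powr_minus field_simps)
  then have "128 * 4 powr kp * (et * N powr kp / H) * (H * N)^2 = 128 * 4 powr kp * (et / et0 * 2) * (H * N)"
   by (simp only: power2_eq_square mult.assoc)
  then show ?thesis by simp
 qed
 also have "... <= 256 * 4 powr kp * ((H * N) * ?l) + 256 * 4 powr kp * (et / et0) * ((H * N) * ?l)"
 proof (intro add_mono)
  have "(1::real) <= 4 powr kp" using k by (intro ge_one_powr_ge_zero) auto
  then have "4 * ((H * N) * ?l) <= (256 * 4 powr kp) * ((H * N) * ?l)"
   using H N l by (intro mult_right_mono) auto
  then show "4 * (H * N) * ?l <= 256 * 4 powr kp * ((H * N) * ?l)" by simp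
  have "H * N * 1 <= (H * N) * ?l" using H N l by (intro mult_left_mono) auto
  then show "256 * 4 powr kp * (et / et0) * (H * N) <= 256 * 4 powr kp * (et / et0) * ((H * N) * ?l)"
   using eta H N by (intro mult_left_mono) (auto simp: et0_def)
 qed
 also have "... = 256 * 4 powr kp * ((H * N) * ?l) * (1 + et / et0)" by (simp add: algebra_simps)
 finally show ?thesis .
qed

lemma sum_sqrt2_power_le: "(\<Sum>i\<le>I. sqrt 2 ^ i) <= 4 * sqrt 2 ^ I"
proof (induction I)
 case (Suc I)
 have s: "7/5 <= sqrt 2" by (rule real_le_rsqrt) (simp add: power2_eq_square)
 have "4 * sqrt 2 ^ I <= (3 * sqrt 2) * sqrt 2 ^ I"
  using s by (intro mult_right_mono) auto
 then have "4 * sqrt 2 ^ I <= 3 * (sqrt 2 * sqrt 2 ^ I)" by (simp only: mult.assoc)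
 moreover have "(\<Sum>i\<le>Suc I. sqrt 2 ^ i) = (\<Sum>i\<le>I. sqrt 2 ^ i) + sqrt 2 * sqrt 2 ^ I" by simp
 ultimately show ?case using Suc.IH by (simp only: power_Suc)
qed simp

text \<open>A dyadic decomposition in the distance of the two points. Pairs closer than the mean
  spacing \<open>et0\<close> receive the trivial bound. For the others the term M/sqrt(Y d) is
  estimated at the scale et0 2^i: the number of pairs grows like 2^i and the term decays like
  2^(-i/2), so that the largest scale \<open>et1\<close> dominates and the number of scales does not
  appear in the result.\<close>

lemma sum_near_pairs_bound:
 fixes V :: "(nat \<times> nat) \<times> (nat \<times> nat) => real"
 assumes k: "1 <= kp" and H: "1 <= H" and N: "1 <= N" and K: "1 <= K" "K <= H * N"
  and Y: "0 < Y" and M: "0 <= M" and C: "0 <= C"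
 defines "\<Lambda> \<equiv> 2 * H * N powr -kp"
 defines "et1 \<equiv> \<Lambda> / K"
 assumes V1: "!!p. p \<in> hn_near kp H N et1 ==> V p <= 4 * M"
  and V2: "!!p. p \<in> hn_near kp H N et1 ==> hn_pt kp (fst p) ~= hn_pt kp (snd p) ==>
    V p <= C * (sqrt (Y * \<bar>hn_pt kp (fst p) - hn_pt kp (snd p)\<bar>) + M / sqrt (Y * \<bar>hn_pt kp (fst p) - hn_pt kp (snd p)\<bar>))"
 shows "(\<Sum>p\<in>hn_near kp H N et1. V p) <= 256 * 4 powr kp * ((1 + ln (2 * H)) * (1 + ln (2 * N))) *
   (8 * (H * N) * M + 16 * C * ((H * N)^2 / K) * (sqrt (Y * et1) + M / sqrt (Y * et1)))"
proof -
 define l where "l = (1 + ln (2 * H)) * (1 + ln (2 * N))"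
 define c1 where "c1 = 256 * 4 powr kp * (H * N * l)"
 define et0 where "et0 = \<Lambda> / (H * N)"
 have l: "1 <= l" using H N mult_mono[of 1 "1 + ln (2 * H)" 1 "1 + ln (2 * N)"] by (simp add: l_def)
 have c1: "0 <= c1" using H N l by (simp add: c1_def)
 have HN: "1 <= H * N" using H N mult_mono[of 1 H 1 N] by simp
 have L: "0 < \<Lambda>" using H N by (simp add: \<Lambda>_def)
 have e0: "0 < et0" and e1: "0 < et1" using L HN K by (auto simp: et0_def et1_def)
 define q where "q = H * N / K"
 have q: "1 <= q" using K by (simp add: q_def)
 have e10: "et1 = et0 * q" using H N K by (simp add: et1_def et0_def q_def)
 have Z: "real (card (hn_near kp H N et)) <= c1 * (1 + et / et0)" if "0 <= et" for et
  using card_hn_near[OF k H N that] by (simp add: c1_def l_def et0_def \<Lambda>_def)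
 obtain I :: nat where I: "q <= 2 ^ I" "2 ^ I <= 2 * q"
 proof -
  define I where "I = nat \<lceil>log 2 q\<rceil>"
  have lq: "0 <= log 2 q" using q by simp
  then have i: "log 2 q <= real I" "real I <= log 2 q + 1" unfolding I_def by linarith+
  have "q = 2 powr log 2 q" using q by simp
  also have "... <= 2 powr real I" using i by (intro powr_mono) auto
  finally have 1: "q <= 2 ^ I" by (simp add: powr_realpow)
  have "2 powr real I <= 2 powr (log 2 q + 1)" using i by (intro powr_mono) auto
  also have "... = 2 * q" using q by (simp add: powr_add)
  finally show ?thesis using that 1 by (simp add: powr_realpow)
 qed
 define P where "P = hn_near kp H N et1"
 define d where "d p = \<bar>hn_pt kp (fst p) - hn_pt kp (snd p)\<bar>" for p
 have finP: "finite P" by (simp add: P_def)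
 have dP: "p \<in> P ==> d p <= et1" for p by (simp add: P_def hn_near_def d_def)
 have cardle: "(\<Sum>p\<in>P. of_bool (d p <= et)) <= c1 * (1 + et / et0)" if "0 <= et" for et
 proof -
  have "(\<Sum>p\<in>P. of_bool (d p <= et)) = real (card {p\<in>P. d p <= et})"
   using finP by (simp add: of_bool_def sum.If_cases Int_def)
  also have "... <= real (card (hn_near kp H N et))"
   by (intro of_nat_mono card_mono) (auto simp: P_def hn_near_def d_def)
  finally show ?thesis using Z[OF that] by linarith
 qed
 define s0 where "s0 = sqrt (Y * et0)"
 have s0: "0 < s0" using Y e0 by (simp add: s0_def)
 \<comment> \<open>All scales are summed instead of the one that fits p. The bound becomes linear in
   indicator functions, and summing over p requires nothing but the counts at each scale.\<close>
 have point: "V p <= 4 * M * of_bool (d p <= et0) + C * sqrt (Y * et1)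
   + C * M * sqrt 2 / s0 * (\<Sum>i\<le>I. (1 / sqrt 2 ^ i) * of_bool (d p <= et0 * 2 ^ i))"
  if p: "p \<in> P" for p
 proof (cases "d p <= et0")
  case True
  have "V p <= 4 * M * of_bool (d p <= et0)" using V1[of p] p True by (simp add: P_def)
  moreover have "0 <= C * sqrt (Y * et1)" using C Y e1 by simp
  moreover have "0 <= C * M * sqrt 2 / s0 * (\<Sum>i\<le>I. (1 / sqrt 2 ^ i) * of_bool (d p <= et0 * 2 ^ i))"
   using C M s0 by (intro mult_nonneg_nonneg sum_nonneg) auto
  ultimately show ?thesis by linarith
 next
  case False
  then have dp: "et0 < d p" by simp
  define i where "i = (LEAST i. d p <= et0 * 2 ^ i)"
  have ex: "d p <= et0 * 2 ^ I" by (rule order_trans[OF dP[OF p]]) (use I e0 in \<open>simp add: e10\<close>)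
  have i1: "d p <= et0 * 2 ^ i" unfolding i_def by (rule LeastI[of _ I]) (rule ex)
  have iI: "i <= I" unfolding i_def by (rule Least_le) (rule ex)
  have "i ~= 0"
  proof
   assume "i = 0" then show False using i1 dp by simp
  qed
  then obtain i' where i': "i = Suc i'" by (cases i) auto
  have "\<not> d p <= et0 * 2 ^ i'" using not_less_Least[of i' "%i. d p <= et0 * 2 ^ i"] i' by (simp add: i_def)
  then have i2: "et0 * 2 ^ i <= 2 * d p" by (simp add: i')
  have dp0: "0 < d p" using dp e0 by linarith
  have b1: "1 / sqrt (Y * d p) <= sqrt 2 / s0 * (1 / sqrt 2 ^ i)"
  proof -
   have "sqrt (Y * (et0 * 2 ^ i)) <= sqrt (2 * (Y * d p))"
    using mult_left_mono[OF i2, of Y] Y by (intro real_sqrt_le_mono) (simp add: mult_ac)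
   then have "s0 * sqrt 2 ^ i <= sqrt 2 * sqrt (Y * d p)"
    by (simp add: s0_def real_sqrt_mult real_sqrt_power mult_ac)
   then show ?thesis using s0 Y dp0 by (simp add: field_simps)
  qed
  have b2: "(1 / sqrt 2 ^ i) <= (\<Sum>i\<le>I. (1 / sqrt 2 ^ i) * of_bool (d p <= et0 * 2 ^ i))"
   using member_le_sum[of i "{..I}" "%i. (1 / sqrt 2 ^ i) * of_bool (d p <= et0 * 2 ^ i)"] iI i1 by simp
  have a: "1 / sqrt (Y * d p) <= sqrt 2 / s0 * (\<Sum>i\<le>I. (1 / sqrt 2 ^ i) * of_bool (d p <= et0 * 2 ^ i))"
   by (rule order_trans[OF b1 mult_left_mono[OF b2]]) (use s0 in simp)
  have "V p <= C * (sqrt (Y * d p) + M * (1 / sqrt (Y * d p)))"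
   using V2[of p] p dp0 by (auto simp: P_def d_def)
  also have "... <= C * (sqrt (Y * et1) + M * (sqrt 2 / s0 * (\<Sum>i\<le>I. (1 / sqrt 2 ^ i) * of_bool (d p <= et0 * 2 ^ i))))"
   using a dP[OF p] C M Y by (intro mult_left_mono add_mono real_sqrt_le_mono) auto
  finally show ?thesis using False by (simp add: algebra_simps)
 qed
 have "(\<Sum>p\<in>P. V p) <= (\<Sum>p\<in>P. 4 * M * of_bool (d p <= et0) + C * sqrt (Y * et1)
   + C * M * sqrt 2 / s0 * (\<Sum>i\<le>I. (1 / sqrt 2 ^ i) * of_bool (d p <= et0 * 2 ^ i)))"
  by (intro sum_mono point)
 also have "... = 4 * M * (\<Sum>p\<in>P. of_bool (d p <= et0)) + C * sqrt (Y * et1) * real (card P)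
   + C * M * sqrt 2 / s0 * (\<Sum>i\<le>I. (1 / sqrt 2 ^ i) * (\<Sum>p\<in>P. of_bool (d p <= et0 * 2 ^ i)))"
 proof -
  have "(\<Sum>p\<in>P. C * M * sqrt 2 / s0 * (\<Sum>i\<le>I. (1 / sqrt 2 ^ i) * of_bool (d p <= et0 * 2 ^ i)))
   = C * M * sqrt 2 / s0 * (\<Sum>i\<le>I. (1 / sqrt 2 ^ i) * (\<Sum>p\<in>P. of_bool (d p <= et0 * 2 ^ i)))"
   unfolding sum_distrib_left[symmetric] by (subst sum.swap) (simp only: sum_distrib_left)
  then show ?thesis by (simp only: sum.distrib sum_distrib_left[symmetric] sum_constant) (simp add: mult_ac)
 qed
 also have "... <= 4 * M * (2 * c1) + C * sqrt (Y * et1) * (2 * c1 * q) + C * M * sqrt 2 / s0 * (2 * c1 * (4 * sqrt (2 * q)))"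
 proof (intro add_mono mult_left_mono)
  show "(\<Sum>p\<in>P. of_bool (d p <= et0)) <= 2 * c1" using cardle[of et0] e0 by simp
  have "real (card P) <= c1 * (1 + q)" using Z[of et1] e1 e0 e10 by (simp add: P_def)
  also have "... <= c1 * (2 * q)" using c1 q by (intro mult_left_mono) auto
  finally show "real (card P) <= 2 * c1 * q" by (simp add: mult_ac)
  have "(\<Sum>i\<le>I. (1 / sqrt 2 ^ i) * (\<Sum>p\<in>P. of_bool (d p <= et0 * 2 ^ i))) <= (\<Sum>i\<le>I. 2 * c1 * sqrt 2 ^ i)"
  proof (rule sum_mono)
   fix i
   have "(\<Sum>p\<in>P. of_bool (d p <= et0 * 2 ^ i)) <= c1 * (1 + 2 ^ i)"
    using cardle[of "et0 * 2 ^ i"] e0 by simp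
   also have "... <= c1 * (2 * 2 ^ i)" using c1 by (intro mult_left_mono) auto
   finally have "(1 / sqrt 2 ^ i) * (\<Sum>p\<in>P. of_bool (d p <= et0 * 2 ^ i)) <= (1 / sqrt 2 ^ i) * (c1 * (2 * 2 ^ i))"
    by (intro mult_left_mono) auto
   also have "... = 2 * c1 * sqrt 2 ^ i"
   proof -
    have "(2::real) ^ i = sqrt 2 ^ i * sqrt 2 ^ i" by (simp add: power_mult_distrib[symmetric])
    then show ?thesis by simp
   qed
   finally show "(1 / sqrt 2 ^ i) * (\<Sum>p\<in>P. of_bool (d p <= et0 * 2 ^ i)) <= 2 * c1 * sqrt 2 ^ i" .
  qed
  also have "... = 2 * c1 * (\<Sum>i\<le>I. sqrt 2 ^ i)" by (simp add: sum_distrib_left)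
  also have "... <= 2 * c1 * (4 * sqrt (2 * q))"
  proof (intro mult_left_mono)
   have "sqrt 2 ^ I = sqrt (2 ^ I)" by (simp add: real_sqrt_power)
   also have "... <= sqrt (2 * q)" using I by (intro real_sqrt_le_mono)
   finally show "(\<Sum>i\<le>I. sqrt 2 ^ i) <= 4 * sqrt (2 * q)" using sum_sqrt2_power_le[of I] by linarith
  qed (use c1 in auto)
  finally show "(\<Sum>i\<le>I. (1 / sqrt 2 ^ i) * (\<Sum>p\<in>P. of_bool (d p <= et0 * 2 ^ i))) <= 2 * c1 * (4 * sqrt (2 * q))" .
 qed (use M C Y e1 s0 in auto)
 also have "C * M * sqrt 2 / s0 * (2 * c1 * (4 * sqrt (2 * q))) = 16 * C * c1 * q * (M / sqrt (Y * et1))"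
 proof -
  have s1: "sqrt (Y * et1) = s0 * sqrt q" by (simp add: e10 s0_def real_sqrt_mult)
  define r where "r = sqrt q"
  have r: "0 < r" "q = r * r" using q by (auto simp: r_def)
  have s2: "sqrt (2 * q) = sqrt 2 * r" by (simp add: real_sqrt_mult r_def)
  have t: "sqrt 2 * (sqrt 2 * x) = 2 * x" for x :: real by (simp add: mult.assoc[symmetric])
  show ?thesis unfolding s1 s2 r_def[symmetric] unfolding r(2) using s0 r(1)
   by (simp add: field_simps t)
 qed
 finally have "(\<Sum>p\<in>P. V p) <= 4 * M * (2 * c1) + C * sqrt (Y * et1) * (2 * c1 * q) + 16 * C * c1 * q * (M / sqrt (Y * et1))" .
 also have "... <= c1 * (8 * M) + c1 * (16 * C * q * sqrt (Y * et1)) + c1 * (16 * C * q * (M / sqrt (Y * et1)))"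
 proof -
  have "0 <= C * (sqrt (Y * et1) * (c1 * q))" using C c1 q Y e1 by simp
  then show ?thesis by (simp add: mult_ac)
 qed
 also have "... = 256 * 4 powr kp * l * (8 * (H * N) * M + 16 * C * ((H * N)^2 / K) * (sqrt (Y * et1) + M / sqrt (Y * et1)))"
  by (simp add: c1_def q_def power2_eq_square algebra_simps add_divide_distrib)
 finally show ?thesis by (simp add: P_def l_def)
qed

lemma norm_sum_squared_le:
 fixes f :: "'a => complex"
 shows "(cmod (\<Sum>x\<in>A. f x))^2 <= real (card A) * (\<Sum>x\<in>A. (cmod (f x))^2)"
proof -
 have "(cmod (\<Sum>x\<in>A. f x))^2 <= (\<Sum>x\<in>A. cmod (f x))^2"
  by (intro power_mono norm_sum) auto
 also have "... = (\<Sum>x\<in>A. 1 * cmod (f x))^2" by simp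
 also have "... <= (\<Sum>x\<in>A. 1^2) * (\<Sum>x\<in>A. (cmod (f x))^2)" by (rule Cauchy_Schwarz_ineq_sum)
 finally show ?thesis by simp
qed

text \<open>
 The points hn_pt kp j are sorted into about \<open>K\<close> classes of length \<open>\<Lambda> / K\<close>; by Cauchy--Schwarz only pairs in
 the same class have to be compared.
\<close>

lemma norm_sum_classes_le:
 fixes g :: "nat => 'j => complex" and w :: "'j => complex" and lam :: "'j => real"
 assumes J: "finite J" and M: "finite Ms" and K: "1 <= K" and L: "0 < L"
  and lam: "!!j. j \<in> J ==> 0 <= lam j \<and> lam j <= L"
  and w: "!!j. j \<in> J ==> cmod (w j) <= 1"
 shows "(\<Sum>m\<in>Ms. (cmod (\<Sum>j\<in>J. w j * g m j))^2)
  <= 2 * K * (\<Sum>p\<in>{p\<in>J\<times>J. \<bar>lam (fst p) - lam (snd p)\<bar> <= L / K}. cmod (\<Sum>m\<in>Ms. g m (fst p) * cnj (g m (snd p))))"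
proof -
 define kk where "kk j = nat \<lfloor>K * lam j / L\<rfloor>" for j
 define Jk where "Jk k = {j\<in>J. kk j = k}" for k
 define P where "P = {p\<in>J\<times>J. \<bar>lam (fst p) - lam (snd p)\<bar> <= L / K}"
 define V where "V p = (\<Sum>m\<in>Ms. g m (fst p) * cnj (g m (snd p)))" for p
 define n where "n = nat \<lfloor>K\<rfloor>"
 have fin: "finite (Jk k)" for k using J by (simp add: Jk_def)
 have kkn: "kk ` J \<subseteq> {..n}"
 proof
  fix k assume "k \<in> kk ` J"
  then obtain j where j: "j \<in> J" "k = kk j" by auto
  have "K * lam j / L <= K" using lam[OF j(1)] K L by (simp add: field_simps mult_left_mono)
  then have "\<lfloor>K * lam j / L\<rfloor> <= \<lfloor>K\<rfloor>" by (rule floor_mono)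
  then show "k \<in> {..n}" by (simp add: j kk_def n_def nat_mono)
 qed
 have same: "\<bar>lam i - lam j\<bar> <= L / K" if "i \<in> J" "j \<in> J" "kk i = kk j" for i j
 proof -
  have nn: "0 <= K * lam i / L" "0 <= K * lam j / L" using lam that K L by auto
  then have "\<lfloor>K * lam i / L\<rfloor> = \<lfloor>K * lam j / L\<rfloor>" using that(3) by (simp add: kk_def eq_nat_nat_iff)
  then have "\<bar>K * lam i / L - K * lam j / L\<bar> <= 1" by linarith
  moreover have "K * lam i / L - K * lam j / L = (lam i - lam j) * (K / L)" by (simp add: right_diff_distrib left_diff_distrib diff_divide_distrib mult.commute)
  ultimately have "\<bar>lam i - lam j\<bar> * (K / L) <= 1" using K L by (simp add: abs_mult)
  then show ?thesis using K L by (simp add: field_simps)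
 qed
 have n2: "real n + 1 <= 2 * K" using K by (simp add: n_def) linarith
 have split: "(\<Sum>j\<in>J. w j * g m j) = (\<Sum>k\<le>n. \<Sum>j\<in>Jk k. w j * g m j)" for m
  unfolding Jk_def by (rule sum.group[symmetric]) (use J kkn in auto)
 have one: "(cmod (\<Sum>j\<in>J. w j * g m j))^2 <= 2 * K * (\<Sum>k\<le>n. (cmod (\<Sum>j\<in>Jk k. w j * g m j))^2)" for m
 proof -
  have "(cmod (\<Sum>j\<in>J. w j * g m j))^2 <= real (card {..n}) * (\<Sum>k\<le>n. (cmod (\<Sum>j\<in>Jk k. w j * g m j))^2)"
   unfolding split by (rule norm_sum_squared_le)
  also have "... <= 2 * K * (\<Sum>k\<le>n. (cmod (\<Sum>j\<in>Jk k. w j * g m j))^2)"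
   using n2 by (intro mult_right_mono sum_nonneg) auto
  finally show ?thesis .
 qed
 have expand: "(\<Sum>m\<in>Ms. (cmod (\<Sum>j\<in>Jk k. w j * g m j))^2) <= (\<Sum>p\<in>Jk k \<times> Jk k. cmod (V p))" for k
 proof -
  have "complex_of_real (\<Sum>m\<in>Ms. (cmod (\<Sum>j\<in>Jk k. w j * g m j))^2)
   = (\<Sum>m\<in>Ms. (\<Sum>j\<in>Jk k. w j * g m j) * cnj (\<Sum>j\<in>Jk k. w j * g m j))"
   by (simp add: complex_norm_square[symmetric] del: cnj_sum)
  also have "... = (\<Sum>m\<in>Ms. \<Sum>p\<in>Jk k \<times> Jk k. (w (fst p) * cnj (w (snd p))) * (g m (fst p) * cnj (g m (snd p))))"
   by (simp add: cnj_sum sum_product sum.cartesian_product case_prod_beta mult_ac)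
  also have "... = (\<Sum>p\<in>Jk k \<times> Jk k. (w (fst p) * cnj (w (snd p))) * V p)"
   by (subst sum.swap) (simp add: V_def sum_distrib_left)
  finally have eq: "complex_of_real (\<Sum>m\<in>Ms. (cmod (\<Sum>j\<in>Jk k. w j * g m j))^2) = (\<Sum>p\<in>Jk k \<times> Jk k. (w (fst p) * cnj (w (snd p))) * V p)" .
  have "0 <= (\<Sum>m\<in>Ms. (cmod (\<Sum>j\<in>Jk k. w j * g m j))^2)" by (intro sum_nonneg) simp
  then have "(\<Sum>m\<in>Ms. (cmod (\<Sum>j\<in>Jk k. w j * g m j))^2) = cmod (\<Sum>p\<in>Jk k \<times> Jk k. (w (fst p) * cnj (w (snd p))) * V p)"
   unfolding eq[symmetric] norm_of_real by simp
  also have "... <= (\<Sum>p\<in>Jk k \<times> Jk k. cmod (V p))"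
  proof (intro sum_norm_le)
   fix p assume "p \<in> Jk k \<times> Jk k"
   then have "cmod (w (fst p)) <= 1" "cmod (w (snd p)) <= 1" using w by (auto simp: Jk_def)
   then have "cmod (w (fst p)) * cmod (w (snd p)) <= 1 * 1" by (intro mult_mono) auto
   then have "cmod (w (fst p)) * cmod (w (snd p)) * cmod (V p) <= 1 * cmod (V p)" by (intro mult_right_mono) auto
   then show "cmod ((w (fst p) * cnj (w (snd p))) * V p) <= cmod (V p)" by (simp add: norm_mult)
  qed
  finally show ?thesis .
 qed
 have "(\<Sum>m\<in>Ms. (cmod (\<Sum>j\<in>J. w j * g m j))^2) <= (\<Sum>m\<in>Ms. 2 * K * (\<Sum>k\<le>n. (cmod (\<Sum>j\<in>Jk k. w j * g m j))^2))"
  by (intro sum_mono one)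
 also have "... = 2 * K * (\<Sum>k\<le>n. \<Sum>m\<in>Ms. (cmod (\<Sum>j\<in>Jk k. w j * g m j))^2)"
  by (subst sum.swap) (simp add: sum_distrib_left)
 also have "... <= 2 * K * (\<Sum>k\<le>n. \<Sum>p\<in>Jk k \<times> Jk k. cmod (V p))"
  using K by (intro mult_left_mono sum_mono expand) auto
 also have "(\<Sum>k\<le>n. \<Sum>p\<in>Jk k \<times> Jk k. cmod (V p)) = (\<Sum>p\<in>(\<Union>k\<le>n. Jk k \<times> Jk k). cmod (V p))"
  by (rule sum.UNION_disjoint[symmetric]) (use J in \<open>auto simp: Jk_def\<close>)
 also have "... <= (\<Sum>p\<in>P. cmod (V p))"
  by (rule sum_mono2) (use J same in \<open>auto simp: P_def Jk_def\<close>)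
 finally show ?thesis using K by (simp add: P_def V_def mult_left_mono)
qed

text \<open>Cauchy-Schwarz over m removes the coefficients \<alpha>. The inner square is expanded
  over pairs (h, n), (h', n') from the same one of about K classes only; the remaining sum over m
  has the phase X \<mu> m^(-kp) with \<mu> the difference of the two points, and is covered by the
  bound for power phases. The number K of classes stays free: a small K weakens Cauchy-Schwarz less
  but leaves more pairs.\<close>

theorem bilinear_sum_bound:
 assumes k: "1 <= kp"
 obtains C :: real where "C > 0" "!!X D D' H N K \<alpha> bt c. 0 < X ==> 1 <= N ==> N <= D ==> D' <= 2 * D ==> 1 <= H ==> 1 <= K ==> K <= H * N
  ==> (!!m. cmod (\<alpha> m) <= 1) ==> (!!n. cmod (bt n) <= 1) ==> (!!h. cmod (c h) <= 1)
  ==> (cmod (\<Sum>(h,n)\<in>hn_set H N. c h * bt n * (\<Sum>m\<in>cof D D' n.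
     \<alpha> m * ecis (real h * X * (real m * real n) powr -kp))))\<^sup>2
    <= C * (D / N) * K * ((1 + ln (2 * H)) * (1 + ln (2 * N))) *
     (H * N * (D / N) + (H * N)^2 / K * (sqrt (X * D powr -kp * H / K) + (D / N) / sqrt (X * D powr -kp * H / K)))"
proof -
 obtain C0 where C0: "C0 > 0" and ph: "!!B M lo hi. B ~= 0 ==> 1/2 <= M ==> M <= lo ==> hi <= 4 * M ==>
  cmod (\<Sum>m\<in>{m::nat. lo < real m \<and> real m <= hi}. ecis (B * real m powr -kp))
   <= C0 * (sqrt (\<bar>B\<bar> * M powr -kp) + M / sqrt (\<bar>B\<bar> * M powr -kp))"
  using power_phase_interval_bound[OF less_le_trans[OF zero_less_one k]] by blast
 define C1 where "C1 = 256 * 4 powr kp * (8 + 16 * C0 * 2 powr (1 + kp))"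
 have main: "(cmod (\<Sum>(h,n)\<in>hn_set H N. c h * bt n * (\<Sum>m\<in>cof D D' n.
     \<alpha> m * ecis (real h * X * (real m * real n) powr -kp))))\<^sup>2
    <= 4 * C1 * (D / N) * K * ((1 + ln (2 * H)) * (1 + ln (2 * N))) *
     (H * N * (D / N) + (H * N)^2 / K * (sqrt (X * D powr -kp * H / K) + (D / N) / sqrt (X * D powr -kp * H / K)))"
  if X: "0 < X" and N: "1 <= N" "N <= D" and D': "D' <= 2 * D" and H: "1 <= H" and K: "1 <= K" "K <= H * N"
   and al: "!!m. cmod (\<alpha> m) <= 1" and be: "!!n. cmod (bt n) <= 1" and c: "!!h. cmod (c h) <= 1"
  for X D D' H N K :: real and \<alpha> bt c :: "nat => complex"
 proof -
  define J where "J = hn_set H N"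
  \<comment> \<open>From N < n <= 2N and D < m n <= 2D it follows that m lies in (M, 4M] for M =
    D/(2N).\<close>
  define M where "M = D / (2 * N)"
  define Ms where "Ms = {m::nat. M < real m \<and> real m <= 4 * M}"
  define In where "In m n = (D < real m * real n \<and> real m * real n <= D')" for m n :: nat
  define lam where "lam = hn_pt kp"
  define w where "w j = c (fst j) * bt (snd j)" for j
  \<comment> \<open>The condition D < m n <= D' is carried as an indicator function. For a pair n,
    n' the product of two such indicators again selects one interval of m.\<close>
  define g where "g m j = of_bool (In m (snd j)) * ecis (X * real m powr -kp * lam j)" for m and j :: "nat \<times> nat"
  define \<Lambda> where "\<Lambda> = 2 * H * N powr -kp"
  have M: "1/2 <= M" using N by (simp add: M_def field_simps)
  have finM: "finite Ms" by (rule finite_subset[OF _ finite_real_le[of "4 * M"]]) (auto simp: Ms_def)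
  have cardM: "real (card Ms) <= 4 * M"
  proof -
   have "Ms \<subseteq> {1..nat \<lfloor>4 * M\<rfloor>}" using M by (auto simp: Ms_def le_nat_floor Suc_le_eq intro!: Nat.gr0I)
   then have "card Ms <= nat \<lfloor>4 * M\<rfloor>" using card_mono[of "{1..nat \<lfloor>4 * M\<rfloor>}" Ms] by simp
   then show ?thesis using M by linarith
  qed
  have InM: "m \<in> Ms" if "In m n" "N < real n" "real n <= 2 * N" for m n
  proof -
   have i: "D < real m * real n" "real m * real n <= 2 * D" using that D' by (auto simp: In_def)
   have "real m * real n <= real m * (2 * N)" "real m * N <= real m * real n" using that by (auto intro!: mult_left_mono)
   then have "D < real m * (2 * N)" "real m * N <= 2 * D" using i by linarith+
   then show ?thesis using N by (simp add: Ms_def M_def field_simps)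
  qed
  have finI: "finite {m. In m n}" if "N < real n" "real n <= 2 * N" for n
   by (rule finite_subset[OF _ finM]) (use InM that in auto)
  have inner: "(\<Sum>m\<in>cof D D' n.
     \<alpha> m * ecis (real h * X * (real m * real n) powr -kp)) = (\<Sum>m\<in>Ms. \<alpha> m * g m (h, n))"
   if j: "(h, n) \<in> J" for h n
  proof -
   have n: "N < real n" "real n <= 2 * N" using j by (auto simp: J_def hn_set_def)
   have "(\<Sum>m\<in>Ms. \<alpha> m * g m (h, n)) = (\<Sum>m\<in>{m. In m n}. \<alpha> m * g m (h, n))"
    by (rule sum.mono_neutral_right[OF finM]) (use InM n in \<open>auto simp: g_def\<close>)
   also have "... = (\<Sum>m\<in>{m. In m n}. \<alpha> m * ecis (real h * X * (real m * real n) powr -kp))"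
    by (intro sum.cong refl) (simp add: g_def lam_def hn_pt_def powr_mult mult_ac)
   finally show ?thesis by (simp add: In_def)
  qed
  let ?S = "\<Sum>(h,n)\<in>hn_set H N. c h * bt n * (\<Sum>m\<in>cof D D' n.
     \<alpha> m * ecis (real h * X * (real m * real n) powr -kp))"
  have "?S = (\<Sum>j\<in>J. w j * (\<Sum>m\<in>Ms. \<alpha> m * g m j))"
   unfolding J_def[symmetric] by (intro sum.cong refl) (auto simp: inner w_def)
  also have "... = (\<Sum>m\<in>Ms. \<alpha> m * (\<Sum>j\<in>J. w j * g m j))"
   unfolding sum_distrib_left by (subst sum.swap) (simp only: mult_ac)
  finally have S: "?S = (\<Sum>m\<in>Ms. \<alpha> m * (\<Sum>j\<in>J. w j * g m j))" .
  have "(cmod ?S)^2 <= real (card Ms) * (\<Sum>m\<in>Ms. (cmod (\<alpha> m * (\<Sum>j\<in>J. w j * g m j)))^2)"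
   unfolding S by (rule norm_sum_squared_le)
  also have "... <= (4 * M) * (\<Sum>m\<in>Ms. (cmod (\<Sum>j\<in>J. w j * g m j))^2)"
  proof (intro mult_mono cardM sum_mono power_mono)
   fix m
   show "cmod (\<alpha> m * (\<Sum>j\<in>J. w j * g m j)) <= cmod (\<Sum>j\<in>J. w j * g m j)"
    using mult_right_mono[OF al[of m], of "cmod (\<Sum>j\<in>J. w j * g m j)"] by (simp add: norm_mult)
  qed (use M in \<open>auto intro: sum_nonneg\<close>)
  also have "(\<Sum>m\<in>Ms. (cmod (\<Sum>j\<in>J. w j * g m j))^2)
   <= 2 * K * (\<Sum>p\<in>{p\<in>J\<times>J. \<bar>lam (fst p) - lam (snd p)\<bar> <= \<Lambda> / K}. cmod (\<Sum>m\<in>Ms. g m (fst p) * cnj (g m (snd p))))"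
  proof (rule norm_sum_classes_le)
   fix j assume j: "j \<in> J"
   obtain h n where e: "j = (h, n)" by (cases j)
   have "real h <= 2 * H" "N < real n" using j by (auto simp: J_def hn_set_def e)
   then show "0 <= lam j \<and> lam j <= \<Lambda>"
    using k N H by (auto simp: lam_def hn_pt_def e \<Lambda>_def intro!: mult_mono powr_mono2')
   show "cmod (w j) <= 1"
    using mult_mono[OF c[of "fst j"] be[of "snd j"]] by (simp add: w_def norm_mult)
  qed (use finM K H N in \<open>auto simp: J_def \<Lambda>_def\<close>)
  also have "{p\<in>J\<times>J. \<bar>lam (fst p) - lam (snd p)\<bar> <= \<Lambda> / K} = hn_near kp H N (\<Lambda> / K)"
   by (simp add: hn_near_def J_def lam_def)
  finally have B1: "(cmod ?S)^2 <= 4 * M * (2 * K * (\<Sum>p\<in>hn_near kp H N (\<Lambda> / K). cmod (\<Sum>m\<in>Ms. g m (fst p) * cnj (g m (snd p)))))"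
   using M by (simp add: mult_left_mono)
  define Y where "Y = X * M powr -kp"
  have Y: "0 < Y" using X M by (simp add: Y_def)
  have B2: "(\<Sum>p\<in>hn_near kp H N (2 * H * N powr -kp / K). cmod (\<Sum>m\<in>Ms. g m (fst p) * cnj (g m (snd p))))
   <= 256 * 4 powr kp * ((1 + ln (2 * H)) * (1 + ln (2 * N))) *
   (8 * (H * N) * M + 16 * C0 * ((H * N)^2 / K) * (sqrt (Y * (2 * H * N powr -kp / K)) + M / sqrt (Y * (2 * H * N powr -kp / K))))"
  proof (rule sum_near_pairs_bound[OF k H N(1) K Y])
   fix p assume p: "p \<in> hn_near kp H N (2 * H * N powr -kp / K)"
   have "cmod (\<Sum>m\<in>Ms. g m (fst p) * cnj (g m (snd p))) <= (\<Sum>m\<in>Ms. 1)"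
    by (rule sum_norm_le) (simp add: g_def norm_mult)
   then show "cmod (\<Sum>m\<in>Ms. g m (fst p) * cnj (g m (snd p))) <= 4 * M" using cardM by simp
   assume ne: "hn_pt kp (fst p) ~= hn_pt kp (snd p)"
   define \<mu> where "\<mu> = hn_pt kp (fst p) - hn_pt kp (snd p)"
   obtain h n h' n' where e: "p = ((h, n), (h', n'))" by (metis prod.collapse)
   have n: "N < real n" "real n <= 2 * N" "N < real n'" "real n' <= 2 * N"
    using p by (auto simp: e hn_near_def hn_set_def)
   have np: "0 < real n" "0 < real n'" using n N by linarith+
   define lo hi where "lo = max (D / real n) (D / real n')" and "hi = min (D' / real n) (D' / real n')"
   have In2: "In m n \<and> In m n' \<longleftrightarrow> lo < real m \<and> real m <= hi" for m
    using np by (auto simp: In_def lo_def hi_def field_simps)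
   have "(\<Sum>m\<in>Ms. g m (fst p) * cnj (g m (snd p))) = (\<Sum>m\<in>Ms. of_bool (In m n \<and> In m n') * ecis (X * \<mu> * real m powr -kp))"
    by (intro sum.cong refl) (auto simp: g_def e \<mu>_def lam_def cis_cnj cis_mult algebra_simps)
   also have "... = (\<Sum>m\<in>{m. lo < real m \<and> real m <= hi}. ecis (X * \<mu> * real m powr -kp))"
    by (rule sum.mono_neutral_cong_right[OF finM]) (use InM n In2 in auto)
   also have "cmod ... <= C0 * (sqrt (\<bar>X * \<mu>\<bar> * M powr -kp) + M / sqrt (\<bar>X * \<mu>\<bar> * M powr -kp))"
   proof (rule ph)
    show "X * \<mu> ~= 0" using X ne by (simp add: \<mu>_def)
    have "M <= D / real n" unfolding M_def using n N np by (intro divide_left_mono) auto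
    then show "M <= lo" by (simp add: lo_def)
    have "D' / real n <= 2 * D / N" using n N np D' by (intro frac_le) auto
    then show "hi <= 4 * M" by (simp add: hi_def M_def)
   qed (use M in auto)
   also have "\<bar>X * \<mu>\<bar> * M powr -kp = Y * \<bar>\<mu>\<bar>" using X by (simp add: Y_def abs_mult)
   finally show "cmod (\<Sum>m\<in>Ms. g m (fst p) * cnj (g m (snd p)))
     <= C0 * (sqrt (Y * \<bar>hn_pt kp (fst p) - hn_pt kp (snd p)\<bar>) + M / sqrt (Y * \<bar>hn_pt kp (fst p) - hn_pt kp (snd p)\<bar>))"
    by (simp add: \<mu>_def)
  qed (use M C0 in auto)
  define \<Phi> where "\<Phi> = X * D powr -kp * H / K"
  have D: "0 < D" using N by linarith
  have Phi: "0 < \<Phi>" using X H K D by (simp add: \<Phi>_def)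
  have P1: "Y * (2 * H * N powr -kp / K) = 2 powr (1 + kp) * \<Phi>"
  proof -
   have "M powr -kp * N powr -kp = (D / 2) powr -kp"
    using N D by (simp add: M_def powr_mult[symmetric])
   also have "... = 2 powr kp * D powr -kp" using D by (simp add: powr_divide powr_minus field_simps)
   finally have *: "M powr -kp * N powr -kp = 2 powr kp * D powr -kp" .
   have "Y * (2 * H * N powr -kp / K) = X * 2 * H / K * (M powr -kp * N powr -kp)" by (simp add: Y_def mult_ac)
   also have "... = 2 powr (1 + kp) * \<Phi>" unfolding * by (simp add: \<Phi>_def powr_add mult_ac)
   finally show ?thesis .
  qed
  define t where "t = (2::real) powr (1 + kp)"
  have t: "1 <= t" using k by (simp add: t_def ge_one_powr_ge_zero)
  have st: "1 <= sqrt t" "sqrt t <= t"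
   using t by (auto intro!: real_le_lsqrt simp: power2_eq_square)
  have MN: "M <= D / N" using N D by (simp add: M_def field_simps)
  define E where "E = H * N * (D / N) + (H * N)^2 / K * (sqrt \<Phi> + (D / N) / sqrt \<Phi>)"
  have bracket: "8 * (H * N) * M + 16 * C0 * ((H * N)^2 / K) * (sqrt (t * \<Phi>) + M / sqrt (t * \<Phi>)) <= (8 + 16 * C0 * t) * E"
  proof -
   have "sqrt (t * \<Phi>) + M / sqrt (t * \<Phi>) <= t * sqrt \<Phi> + t * ((D / N) / sqrt \<Phi>)"
   proof (intro add_mono)
    show "sqrt (t * \<Phi>) <= t * sqrt \<Phi>" using st Phi by (simp add: real_sqrt_mult mult_right_mono)
    have "M / sqrt (t * \<Phi>) <= (D / N) / sqrt \<Phi>"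
     using MN st Phi M by (intro frac_le) (auto simp: real_sqrt_mult)
    also have "... <= t * ((D / N) / sqrt \<Phi>)"
     using t D N Phi mult_right_mono[of 1 t "(D / N) / sqrt \<Phi>"] by simp
    finally show "M / sqrt (t * \<Phi>) <= t * ((D / N) / sqrt \<Phi>)" .
   qed
   then have "16 * C0 * ((H * N)^2 / K) * (sqrt (t * \<Phi>) + M / sqrt (t * \<Phi>)) <= 16 * C0 * ((H * N)^2 / K) * (t * sqrt \<Phi> + t * ((D / N) / sqrt \<Phi>))"
    using C0 K by (intro mult_left_mono) auto
   also have "... = (16 * C0 * t) * ((H * N)^2 / K * (sqrt \<Phi> + (D / N) / sqrt \<Phi>))" by (simp add: algebra_simps)
   also have "... <= (8 + 16 * C0 * t) * ((H * N)^2 / K * (sqrt \<Phi> + (D / N) / sqrt \<Phi>))"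
    using C0 K D N Phi by (intro mult_right_mono) auto
   finally have a: "16 * C0 * ((H * N)^2 / K) * (sqrt (t * \<Phi>) + M / sqrt (t * \<Phi>)) <= (8 + 16 * C0 * t) * ((H * N)^2 / K * (sqrt \<Phi> + (D / N) / sqrt \<Phi>))" .
   have "8 * (H * N) * M <= (8 + 16 * C0 * t) * (H * N * (D / N))"
    unfolding mult.assoc[symmetric]
    using MN M C0 t H N by (intro mult_mono) auto
   then show ?thesis using a unfolding E_def by (simp only: distrib_left)
  qed
  have "(cmod ?S)^2 <= 4 * M * (2 * K * (256 * 4 powr kp * ((1 + ln (2 * H)) * (1 + ln (2 * N))) * ((8 + 16 * C0 * t) * E)))"
  proof (rule order_trans[OF B1], intro mult_left_mono)
   show "(\<Sum>p\<in>hn_near kp H N (\<Lambda> / K). cmod (\<Sum>m\<in>Ms. g m (fst p) * cnj (g m (snd p))))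
     <= 256 * 4 powr kp * ((1 + ln (2 * H)) * (1 + ln (2 * N))) * ((8 + 16 * C0 * t) * E)"
    unfolding \<Lambda>_def
    by (rule order_trans[OF B2], unfold P1, unfold t_def[symmetric], intro mult_left_mono bracket) (use H N in auto)
  qed (use M K in auto)
  also have "... = 4 * C1 * (D / N) * K * ((1 + ln (2 * H)) * (1 + ln (2 * N))) * E"
   by (simp add: M_def C1_def t_def algebra_simps add_divide_distrib)
  finally show ?thesis by (simp add: E_def \<Phi>_def)
 qed
 have "4 * C1 > 0" using C0 by (auto simp: C1_def intro!: add_pos_pos mult_pos_pos)
 then show ?thesis by (rule that, intro main; simp)
qed

section \<open>Fourier approximation of the floor function\<close>

text \<open>This is the integral of the floor function from 0 to u in closed form. It is convex, so
  its difference quotients to the left and to the right enclose the floor.\<close>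

definition int_floor :: "real => real" where
 "int_floor u = of_int \<lfloor>u\<rfloor> * u - of_int \<lfloor>u\<rfloor> * (of_int \<lfloor>u\<rfloor> + 1) / 2"

text \<open>Convexity with the floor as subgradient. With m and n the integer parts of v and u, the
  difference of the two sides is the product (m - n)(v - (m + n + 1)/2), whose factors never have
  opposite signs.\<close>

lemma int_floor_tangent: "int_floor u + of_int \<lfloor>u\<rfloor> * (v - u) <= int_floor v"
proof -
 define m n where "m = \<lfloor>v\<rfloor>" and "n = \<lfloor>u\<rfloor>"
 have mv: "of_int m <= v" "v < of_int m + 1" by (auto simp: m_def)
 have "0 <= (of_int m - of_int n) * (v - (of_int m + of_int n + 1) / 2)"
 proof (cases m n rule: linorder_cases)
  case greater
  then have "real_of_int n + 1 <= real_of_int m" by linarith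
  then show ?thesis using mv by (intro mult_nonneg_nonneg) auto
 next
  case less
  then have "real_of_int m + 1 <= real_of_int n" by linarith
  then show ?thesis using mv by (intro mult_nonpos_nonpos) auto
 qed simp
 then show ?thesis unfolding int_floor_def m_def[symmetric] n_def[symmetric] by (simp add: field_simps)
qed


text \<open>Half the periodic Bernoulli function of degree 2. In contrast to the series of the
  sawtooth itself, this Fourier series converges absolutely and uniformly.\<close>

definition bern :: "real => real" where
 "bern u = (\<Sum>h. cos (2 * pi * real (Suc h) * u) / (2 * pi^2 * (real (Suc h))^2))"

lemma summable_inverse_Suc_squares: "summable (%h. 1 / (2 * pi^2 * (real (Suc h))^2))"
proof -
 have "summable (%h. 1 / (real (Suc h))^2)"
  using inverse_squares_sums by (simp add: sums_iff add.commute)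
 from summable_mult[OF this, of "1 / (2 * pi^2)"] show ?thesis by simp
qed

lemma sums_bern: "(%h. cos (2 * pi * real (Suc h) * u) / (2 * pi^2 * (real (Suc h))^2)) sums bern u"
 unfolding bern_def
proof (intro summable_sums summable_comparison_test[OF _ summable_inverse_Suc_squares] exI allI impI)
 fix n
 show "norm (cos (2 * pi * real (Suc n) * u) / (2 * pi^2 * (real (Suc n))^2)) <= 1 / (2 * pi^2 * (real (Suc n))^2)"
  by (simp add: abs_mult divide_right_mono del: of_nat_Suc)
qed

lemma bern_0: "bern 0 = 1 / 12"
proof -
 have "(%h. 1 / (real (Suc h))^2) sums (pi^2 / 6)" using inverse_squares_sums by (simp add: add.commute)
 from sums_mult[OF this, of "1 / (2 * pi^2)"] have "(%h. 1 / (2 * pi^2 * (real (Suc h))^2)) sums (1 / 12)"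
  by simp
 then show ?thesis using sums_bern[of 0] by (simp add: sums_iff)
qed

text \<open>The Abel means of the series. For r < 1 they may be differentiated termwise; taking (r,
  u) as one argument allows joint continuity up to r = 1 to be stated.\<close>

definition abel_bern :: "real \<times> real => real" where
 "abel_bern p = (\<Sum>h. fst p ^ Suc h * (cos (2 * pi * real (Suc h) * snd p) / (2 * pi^2 * (real (Suc h))^2)))"

lemma abel_bern_1: "abel_bern (1, u) = bern u"
 by (simp add: abel_bern_def bern_def)

lemma continuous_abel_bern: "continuous_on ({0..1} \<times> UNIV) abel_bern"
proof (rule uniform_limit_theorem)
 show "\<forall>\<^sub>F n in sequentially. continuous_on ({0..1} \<times> UNIV)
   (%p. \<Sum>h<n. fst p ^ Suc h * (cos (2 * pi * real (Suc h) * snd p) / (2 * pi^2 * (real (Suc h))^2)))"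
  by (intro always_eventually allI continuous_intros) auto
 show "uniform_limit ({0..1} \<times> UNIV)
   (%n p. \<Sum>h<n. fst p ^ Suc h * (cos (2 * pi * real (Suc h) * snd p) / (2 * pi^2 * (real (Suc h))^2))) abel_bern sequentially"
  unfolding abel_bern_def
 proof (rule Weierstrass_m_test[OF _ summable_inverse_Suc_squares])
  fix n and p :: "real \<times> real" assume p: "p \<in> {0..1} \<times> UNIV"
  have "fst p ^ Suc n <= 1" "0 <= fst p ^ Suc n" using p by (auto intro!: power_le_one simp del: power_Suc)
  then have "\<bar>fst p ^ Suc n\<bar> * \<bar>cos (2 * pi * real (Suc n) * snd p)\<bar> <= 1 * 1" by (intro mult_mono) auto
  then have "\<bar>fst p ^ Suc n\<bar> * \<bar>cos (2 * pi * real (Suc n) * snd p)\<bar> / (2 * pi^2 * (real (Suc n))^2) <= 1 / (2 * pi^2 * (real (Suc n))^2)"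
   by (intro divide_right_mono) auto
  then show "norm (fst p ^ Suc n * (cos (2 * pi * real (Suc n) * snd p) / (2 * pi^2 * (real (Suc n))^2))) <= 1 / (2 * pi^2 * (real (Suc n))^2)"
   by (simp only: real_norm_def abs_mult abs_divide times_divide_eq_right) simp
 qed
qed auto

text \<open>The termwise derivative is -1/\<pi> times the sum of r^h sin(2 \<pi> h u)/h, which is
  the imaginary part of the logarithmic series at r e(u).\<close>

lemma DERIV_abel_bern:
 assumes r: "0 <= r" "r < 1"
 shows "((%u. abel_bern (r, u)) has_real_derivative Im (Ln (1 - of_real r * ecis u)) / pi) (at u)"
proof -
 define f where "f h u = r ^ Suc h * (cos (2 * pi * real (Suc h) * u) / (2 * pi^2 * (real (Suc h))^2))" for h u
 define f' where "f' h u = - (r ^ Suc h * sin (2 * pi * real (Suc h) * u) / real (Suc h)) / pi" for h u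
 have d: "(f h has_field_derivative f' h u) (at u within UNIV)" for h u
  unfolding f_def f'_def
  by (rule derivative_eq_intros refl | simp add: field_simps power2_eq_square del: of_nat_Suc power_Suc)+
 have unif: "uniformly_convergent_on UNIV (%n u. \<Sum>i<n. f' i u)"
 proof (rule Weierstrass_m_test')
  show "summable (%h. r ^ Suc h)" using r by (auto simp: summable_geometric_iff)
  fix n u
  have "\<bar>r ^ Suc n\<bar> * \<bar>sin (2 * pi * real (Suc n) * u)\<bar> <= r ^ Suc n * 1"
   using r by (intro mult_mono) auto
  moreover have "1 <= real (Suc n) * pi" using pi_ge_two mult_mono[of 1 "real (Suc n)" 1 pi] by simp
  ultimately have "\<bar>r ^ Suc n\<bar> * \<bar>sin (2 * pi * real (Suc n) * u)\<bar> / (real (Suc n) * pi) <= r ^ Suc n * 1 / 1"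
   using r by (intro frac_le) auto
  then show "norm (f' n u) <= r ^ Suc n"
   by (simp add: f'_def abs_mult abs_divide del: of_nat_Suc power_Suc)
 qed
 have "summable (%h. f h 0)"
 proof (rule summable_comparison_test[OF _ summable_inverse_Suc_squares], intro exI allI impI)
  fix n
  have "\<bar>r ^ Suc n\<bar> <= 1" using r power_le_one[of r "Suc n"] by simp
  then show "norm (f n 0) <= 1 / (2 * pi^2 * (real (Suc n))^2)"
   unfolding f_def by (simp add: abs_mult divide_right_mono del: of_nat_Suc power_Suc)
 qed
 then have D: "((%u. \<Sum>h. f h u) has_field_derivative (\<Sum>h. f' h u)) (at u)"
  by (intro has_field_derivative_series'(2)[OF convex_UNIV d unif]) auto
 have "(%n. - ((- (- (of_real r * ecis u))) ^ n) / of_nat n) sums Ln (1 + (- (of_real r * ecis u)))"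
  using r by (intro Ln_series') (auto simp: norm_mult)
 from sums_Im[OF this] have "(%n. Im (- ((of_real r * ecis u) ^ n) / of_nat n)) sums Im (Ln (1 - of_real r * ecis u))"
  by simp
 moreover have "Im (- ((of_real r * ecis u) ^ n) / of_nat n) = - (r ^ n * sin (2 * pi * real n * u) / real n)" for n
 proof -
  have "(of_real r * ecis u) ^ n = of_real (r ^ n) * cis (2 * pi * real n * u)"
  proof -
   have "ecis u ^ n = cis (2 * pi * real n * u)"
    by (induction n) (simp_all add: cis_mult algebra_simps)
   then show ?thesis by (simp only: power_mult_distrib of_real_power)
  qed
  moreover have "(of_nat n :: complex) = of_real (real n)" by simp
  ultimately show ?thesis by (simp only: complex_of_real_def[symmetric] Im_divide_of_real) simp
 qed
 ultimately have "(%n. - (r ^ n * sin (2 * pi * real n * u) / real n)) sums Im (Ln (1 - of_real r * ecis u))"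
  by (simp only:)
 then have "(%n. - (r ^ Suc n * sin (2 * pi * real (Suc n) * u) / real (Suc n))) sums Im (Ln (1 - of_real r * ecis u))"
  by (subst sums_Suc_iff) simp
 from sums_divide[OF this, of pi] have "(\<Sum>h. f' h u) = Im (Ln (1 - of_real r * ecis u)) / pi"
  by (simp add: sums_iff f'_def)
 then show ?thesis using D by (simp add: f_def abel_bern_def)
qed

lemma Im_Ln_one_minus_cis:
 assumes "0 < u" "u < 1"
 shows "Im (Ln (1 - ecis u)) = pi * (u - 1/2)"
proof -
 have s: "0 < sin (pi * u)" using assms by (intro sin_gt_zero) auto
 have "1 - ecis u = of_real (2 * sin (pi * u)) * cis (pi * (u - 1/2))"
 proof -
  have "cos (2 * (pi * u)) = 1 - 2 * sin (pi * u) * sin (pi * u)" "sin (2 * (pi * u)) = 2 * sin (pi * u) * cos (pi * u)"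
   by (simp_all add: cos_double_sin sin_double power2_eq_square)
  moreover have "cos (pi * (u - 1/2)) = sin (pi * u)" "sin (pi * (u - 1/2)) = - cos (pi * u)"
   by (simp_all add: right_diff_distrib cos_diff sin_diff)
  ultimately show ?thesis by (simp add: complex_eq_iff mult.assoc)
 qed
 also have "... = exp (of_real (ln (2 * sin (pi * u))) + \<i> * of_real (pi * (u - 1/2)))"
  using s by (simp add: exp_add cis_conv_exp exp_of_real)
 finally have e: "1 - ecis u = exp (of_real (ln (2 * sin (pi * u))) + \<i> * of_real (pi * (u - 1/2)))" .
 have "- pi < pi * (u - 1/2)" "pi * (u - 1/2) <= pi"
  using assms mult_strict_left_mono[of "-1" "u - 1/2" pi] mult_left_mono[of "u - 1/2" 1 pi] by auto
 then have "Ln (1 - ecis u) = of_real (ln (2 * sin (pi * u))) + \<i> * of_real (pi * (u - 1/2))"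
  unfolding e by (intro Ln_exp) auto
 then show ?thesis by simp
qed

text \<open>The mean value theorem is applied for r < 1, after which r tends to 1. On [a, b] inside
  (0, 1) the point 1 - r e(u) avoids the cut of the logarithm, so the derivative tends to u - 1/2
  uniformly. This breaks down at the integers, whence the strict inequalities.\<close>

lemma bern_diff:
 assumes ab: "0 < a" "a < b" "b < 1"
 shows "bern b - bern a = (b\<^sup>2 - b) / 2 - (a\<^sup>2 - a) / 2"
proof -
 define h where "h p = Im (Ln (1 - of_real (fst p) * ecis (snd p)))" for p :: "real \<times> real"
 have cont: "continuous_on ({0..1} \<times> {a..b}) h"
  unfolding h_def
 proof (intro continuous_intros)
  fix p :: "real \<times> real" assume p: "p \<in> {0..1} \<times> {a..b}"
  obtain r u where e: "p = (r, u)" by (cases p)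
  have u: "0 < u" "u < 1" "0 <= r" "r <= 1" using p ab by (auto simp: e)
  have "cos (2 * (pi * u)) = 1 - 2 * (sin (pi * u))^2" by (simp add: cos_double_sin)
  moreover have "0 < (sin (pi * u))^2" using sin_gt_zero[of "pi * u"] u by simp
  ultimately have c: "cos (2 * pi * u) < 1" by (simp add: mult.assoc)
  have "r * cos (2 * pi * u) < 1"
  proof (cases "cos (2 * pi * u) <= 0")
   case True then show ?thesis using u mult_nonneg_nonpos[of r "cos (2 * pi * u)"] by linarith
  next
   case False then show ?thesis using u c mult_right_mono[of r 1 "cos (2 * pi * u)"] by linarith
  qed
  then show "1 - complex_of_real (fst p) * ecis (snd p) \<notin> \<real>\<^sub>\<le>\<^sub>0"
   by (auto simp: e complex_nonpos_Reals_iff)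
 qed
 have uc: "uniformly_continuous_on ({0..1} \<times> {a..b}) h"
  by (rule compact_uniformly_continuous[OF cont]) (auto intro: compact_Times)
 define D where "D r u = abel_bern (r, u) - (u\<^sup>2 - u) / 2" for r u
 have D1: "D 1 u = bern u - (u\<^sup>2 - u) / 2" for u by (simp add: D_def abel_bern_1)
 have contD: "continuous_on {0..1} (%r. D r u)" for u
  unfolding D_def by (intro continuous_intros continuous_on_compose2[OF continuous_abel_bern]) auto
 have small: "\<bar>D 1 b - D 1 a\<bar> <= e" if e: "e > 0" for e
 proof -
  obtain d where d: "d > 0" "\<forall>x\<in>{0..1} \<times> {a..b}. \<forall>y\<in>{0..1} \<times> {a..b}. dist y x < d \<longrightarrow> dist (h y) (h x) < e"
   using uc[unfolded uniformly_continuous_on_def, THEN spec, THEN mp, OF e] by (elim exE conjE)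
  have ev: "\<bar>D r b - D r a\<bar> <= e" if r: "0 <= r" "r < 1" "1 - d < r" for r
  proof -
   have der: "DERIV (D r) u :> h (r, u) / pi - (u - 1/2)" for u
    unfolding D_def h_def
    by (rule derivative_eq_intros DERIV_abel_bern r refl | simp add: field_simps)+
   obtain z where z: "a < z" "z < b" "D r b - D r a = (b - a) * (h (r, z) / pi - (z - 1/2))"
    using MVT2[OF ab(2) der] by auto
   have "dist (h (r, z)) (h (1, z)) < e"
   proof (rule d(2)[THEN bspec, THEN bspec, THEN mp])
    show "(1::real, z) \<in> {0..1} \<times> {a..b}" "(r, z) \<in> {0..1} \<times> {a..b}" using z r by auto
    show "dist (r, z) (1, z) < d" using r by (simp add: dist_Pair_Pair dist_real_def)
   qed
   moreover have "h (1, z) = pi * (z - 1/2)" using Im_Ln_one_minus_cis[of z] z ab by (simp add: h_def)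
   ultimately have "\<bar>h (r, z) - pi * (z - 1/2)\<bar> < e" by (simp add: dist_real_def)
   moreover have "h (r, z) / pi - (z - 1/2) = (h (r, z) - pi * (z - 1/2)) / pi" by (simp add: field_simps)
   ultimately have "\<bar>h (r, z) / pi - (z - 1/2)\<bar> <= e / pi" by (simp add: abs_divide divide_right_mono)
   moreover have "e / pi <= e / 1" using e pi_ge_two by (intro divide_left_mono) auto
   ultimately have "\<bar>h (r, z) / pi - (z - 1/2)\<bar> <= e" by simp
   then have "\<bar>b - a\<bar> * \<bar>h (r, z) / pi - (z - 1/2)\<bar> <= 1 * e" using ab e by (intro mult_mono) auto
   then show ?thesis unfolding z(3) abs_mult by simp
  qed
  have "((%r. \<bar>D r b - D r a\<bar>) \<longlongrightarrow> \<bar>D 1 b - D 1 a\<bar>) (at 1 within {0..1})"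
   using contD by (intro tendsto_intros) (auto simp: continuous_on_def)
  moreover have "\<forall>\<^sub>F r in at 1 within {0..1}. \<bar>D r b - D r a\<bar> <= e"
   unfolding eventually_at by (rule exI[of _ d]) (use d ev in \<open>auto simp: dist_real_def\<close>)
  moreover have "at (1::real) within {0..1} ~= bot" by (simp add: at_within_Icc_at_left)
  ultimately show ?thesis by (intro tendsto_upperbound) auto
 qed
 have "\<bar>D 1 b - D 1 a\<bar> <= 0"
  by (rule field_le_epsilon) (simp add: small)
 then show ?thesis by (simp add: D1)
qed

lemma continuous_bern: "continuous_on UNIV bern"
proof -
 have "continuous_on UNIV (%u. abel_bern (1, u))"
  by (intro continuous_on_compose2[OF continuous_abel_bern] continuous_intros) auto
 then show ?thesis by (simp add: abel_bern_1)
qed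

text \<open>The difference between the series and the polynomial is constant on (0, 1) by
  \<open>bern_diff\<close>. Continuity at 0 determines the constant, since the series there is a
  multiple of the sum of inverse squares.\<close>

lemma bern_eq:
 assumes "0 <= u" "u < 1"
 shows "bern u = (u^2 - u + 1/6) / 2"
proof (cases "u = 0")
 case True
 then show ?thesis by (simp add: bern_0)
next
 case False
 then have u: "0 < u" using assms by simp
 define g where "g a = bern a - (a\<^sup>2 - a) / 2" for a
 have "continuous_on UNIV g" unfolding g_def by (auto intro!: continuous_intros continuous_bern)
 then have "(g \<longlongrightarrow> g 0) (at_right 0)"
  by (metis UNIV_I at_within_open continuous_on_def filterlim_at_split open_UNIV)
 moreover have "(g \<longlongrightarrow> g u) (at_right 0)"
 proof (rule tendsto_eventually)
  show "\<forall>\<^sub>F a in at_right 0. g a = g u"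
   unfolding eventually_at_right_field
  proof (intro exI[of _ u] conjI allI impI)
   fix y assume "0 < y" "y < u"
   then show "g y = g u" using bern_diff[of y u] assms by (simp add: g_def)
  qed (use u in auto)
 qed
 ultimately have "g u = g 0" by (intro tendsto_unique) auto
 then show ?thesis by (simp add: g_def bern_0 field_simps)
qed

lemma bern_periodic: "bern (u + of_int k) = bern u"
proof -
 have "cos (2 * pi * real (Suc h) * (u + of_int k)) = cos (2 * pi * real (Suc h) * u)" for h
 proof -
  have "2 * pi * real (Suc h) * (u + of_int k) = 2 * pi * real (Suc h) * u + 2 * pi * of_int (int (Suc h) * k)"
   by (simp add: algebra_simps)
  then show ?thesis by (simp only: cos_add cos_int_2pin sin_int_2pin)
 qed
 then show ?thesis by (simp add: bern_def)
qed

lemma int_floor_bern: "int_floor u = u^2 / 2 - u / 2 + 1 / 12 - bern u"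
proof -
 define n t where "n = \<lfloor>u\<rfloor>" and "t = u - of_int n"
 have t: "0 <= t" "t < 1" by (auto simp: t_def n_def) linarith
 have u: "u = t + of_int n" by (simp add: t_def)
 have "bern u = (t^2 - t + 1/6) / 2" unfolding u bern_periodic by (rule bern_eq[OF t])
 then show ?thesis
  unfolding int_floor_def n_def[symmetric] by (simp add: u field_simps power2_eq_square)
qed

text \<open>An approximation to the sawtooth function, up to sign: a difference quotient of its
  primitive. Its h-th Fourier coefficient is at most min(1/h, 1/(h^2 dl)).\<close>

definition saw :: "real => real => real" where
 "saw dl u = (bern (u + dl) - bern u) / dl"

lemma norm_cis_minus_one_le: "cmod (cis t - 1) <= min 2 \<bar>t\<bar>"
proof -
 have "cmod (cis t - 1) <= cmod (cis t) + cmod 1" by (rule norm_triangle_ineq4)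
 moreover have "cmod (exp (\<i> * of_real t) - 1) <= \<bar>t\<bar>"
 proof -
  have "(cmod (cis t - 1))\<^sup>2 = 4 * (sin (t / 2))\<^sup>2"
  proof -
   have "(cmod (cis t - 1))\<^sup>2 = (cos t - 1)\<^sup>2 + (sin t)\<^sup>2" by (simp add: cmod_power2)
   also have "... = 2 - 2 * cos t" using sin_cos_squared_add[of t] by (simp add: power2_eq_square algebra_simps)
   also have "... = 4 * (sin (t / 2))^2" using cos_double_sin[of "t / 2"] by simp
   finally show ?thesis .
  qed
  also have "... <= 4 * (t / 2)^2"
   using abs_sin_x_le_abs_x[of "t / 2"] by (simp only: abs_le_square_iff)
  finally have "(cmod (cis t - 1))\<^sup>2 <= \<bar>t\<bar>\<^sup>2" by (simp add: power_divide)
  then have "cmod (cis t - 1) <= \<bar>t\<bar>" by (rule power2_le_imp_le) simp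
  then show ?thesis by (simp add: cis_conv_exp)
 qed
 ultimately show ?thesis by (simp add: cis_conv_exp)
qed

text \<open>The coefficients come from |e^(it) - 1| <= min(2, |t|). The shift s multiplies them by
  numbers of modulus 1, so one bound W serves the approximation from both sides. All partial sums
  are bounded by W and the limit inherits the bound.\<close>

lemma saw_sum_bound:
 fixes a u :: "'d => real"
 assumes d: "0 < dl"
  and W: "!!J. (\<Sum>h<J. min (1 / real (Suc h)) (1 / ((real (Suc h))^2 * dl)) * cmod (\<Sum>d\<in>S. a d * ecis (real (Suc h) * u d))) <= W"
 shows "\<bar>\<Sum>d\<in>S. a d * saw dl (u d - s)\<bar> <= W"
proof -
 define E where "E h = (\<Sum>d\<in>S. complex_of_real (a d) * ecis (real h * u d))" for h
 define c where "c h = (1 / (2 * pi^2 * (real h)^2 * dl)) *\<^sub>R ((cis (2 * pi * real h * dl) - 1) * cis (- (2 * pi * real h * s)))" for h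
 have cb: "cmod (c (Suc h)) <= min (1 / real (Suc h)) (1 / ((real (Suc h))^2 * dl))" for h
 proof -
  let ?h = "real (Suc h)"
  have pi1: "1 <= pi" using pi_ge_two by simp
  then have pi2: "1 <= pi^2" by simp
  have n: "cmod (c (Suc h)) = cmod (cis (2 * pi * ?h * dl) - 1) / (2 * pi^2 * ?h^2 * dl)"
   using d by (simp add: c_def norm_mult del: of_nat_Suc)
  have "cmod (c (Suc h)) <= 2 / (2 * pi^2 * ?h^2 * dl)"
   unfolding n using norm_cis_minus_one_le[of "2 * pi * ?h * dl"] d by (intro divide_right_mono) auto
  also have "... = 1 / (pi^2 * (?h^2 * dl))" by simp
  also have "... <= 1 / (1 * (?h^2 * dl))" using d pi2 by (intro divide_left_mono mult_right_mono) auto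
  finally have 1: "cmod (c (Suc h)) <= 1 / (?h^2 * dl)" by simp
  have "cmod (c (Suc h)) <= (2 * pi * ?h * dl) / (2 * pi^2 * ?h^2 * dl)"
   unfolding n using norm_cis_minus_one_le[of "2 * pi * ?h * dl"] d by (intro divide_right_mono) (auto simp: abs_mult)
  also have "... = 1 / (pi * ?h)" using d by (simp add: power2_eq_square del: of_nat_Suc)
  also have "... <= 1 / (1 * ?h)" using pi1 by (intro divide_left_mono mult_right_mono) auto
  finally show ?thesis using 1 by simp
 qed
 have "(%h. (cos (2 * pi * real (Suc h) * (v + dl)) / (2 * pi^2 * (real (Suc h))^2) - cos (2 * pi * real (Suc h) * v) / (2 * pi^2 * (real (Suc h))^2)) / dl) sums saw dl v" for v
  unfolding saw_def by (intro sums_divide sums_diff sums_bern)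
 then have "(%h. \<Sum>d\<in>S. a d * ((cos (2 * pi * real (Suc h) * ((u d - s) + dl)) / (2 * pi^2 * (real (Suc h))^2) - cos (2 * pi * real (Suc h) * (u d - s)) / (2 * pi^2 * (real (Suc h))^2)) / dl))
   sums (\<Sum>d\<in>S. a d * saw dl (u d - s))"
  by (intro sums_sum sums_mult)
 moreover have "(\<Sum>d\<in>S. a d * ((cos (2 * pi * real (Suc h) * ((u d - s) + dl)) / (2 * pi^2 * (real (Suc h))^2) - cos (2 * pi * real (Suc h) * (u d - s)) / (2 * pi^2 * (real (Suc h))^2)) / dl)) = Re (c (Suc h) * E (Suc h))" for h
 proof -
  let ?h = "real (Suc h)"
  have "a d * ((cos (2 * pi * ?h * ((u d - s) + dl)) / (2 * pi^2 * ?h^2) - cos (2 * pi * ?h * (u d - s)) / (2 * pi^2 * ?h^2)) / dl)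
   = Re (c (Suc h) * (complex_of_real (a d) * ecis (?h * u d)))" for d
  proof -
   have "(cis (2 * pi * ?h * dl) - 1) * cis (- (2 * pi * ?h * s)) * ecis (?h * u d)
    = cis (2 * pi * ?h * ((u d - s) + dl)) - cis (2 * pi * ?h * (u d - s))"
    by (simp add: left_diff_distrib cis_mult algebra_simps)
   moreover define k where "k = 1 / (2 * pi^2 * ?h^2 * dl)"
   have "c (Suc h) * (complex_of_real (a d) * ecis (?h * u d)) = of_real (a d * k) * ((cis (2 * pi * ?h * dl) - 1) * cis (- (2 * pi * ?h * s)) * ecis (?h * u d))"
    unfolding c_def scaleR_conv_of_real k_def[symmetric] by (simp only: of_real_mult mult_ac)
   ultimately have "Re (c (Suc h) * (complex_of_real (a d) * ecis (?h * u d))) = a d * k * (cos (2 * pi * ?h * ((u d - s) + dl)) - cos (2 * pi * ?h * (u d - s)))"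
    by (simp only:) (simp only: Re_complex_of_real Im_complex_of_real times_complex.sel minus_complex.sel cis.sel mult_zero_left diff_zero)
   then show ?thesis by (simp add: k_def diff_divide_distrib right_diff_distrib)
  qed
  then show ?thesis by (simp add: E_def sum_distrib_left)
 qed
 ultimately have sm: "(%h. Re (c (Suc h) * E (Suc h))) sums (\<Sum>d\<in>S. a d * saw dl (u d - s))" by simp
 have "\<bar>\<Sum>h<J. Re (c (Suc h) * E (Suc h))\<bar> <= W" for J
 proof -
  have "\<bar>\<Sum>h<J. Re (c (Suc h) * E (Suc h))\<bar> <= (\<Sum>h<J. \<bar>Re (c (Suc h) * E (Suc h))\<bar>)" by (rule sum_abs)
  also have "... <= (\<Sum>h<J. min (1 / real (Suc h)) (1 / ((real (Suc h))^2 * dl)) * cmod (E (Suc h)))"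
  proof (rule sum_mono)
   fix h
   have "\<bar>Re (c (Suc h) * E (Suc h))\<bar> <= cmod (c (Suc h)) * cmod (E (Suc h))"
    using abs_Re_le_cmod[of "c (Suc h) * E (Suc h)"] by (simp add: norm_mult)
   also have "... <= min (1 / real (Suc h)) (1 / ((real (Suc h))^2 * dl)) * cmod (E (Suc h))"
    by (intro mult_right_mono cb) auto
   finally show "\<bar>Re (c (Suc h) * E (Suc h))\<bar> <= min (1 / real (Suc h)) (1 / ((real (Suc h))^2 * dl)) * cmod (E (Suc h))" .
  qed
  also have "... <= W" using W[of J] by (simp add: E_def)
  finally show ?thesis .
 qed
 moreover have "(%J. \<bar>\<Sum>h<J. Re (c (Suc h) * E (Suc h))\<bar>) \<longlonglongrightarrow> \<bar>\<Sum>d\<in>S. a d * saw dl (u d - s)\<bar>"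
  using sm unfolding sums_def by (rule tendsto_rabs)
 ultimately show ?thesis by (intro LIMSEQ_le_const2) auto
qed

text \<open>The floor of v lies between the quotients \<open>Fl (v - dl)\<close> and
  \<open>Fl v\<close>, so the error of replacing it by \<open>Fl v\<close> is at most the
  nonnegative difference of the two. In that majorant the coefficients have been replaced by A: its
  constant part is dl, and the rest is a sum of exponentials without coefficients. This is why a
  bound W1 for the unweighted sums is required beside W.\<close>

theorem floor_sum_bound:
 fixes a u :: "'d => real"
 assumes d: "0 < dl" and A: "!!d. d \<in> S ==> \<bar>a d\<bar> <= A" and A0: "0 <= A"
  and W: "!!J. (\<Sum>h<J. min (1 / real (Suc h)) (1 / ((real (Suc h))^2 * dl)) * cmod (\<Sum>d\<in>S. a d * ecis (real (Suc h) * u d))) <= W"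
  and W1: "!!J. (\<Sum>h<J. min (1 / real (Suc h)) (1 / ((real (Suc h))^2 * dl)) * cmod (\<Sum>d\<in>S. ecis (real (Suc h) * u d))) <= W1"
 shows "\<bar>\<Sum>d\<in>S. a d * sawt (u d)\<bar> <= 2 * A * dl * real (card S) + W + 2 * A * W1"
proof -
 define Fl where "Fl v = (int_floor (v + dl) - int_floor v) / dl" for v
 have Fl: "Fl v = v + dl / 2 - 1/2 - saw dl v" for v
  using d unfolding Fl_def int_floor_bern saw_def by (simp add: field_simps power2_eq_square)
 have up: "of_int \<lfloor>v\<rfloor> <= Fl v" for v
  using int_floor_tangent[of v "v + dl"] d by (simp add: Fl_def field_simps)
 have lo: "Fl (v - dl) <= of_int \<lfloor>v\<rfloor>" for v
  using int_floor_tangent[of v "v - dl"] d by (simp add: Fl_def field_simps)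
 have 1: "\<bar>\<Sum>d\<in>S. a d * saw dl (u d - 0)\<bar> <= W" by (rule saw_sum_bound[OF d W])
 have 2: "\<bar>\<Sum>d\<in>S. (1::real) * saw dl (u d - s)\<bar> <= W1" for s
  by (rule saw_sum_bound[OF d]) (use W1 in simp)
 have dec: "(\<Sum>d\<in>S. a d * sawt (u d)) = (\<Sum>d\<in>S. a d * (of_int \<lfloor>u d\<rfloor> - Fl (u d))) + ((\<Sum>d\<in>S. a d) * (dl / 2) - (\<Sum>d\<in>S. a d * saw dl (u d)))"
  unfolding Fl sum_distrib_right sum_subtractf[symmetric] sum.distrib[symmetric] by (intro sum.cong refl) (simp add: algebra_simps)
 have p1: "\<bar>\<Sum>d\<in>S. a d * (of_int \<lfloor>u d\<rfloor> - Fl (u d))\<bar> <= A * (dl * real (card S) + W1 + W1)"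
 proof -
  have "\<bar>\<Sum>d\<in>S. a d * (of_int \<lfloor>u d\<rfloor> - Fl (u d))\<bar> <= (\<Sum>d\<in>S. \<bar>a d\<bar> * \<bar>of_int \<lfloor>u d\<rfloor> - Fl (u d)\<bar>)"
   unfolding abs_mult[symmetric] by (rule sum_abs)
  also have "... <= (\<Sum>d\<in>S. A * (Fl (u d) - Fl (u d - dl)))"
  proof (intro sum_mono mult_mono A)
   fix d
   show "\<bar>of_int \<lfloor>u d\<rfloor> - Fl (u d)\<bar> <= Fl (u d) - Fl (u d - dl)"
    using up[of "u d"] lo[of "u d"] by linarith
  qed (use A0 in auto)
  also have "... = A * (dl * real (card S) - (\<Sum>d\<in>S. 1 * saw dl (u d - 0)) + (\<Sum>d\<in>S. 1 * saw dl (u d - dl)))"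
   unfolding Fl by (simp add: sum_distrib_left[symmetric] sum.distrib sum_subtractf algebra_simps)
  also have "... <= A * (dl * real (card S) + W1 + W1)"
   using 2[of 0] 2[of dl] A0 by (intro mult_left_mono) linarith+
  finally show ?thesis .
 qed
 have p2: "\<bar>(\<Sum>d\<in>S. a d) * (dl / 2)\<bar> <= A * dl * real (card S)"
 proof -
  have "\<bar>\<Sum>d\<in>S. a d\<bar> <= (\<Sum>d\<in>S. A)" by (rule order_trans[OF sum_abs]) (intro sum_mono A)
  then have "\<bar>\<Sum>d\<in>S. a d\<bar> * (dl / 2) <= (A * real (card S)) * dl" using d by (intro mult_mono) (auto simp: mult.commute)
  then show ?thesis using d by (simp add: abs_mult mult_ac)
 qed
 show ?thesis unfolding dec using p1 p2 1 by (simp add: algebra_simps abs_le_iff)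
qed

section \<open>Dirichlet convolution\<close>

text \<open>At n = 0 the index set is infinite and the sum is therefore 0, in agreement with the
  dummy value of \<open>mu2\<close> at 0.\<close>

definition dconv :: "(nat => real) => (nat => real) => nat => real" where
 "dconv f g n = (\<Sum>(a, b)\<in>{(a, b). a * b = n}. f a * g b)"

definition dunit :: "nat => real" where "dunit n = of_bool (n = 1)"

lemma finite_factorizations:
 assumes "n > 0" shows "finite {(a, b). a * b = (n::nat)}"
proof (rule finite_subset)
 show "{(a, b). a * b = n} \<subseteq> {..n} \<times> {..n}"
 proof clarify
  fix a b assume "n = a * b"
  then have "a dvd a * b" "b dvd a * b" "a * b > 0" using assms by simp_all
  then show "a \<in> {..a * b} \<and> b \<in> {..a * b}" by (auto dest: dvd_imp_le)
 qed
qed simp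

lemma dconv_0 [simp]: "dconv f g 0 = 0"
proof -
 have "infinite {(a, b). a * b = (0::nat)}"
 proof
  assume "finite {(a, b). a * b = (0::nat)}"
  then have "finite ((%b. (0::nat, b::nat)) ` UNIV)" by (rule finite_subset[rotated]) auto
  then have "finite (UNIV :: nat set)" by (rule finite_imageD) (auto simp: inj_on_def)
  then show False by simp
 qed
 then show ?thesis by (simp add: dconv_def)
qed

lemma dconv_commute: "dconv f g n = dconv g f n"
 unfolding dconv_def
 by (rule sum.reindex_bij_witness[of _ prod.swap prod.swap]) (auto simp: mult.commute)

lemma dconv_assoc: "dconv (dconv f g) h n = dconv f (dconv g h) n"
proof (cases "n = 0")
 case False
 then have n: "n > 0" by simp
 have fin: "finite {(a, b). a * b = n}" by (rule finite_factorizations[OF n])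
 have fs: "finite {(a, b). a * b = fst p}" "finite {(a, b). a * b = snd p}" if "p \<in> {(a, b). a * b = n}" for p
  using that n by (auto intro!: finite_factorizations Nat.gr0I)
 have "dconv (dconv f g) h n = (\<Sum>p\<in>{(a, b). a * b = n}. \<Sum>q\<in>{(a, b). a * b = fst p}. f (fst q) * g (snd q) * h (snd p))"
  by (simp add: dconv_def case_prod_beta sum_distrib_right)
 also have "... = (\<Sum>(p, q)\<in>(SIGMA p:{(a, b). a * b = n}. {(a, b). a * b = fst p}). f (fst q) * g (snd q) * h (snd p))"
  by (rule sum.Sigma) (use fin fs in auto)
 also have "... = (\<Sum>(p, q)\<in>(SIGMA p:{(a, b). a * b = n}. {(a, b). a * b = snd p}). f (fst p) * (g (fst q) * h (snd q)))"
  by (rule sum.reindex_bij_witness[of _ "%(p, q). ((fst p * fst q, snd q), (fst p, fst q))" "%(p, q). ((fst q, snd q * snd p), (snd q, snd p))"])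
   (auto simp: mult_ac)
 also have "... = (\<Sum>p\<in>{(a, b). a * b = n}. \<Sum>q\<in>{(a, b). a * b = snd p}. f (fst p) * (g (fst q) * h (snd q)))"
  by (rule sum.Sigma[symmetric]) (use fin fs in auto)
 also have "... = dconv f (dconv g h) n"
  by (simp add: dconv_def case_prod_beta sum_distrib_left)
 finally show ?thesis .
qed simp

lemma dconv_add_left: "dconv (%n. f n + g n) h n = dconv f h n + dconv g h n"
 by (simp add: dconv_def case_prod_beta distrib_right sum.distrib)

lemma dconv_add_right: "dconv f (%n. g n + h n) n = dconv f g n + dconv f h n"
 by (simp add: dconv_def case_prod_beta distrib_left sum.distrib)

lemma dconv_dunit_right: "n > 0 ==> dconv f dunit n = f n"
proof -
 assume n: "n > 0"
 have fin: "finite {p. fst p * snd p = n}"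
  using finite_factorizations[OF n] by (simp add: case_prod_unfold)
 have "dconv f dunit n = (\<Sum>p\<in>{(n, 1)}. f (fst p) * dunit (snd p))"
  unfolding dconv_def case_prod_beta
  by (rule sum.mono_neutral_right) (use fin in \<open>auto simp: dunit_def\<close>)
 then show ?thesis by (simp add: dunit_def)
qed

lemma dconv_cong:
 assumes "!!n. n > 0 ==> f n = f' n" "!!n. n > 0 ==> g n = g' n"
 shows "dconv f g n = dconv f' g' n"
proof (cases "n = 0")
 case False
 show ?thesis unfolding dconv_def
  by (intro sum.cong refl) (use assms False in \<open>auto\<close>)
qed simp

lemma dconv_one: "n > 0 ==> dconv f (%_. 1) n = (\<Sum>d | d dvd n. f d)"
 unfolding dconv_def case_prod_beta
 by (rule sum.reindex_bij_witness[of _ "%d. (d, n div d)" fst]) auto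

definition ndiv :: "nat => real" where "ndiv = dconv (%_. 1) (%_. 1)"

lemma ndiv_eq: "n > 0 ==> ndiv n = real (card {d. d dvd n})"
 by (simp add: ndiv_def dconv_one)

lemma ndiv_nonneg: "0 <= ndiv n"
 by (auto simp: ndiv_def dconv_def intro!: sum_nonneg)

lemma card_divisors_mult_coprime:
 assumes "coprime m (n::nat)"
 shows "card {d. d dvd m * n} = card {d. d dvd m} * card {d. d dvd n}"
proof -
 have "bij_betw (%(a, b). a * b) ({d. d dvd m} \<times> {d. d dvd n}) {d. d dvd m * n}"
 proof (rule bij_betwI')
  fix x y assume x: "x \<in> {d. d dvd m} \<times> {d. d dvd n}" and y: "y \<in> {d. d dvd m} \<times> {d. d dvd n}"
  obtain a b a' b' where e: "x = (a, b)" "y = (a', b')" by (metis prod.collapse)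
  have d: "a dvd m" "b dvd n" "a' dvd m" "b' dvd n" using x y e by auto
  have c: "coprime a b'" "coprime a' b" using d assms by (meson coprime_divisors)+
  show "((case x of (a, b) => a * b) = (case y of (a, b) => a * b)) = (x = y)"
  proof
   assume "(case x of (a, b) => a * b) = (case y of (a, b) => a * b)"
   then have eq: "a * b = a' * b'" by (simp add: e)
   have "a dvd a'" using eq c by (metis coprime_dvd_mult_left_iff dvd_triv_left)
   moreover have "a' dvd a" using eq c by (metis coprime_dvd_mult_left_iff dvd_triv_left)
   ultimately have "a = a'" by (rule dvd_antisym)
   moreover have "b dvd b'" using eq c by (metis coprime_commute coprime_dvd_mult_right_iff dvd_triv_right)
   moreover have "b' dvd b" using eq c by (metis coprime_commute coprime_dvd_mult_right_iff dvd_triv_right)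
   ultimately show "x = y" by (simp add: e dvd_antisym)
  qed simp
 next
  fix x assume "x \<in> {d. d dvd m} \<times> {d. d dvd n}"
  then show "(case x of (a, b) => a * b) \<in> {d. d dvd m * n}" by (auto intro: mult_dvd_mono)
 next
  fix y assume "y \<in> {d. d dvd m * n}"
  then obtain a b where "y = a * b" "a dvd m" "b dvd n" using division_decomp[of y m n] by auto
  then show "\<exists>x\<in>{d. d dvd m} \<times> {d. d dvd n}. y = (case x of (a, b) => a * b)" by auto
 qed
 from bij_betw_same_card[OF this] show ?thesis by (simp add: card_cartesian_product)
qed

lemma card_divisors_prime_power: "prime p ==> card {d. d dvd p ^ k} = k + 1" for p :: nat
proof -
 assume p: "prime p"
 have "{d. d dvd p ^ k} = (%i. p ^ i) ` {..k}"
  using p by (auto simp: divides_primepow_nat)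
 moreover have "inj_on (%i. p ^ i) {..k}"
  using prime_gt_1_nat[OF p] by (auto simp: inj_on_def)
 ultimately show ?thesis by (simp add: card_image)
qed

text \<open>
 Only the finitely many primes below \<open>2\<^bsup>1/ep\<^esup>\<close> violate \<open>k + 1 <= p\<^bsup>kep\<^esup>\<close>, and each of them costs a bounded factor.
\<close>

lemma divisor_bound:
 assumes e: "ep > 0"
 obtains C where "C >= 1" "!!n. n > 0 ==> ndiv n <= C * real n powr ep"
proof -
 define B where "B = (2::real) powr (1 / ep)"
 \<comment> \<open>With this A the inequality k + 1 <= A (1 + k ep ln 2) holds for all k, which
   bounds the local factor of every prime below B.\<close>
 define A where "A = 1 + 1 / (ep * ln 2)"
 have A: "A >= 1" using e by (simp add: A_def)
 have two: "real k + 1 <= A * 2 powr (real k * ep)" for k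
 proof -
  have "1 + real k * ep * ln 2 <= exp (real k * ep * ln 2)" by (rule exp_ge_add_one_self)
  then have "1 + real k * ep * ln 2 <= 2 powr (real k * ep)" by (simp add: powr_def)
  then have "A * (1 + real k * ep * ln 2) <= A * 2 powr (real k * ep)" using A by (intro mult_left_mono) auto
  moreover have "real k + 1 <= A * (1 + real k * ep * ln 2)"
  proof -
   have "1 / (ep * ln 2) * (real k * ep * ln 2) = real k" using e by simp
   moreover have "0 <= real k * ep * ln 2" "0 <= 1 / (ep * ln 2)" using e by auto
   ultimately show ?thesis unfolding A_def distrib_right distrib_left by linarith
  qed
  ultimately show ?thesis by linarith
 qed
 define Q where "Q = {p::nat. prime p \<and> real p < B}"
 have finQ: "finite Q"
  by (rule finite_subset[of _ "{..nat \<lceil>B\<rceil>}"]) (auto simp: Q_def, linarith)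
 have key: "real (card {d. d dvd n}) <= A ^ card (prime_factors n \<inter> Q) * real n powr ep" if "n > 0" for n
  using that
 proof (induction n rule: less_induct)
  case (less n)
  show ?case
  proof (cases "n = 1")
   case True
   then show ?thesis by simp
  next
   case False
   then obtain p where p: "prime p" "p dvd n" using prime_factor_nat by blast
   define k where "k = multiplicity p n"
   obtain m where m: "n = p ^ k * m" "\<not> p dvd m"
    using multiplicity_decompose'[of n p] less.prems p(1) k_def by (metis not_prime_unit not_gr_zero)
   have m0: "m > 0" using m less.prems by (intro Nat.gr0I) auto
   have k0: "k > 0" using p less.prems by (simp add: k_def prime_multiplicity_gt_zero_iff)
   have "p ^ k > 1" using one_less_power[OF prime_gt_1_nat[OF p(1)] k0] .
   then have mn: "m < n" using m0 m(1) by simp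
   have cop: "coprime (p ^ k) m" using m(2) p(1) by (simp add: prime_imp_coprime)
   have IH: "real (card {d. d dvd m}) <= A ^ card (prime_factors m \<inter> Q) * real m powr ep"
    using less.IH[OF mn m0] .
   have pf: "prime_factors n = insert p (prime_factors m)"
   proof -
    have "x = p" if "prime x" "x dvd p ^ k" for x
     using prime_dvd_power[OF that] p(1) that(1) by (simp add: primes_dvd_imp_eq)
    then show ?thesis
     unfolding m(1) using p m0 k0 by (auto simp: in_prime_factors_iff prime_dvd_mult_iff)
   qed
   have pnm: "p \<notin> prime_factors m" using m(2) by auto
   have "real (card {d. d dvd n}) = (real k + 1) * real (card {d. d dvd m})"
    unfolding m(1) card_divisors_mult_coprime[OF cop] card_divisors_prime_power[OF p(1)] by (simp add: algebra_simps)
   also have "... <= (if p \<in> Q then A else 1) * (real (p ^ k) powr ep) * (A ^ card (prime_factors m \<inter> Q) * real m powr ep)"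
   proof (intro mult_mono IH)
    have pk: "real (p ^ k) powr ep = real p powr (real k * ep)"
     using prime_gt_0_nat[OF p(1)] by (simp add: powr_powr[symmetric] powr_realpow)
    show "real k + 1 <= (if p \<in> Q then A else 1) * real (p ^ k) powr ep"
    proof (cases "p \<in> Q")
     case True
     have "2 powr (real k * ep) <= real p powr (real k * ep)"
      using prime_ge_2_nat[OF p(1)] e by (intro powr_mono2) auto
     then have "A * 2 powr (real k * ep) <= A * real p powr (real k * ep)" using A by (intro mult_left_mono) auto
     then show ?thesis using two[of k] True unfolding pk by simp
    next
     case False
     then have "B <= real p" using p by (simp add: Q_def)
     then have "B powr (real k * ep) <= real p powr (real k * ep)" using e by (intro powr_mono2) (auto simp: B_def)
     moreover have "B powr (real k * ep) = 2 ^ k" using e by (simp add: B_def powr_powr powr_realpow)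
     moreover have "real k + 1 <= 2 ^ k"
     proof -
      have "Suc k <= 2 ^ k" by (simp add: Suc_le_eq)
      then have "real (Suc k) <= real (2 ^ k)" by (simp only: of_nat_le_iff)
      then show ?thesis by simp
     qed
     ultimately show ?thesis using False unfolding pk by simp
    qed
   qed (use A in auto)
   also have "... = A ^ card (prime_factors n \<inter> Q) * real n powr ep"
   proof -
    have "A ^ card (prime_factors n \<inter> Q) = (if p \<in> Q then A else 1) * A ^ card (prime_factors m \<inter> Q)"
     using pnm by (auto simp: pf)
    moreover have "real n powr ep = real (p ^ k) powr ep * real m powr ep"
     unfolding m(1) by (simp add: powr_mult)
    ultimately show ?thesis by (simp add: mult_ac)
   qed
   finally show ?thesis .
  qed
 qed
 show ?thesis
 proof (rule that[of "A ^ card Q"])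
  fix n :: nat assume n: "n > 0"
  have "A ^ card (prime_factors n \<inter> Q) <= A ^ card Q"
   using A finQ by (intro power_increasing card_mono) auto
  then have h: "A ^ card (prime_factors n \<inter> Q) * real n powr ep <= A ^ card Q * real n powr ep"
   by (intro mult_right_mono) auto
  show "ndiv n <= A ^ card Q * real n powr ep"
   unfolding ndiv_eq[OF n] by (rule order_trans[OF key[OF n] h])
 qed (use A in \<open>simp add: one_le_power\<close>)
qed

lemma dconv_bound:
 assumes f: "!!k. 0 < k ==> \<bar>f k\<bar> <= A * real k powr ep" and g: "!!k. 0 < k ==> \<bar>g k\<bar> <= B * real k powr ep"
  and C: "!!k. 0 < k ==> ndiv k <= C * real k powr dl" and n: "0 < n" and AB: "0 <= A" "0 <= B"
 shows "\<bar>dconv f g n\<bar> <= A * B * C * real n powr (ep + dl)"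
proof -
 have "\<bar>dconv f g n\<bar> <= (\<Sum>(a, b)\<in>{(a, b). a * b = n}. \<bar>f a * g b\<bar>)"
  unfolding dconv_def case_prod_beta by (rule sum_abs)
 also have "... <= (\<Sum>(a, b)\<in>{(a, b). a * b = n}. A * B * real n powr ep)"
 proof (rule sum_mono, clarify)
  fix a b assume e: "n = a * b"
  have "\<bar>f a\<bar> * \<bar>g b\<bar> <= (A * real a powr ep) * (B * real b powr ep)"
   using n e AB by (intro mult_mono f g) auto
  then show "\<bar>f a * g b\<bar> <= A * B * real (a * b) powr ep" by (simp add: abs_mult powr_mult mult_ac)
 qed
 also have "... = A * B * real n powr ep * ndiv n" by (simp add: ndiv_def dconv_def)
 also have "... <= A * B * real n powr ep * (C * real n powr dl)"
  using AB n by (intro mult_left_mono C) auto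
 finally show ?thesis by (simp add: powr_add mult_ac)
qed

section \<open>The Moebius function and a Vaughan-type identity\<close>

definition moebius :: "nat => real" where
 "moebius n = (if squarefree n then (-1) ^ card (prime_factors n) else 0)"

lemma abs_moebius_le: "\<bar>moebius n\<bar> <= 1"
 by (simp add: moebius_def power_abs)

lemma moebius_0 [simp]: "moebius 0 = 0"
 by (simp add: moebius_def)

text \<open>Squarefree divisors of n correspond to sets of prime factors of n, and the alternating
  sum over all subsets of a set P expands (-1 + 1)^|P|.\<close>

lemma sum_moebius:
 assumes n: "n > 0"
 shows "(\<Sum>d | d dvd n. moebius d) = of_bool (n = 1)"
proof -
 let ?P = "prime_factors n"
 have prm: "prime p" if "p \<in> ?P" for p using that by auto
 have pf: "prime_factors (\<Prod>S) = S" if "S \<subseteq> ?P" for S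
 proof -
  have fin: "finite S" using that finite_subset by blast
  show ?thesis
   using fin that
  proof (induction S)
   case (insert p S)
   have "prime p" using insert prm by auto
   moreover have "\<Prod>S ~= 0" using insert prm by (auto simp: prod_zero_iff intro: ccontr)
   ultimately show ?case using insert by (simp add: prime_factors_product prime_prime_factors)
  qed simp
 qed
 have sqf: "squarefree (\<Prod>S)" if "S \<subseteq> ?P" for S
 proof -
  have fin: "finite S" using that finite_subset by blast
  show ?thesis using fin that
  proof (induction S)
   case (insert p S)
   have p: "prime p" using insert prm by auto
   have "coprime p (\<Prod>S)"
    using insert p prm by (intro prod_coprime_right) (auto intro!: primes_coprime)
   then show ?case using insert p by (simp add: squarefree_mult_coprime squarefree_prime)
  qed simp
 qed
 have "(\<Sum>d | d dvd n. moebius d) = (\<Sum>d | d dvd n \<and> squarefree d. moebius d)"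
  by (rule sum.mono_neutral_right) (use n in \<open>auto simp: moebius_def\<close>)
 also have "... = (\<Sum>S\<in>Pow ?P. (-1) ^ card S)"
 proof (rule sum.reindex_bij_witness[of _ "%S. \<Prod>S" prime_factors])
  fix d assume d: "d \<in> {d. d dvd n \<and> squarefree d}"
  then have d0: "d ~= 0" using n by auto
  show "\<Prod>(prime_factors d) = d"
  proof -
   have "d = (\<Prod>p\<in>prime_factors d. p ^ multiplicity p d)" using d0 by (simp add: prime_factorization_nat)
   also have "... = (\<Prod>p\<in>prime_factors d. p)"
    using d d0 by (intro prod.cong refl) (auto simp: squarefree_factorial_semiring' prime_factors_multiplicity)
   finally show ?thesis by simp
  qed
  show "prime_factors d \<in> Pow ?P" using d n by (auto intro: dvd_prime_factors[THEN subsetD])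
  show "(- 1) ^ card (prime_factors d) = moebius d" using d by (simp add: moebius_def)
 next
  fix S assume S: "S \<in> Pow ?P"
  then show "prime_factors (\<Prod>S) = S" using pf by auto
  have "\<Prod>S dvd \<Prod>?P" using S by (intro prod_dvd_prod_subset) auto
  also have "\<Prod>?P dvd n"
  proof -
   have "(\<Prod>p\<in>?P. p) dvd (\<Prod>p\<in>?P. p ^ multiplicity p n)"
    by (intro prod_dvd_prod dvd_power) (auto simp: prime_factors_multiplicity)
   then show ?thesis using n by (simp add: prime_factorization_nat[symmetric])
  qed
  finally show "\<Prod>S \<in> {d. d dvd n \<and> squarefree d}" using sqf S by auto
 qed
 also have "... = of_bool (?P = {})"
 proof -
  have "(\<Sum>S\<in>Pow ?P. (-1) ^ card S :: real) = (\<Prod>p\<in>?P. (-1) + 1)"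
   by (subst prod_add) (auto simp: prod_constant)
  then show ?thesis by (auto simp: power_0_left card_eq_0_iff)
 qed
 also have "(?P = {}) \<longleftrightarrow> n = 1"
  using n prime_factorization_empty_iff[of n] by auto
 finally show ?thesis .
qed

lemma dconv_moebius_one: "n > 0 ==> dconv moebius (%_. 1) n = dunit n"
 by (simp add: dconv_one sum_moebius dunit_def)

definition moebius2 :: "nat => real" where "moebius2 = dconv moebius moebius"

lemma abs_moebius2_le: "n > 0 ==> \<bar>moebius2 n\<bar> <= ndiv n"
proof -
 have "\<bar>moebius2 n\<bar> <= (\<Sum>p\<in>{(a, b). a * b = n}. \<bar>moebius (fst p) * moebius (snd p)\<bar>)"
  unfolding moebius2_def dconv_def case_prod_beta by (rule sum_abs)
 also have "... <= (\<Sum>p\<in>{(a, b). a * b = n}. 1)"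
  using mult_mono[OF abs_moebius_le abs_moebius_le] by (intro sum_mono) (simp add: abs_mult)
 finally show ?thesis by (simp add: ndiv_def dconv_def)
qed

text \<open>The same function as \<open>ndiv\<close>; the second name marks its role as the
  convolution inverse of \<open>moebius2\<close> instead of a majorant.\<close>

definition ones2 :: "nat => real" where "ones2 = dconv (%_. 1) (%_. 1)"

lemma dconv_moebius2_ones2: "n > 0 ==> dconv moebius2 ones2 n = dunit n"
proof -
 assume n: "n > 0"
 have "dconv moebius2 ones2 n = dconv moebius (dconv moebius (dconv (%_. 1) (%_. 1))) n"
  unfolding moebius2_def ones2_def by (rule dconv_assoc)
 also have "... = dconv moebius (dconv (dconv moebius (%_. 1)) (%_. 1)) n"
  by (rule dconv_cong) (auto simp: dconv_assoc)
 also have "... = dconv moebius (%_. 1) n"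
 proof (rule dconv_cong)
  fix k :: nat assume k: "k > 0"
  have "dconv (dconv moebius (%_. 1)) (%_. 1) k = dconv dunit (%_. 1) k"
   by (rule dconv_cong) (auto simp: dconv_moebius_one)
  then show "dconv (dconv moebius (%_. 1)) (%_. 1) k = 1"
   using dconv_dunit_right[OF k, of "%_. 1"] by (simp add: dconv_commute[of dunit])
 qed simp
 finally show ?thesis using dconv_moebius_one[OF n] by simp
qed

text \<open>A Vaughan-type identity: \<open>(R - P)(R + P) = R\<^sup>2 - P\<^sup>2\<close>, where \<open>R + P\<close> is inverse to \<open>ones2\<close>.\<close>

lemma vaughan_identity:
 assumes PR: "!!n. moebius2 n = P n + R n" and n: "n > 0"
 shows "R n - P n = dconv R (dconv R ones2) n - dconv (dconv P P) ones2 n"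
proof -
 have m: "dconv f (dconv moebius2 ones2) n = f n" if "n > 0" for f n
  using that dconv_cong[of f f "dconv moebius2 ones2" dunit n] by (simp add: dconv_moebius2_ones2 dconv_dunit_right)
 have e: "moebius2 = (%n. P n + R n)" using PR by auto
 \<comment> \<open>Convolving with \<open>moebius2\<close> and then with its inverse changes
   nothing, so f is the sum of f * P * ones2 and f * R * ones2. On subtracting the case f = P from
   the case f = R the mixed products cancel.\<close>
 have ex: "f n = dconv f (dconv P ones2) n + dconv f (dconv R ones2) n" for f
 proof -
  have "f n = dconv f (dconv moebius2 ones2) n" using m[OF n] by simp
  also have "... = dconv f (%k. dconv P ones2 k + dconv R ones2 k) n"
   by (intro dconv_cong refl) (simp add: e dconv_add_left)
  also have "... = dconv f (dconv P ones2) n + dconv f (dconv R ones2) n" by (rule dconv_add_right)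
  finally show ?thesis .
 qed
 have sw: "dconv R (dconv P ones2) n = dconv P (dconv R ones2) n"
 proof -
  have "dconv R (dconv P ones2) n = dconv (dconv R P) ones2 n" by (rule dconv_assoc[symmetric])
  also have "... = dconv (dconv P R) ones2 n" by (rule dconv_cong) (auto simp: dconv_commute)
  also have "... = dconv P (dconv R ones2) n" by (rule dconv_assoc)
  finally show ?thesis .
 qed
 show ?thesis using ex[of R] ex[of P] sw dconv_assoc[of P P ones2 n] by linarith
qed

section \<open>The floor sum over small divisors\<close>

definition esum :: "real => real => real => (nat => real) => real => complex" where
 "esum kp X D g h = (\<Sum>d | D < real d \<and> real d <= 2 * D. of_real (g d) * ecis (h * X * real d powr -kp))"

lemma finite_block: "finite {d::nat. D < real d \<and> real d <= E}"
 by (rule finite_subset[of _ "{..nat \<lfloor>E\<rfloor>}"]) (auto simp: le_nat_floor)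

lemma esum_cong: "(!!d. D < real d ==> real d <= 2 * D ==> f d = g d) ==> esum kp X D f h = esum kp X D g h"
 unfolding esum_def by (intro sum.cong refl) auto

lemma esum_add: "esum kp X D (%d. f d + g d) h = esum kp X D f h + esum kp X D g h"
 unfolding esum_def sum.distrib[symmetric] by (intro sum.cong refl) (simp add: algebra_simps)

lemma esum_scale: "esum kp X D (%d. k * f d) h = of_real k * esum kp X D f h"
 unfolding esum_def sum_distrib_left by (intro sum.cong refl) simp

text \<open>The convolution is opened into pairs (n, m). Its support is prescribed only for n up to
  2D because a larger n has no cofactor in the block.\<close>

lemma esum_dconv:
 assumes D: "0 <= D" and p: "!!n. 0 < n ==> real n <= 2 * D ==> n \<notin> ns ==> p n = 0" and ns: "finite ns"
 shows "esum kp X D (dconv p q) h = (\<Sum>n\<in>ns. of_real (p n) *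
  (\<Sum>m\<in>cof D (2 * D) n. of_real (q m) * ecis (h * X * (real m * real n) powr -kp)))"
proof -
 define S where "S = {d::nat. D < real d \<and> real d <= 2 * D}"
 define P where "P = {r::nat \<times> nat. D < real (fst r) * real (snd r) \<and> real (fst r) * real (snd r) <= 2 * D}"
 define F where "F r = of_real (p (fst r) * q (snd r)) * ecis (h * X * (real (snd r) * real (fst r)) powr -kp)" for r
 have pos: "0 < a \<and> 0 < b \<and> real a <= 2 * D \<and> real b <= 2 * D" if "(a, b) \<in> P" for a b
 proof -
  have ab: "D < real a * real b" "real a * real b <= 2 * D" using that by (auto simp: P_def)
  then have "0 < a" "0 < b" using D by (auto intro!: Nat.gr0I)
  moreover have "real a * 1 <= real a * real b" "1 * real b <= real a * real b"
   using \<open>0 < a\<close> \<open>0 < b\<close> by (intro mult_left_mono mult_right_mono; simp)+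
  ultimately show ?thesis using ab by (intro conjI) linarith+
 qed
 have finP: "finite P"
 proof (rule finite_subset)
  show "P \<subseteq> {..nat \<lfloor>2 * D\<rfloor>} \<times> {..nat \<lfloor>2 * D\<rfloor>}" using pos by (auto simp: le_nat_floor)
 qed simp
 have finS: "finite S" unfolding S_def by (rule finite_block)
 have S0: "d > 0" if "d \<in> S" for d using that D by (auto simp: S_def intro!: Nat.gr0I)
 have "esum kp X D (dconv p q) h = (\<Sum>d\<in>S. \<Sum>r\<in>{(a, b). a * b = d}. F r)"
  unfolding esum_def S_def[symmetric]
 proof (intro sum.cong refl)
  fix d assume "d \<in> S"
  show "of_real (dconv p q d) * ecis (h * X * real d powr -kp) = (\<Sum>r\<in>{(a, b). a * b = d}. F r)"
   unfolding dconv_def of_real_sum sum_distrib_right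
   by (intro sum.cong refl) (auto simp: F_def mult.commute)
 qed
 also have "... = (\<Sum>(d, r)\<in>(SIGMA d:S. {(a, b). a * b = d}). F r)"
  by (rule sum.Sigma[OF finS]) (use S0 in \<open>auto intro: finite_factorizations\<close>)
 also have "... = (\<Sum>r\<in>P. F r)"
  by (rule sum.reindex_bij_witness[of _ "%r. (fst r * snd r, r)" snd]) (auto simp: P_def S_def)
 also have "... = (\<Sum>r\<in>{r \<in> P. fst r \<in> ns}. F r)"
 proof (rule sum.mono_neutral_right[OF finP])
  show "\<forall>r\<in>P - {r \<in> P. fst r \<in> ns}. F r = 0"
  proof
   fix r assume r: "r \<in> P - {r \<in> P. fst r \<in> ns}"
   then have "0 < fst r \<and> real (fst r) <= 2 * D" "fst r \<notin> ns" using pos[of "fst r" "snd r"] by simp_all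
   then have "p (fst r) = 0" by (intro p) simp_all
   then show "F r = 0" by (simp add: F_def)
  qed
 qed blast
 also have "{r \<in> P. fst r \<in> ns} = (SIGMA n:ns. cof D (2 * D) n)"
  by (auto simp: P_def mult.commute)
 also have "(\<Sum>r\<in>.... F r) = (\<Sum>n\<in>ns. \<Sum>m\<in>cof D (2 * D) n. F (n, m))"
 proof (subst sum.Sigma[OF ns])
  show "\<forall>n\<in>ns. finite (cof D (2 * D) n)"
  proof
   fix n
   have "cof D (2 * D) n \<subseteq> snd ` P"
   proof
    fix m assume "m \<in> cof D (2 * D) n"
    then have "(n, m) \<in> P" by (simp add: P_def mult.commute)
    then show "m \<in> snd ` P" by (rule image_eqI[rotated]) simp
   qed
   then show "finite (cof D (2 * D) n)" using finP by (auto intro: finite_subset)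
  qed
 qed (auto simp: case_prod_beta)
 also have "... = (\<Sum>n\<in>ns. of_real (p n) * (\<Sum>m\<in>cof D (2 * D) n.
   of_real (q m) * ecis (h * X * (real m * real n) powr -kp)))"
  unfolding sum_distrib_left by (intro sum.cong refl) (simp add: F_def)
 finally show ?thesis .
qed

section \<open>Type II sums\<close>

text \<open>T stands for y^(7/8) and F for the size of the phase at the block D. With K = H N \<rho>
  the diagonal contribution is H^2 D^2 \<rho>, and the first two inequalities say that \<rho> makes
  it of order (H T)^2. The last two are what is needed for the off-diagonal terms, D N s and D^2/s
  up to the factor H^2, to be of the same order; these are compared after squaring because s is a
  square root.\<close>

lemma typeII_numeric:
 fixes D N H \<rho> F T c :: real
 assumes pos: "0 < D" "0 < N" "0 < H" "0 < \<rho>" "0 < F" "0 < T" "1 <= c"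
  and 1: "D^2 * \<rho> <= 4 * T^2" and 2: "T^2 <= D^2 * \<rho>" and 3: "N * F * D ^ 4 <= c * T ^ 6" and 4: "N * D^2 <= c * (F * T^2)"
 defines "K \<equiv> H * N * \<rho>"
 shows "(D / N) * K * (H * N * (D / N) + (H * N)^2 / K * (sqrt (F * H / K) + (D / N) / sqrt (F * H / K))) <= 7 * c * (H * T)^2"
proof -
 have K: "K > 0" using pos by (simp add: K_def)
 have Phi: "F * H / K = F / (N * \<rho>)" using pos by (simp add: K_def)
 define s where "s = sqrt (F / (N * \<rho>))"
 have s: "s > 0" "s^2 = F / (N * \<rho>)" using pos by (auto simp: s_def)
 have A: "D * N * s <= c * T^2"
 proof (rule power2_le_imp_le)
  have "(D * N * s)^2 = D^2 * N^2 * s^2" by (simp add: power_mult_distrib)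
  also have "... = D^2 * N * F / \<rho>" unfolding s(2) using pos by (simp add: power2_eq_square)
  also have "... <= c * T ^ 4"
  proof -
   have "T^2 * (D^2 * N * F) <= (D^2 * \<rho>) * (D^2 * N * F)" using 2 pos by (intro mult_right_mono) auto
   also have "... = \<rho> * (N * F * D ^ 4)" by (simp add: power2_eq_square power4_eq_xxxx)
   also have "... <= \<rho> * (c * T ^ 6)" using 3 pos by (intro mult_left_mono) auto
   also have "... = T^2 * (c * T ^ 4 * \<rho>)" by (simp add: power_add[symmetric])
   finally have "D^2 * N * F <= c * T ^ 4 * \<rho>" using pos by simp
   then show ?thesis using pos by (simp add: divide_le_eq)
  qed
  also have "c * T ^ 4 <= c^2 * T ^ 4" using pos self_le_power[of c 2] by (intro mult_right_mono) auto
  finally show "(D * N * s)^2 <= (c * T^2)^2" by (simp add: power_mult_distrib)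
 qed (use pos in auto)
 have B: "D^2 / s <= 2 * c * T^2"
 proof (rule power2_le_imp_le)
  have "(D^2 / s)^2 = D ^ 4 / s^2" by (simp add: power_divide)
  also have "... = D ^ 4 * N * \<rho> / F" unfolding s(2) by (simp add: mult_ac)
  also have "... <= 4 * c * T ^ 4"
  proof -
   have "D ^ 4 * N * \<rho> = (D^2 * \<rho>) * (N * D^2)" by (simp add: power2_eq_square power4_eq_xxxx)
   also have "... <= (4 * T^2) * (c * (F * T^2))" by (rule mult_mono[OF 1 4]) (use pos in auto)
   also have "... = 4 * c * T ^ 4 * F" by (simp add: power2_eq_square power4_eq_xxxx)
   finally show ?thesis using pos by (simp add: divide_le_eq)
  qed
  also have "4 * c * T ^ 4 <= 4 * c^2 * T ^ 4" using pos self_le_power[of c 2] by (intro mult_right_mono) auto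
  finally show "(D^2 / s)^2 <= (2 * c * T^2)^2" by (simp add: power_mult_distrib)
 qed (use pos in auto)
 have "(D / N) * K * (H * N * (D / N) + (H * N)^2 / K * (s + (D / N) / s))
   = (D / N) * K * (H * N * (D / N)) + (D / N) * (K * ((H * N)^2 / K)) * (s + (D / N) / s)" by (simp add: distrib_left mult_ac)
 also have "K * ((H * N)^2 / K) = (H * N)^2" using K by simp
 also have "(D / N) * K * (H * N * (D / N)) = H^2 * (D^2 * \<rho>)" using pos by (simp add: K_def power2_eq_square)
 also have "(D / N) * (H * N)^2 * (s + (D / N) / s) = H^2 * (D * N * s + D^2 / s)"
  using pos s(1) by (simp add: power2_eq_square field_simps)
 also have "H^2 * (D^2 * \<rho>) + H^2 * (D * N * s + D^2 / s) = H^2 * (D^2 * \<rho> + D * N * s + D^2 / s)" by (simp add: algebra_simps)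
 also have "... <= H^2 * (4 * T^2 + c * T^2 + 2 * c * T^2)" using 1 A B by (intro mult_left_mono add_mono) auto
 also have "... <= H^2 * (7 * c * T^2)"
 proof (rule mult_left_mono)
  have "4 * 1 * T^2 <= 4 * c * T^2" using pos by (intro mult_right_mono) auto
  then show "4 * T^2 + c * T^2 + 2 * c * T^2 <= 7 * c * T^2" by simp
 qed simp
 finally show ?thesis unfolding Phi s_def[symmetric] by (simp add: power_mult_distrib mult_ac)
qed

text \<open>For N of order sqrt D the left sides are, up to constants, y^(\<kappa> + 3/4) D^(9/2 -
  \<kappa>) and D^(5/2). The first is largest at D = 2y because \<kappa> <= 9/2, and there the
  exponent of y is 21/4 = 6 (7/8). In the second, dividing by D^(-\<kappa>) gives D^(5/2 +
  \<kappa>), again largest at D = 2y, and 5/2 + \<kappa> = (\<kappa> + 3/4) + 7/4. Both inequalities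
  are thus tight for D near y.\<close>

lemma block_numeric:
 fixes kp y D N :: real
 assumes k: "1 < kp" "kp <= 9/2" and y: "1 <= y" and D: "y powr (7/8) <= D" "D <= 2 * y" and N: "N <= 2 * sqrt D"
 defines "F \<equiv> y powr (kp + 3/4) * D powr -kp" and "T \<equiv> y powr (7/8)"
 shows "N * F * D ^ 4 <= 256 * T ^ 6" "N * D^2 <= 256 * (F * T^2)"
proof -
 have y0: "0 < y" using y by simp
 have D0: "0 < D" using D(1) y0 powr_gt_zero[of y "7/8"] by linarith
 have F0: "F > 0" using y0 D0 by (simp add: F_def)
 have Dp: "D ^ n = D powr real n" for n using D0 by (simp add: powr_realpow)
 have T: "T ^ n = y powr (7/8 * real n)" for n using y0 by (simp add: T_def powr_powr flip: powr_realpow)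
 have sq: "sqrt D = D powr (1/2)" using D0 by (simp add: powr_half_sqrt)
 have "N * F * D ^ 4 <= (2 * D powr (1/2)) * F * D ^ 4" using N F0 D0 by (intro mult_right_mono) (auto simp: sq)
 also have "... = 2 * y powr (kp + 3/4) * (D powr (1/2) * D powr -kp * D powr 4)" by (simp add: F_def Dp)
 also have "D powr (1/2) * D powr -kp * D powr 4 = D powr (9/2 - kp)" by (simp flip: powr_add)
 also have "2 * y powr (kp + 3/4) * D powr (9/2 - kp) <= 2 * y powr (kp + 3/4) * (2 * y) powr (9/2 - kp)"
  using D D0 k by (intro mult_left_mono powr_mono2) auto
 also have "(2 * y) powr (9/2 - kp) = 2 powr (9/2 - kp) * y powr (9/2 - kp)" by (rule powr_mult)
 also have "2 * y powr (kp + 3/4) * (2 powr (9/2 - kp) * y powr (9/2 - kp)) = 2 * 2 powr (9/2 - kp) * (y powr (kp + 3/4) * y powr (9/2 - kp))" by simp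
 also have "y powr (kp + 3/4) * y powr (9/2 - kp) = T ^ 6" unfolding T powr_add[symmetric] by simp
 also have "2 * 2 powr (9/2 - kp) * T ^ 6 <= 2 * 2 powr 7 * T ^ 6"
  using k y0 by (intro mult_right_mono mult_left_mono powr_mono) (auto simp: T_def)
 finally show "N * F * D ^ 4 <= 256 * T ^ 6" by simp
 have "N * D^2 <= (2 * D powr (1/2)) * D^2" using N by (intro mult_right_mono) (auto simp: sq)
 also have "... = 2 * (D powr (5/2 + kp) * D powr -kp)" by (simp add: Dp flip: powr_add)
 also have "... <= 2 * ((2 * y) powr (5/2 + kp) * D powr -kp)"
  using D D0 k by (intro mult_left_mono mult_right_mono powr_mono2) auto
 also have "(2 * y) powr (5/2 + kp) = 2 powr (5/2 + kp) * y powr (5/2 + kp)" by (rule powr_mult)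
 also have "y powr (5/2 + kp) = y powr (kp + 3/4) * T^2" unfolding T powr_add[symmetric] by simp
 also have "2 * (2 powr (5/2 + kp) * (y powr (kp + 3/4) * T^2) * D powr -kp) = 2 * 2 powr (5/2 + kp) * (F * T^2)" by (simp add: F_def)
 also have "... <= 2 * 2 powr 7 * (F * T^2)"
  using k F0 by (intro mult_right_mono mult_left_mono powr_mono) auto
 finally show "N * D^2 <= 256 * (F * T^2)" by simp
qed

text \<open>The absolute values of the sums over h are absorbed into coefficients of modulus at most
  1, so that h and n together can play the short variable in the bilinear bound. The bound A scales
  the coefficients of p and q to modulus at most 1.\<close>

theorem typeII_single:
 assumes k: "1 < kp" "kp <= 9/2"
 obtains C where "C > 0" "!!y D N H A p q. 1 <= y ==> y powr (7/8) <= D ==> D <= 2 * y ==> 4 <= D ==> D powr (1/4) <= N ==> N <= 2 * sqrt D ==>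
  1 <= H ==> 0 < A ==> (!!n. 0 < n ==> real n <= 2 * D ==> \<bar>p n\<bar> <= A) ==> (!!n. 0 < n ==> real n <= 2 * D ==> \<bar>q n\<bar> <= A) ==>
  (!!n. p n ~= 0 ==> N < real n \<and> real n <= 2 * N) ==>
  (\<Sum>h\<in>{h. H <= real h \<and> real h <= 2 * H}. cmod (esum kp (y powr (kp + 3/4)) D (dconv p q) (real h)))
   <= C * A^2 * H * y powr (7/8) * ((1 + ln (2 * H)) * (1 + ln (2 * N)))"
proof -
 obtain C where C: "C > 0" "!!X D D' H N K \<alpha> bt c. 0 < X ==> 1 <= N ==> N <= D ==> D' <= 2 * D ==> 1 <= H ==> 1 <= K ==> K <= H * N
  ==> (!!m. cmod (\<alpha> m) <= 1) ==> (!!n. cmod (bt n) <= 1) ==> (!!h. cmod (c h) <= 1)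
  ==> (cmod (\<Sum>(h,n)\<in>hn_set H N. c h * bt n * (\<Sum>m\<in>cof D D' n.
     \<alpha> m * ecis (real h * X * (real m * real n) powr -kp))))\<^sup>2
    <= C * (D / N) * K * ((1 + ln (2 * H)) * (1 + ln (2 * N))) *
     (H * N * (D / N) + (H * N)^2 / K * (sqrt (X * D powr -kp * H / K) + (D / N) / sqrt (X * D powr -kp * H / K)))"
  by (rule bilinear_sum_bound[OF less_imp_le[OF k(1)]]) blast
 define B where "B = sqrt (C * (7 * 256)) + 1"
 have B: "B > 0" by (simp add: B_def add_nonneg_pos C(1) less_imp_le)
 show ?thesis
 proof (rule that[OF B])
  fix y D N H A :: real and p q :: "nat => real"
  assume y: "1 <= y" and D: "y powr (7/8) <= D" "D <= 2 * y" "4 <= D" and N: "D powr (1/4) <= N" "N <= 2 * sqrt D"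
   and H: "1 <= H" and A: "0 < A" and pA: "!!n. 0 < n ==> real n <= 2 * D ==> \<bar>p n\<bar> <= A"
   and qA: "!!n. 0 < n ==> real n <= 2 * D ==> \<bar>q n\<bar> <= A" and supp: "!!n. p n ~= 0 ==> N < real n \<and> real n <= 2 * N"
  define X where "X = y powr (kp + 3/4)"
  define T where "T = y powr (7/8)"
  have X: "X > 0" using y by (simp add: X_def)
  have T0: "T > 0" "T <= D" using y D by (auto simp: T_def)
  have D0: "D > 0" using D by simp
  have N1: "1 <= N" using N(1) D ge_one_powr_ge_zero[of D "1/4"] by linarith
  have ND: "N <= D"
  proof -
   have "2 <= sqrt D" using real_sqrt_le_mono[OF D(3)] by simp
   then have "2 * sqrt D <= sqrt D * sqrt D" using D0 by (intro mult_right_mono) auto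
   also have "... = D" using D0 by simp
   finally show ?thesis using N(2) by linarith
  qed
  \<comment> \<open>For D <= 2T the finest admissible choice K = H N is made. For longer blocks the
    number of classes is lowered until the diagonal term D^2 \<rho> equals 4 T^2.\<close>
  define \<rho> where "\<rho> = min 1 (4 * T^2 / D^2)"
  have \<rho>: "\<rho> > 0" "\<rho> <= 1" using T0 D0 by (auto simp: \<rho>_def)
  have D\<rho>: "D^2 * \<rho> = min (D^2) (4 * T^2)" using D0 by (auto simp: \<rho>_def min_def field_simps)
  have T2: "T^2 <= D^2" using T0 by (intro power_mono) auto
  have \<rho>12: "D^2 * \<rho> <= 4 * T^2" "T^2 <= D^2 * \<rho>" unfolding D\<rho> using T2 by auto
  define K where "K = H * N * \<rho>"
  \<comment> \<open>There must be at least one class. This is the purpose of N >= D^(1/4): since D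
    <= 2y, D^(7/4) is at most 4 y^(7/4) = 4 T^2.\<close>
  have K1: "1 <= K"
  proof (cases "\<rho> = 1")
   case True
   then show ?thesis using mult_mono[of 1 H 1 N] H N1 by (simp add: K_def)
  next
   case False
   then have "\<rho> = 4 * T^2 / D^2" by (auto simp: \<rho>_def min_def split: if_splits)
   have "D powr (7/4) <= (2 * y) powr (7/4)" using D D0 by (intro powr_mono2) auto
   also have "... = 2 powr (7/4) * y powr (7/4)" by (rule powr_mult)
   also have "... <= 4 * y powr (7/4)" using powr_mono[of "7/4" 2 "2::real"] by (intro mult_right_mono) auto
   also have "y powr (7/4) = T^2" using y by (simp add: T_def power2_eq_square flip: powr_add)
   finally have "D powr (7/4) <= 4 * T^2" .
   then have "D powr (1/4) * D powr (7/4) <= N * (4 * T^2)" using N N1 by (intro mult_mono) auto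
   also have "D powr (1/4) * D powr (7/4) = D^2" using D0 by (simp flip: powr_add)
   finally have "1 <= N * (4 * T^2) / D^2" using D0 by (subst pos_le_divide_eq) auto
   then have "1 <= N * \<rho>" unfolding \<open>\<rho> = 4 * T^2 / D^2\<close> by simp
   then have "1 * 1 <= H * (N * \<rho>)" using mult_mono[OF H \<open>1 <= N * \<rho>\<close>] H by simp
   then show ?thesis by (simp add: K_def mult.assoc)
  qed
  have KHN: "K <= H * N" using mult_left_mono[OF \<rho>(2), of "H * N"] H N1 by (simp add: K_def)
  \<comment> \<open>The coefficients are cut off at 2D, up to where the bound A is available, so
    that the modulus is at most 1 for every index.\<close>
  define \<alpha> where "\<alpha> m = (if 0 < m \<and> real m <= 2 * D then complex_of_real (q m / A) else 0)" for m
  define bt where "bt n = (if 0 < n \<and> real n <= 2 * D then complex_of_real (p n / A) else 0)" for n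
  have ab: "cmod (\<alpha> m) <= 1" "cmod (bt m) <= 1" for m
   using pA[of m] qA[of m] A by (auto simp: \<alpha>_def bt_def norm_divide)
  define Z where "Z h n = (\<Sum>m\<in>cof D (2 * D) n. \<alpha> m * ecis (real h * X * (real m * real n) powr -kp))" for h n :: nat
  define E where "E h = esum kp X D (dconv p q) (real h)" for h :: nat
  define ns where "ns = {n. N < real n \<and> real n <= 2 * N}"
  have EZ: "E h = of_real (A^2) * (\<Sum>n\<in>ns. bt n * Z h n)" for h
  proof -
   have "E h = (\<Sum>n\<in>ns. of_real (p n) * (\<Sum>m\<in>cof D (2 * D) n. of_real (q m) * ecis (real h * X * (real m * real n) powr -kp)))"
    unfolding E_def
   proof (rule esum_dconv)
    show "finite ns" unfolding ns_def by (rule finite_block)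
   qed (use D0 supp in \<open>auto simp: ns_def\<close>)
   also have "... = (\<Sum>n\<in>ns. of_real (A^2) * (bt n * Z h n))"
   proof (intro sum.cong refl)
    fix n assume "n \<in> ns"
    then have n: "0 < n" using N1 by (auto simp: ns_def intro!: Nat.gr0I)
    show "of_real (p n) * (\<Sum>m\<in>cof D (2 * D) n. of_real (q m) * ecis (real h * X * (real m * real n) powr -kp))
      = of_real (A^2) * (bt n * Z h n)"
    proof (cases "real n <= 2 * D")
     case True
     have "Z h n = (\<Sum>m\<in>cof D (2 * D) n. of_real (q m) * ecis (real h * X * (real m * real n) powr -kp) / of_real A)"
      unfolding Z_def
     proof (intro sum.cong refl)
      fix m assume m: "m \<in> cof D (2 * D) n"
      then have "0 < m" using D0 by (auto intro!: Nat.gr0I)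
      moreover have "real m * 1 <= real m * real n" using n by (intro mult_left_mono) auto
      moreover have "real m * real n <= 2 * D" using m by simp
      ultimately have "0 < m \<and> real m <= 2 * D" by linarith
      then show "\<alpha> m * ecis (real h * X * (real m * real n) powr -kp) = of_real (q m) * ecis (real h * X * (real m * real n) powr -kp) / of_real A"
       by (simp add: \<alpha>_def)
     qed
     also have "... = (\<Sum>m\<in>cof D (2 * D) n. of_real (q m) * ecis (real h * X * (real m * real n) powr -kp)) / of_real A"
      by (rule sum_divide_distrib[symmetric])
     finally show ?thesis using n True A by (simp add: bt_def power2_eq_square)
    next
     case False
     have e: "cof D (2 * D) n = {}"
     proof -
      have False if "D < real m * real n" "real m * real n <= 2 * D" for m
      proof -
       have "0 < m" using that D0 by (auto intro!: Nat.gr0I)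
       then have "1 * real n <= real m * real n" by (intro mult_right_mono) auto
       then show False using that False by linarith
      qed
      then show ?thesis by blast
     qed
     show ?thesis unfolding Z_def e by simp
    qed
   qed
   finally show ?thesis by (simp add: sum_distrib_left)
  qed
  define U where "U h = (\<Sum>n\<in>ns. bt n * Z h n)" for h
  \<comment> \<open>The factor of modulus 1 that rotates \<open>U h\<close> onto its absolute
    value.\<close>
  define c where "c h = (if U h = 0 then 0 else of_real (cmod (U h)) / U h)" for h
  have c1: "cmod (c h) <= 1" for h by (simp add: c_def norm_divide)
  have cU: "c h * U h = of_real (cmod (U h))" for h by (simp add: c_def)
  define hs where "hs = {h. H <= real h \<and> real h <= 2 * H}"
  have fin: "finite hs" "finite ns"
   unfolding hs_def ns_def by (rule finite_subset[of _ "{..nat \<lfloor>2 * H\<rfloor>}"], auto simp: le_nat_floor) (rule finite_block)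
  have hn: "hn_set H N = hs \<times> ns" by (auto simp: hn_set_def hs_def ns_def)
  have "(\<Sum>(h,n)\<in>hn_set H N. c h * bt n * Z h n) = (\<Sum>h\<in>hs. c h * U h)"
   unfolding hn U_def sum_distrib_left by (subst sum.Sigma[symmetric]) (auto simp: fin mult.assoc)
  also have "... = of_real (\<Sum>h\<in>hs. cmod (U h))" by (simp add: cU)
  finally have sm: "(\<Sum>(h,n)\<in>hn_set H N. c h * bt n * Z h n) = of_real (\<Sum>h\<in>hs. cmod (U h))" .
  define L where "L = (1 + ln (2 * H)) * (1 + ln (2 * N))"
  have L1: "1 <= L"
   unfolding L_def using H N1 mult_mono[of 1 "1 + ln (2 * H)" 1 "1 + ln (2 * N)"] by simp
  have S0: "0 <= (\<Sum>h\<in>hs. cmod (U h))" by (intro sum_nonneg) auto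
  have "(\<Sum>h\<in>hs. cmod (U h))^2 = (cmod (\<Sum>(h,n)\<in>hn_set H N. c h * bt n * Z h n))^2" by (simp only: sm norm_of_real power2_abs)
  also have "... <= C * (D / N) * K * L * (H * N * (D / N) + (H * N)^2 / K * (sqrt (X * D powr -kp * H / K) + (D / N) / sqrt (X * D powr -kp * H / K)))"
   unfolding Z_def L_def by (rule C(2)[OF X N1 ND _ H K1 KHN ab c1]) simp
  also have "... = (C * L) * ((D / N) * K * (H * N * (D / N) + (H * N)^2 / K * (sqrt (X * D powr -kp * H / K) + (D / N) / sqrt (X * D powr -kp * H / K))))"
   by (simp only: mult_ac)
  also have "... <= (C * L) * (7 * 256 * (H * T)^2)"
  proof (rule mult_left_mono)
   show "(D / N) * K * (H * N * (D / N) + (H * N)^2 / K * (sqrt (X * D powr -kp * H / K) + (D / N) / sqrt (X * D powr -kp * H / K))) <= 7 * 256 * (H * T)^2"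
   proof -
    have "0 < N" "0 < H" "0 < X * D powr -kp" using N1 H X D0 by simp_all
    from typeII_numeric[OF D0 this(1,2) \<rho>(1) this(3) T0(1) _ \<rho>12 block_numeric[OF k y D(1,2) N(2), folded X_def T_def]]
    show ?thesis unfolding K_def by simp
   qed
  qed (use C L1 in auto)
  also have "... <= (C * (L * L)) * (7 * 256 * (H * T)^2)"
   using C L1 mult_left_mono[of 1 L L] by (intro mult_right_mono mult_left_mono) auto
  also have "... = (C * (7 * 256)) * (L * H * T)^2" by (simp add: power_mult_distrib power2_eq_square)
  also have "... <= B^2 * (L * H * T)^2"
  proof (rule mult_right_mono)
   have "C * (7 * 256) = (sqrt (C * (7 * 256)))^2" using C by simp
   also have "... <= B^2" using C by (intro power_mono) (auto simp: B_def)
   finally show "C * (7 * 256) <= B^2" .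
  qed simp
  finally have "(\<Sum>h\<in>hs. cmod (U h))^2 <= (B * (L * H * T))^2" by (simp add: power_mult_distrib)
  then have "(\<Sum>h\<in>hs. cmod (U h)) <= B * (L * H * T)"
   by (rule power2_le_imp_le) (use B L1 H T0 in auto)
  then have "A^2 * (\<Sum>h\<in>hs. cmod (U h)) <= A^2 * (B * (L * H * T))" by (rule mult_left_mono) simp
  moreover have "(\<Sum>h\<in>hs. cmod (E h)) = A^2 * (\<Sum>h\<in>hs. cmod (U h))"
   unfolding sum_distrib_left EZ U_def[symmetric] by (simp add: norm_mult norm_power)
  ultimately show "(\<Sum>h\<in>{h. H <= real h \<and> real h <= 2 * H}. cmod (esum kp (y powr (kp + 3/4)) D (dconv p q) (real h)))
   <= B * A^2 * H * y powr (7/8) * ((1 + ln (2 * H)) * (1 + ln (2 * N)))"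
   by (simp add: hs_def E_def X_def T_def L_def mult_ac)
 qed
qed

definition hweight :: "real => real => real" where
 "hweight dl h = min (1 / h) (1 / (h^2 * dl))"

definition wsum :: "real => real => real => real => (nat => real) => nat => real" where
 "wsum kp X D dl g J = (\<Sum>h<J. hweight dl (real (Suc h)) * cmod (esum kp X D g (real (Suc h))))"

lemma hweight_nonneg: "0 < dl ==> 0 < h ==> 0 <= hweight dl h"
 by (simp add: hweight_def)

text \<open>From min(1, 1/t) <= t^(-s) with t = h dl. A small positive s makes the weights 1/h
  summable at the price of the factor dl^(-s).\<close>

lemma hweight_le:
 assumes "0 < dl" "0 < h" "0 <= s" "s <= 1"
 shows "hweight dl h <= dl powr -s * h powr (-1 - s)"
proof -
 have e: "dl powr -s * h powr (-1 - s) = (1 / h) * (h * dl) powr -s"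
  using assms by (simp add: powr_mult powr_diff powr_minus field_simps)
 show ?thesis
 proof (cases "h * dl <= 1")
  case True
  then have "1 <= (h * dl) powr -s" using assms powr_mono'[of "-s" 0 "h * dl"] by simp
  then have "(1 / h) * 1 <= (1 / h) * (h * dl) powr -s" using assms by (intro mult_left_mono) auto
  then show ?thesis unfolding e by (simp add: hweight_def)
 next
  case False
  then have "(h * dl) powr -1 <= (h * dl) powr -s" using assms by (intro powr_mono) auto
  then have "(1 / h) * (h * dl) powr -1 <= (1 / h) * (h * dl) powr -s" using assms by (intro mult_left_mono) auto
  moreover have "(1 / h) * (h * dl) powr -1 = 1 / (h^2 * dl)" using assms by (simp add: powr_minus power2_eq_square field_simps)
  ultimately show ?thesis unfolding e by (simp add: hweight_def)
 qed
qed

text \<open>The dyadic block at H contributes at most b H^(-s/2), so the blocks form a geometric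
  series. The factor H^(s/2) granted in the hypothesis pays for the logarithms of H in the bilinear
  bound.\<close>

lemma dyadic_weight:
 fixes e :: "nat => real" and b s :: real
 assumes e: "!!h. 0 <= e h" and s: "0 < s"
  and b: "!!H. 1 <= H ==> (\<Sum>h\<in>{h. H <= real h \<and> real h <= 2 * H}. e h) <= b * H powr (1 + s / 2)"
 shows "(\<Sum>h<J. real (Suc h) powr (-1 - s) * e (Suc h)) <= b / (1 - 2 powr (- s / 2))"
proof -
 define q where "q = (2::real) powr (- s / 2)"
 have q: "0 < q" "q < 1" using s powr_less_mono[of "- s / 2" 0 "2::real"] by (auto simp: q_def)
 have b0: "0 <= b" using b[of 1] sum_nonneg[of "{h. 1 <= real h \<and> real h <= 2 * 1}" e] e by simp
 have ind: "(\<Sum>n\<in>{1..<2 ^ k}. real n powr (-1 - s) * e n) <= b * (\<Sum>j<k. q ^ j)" for k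
 proof (induction k)
  case (Suc k)
  define H where "H = (2::real) ^ k"
  have H: "1 <= H" by (simp add: H_def)
  have "(\<Sum>n\<in>{2 ^ k..<2 ^ Suc k}. real n powr (-1 - s) * e n) <= (\<Sum>n\<in>{2 ^ k..<2 ^ Suc k}. H powr (-1 - s) * e n)"
  proof (intro sum_mono mult_right_mono e)
   fix n :: nat assume "n \<in> {2 ^ k..<2 ^ Suc k}"
   then have "real (2 ^ k) <= real n" by (simp only: of_nat_le_iff atLeastLessThan_iff)
   then show "real n powr (-1 - s) <= H powr (-1 - s)" using H s by (intro powr_mono2') (auto simp: H_def)
  qed
  also have "... = H powr (-1 - s) * (\<Sum>n\<in>{2 ^ k..<2 ^ Suc k}. e n)" by (simp add: sum_distrib_left)
  also have "... <= H powr (-1 - s) * (\<Sum>h\<in>{h. H <= real h \<and> real h <= 2 * H}. e h)"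
  proof (intro mult_left_mono sum_mono2)
   show "finite {h. H <= real h \<and> real h <= 2 * H}"
    by (rule finite_subset[of _ "{..nat \<lfloor>2 * H\<rfloor>}"]) (auto simp: le_nat_floor)
   show "{2 ^ k..<2 ^ Suc k} \<subseteq> {h. H <= real h \<and> real h <= 2 * H}"
   proof
    fix n :: nat assume "n \<in> {2 ^ k..<2 ^ Suc k}"
    then have "2 ^ k <= n" "n <= 2 ^ Suc k" by auto
    then have "real (2 ^ k) <= real n" "real n <= real (2 ^ Suc k)" by (simp_all only: of_nat_le_iff)
    then show "n \<in> {h. H <= real h \<and> real h <= 2 * H}" by (simp add: H_def)
   qed
  qed (use e in auto)
  also have "... <= H powr (-1 - s) * (b * H powr (1 + s / 2))" by (intro mult_left_mono b H) auto
  also have "... = b * (H powr (-1 - s) * H powr (1 + s / 2))" by simp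
  also have "H powr (-1 - s) * H powr (1 + s / 2) = H powr (- s / 2)" unfolding powr_add[symmetric] by simp
  also have "H powr (- s / 2) = q ^ k"
   unfolding H_def q_def by (simp add: powr_powr mult.commute flip: powr_realpow)
  finally have "(\<Sum>n\<in>{2 ^ k..<2 ^ Suc k}. real n powr (-1 - s) * e n) <= b * q ^ k" .
  moreover have "{1..<2 ^ Suc k} = {1..<2 ^ k} \<union> {2 ^ k..<2 ^ Suc k :: nat}" by (auto intro: order_trans)
  then have "(\<Sum>n\<in>{1..<2 ^ Suc k}. real n powr (-1 - s) * e n)
   = (\<Sum>n\<in>{1..<2 ^ k}. real n powr (-1 - s) * e n) + (\<Sum>n\<in>{2 ^ k..<2 ^ Suc k}. real n powr (-1 - s) * e n)"
   by (simp only:) (intro sum.union_disjoint; auto)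
  ultimately show ?case using Suc by (simp add: distrib_left)
 qed simp
 have "(\<Sum>h<J. real (Suc h) powr (-1 - s) * e (Suc h)) = (\<Sum>n\<in>{1..J}. real n powr (-1 - s) * e n)"
  by (rule sum.reindex_bij_witness[of _ "%n. n - 1" Suc]) auto
 also have "... <= (\<Sum>n\<in>{1..<2 ^ J}. real n powr (-1 - s) * e n) + real (2 ^ J) powr (-1 - s) * e (2 ^ J)"
 proof -
  have "(\<Sum>n\<in>{1..J}. real n powr (-1 - s) * e n) <= (\<Sum>n\<in>{1..<2 ^ J}. real n powr (-1 - s) * e n)"
  proof (rule sum_mono2)
   show "{1..J} \<subseteq> {1..<2 ^ J}"
   proof
    fix x assume "x \<in> {1..J}"
    then have "1 <= x" "x <= J" by simp_all
    with le_less_trans[OF \<open>x <= J\<close> less_exp[of J]] show "x \<in> {1..<2 ^ J}" by (simp only: atLeastLessThan_iff)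
   qed
  qed (use e in auto)
  then show ?thesis using e[of "2 ^ J"] by (simp add: add_increasing2)
 qed
 also have "... = (\<Sum>n\<in>insert (2 ^ J) {1..<2 ^ J}. real n powr (-1 - s) * e n)" by simp
 also have "... <= (\<Sum>n\<in>{1..<2 ^ Suc J}. real n powr (-1 - s) * e n)"
  by (rule sum_mono2) (use e in auto)
 also have "... <= b * (\<Sum>j<Suc J. q ^ j)" by (rule ind)
 also have "(\<Sum>j<Suc J. q ^ j) <= (\<Sum>j. q ^ j)" using q by (intro sum_le_suminf summable_geometric) auto
 also have "(\<Sum>j. q ^ j) = 1 / (1 - q)" using q by (intro suminf_geometric) auto
 finally show ?thesis using b0 by (simp add: q_def mult_left_mono)
qed

lemma wsum_le:
 assumes d: "0 < dl" and s: "0 < s" "s <= 1"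
  and b: "!!H. 1 <= H ==> (\<Sum>h\<in>{h. H <= real h \<and> real h <= 2 * H}. cmod (esum kp X D g (real h))) <= b * H powr (1 + s / 2)"
 shows "wsum kp X D dl g J <= dl powr -s * (b / (1 - 2 powr (- s / 2)))"
proof -
 have "wsum kp X D dl g J <= (\<Sum>h<J. (dl powr -s * real (Suc h) powr (-1 - s)) * cmod (esum kp X D g (real (Suc h))))"
  unfolding wsum_def by (intro sum_mono mult_right_mono hweight_le) (use d s in auto)
 also have "... = dl powr -s * (\<Sum>h<J. real (Suc h) powr (-1 - s) * cmod (esum kp X D g (real (Suc h))))"
  by (simp add: sum_distrib_left mult.assoc)
 also have "... <= dl powr -s * (b / (1 - 2 powr (- s / 2)))"
  by (intro mult_left_mono dyadic_weight[where e = "%h. cmod (esum kp X D g (real h))"] s b) auto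
 finally show ?thesis .
qed

lemma wsum_add_le:
 assumes "0 < dl" shows "wsum kp X D dl (%d. f d + g d) J <= wsum kp X D dl f J + wsum kp X D dl g J"
 unfolding wsum_def sum.distrib[symmetric]
proof (rule sum_mono)
 fix h
 show "hweight dl (real (Suc h)) * cmod (esum kp X D (%d. f d + g d) (real (Suc h)))
  <= hweight dl (real (Suc h)) * cmod (esum kp X D f (real (Suc h))) + hweight dl (real (Suc h)) * cmod (esum kp X D g (real (Suc h)))"
  unfolding distrib_left[symmetric] esum_add using assms by (intro mult_left_mono norm_triangle_ineq hweight_nonneg) auto
qed

lemma wsum_scale: "wsum kp X D dl (%d. k * f d) J = \<bar>k\<bar> * wsum kp X D dl f J"
 by (simp add: wsum_def esum_scale norm_mult sum_distrib_left mult_ac)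

lemma wsum_cong: "(!!d. D < real d ==> real d <= 2 * D ==> f d = g d) ==> wsum kp X D dl f J = wsum kp X D dl g J"
 using esum_cong[of D f g] by (simp add: wsum_def)

lemma log_growth:
 fixes s x :: real
 assumes "0 < s" "1 <= x" shows "ln x <= (1 / s) * x powr s"
 using ln_powr_bound[OF assms(2,1)] by simp

lemma ln_2_le_1: "ln (2::real) <= 1"
 using ln_le_minus_one[of "2::real"] by simp

lemma delta_powr_bound:
 fixes y D s :: real
 assumes y: "1 <= y" and D: "y powr (7/8) <= D" "D <= 2 * y" and s: "0 <= s" "s <= 1"
 shows "(y powr (7/8) / D) powr -s <= 2 * y powr s"
proof -
 have T: "0 < y powr (7/8)" "1 <= y powr (7/8)" using y by (auto intro: ge_one_powr_ge_zero)
 have D0: "0 < D" using T D by linarith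
 have "(y powr (7/8) / D) powr -s = (D / y powr (7/8)) powr s"
  using T D0 by (simp add: powr_minus powr_divide)
 also have "... <= (2 * y) powr s"
 proof (intro powr_mono2)
  have "D / y powr (7/8) <= D / 1" using T D0 by (intro divide_left_mono) auto
  then show "D / y powr (7/8) <= 2 * y" using D by simp
 qed (use s T D0 in auto)
 also have "... = 2 powr s * y powr s" by (rule powr_mult)
 also have "... <= 2 * y powr s" using s powr_mono[of s 1 "2::real"] by (intro mult_right_mono) auto
 finally show ?thesis .
qed

text \<open>The step dl = T/D is chosen such that dl times the length of the block is of order T =
  y^(7/8). The support of p is divided into dyadic pieces from D^(1/4) upwards. With s = et/4, one
  factor y^s each pays for dl^(-s), for the logarithm of N and for the number of pieces.\<close>

theorem typeII_bound:
 assumes k: "1 < kp" "kp <= 9/2" and eta: "0 < et" "et <= 1"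
 obtains C where "C > 0" "!!y D A p q J. 1 <= y ==> y powr (7/8) <= D ==> D <= 2 * y ==> 4 <= D ==> 0 < A ==>
  (!!n. 0 < n ==> real n <= 2 * D ==> \<bar>p n\<bar> <= A) ==> (!!n. 0 < n ==> real n <= 2 * D ==> \<bar>q n\<bar> <= A) ==>
  (!!n. p n ~= 0 ==> D powr (1/4) < real n \<and> real n <= 2 * sqrt D) ==>
  wsum kp (y powr (kp + 3/4)) D (y powr (7/8) / D) (dconv p q) J <= C * A^2 * y powr (7/8 + et)"
proof -
 obtain C where C: "C > 0" "!!y D N H A p q. 1 <= y ==> y powr (7/8) <= D ==> D <= 2 * y ==> 4 <= D ==> D powr (1/4) <= N ==> N <= 2 * sqrt D ==>
  1 <= H ==> 0 < A ==> (!!n. 0 < n ==> real n <= 2 * D ==> \<bar>p n\<bar> <= A) ==> (!!n. 0 < n ==> real n <= 2 * D ==> \<bar>q n\<bar> <= A) ==>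
  (!!n. p n ~= 0 ==> N < real n \<and> real n <= 2 * N) ==>
  (\<Sum>h\<in>{h. H <= real h \<and> real h <= 2 * H}. cmod (esum kp (y powr (kp + 3/4)) D (dconv p q) (real h)))
   <= C * A^2 * H * y powr (7/8) * ((1 + ln (2 * H)) * (1 + ln (2 * N)))"
  by (rule typeII_single[OF k]) blast
 define s where "s = et / 4"
 have s: "0 < s" "s <= 1" using eta by (auto simp: s_def)
 define c1 where "c1 = 2 + 2 / s"
 define c2 where "c2 = 3 + 1 / s"
 define c3 where "c3 = 4 + 2 / s"
 define Q where "Q = 1 - (2::real) powr (- s / 2)"
 have c: "c1 > 0" "c2 > 0" "c3 > 0" using s by (auto simp: c1_def c2_def c3_def add_pos_pos)
 have Q: "Q > 0" using s powr_less_mono[of "- s / 2" 0 "2::real"] by (simp add: Q_def)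
 define B where "B = c3 * (2 * (C * c1 * c2 / Q))"
 have B: "B > 0" using c Q C(1) by (simp add: B_def)
 show ?thesis
 proof (rule that[OF B])
  fix y D A :: real and p q :: "nat => real" and J
  assume y: "1 <= y" and D: "y powr (7/8) <= D" "D <= 2 * y" "4 <= D" and A: "0 < A"
   and pA: "!!n. 0 < n ==> real n <= 2 * D ==> \<bar>p n\<bar> <= A" and qA: "!!n. 0 < n ==> real n <= 2 * D ==> \<bar>q n\<bar> <= A"
   and supp: "!!n. p n ~= 0 ==> D powr (1/4) < real n \<and> real n <= 2 * sqrt D"
  define X where "X = y powr (kp + 3/4)"
  define T where "T = y powr (7/8)"
  define dl where "dl = T / D"
  define z where "z = D powr (1/4)"
  have T0: "T > 0" using y by (simp add: T_def)
  have D0: "D > 0" using D by simp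
  have dl: "dl > 0" using T0 D0 by (simp add: dl_def)
  have z1: "1 <= z" using D ge_one_powr_ge_zero[of D "1/4"] by (simp add: z_def)
  have sD: "2 * sqrt D <= D"
  proof -
   have "2 <= sqrt D" using real_sqrt_le_mono[OF D(3)] by simp
   then have "2 * sqrt D <= sqrt D * sqrt D" using D0 by (intro mult_right_mono) auto
   then show ?thesis using D0 by simp
  qed
  define Bd where "Bd = 2 * y powr s * (C * A^2 * T * c1 * (c2 * y powr s) / Q)"
  have Bd0: "Bd >= 0" using C(1) T0 c Q by (simp add: Bd_def)
  have single: "wsum kp X D dl (dconv p' q) J <= Bd"
   if N: "z <= N" "N <= 2 * sqrt D" and p': "!!n. 0 < n ==> real n <= 2 * D ==> \<bar>p' n\<bar> <= A" "!!n. p' n ~= 0 ==> N < real n \<and> real n <= 2 * N" for N p'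
  proof -
   have N0: "1 <= N" using N z1 by simp
   have lN: "1 + ln (2 * N) <= c2 * y powr s"
   proof -
    have "N <= 2 * y" using N sD D by simp
    then have "ln N <= ln (2 * y)" using N0 y by (subst ln_le_cancel_iff) auto
    also have "ln (2 * y) = ln 2 + ln y" using y by (simp add: ln_mult)
    finally have "ln (2 * N) <= ln 2 + (ln 2 + ln y)" using N0 by (simp add: ln_mult)
    also have "... <= 2 + (1 / s) * y powr s" using ln_2_le_1 log_growth[OF s(1) y] by linarith
    finally have "1 + ln (2 * N) <= 3 * 1 + (1 / s) * y powr s" by simp
    also have "... <= 3 * y powr s + (1 / s) * y powr s" using y s by (intro add_right_mono mult_left_mono ge_one_powr_ge_zero) auto
    finally show ?thesis by (simp add: c2_def algebra_simps)
   qed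
   have "wsum kp X D dl (dconv p' q) J <= dl powr -s * ((C * A^2 * T * c1 * (c2 * y powr s)) / (1 - 2 powr (- s / 2)))"
   proof (rule wsum_le[OF dl s])
    fix H :: real assume H: "1 <= H"
    have lH: "1 + ln (2 * H) <= c1 * H powr (s / 2)"
    proof -
     have "ln (2 * H) = ln 2 + ln H" using H by (simp add: ln_mult)
     also have "... <= 1 + (2 / s) * H powr (s / 2)" using ln_2_le_1 log_growth[of "s / 2" H] s H by simp
     finally have "1 + ln (2 * H) <= 2 * 1 + (2 / s) * H powr (s / 2)" by simp
     also have "... <= 2 * H powr (s / 2) + (2 / s) * H powr (s / 2)" using H s by (intro add_right_mono mult_left_mono ge_one_powr_ge_zero) auto
     finally show ?thesis by (simp add: c1_def algebra_simps)
    qed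
    have "(\<Sum>h\<in>{h. H <= real h \<and> real h <= 2 * H}. cmod (esum kp X D (dconv p' q) (real h)))
     <= C * A^2 * H * T * ((1 + ln (2 * H)) * (1 + ln (2 * N)))"
     unfolding X_def T_def by (rule C(2)[OF y D _ N(2) H A p'(1) qA p'(2)]) (use N(1) in \<open>simp_all add: z_def\<close>)
    also have "... <= C * A^2 * H * T * ((c1 * H powr (s / 2)) * (c2 * y powr s))"
     using C(1) T0 H N0 lH lN c by (intro mult_left_mono mult_mono) auto
    also have "... = C * A^2 * T * c1 * (c2 * y powr s) * (H * H powr (s / 2))" by simp
    also have "H * H powr (s / 2) = H powr (1 + s / 2)" using H by (simp add: powr_add)
    finally show "(\<Sum>h\<in>{h. H <= real h \<and> real h <= 2 * H}. cmod (esum kp X D (dconv p' q) (real h)))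
     <= C * A^2 * T * c1 * (c2 * y powr s) * H powr (1 + s / 2)" .
   qed
   also have "... <= (2 * y powr s) * ((C * A^2 * T * c1 * (c2 * y powr s)) / (1 - 2 powr (- s / 2)))"
    using delta_powr_bound[OF y D(1,2), of s] s C(1) T0 c Q
    by (intro mult_right_mono) (auto simp: dl_def T_def Q_def)
   finally show ?thesis by (simp add: Bd_def Q_def)
  qed
  have multi: "wsum kp X D dl (dconv p' q) J <= real j * Bd"
   if "!!n. 0 < n ==> real n <= 2 * D ==> \<bar>p' n\<bar> <= A" "!!n. p' n ~= 0 ==> z < real n \<and> real n <= 2 ^ j * z \<and> real n <= 2 * sqrt D" for p' j
   using that
  proof (induction j arbitrary: p')
   case 0
   then have "p' n = 0" for n using linorder_not_le[of "real n" z] by (metis mult_1 power_0)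
   then have "dconv p' q d = 0" for d by (simp add: dconv_def)
   then show ?case by (simp add: wsum_def esum_def)
  next
   case (Suc j)
   show ?case
   proof (cases "2 ^ j * z <= 2 * sqrt D")
    case True
    define p1 where "p1 n = (if real n <= 2 ^ j * z then p' n else 0)" for n
    define p2 where "p2 n = (if real n <= 2 ^ j * z then 0 else p' n)" for n
    have "dconv p' q = (%d. dconv p1 q d + dconv p2 q d)"
     unfolding dconv_add_left[symmetric] by (intro ext arg_cong2[where f = "%f d. dconv f q d"]) (auto simp: p1_def p2_def)
    then have "wsum kp X D dl (dconv p' q) J <= wsum kp X D dl (dconv p1 q) J + wsum kp X D dl (dconv p2 q) J"
     using wsum_add_le[OF dl] by simp
    also have "wsum kp X D dl (dconv p1 q) J <= real j * Bd"
    proof (rule Suc.IH)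
     show "\<bar>p1 n\<bar> <= A" if "0 < n" "real n <= 2 * D" for n
      using Suc.prems(1)[OF that] A by (simp add: p1_def)
     show "z < real n \<and> real n <= 2 ^ j * z \<and> real n <= 2 * sqrt D" if "p1 n ~= 0" for n
      using that Suc.prems(2)[of n] by (auto simp: p1_def split: if_splits)
    qed
    also have "wsum kp X D dl (dconv p2 q) J <= Bd"
    proof (rule single[OF _ True])
     show "z <= 2 ^ j * z" using z1 mult_right_mono[of 1 "2 ^ j" z] by simp
     show "\<bar>p2 n\<bar> <= A" if "0 < n" "real n <= 2 * D" for n
      using Suc.prems(1)[OF that] A by (simp add: p2_def)
     show "2 ^ j * z < real n \<and> real n <= 2 * (2 ^ j * z)" if "p2 n ~= 0" for n
      using that Suc.prems(2)[of n] by (auto simp: p2_def split: if_splits)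
    qed
    finally show ?thesis by (simp add: distrib_right)
   next
    \<comment> \<open>The next dyadic piece would begin beyond 2 sqrt D, where p vanishes.\<close>
    case False
    have "wsum kp X D dl (dconv p' q) J <= real j * Bd"
    proof (rule Suc.IH[OF Suc.prems(1)])
     show "z < real n \<and> real n <= 2 ^ j * z \<and> real n <= 2 * sqrt D" if "p' n ~= 0" for n
      using Suc.prems(2)[OF that] False by linarith
    qed
    then show ?thesis using Bd0 by (simp add: distrib_right)
   qed
  qed
  define j where "j = nat \<lceil>log 2 (2 * sqrt D)\<rceil>"
  have "1 <= sqrt D" using D(3) by (intro real_sqrt_ge_one) simp
  then have sq2: "2 * sqrt D >= 1" by linarith
  have "2 * sqrt D = 2 powr (log 2 (2 * sqrt D))" using sq2 D0 by (subst powr_log_cancel) auto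
  also have "... <= 2 powr (real j)" unfolding j_def by (intro powr_mono real_nat_ceiling_ge) auto
  also have "... = 2 ^ j" by (simp add: powr_realpow)
  also have "... <= 2 ^ j * z" using mult_left_mono[OF z1, of "2 ^ j"] by simp
  finally have j1: "2 * sqrt D <= 2 ^ j * z" .
  have "wsum kp X D dl (dconv p q) J <= real j * Bd"
  proof (rule multi[OF pA])
   show "z < real n \<and> real n <= 2 ^ j * z \<and> real n <= 2 * sqrt D" if "p n ~= 0" for n
    using supp[OF that] j1 by (simp add: z_def)
  qed
  also have "real j <= c3 * y powr s"
  proof -
   have l2: "1/2 <= ln (2::real)" using ln2_ge_two_thirds by simp
   have "log 2 (2 * sqrt D) >= 0" using sq2 D0 by (subst zero_le_log_cancel_iff) auto
   then have "real j <= log 2 (2 * sqrt D) + 1" unfolding j_def by linarith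
   also have "log 2 (2 * sqrt D) <= log 2 (2 * y)" using sq2 sD D y by (subst log_le_cancel_iff) auto
   also have "log 2 (2 * y) = 1 + ln y / ln 2" using y by (simp add: log_def ln_mult add_divide_distrib)
   also have "ln y / ln 2 <= ln y / (1/2)" using l2 y by (intro divide_left_mono) auto
   also have "ln y / (1/2) <= 2 * ((1 / s) * y powr s)" using log_growth[OF s(1) y] by simp
   finally have "real j <= 2 * 1 + 2 * ((1 / s) * y powr s)" by simp
   also have "... <= 4 * y powr s + 2 * ((1 / s) * y powr s)" using y s ge_one_powr_ge_zero[of y s] by (intro add_right_mono) auto
   finally show ?thesis by (simp add: c3_def algebra_simps)
  qed
  also have "c3 * y powr s * Bd = B * A^2 * (T * (y powr s * y powr s * y powr s))" by (simp add: Bd_def B_def)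
  also have "T * (y powr s * y powr s * y powr s) = y powr (7/8 + 3 * s)"
   unfolding T_def powr_add[symmetric] by (simp add: algebra_simps)
  also have "B * A^2 * y powr (7/8 + 3 * s) <= B * A^2 * y powr (7/8 + et)"
   using y eta B by (intro mult_left_mono powr_mono) (auto simp: s_def)
  finally show "wsum kp (y powr (kp + 3/4)) D (y powr (7/8) / D) (dconv p q) J <= B * A^2 * y powr (7/8 + et)"
   using Bd0 by (simp add: X_def dl_def T_def mult_right_mono)
 qed
qed

section \<open>Type I sums\<close>

text \<open>These are the two terms of the second derivative test, multiplied by the number D^(1/4)
  of values of n. Squaring reduces the first to D^(3/2) F <= 4 T^3; for \<kappa> >= 3/2 the worst
  case is D = T, and comparing the exponents there leads precisely to \<kappa> <= 9/2. The second is
  tight at D near y: 1/4 + 1 - 3/8 = 7/8.\<close>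

lemma typeI_numeric:
 fixes kp y D :: real
 assumes k: "1 < kp" "kp <= 9/2" and y: "1 <= y" and D: "y powr (7/8) <= D" "D <= 2 * y"
 defines "F \<equiv> y powr (kp + 3/4) * D powr -kp" and "T \<equiv> y powr (7/8)"
 shows "D powr (1/4) * (sqrt F * (T / D) powr -(1/2)) <= 2 * T" "D powr (1/4) * (D / sqrt F) <= 32 * T"
proof -
 have y0: "0 < y" using y by simp
 have T0: "0 < T" using y0 by (simp add: T_def)
 have D0: "0 < D" using D(1) T0 unfolding T_def by linarith
 have F0: "F > 0" using y0 D0 by (simp add: F_def)
 have Tp: "T powr u = y powr (7/8 * u)" for u by (simp add: T_def powr_powr)
 have T3: "T ^ 3 = y powr (21/8)" using Tp[of 3] T0 by simp
 have DF: "D powr (3/2) * F <= 4 * T ^ 3"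
 proof -
  have "D powr (3/2) * F = y powr (kp + 3/4) * D powr (3/2 - kp)"
   by (simp add: F_def mult_ac flip: powr_add)
  also have "... <= y powr (kp + 3/4) * (4 * y powr (21/8 - (kp + 3/4)))"
  proof (rule mult_left_mono)
   show "D powr (3/2 - kp) <= 4 * y powr (21/8 - (kp + 3/4))"
   proof (cases "kp >= 3/2")
    case True
    have "D powr (3/2 - kp) <= T powr (3/2 - kp)" using True D T0 by (intro powr_mono2') (auto simp: T_def)
    also have "... = y powr (7/8 * (3/2 - kp))" by (rule Tp)
    also have "... <= y powr (21/8 - (kp + 3/4))" using y k by (intro powr_mono) auto
    also have "... <= 4 * y powr (21/8 - (kp + 3/4))" by simp
    finally show ?thesis .
   next
    case False
    have "D powr (3/2 - kp) <= (2 * y) powr (3/2 - kp)" using False D D0 by (intro powr_mono2) auto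
    also have "... = 2 powr (3/2 - kp) * y powr (3/2 - kp)" by (rule powr_mult)
    also have "... <= 2 powr 2 * y powr (21/8 - (kp + 3/4))" using y k by (intro mult_mono powr_mono) auto
    finally show ?thesis by simp
   qed
  qed simp
  also have "... = 4 * (y powr (kp + 3/4) * y powr (21/8 - (kp + 3/4)))" by simp
  also have "y powr (kp + 3/4) * y powr (21/8 - (kp + 3/4)) = T ^ 3" unfolding T3 powr_add[symmetric] by simp
  finally show ?thesis .
 qed
 show "D powr (1/4) * (sqrt F * (T / D) powr -(1/2)) <= 2 * T"
 proof (rule power2_le_imp_le)
  have p: "(x powr u)^2 = x powr (2 * u)" for x u :: real by (simp add: power2_eq_square flip: powr_add)
  have "(D powr (1/4) * (sqrt F * (T / D) powr -(1/2)))\<^sup>2 = D powr (1/2) * (F * (T / D) powr -1)"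
   using F0 by (simp add: power_mult_distrib p)
  also have "(T / D) powr -1 = D / T" using T0 D0 by (simp add: powr_minus)
  also have "D powr (1/2) * (F * (D / T)) = (D powr (1/2) * D powr 1) * F / T" using D0 by simp
  also have "D powr (1/2) * D powr 1 = D powr (3/2)" unfolding powr_add[symmetric] by simp
  also have "D powr (3/2) * F / T <= 4 * T ^ 3 / T" using DF T0 by (intro divide_right_mono) auto
  also have "... = (2 * T)^2" using T0 by (simp add: power2_eq_square power3_eq_cube)
  finally show "(D powr (1/4) * (sqrt F * (T / D) powr -(1/2)))\<^sup>2 <= (2 * T)\<^sup>2" .
 qed (use T0 in auto)
 show "D powr (1/4) * (D / sqrt F) <= 32 * T"
 proof -
  have Fl: "y powr (3/4) / 32 <= F"
  proof -
   have "2 powr -5 * y powr (3/4) <= 2 powr -kp * y powr (3/4)" using k by (intro mult_right_mono powr_mono) auto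
   also have "... = y powr (kp + 3/4) * (2 powr -kp * y powr -kp)" by (simp add: mult_ac flip: powr_add)
   also have "2 powr -kp * y powr -kp = (2 * y) powr -kp" by (rule powr_mult[symmetric])
   also have "y powr (kp + 3/4) * (2 * y) powr -kp <= F"
    unfolding F_def using D D0 k by (intro mult_left_mono powr_mono2') auto
   finally show ?thesis by (simp add: powr_minus)
  qed
  have "y powr (3/8) / 6 <= sqrt F"
  proof (rule real_le_rsqrt)
   have "(y powr (3/8) / 6)^2 = y powr (3/4) / 36" by (simp add: power_divide power2_eq_square flip: powr_add)
   also have "... <= y powr (3/4) / 32" by (intro divide_left_mono) auto
   finally show "(y powr (3/8) / 6)^2 <= F" using Fl by simp
  qed
  then have "D powr (1/4) * D / sqrt F <= (2 * y) powr (5/4) / (y powr (3/8) / 6)"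
  proof (intro frac_le)
   have "D powr (1/4) * D = D powr (1/4) * D powr 1" using D0 by simp
   also have "... = D powr (5/4)" unfolding powr_add[symmetric] by simp
   also have "... <= (2 * y) powr (5/4)" using D D0 by (intro powr_mono2) auto
   finally show "D powr (1/4) * D <= (2 * y) powr (5/4)" .
  qed (use y0 in auto)
  also have "(2 * y) powr (5/4) = 2 powr (5/4) * y powr (5/4)" by (rule powr_mult)
  also have "2 powr (5/4) * y powr (5/4) / (y powr (3/8) / 6) = 6 * 2 powr (5/4) * (y powr (5/4) / y powr (3/8))" by simp
  also have "y powr (5/4) / y powr (3/8) = T" unfolding powr_diff[symmetric] T_def by simp
  also have "6 * 2 powr (5/4) * T <= 6 * 2 powr 2 * T" using T0 by (intro mult_right_mono mult_left_mono powr_mono) auto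
  also have "... <= 32 * T" using T0 by simp
  finally show ?thesis by simp
 qed
qed

lemma sum_powr_bounded:
 fixes s :: real
 assumes s: "0 < s"
 shows "(\<Sum>h<J. real (Suc h) powr (-1 - s)) <= 3 / (1 - 2 powr (- s / 2))"
proof -
 have "(\<Sum>h<J. real (Suc h) powr (-1 - s) * 1) <= 3 / (1 - 2 powr (- s / 2))"
 proof (rule dyadic_weight[where e = "%_. 1"])
  fix H :: real assume H: "1 <= H"
  have "{h. H <= real h \<and> real h <= 2 * H} \<subseteq> {1..nat \<lfloor>2 * H\<rfloor>}"
  proof
   fix h assume "h \<in> {h. H <= real h \<and> real h <= 2 * H}"
   then have "1 <= real h" "real h <= 2 * H" using H by auto
   then show "h \<in> {1..nat \<lfloor>2 * H\<rfloor>}" by (auto simp: le_nat_floor)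
  qed
  from card_mono[OF _ this] have "card {h. H <= real h \<and> real h <= 2 * H} <= nat \<lfloor>2 * H\<rfloor>" by simp
  then have "real (card {h. H <= real h \<and> real h <= 2 * H}) <= 2 * H" using H by linarith
  also have "... <= 3 * H powr 1" using H by simp
  also have "... <= 3 * H powr (1 + s / 2)" using H s by (intro mult_left_mono powr_mono) auto
  finally show "(\<Sum>h\<in>{h. H <= real h \<and> real h <= 2 * H}. 1) <= 3 * H powr (1 + s / 2)" by simp
 qed (use s in auto)
 then show ?thesis by simp
qed

text \<open>For each n the sum over m in (D/n, 2D/n] has smooth coefficients, and its phase has size
  h F independently of n. In the sum over h the term sqrt(h F) requires the weight to be
  interpolated with exponent 1/2 + et, hence et <= 1/2; for the term D/sqrt(h F) the weight 1/h is
  enough.\<close>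

theorem typeI_bound:
 assumes k: "1 < kp" "kp <= 9/2" and eta: "0 < et" "et <= 1/2"
 obtains C where "C > 0" "!!y D A r J. 1 <= y ==> y powr (7/8) <= D ==> D <= 2 * y ==> 0 < A ==>
  (!!n. 0 < n ==> real n <= 2 * D ==> \<bar>r n\<bar> <= A) ==>
  (!!n. 0 < n ==> r n ~= 0 ==> real n <= D powr (1/4)) ==>
  wsum kp (y powr (kp + 3/4)) D (y powr (7/8) / D) (dconv r (%_. 1)) J <= C * A * y powr (7/8 + et)"
proof -
 obtain C where C: "C > 0" "!!B M lo hi. B ~= 0 ==> 1/2 <= M ==> M <= lo ==> hi <= 4 * M ==>
  cmod (\<Sum>m\<in>{m::nat. lo < real m \<and> real m <= hi}. ecis (B * real m powr -kp))
   <= C * (sqrt (\<bar>B\<bar> * M powr -kp) + M / sqrt (\<bar>B\<bar> * M powr -kp))"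
  by (rule power_phase_interval_bound[of kp]) (use k in auto)
 define Z where "Z = 3 / (1 - (2::real) powr (- et / 2))"
 have Z: "Z > 0" using eta powr_less_mono[of "- et / 2" 0 "2::real"] by (simp add: Z_def)
 define B where "B = C * Z * (4 + 32)"
 have B: "B > 0" using Z C by (simp add: B_def)
 show ?thesis
 proof (rule that[OF B])
  fix y D A :: real and r :: "nat => real" and J
  assume y: "1 <= y" and D: "y powr (7/8) <= D" "D <= 2 * y" and A: "0 < A"
   and rA: "!!n. 0 < n ==> real n <= 2 * D ==> \<bar>r n\<bar> <= A" and supp: "!!n. 0 < n ==> r n ~= 0 ==> real n <= D powr (1/4)"
  define X where "X = y powr (kp + 3/4)"
  define T where "T = y powr (7/8)"
  define dl where "dl = T / D"
  define z where "z = D powr (1/4)"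
  define F where "F = X * D powr -kp"
  have T0: "T > 0" "T >= 1" using y by (auto simp: T_def intro: ge_one_powr_ge_zero)
  have D0: "D > 0" "D >= 1" using D T0 by (auto simp: T_def)
  have X0: "X > 0" using y by (simp add: X_def)
  have F0: "F > 0" using X0 D0 by (simp add: F_def)
  have dl: "dl > 0" using T0 D0 by (simp add: dl_def)
  have zD: "z <= D" using powr_mono[of "1/4" 1 D] D0 by (simp add: z_def)
  define ns where "ns = {n. 0 < real n \<and> real n <= z}"
  have cn: "real (card ns) <= z"
  proof -
   have "ns \<subseteq> {1..nat \<lfloor>z\<rfloor>}" by (auto simp: ns_def le_nat_floor)
   from card_mono[OF _ this] have "card ns <= nat \<lfloor>z\<rfloor>" by simp
   then show ?thesis using powr_ge_zero[of D "1/4"] unfolding z_def by linarith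
  qed
  have E: "cmod (esum kp X D (dconv r (%_. 1)) h) <= z * (A * (C * (sqrt (h * F) + D / sqrt (h * F))))" if h: "0 < h" for h
  proof -
   define Y where "Y = A * (C * (sqrt (h * F) + D / sqrt (h * F)))"
   have hF: "0 < h * F" using h F0 by simp
   have Y0: "0 <= Y" using A C(1) D0 hF by (simp add: Y_def)
   have "esum kp X D (dconv r (%_. 1)) h = (\<Sum>n\<in>ns. of_real (r n) *
    (\<Sum>m\<in>cof D (2 * D) n. of_real 1 * ecis (h * X * (real m * real n) powr -kp)))"
   proof (rule esum_dconv)
    show "finite ns" unfolding ns_def by (rule finite_block)
    show "r n = 0" if "0 < n" "n \<notin> ns" for n using that supp[of n] by (auto simp: ns_def z_def)
   qed (use D0 in simp)
   also have "cmod ... <= (\<Sum>n\<in>ns. Y)"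
   proof (intro sum_norm_le)
    fix n assume n: "n \<in> ns"
    have n0: "0 < real n" "1 <= real n" "real n <= D" using n zD by (auto simp: ns_def)
    define Bn where "Bn = h * X * real n powr -kp"
    have Bn: "Bn > 0" using h X0 n0 by (simp add: Bn_def)
    have "(\<Sum>m\<in>cof D (2 * D) n. of_real 1 * ecis (h * X * (real m * real n) powr -kp))
     = (\<Sum>m\<in>{m. D / real n < real m \<and> real m <= 2 * (D / real n)}. ecis (Bn * real m powr -kp))"
     by (intro sum.cong) (use n0 in \<open>auto simp: field_simps Bn_def powr_mult\<close>)
    also have "cmod ... <= C * (sqrt (\<bar>Bn\<bar> * (D / real n) powr -kp) + D / real n / sqrt (\<bar>Bn\<bar> * (D / real n) powr -kp))"
    proof (rule C(2))
     have "1 <= D / real n" using n0 by (simp add: le_divide_eq)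
     then show "1/2 <= D / real n" "2 * (D / real n) <= 4 * (D / real n)" by linarith+
    qed (use Bn in auto)
    also have "\<bar>Bn\<bar> * (D / real n) powr -kp = h * F"
    proof -
     have "\<bar>Bn\<bar> * (D / real n) powr -kp = h * X * (real n powr -kp * (D / real n) powr -kp)"
      using Bn by (simp add: Bn_def)
     also have "real n powr -kp * (D / real n) powr -kp = D powr -kp"
      unfolding powr_mult[symmetric] using n0 by simp
     finally show ?thesis by (simp add: F_def)
    qed
    also have "C * (sqrt (h * F) + D / real n / sqrt (h * F)) <= C * (sqrt (h * F) + D / sqrt (h * F))"
    proof (intro mult_left_mono add_left_mono divide_right_mono)
     show "D / real n <= D" using n0 D0 divide_left_mono[of 1 "real n" D] by simp
    qed (use hF C in auto)
    finally have "cmod (of_real (r n)) * cmod (\<Sum>m\<in>cof D (2 * D) n. of_real 1 * ecis (h * X * (real m * real n) powr -kp))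
      <= A * (C * (sqrt (h * F) + D / sqrt (h * F)))"
     using rA[of n] n0 A D0 by (intro mult_mono) auto
    then show "cmod (of_real (r n) * (\<Sum>m\<in>cof D (2 * D) n. of_real 1 * ecis (h * X * (real m * real n) powr -kp))) <= Y"
     by (simp add: norm_mult Y_def)
   qed
   also have "... <= z * Y" using cn Y0 by (simp add: mult_right_mono)
   finally show ?thesis by (simp add: Y_def)
  qed
  define G where "G = dl powr -et * (dl powr -(1/2) * sqrt F) + D / sqrt F"
  have w: "hweight dl h * cmod (esum kp X D (dconv r (%_. 1)) h) <= (A * C * z * G) * h powr (-1 - et)" if h: "1 <= h" for h
  proof -
   have h0: "0 < h" using h by simp
   have sq: "sqrt (h * F) = h powr (1/2) * sqrt F" using h0 by (simp add: real_sqrt_mult powr_half_sqrt)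
   have w1: "hweight dl h * h powr (1/2) <= dl powr -et * dl powr -(1/2) * h powr (-1 - et)"
   proof -
    have "hweight dl h * h powr (1/2) <= (dl powr -(1/2 + et) * h powr (-1 - (1/2 + et))) * h powr (1/2)"
     using dl h0 eta by (intro mult_right_mono hweight_le) auto
    also have "... = dl powr -(1/2 + et) * (h powr (-1 - (1/2 + et)) * h powr (1/2))" by simp
    also have "h powr (-1 - (1/2 + et)) * h powr (1/2) = h powr (-1 - et)" unfolding powr_add[symmetric] by simp
    also have "dl powr -(1/2 + et) = dl powr -et * dl powr -(1/2)"
     unfolding powr_add[symmetric] by (rule arg_cong[where f = "(powr) dl"]) simp
    finally show ?thesis .
   qed
   have w2: "hweight dl h / h powr (1/2) <= h powr (-1 - et)"
   proof -
    have "hweight dl h / h powr (1/2) <= h powr -1 / h powr (1/2)"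
     using h0 by (intro divide_right_mono) (auto simp: hweight_def powr_minus_divide)
    also have "... = h powr (-1 - 1/2)" unfolding powr_diff[symmetric] by simp
    also have "... <= h powr (-1 - et)" using h eta by (intro powr_mono) auto
    finally show ?thesis .
   qed
   have "hweight dl h * cmod (esum kp X D (dconv r (%_. 1)) h) <= hweight dl h * (z * (A * (C * (sqrt (h * F) + D / sqrt (h * F)))))"
    using E[OF h0] hweight_nonneg[OF dl h0] by (rule mult_left_mono)
   also have "... = A * C * z * ((hweight dl h * h powr (1/2)) * sqrt F + (hweight dl h / h powr (1/2)) * (D / sqrt F))"
    unfolding sq by (simp add: distrib_left mult_ac)
   also have "... <= A * C * z * ((dl powr -et * dl powr -(1/2) * h powr (-1 - et)) * sqrt F + h powr (-1 - et) * (D / sqrt F))"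
    using w1 w2 A C(1) D0 F0 by (intro mult_left_mono add_mono mult_right_mono) (auto simp: z_def)
   also have "... = (A * C * z * G) * h powr (-1 - et)" by (simp add: G_def distrib_left distrib_right mult_ac)
   finally show ?thesis .
  qed
  have zG: "z * G <= 36 * T * y powr et"
  proof -
   have n1: "z * (dl powr -(1/2) * sqrt F) <= 2 * T" "z * (D / sqrt F) <= 32 * T"
    using typeI_numeric[OF k y D] by (simp_all add: z_def dl_def T_def F_def X_def mult_ac)
   have "z * G = dl powr -et * (z * (dl powr -(1/2) * sqrt F)) + z * (D / sqrt F)" by (simp add: G_def distrib_left mult_ac)
   also have "... <= (2 * y powr et) * (2 * T) + 32 * T * y powr et"
   proof (rule add_mono)
    have "dl powr -et <= 2 * y powr et" using delta_powr_bound[OF y D, of et] eta by (simp add: dl_def T_def)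
    then show "dl powr -et * (z * (dl powr -(1/2) * sqrt F)) <= (2 * y powr et) * (2 * T)"
     by (rule mult_mono[OF _ n1(1)]) (use F0 in \<open>auto simp: z_def\<close>)
    have "32 * T * 1 <= 32 * T * y powr et" using T0 y eta by (intro mult_left_mono ge_one_powr_ge_zero) auto
    then show "z * (D / sqrt F) <= 32 * T * y powr et" using n1(2) by simp
   qed
   finally show ?thesis by simp
  qed
  have "wsum kp X D dl (dconv r (%_. 1)) J <= (\<Sum>h<J. (A * C * z * G) * real (Suc h) powr (-1 - et))"
   unfolding wsum_def by (intro sum_mono w) simp
  also have "... = (A * C * (z * G)) * (\<Sum>h<J. real (Suc h) powr (-1 - et))" by (simp add: sum_distrib_left mult_ac)
  also have "... <= (A * C * (36 * T * y powr et)) * Z"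
  proof (rule mult_mono)
   show "A * C * (z * G) <= A * C * (36 * T * y powr et)" by (rule mult_left_mono[OF zG]) (use A C(1) in simp)
   show "(\<Sum>h<J. real (Suc h) powr (-1 - et)) <= Z" unfolding Z_def by (rule sum_powr_bounded[OF eta(1)])
  qed (use A C(1) T0 in \<open>auto intro!: sum_nonneg\<close>)
  also have "... = B * A * (T * y powr et)" by (simp add: B_def)
  also have "T * y powr et = y powr (7/8 + et)" by (simp add: T_def powr_add)
  finally show "wsum kp (y powr (kp + 3/4)) D (y powr (7/8) / D) (dconv r (%_. 1)) J <= B * A * y powr (7/8 + et)"
   by (simp add: X_def dl_def T_def)
 qed
qed

section \<open>Decomposition of the coefficients and summation over blocks\<close>

definition cut_le :: "real => (nat => real) => nat => real" where
 "cut_le z f n = (if real n <= z then f n else 0)"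

definition cut_gt :: "real => (nat => real) => nat => real" where
 "cut_gt z f n = (if real n <= z then 0 else f n)"

lemma cut_add: "cut_le z f n + cut_gt z f n = f n"
 by (simp add: cut_le_def cut_gt_def)

lemma abs_cut_le: "\<bar>cut_le z f n\<bar> <= \<bar>f n\<bar>" "\<bar>cut_gt z f n\<bar> <= \<bar>f n\<bar>"
 by (simp_all add: cut_le_def cut_gt_def)

lemma dconv_cut_left: "dconv f g n = dconv (cut_le z f) g n + dconv (cut_gt z f) g n"
 unfolding dconv_add_left[symmetric] cut_add ..

lemma dconv_cut_right: "dconv f g n = dconv f (cut_le z g) n + dconv f (cut_gt z g) n"
 unfolding dconv_add_right[symmetric] cut_add ..

lemma dconv_nonzeroE:
 assumes "dconv f g n ~= 0" obtains a b where "a * b = n" "f a ~= 0" "g b ~= 0" "0 < a" "0 < b"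
proof -
 have n: "n ~= 0" using assms by (metis dconv_0)
 have "\<exists>p\<in>{(a, b). a * b = n}. (case p of (a, b) => f a * g b) ~= 0"
  using assms unfolding dconv_def by (metis (no_types, lifting) sum.neutral)
 then show ?thesis using n that by (auto simp: split: prod.splits)
qed

lemma dconv_support_le:
 assumes "dconv f g n ~= 0" "!!a. f a ~= 0 ==> real a <= u" "!!b. g b ~= 0 ==> real b <= v" "0 <= u"
 shows "real n <= u * v"
proof -
 from assms(1) obtain a b where ab: "a * b = n" "f a ~= 0" "g b ~= 0" by (rule dconv_nonzeroE)
 have "real a * real b <= u * v" using assms(2)[OF ab(2)] assms(3)[OF ab(3)] assms(4) by (intro mult_mono) auto
 then show ?thesis using ab(1) by auto
qed

lemma dconv_support_gt:
 assumes "dconv f g n ~= 0" "!!a. f a ~= 0 ==> z < real a"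
 shows "z < real n"
proof -
 from assms(1) obtain a b where ab: "a * b = n" "f a ~= 0" "0 < b" by (rule dconv_nonzeroE)
 have "real a * 1 <= real a * real b" using ab(3) by (intro mult_left_mono) auto
 then show ?thesis using assms(2)[OF ab(2)] ab(1) by auto
qed

text \<open>After the Vaughan-type identity there remains p * 1 * 1 with p supported up to z^2.
  Cutting p, then one factor 1, then q at z gives products in which some factor lies in (z, z^2] or
  in which both factors exceed z; these are of type II. The exception is q, cut at z, convolved with
  1, which is of type I. It occurs twice because, for d > z^2, its cofactor exceeds z
  automatically.\<close>

lemma moebius2_decomposition:
 fixes z :: real and d :: nat
 assumes z: "1 <= z" "z * z < real d"
 defines "p \<equiv> dconv (cut_le z moebius2) (cut_le z moebius2)" and "R \<equiv> cut_gt z moebius2"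
  and "one \<equiv> %_::nat. 1::real"
 defines "q \<equiv> dconv (cut_le z p) (cut_le z one)"
 shows "moebius2 d = dconv R (dconv R ones2) d - dconv (cut_gt z p) ones2 d - dconv (dconv (cut_le z p) (cut_gt z one)) (cut_gt z one) d
  - dconv (cut_gt z q) one d - dconv (cut_gt z q) (cut_gt z one) d - 2 * dconv (cut_le z q) one d"
proof -
 have "z * 1 <= z * z" using z by (intro mult_left_mono) auto
 then have zd: "z < real d" using z(2) by linarith
 then have d0: "0 < d" using z by auto
 have R: "R d = moebius2 d" "cut_le z moebius2 d = 0" using zd by (auto simp: R_def cut_gt_def cut_le_def)
 have v: "moebius2 d = dconv R (dconv R ones2) d - dconv p ones2 d"
  using vaughan_identity[of "cut_le z moebius2" R d] d0 R by (simp add: R_def cut_add p_def)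
 have o2: "ones2 = dconv one one" by (simp add: ones2_def one_def)
 let ?lp = "cut_le z p"
 have "dconv ?lp ones2 d = dconv (dconv ?lp one) one d" unfolding o2 by (rule dconv_assoc[symmetric])
 also have "dconv ?lp one = (%n. q n + dconv ?lp (cut_gt z one) n)"
  unfolding q_def by (rule ext) (rule dconv_cut_right)
 also have "dconv (%n. q n + dconv ?lp (cut_gt z one) n) one d = dconv q one d + dconv (dconv ?lp (cut_gt z one)) one d"
  by (rule dconv_add_left)
 also have "dconv (dconv ?lp (cut_gt z one)) one d = dconv (dconv ?lp (cut_gt z one)) (cut_le z one) d + dconv (dconv ?lp (cut_gt z one)) (cut_gt z one) d"
  by (rule dconv_cut_right)
 also have "dconv (dconv ?lp (cut_gt z one)) (cut_le z one) d = dconv q (cut_gt z one) d"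
 proof -
  have "dconv (dconv ?lp (cut_gt z one)) (cut_le z one) d = dconv ?lp (dconv (cut_gt z one) (cut_le z one)) d" by (rule dconv_assoc)
  also have "... = dconv ?lp (dconv (cut_le z one) (cut_gt z one)) d" by (rule dconv_cong) (auto intro: dconv_commute)
  also have "... = dconv q (cut_gt z one) d" unfolding q_def by (rule dconv_assoc[symmetric])
  finally show ?thesis .
 qed
 finally have e1: "dconv ?lp ones2 d = dconv q one d + (dconv q (cut_gt z one) d + dconv (dconv ?lp (cut_gt z one)) (cut_gt z one) d)" .
 have e2: "dconv (cut_le z q) (cut_gt z one) d = dconv (cut_le z q) one d"
 proof -
  have "dconv (cut_le z q) (cut_le z one) d = 0"
  proof (rule ccontr)
   assume "dconv (cut_le z q) (cut_le z one) d ~= 0"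
   then have "real d <= z * z"
    by (rule dconv_support_le) (use z in \<open>auto simp: cut_le_def split: if_splits\<close>)
   then show False using z by simp
  qed
  then show ?thesis using dconv_cut_right[of "cut_le z q" one d z] by simp
 qed
 show ?thesis
  using v e1 e2 dconv_cut_left[of p ones2 d z] dconv_cut_left[of q one d z] dconv_cut_left[of q "cut_gt z one" d z] by linarith
qed

text \<open>The level z = D^(1/4) fits both types: coefficients of type I are allowed up to D^(1/4),
  and z^2 = sqrt D lies inside the range of type II. The coefficients are bounded by powers of the
  divisor bound, whose total is a small power of y.\<close>

theorem block_bound:
 assumes k: "1 < kp" "kp <= 9/2" and eta: "0 < et" "et <= 1/2"
 obtains C where "C > 0" "!!y D. 1 <= y ==> y powr (7/8) <= D ==> D <= 2 * y ==> 4 <= D ==>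
  \<bar>\<Sum>d | D < real d \<and> real d <= 2 * D. moebius2 d * sawt (y powr (kp + 3/4) * real d powr -kp)\<bar>
   <= C * y powr (7/8 + et)"
proof -
 \<comment> \<open>The coefficients are at most A, a constant times y^(3 \<nu>), because of at most
   three levels of divisor bounds. A enters squared, and 6 \<nu> is less than the remaining
   et/2.\<close>
 define \<nu> where "\<nu> = et / 16"
 have \<nu>: "\<nu> > 0" using eta by (simp add: \<nu>_def)
 obtain C0 where C0: "C0 >= 1" "!!n. n > 0 ==> ndiv n <= C0 * real n powr \<nu>" using divisor_bound[OF \<nu>] by blast
 have eta2: "0 < et / 2" "et / 2 <= 1" "et / 2 <= 1/2" using eta by auto
 obtain C1 where C1: "C1 > 0" "!!y D A p q J. 1 <= y ==> y powr (7/8) <= D ==> D <= 2 * y ==> 4 <= D ==> 0 < A ==>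
  (!!n. 0 < n ==> real n <= 2 * D ==> \<bar>p n\<bar> <= A) ==> (!!n. 0 < n ==> real n <= 2 * D ==> \<bar>q n\<bar> <= A) ==>
  (!!n. p n ~= 0 ==> D powr (1/4) < real n \<and> real n <= 2 * sqrt D) ==>
  wsum kp (y powr (kp + 3/4)) D (y powr (7/8) / D) (dconv p q) J <= C1 * A^2 * y powr (7/8 + et / 2)"
  by (rule typeII_bound[OF k eta2(1,2)]) blast
 obtain C2 where C2: "C2 > 0" "!!y D A r J. 1 <= y ==> y powr (7/8) <= D ==> D <= 2 * y ==> 0 < A ==>
  (!!n. 0 < n ==> real n <= 2 * D ==> \<bar>r n\<bar> <= A) ==>
  (!!n. 0 < n ==> r n ~= 0 ==> real n <= D powr (1/4)) ==>
  wsum kp (y powr (kp + 3/4)) D (y powr (7/8) / D) (dconv r (%_. 1)) J <= C2 * A * y powr (7/8 + et / 2)"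
  by (rule typeI_bound[OF k eta2(1,3)]) blast
 \<comment> \<open>The divisor constant enters once in the given functions, and each convolution
   turns an exponent j into 2j + 1: 1, 3, 7.\<close>
 define K where "K = C0 ^ 7 * 4 powr (3 * \<nu>)"
 have K: "K >= 1"
  unfolding K_def using C0 \<nu> mult_mono[of 1 "C0 ^ 7" 1 "4 powr (3 * \<nu>)"] by (simp add: ge_one_powr_ge_zero)
 define B where "B = (12 + (7 * C1 + 2 * C2) + 2 * C2) * K^2"
 have B: "B > 0" using K C1(1) C2(1) by (simp add: B_def add_pos_pos)
 show ?thesis
 proof (rule that[OF B])
  fix y D :: real assume y: "1 <= y" and D: "y powr (7/8) <= D" "D <= 2 * y" "4 <= D"
  define X where "X = y powr (kp + 3/4)"
  define T where "T = y powr (7/8)"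
  define dl where "dl = T / D"
  define z where "z = D powr (1/4)"
  define A where "A = K * y powr (3 * \<nu>)"
  define Y where "Y = y powr (7/8 + et / 2)"
  have T0: "T > 0" using y by (simp add: T_def)
  have D0: "D > 0" using D by simp
  have dl: "dl > 0" using T0 D0 by (simp add: dl_def)
  have z1: "1 <= z" using D ge_one_powr_ge_zero[of D "1/4"] by (simp add: z_def)
  have zz: "z * z = sqrt D" using D0 by (simp add: z_def powr_half_sqrt flip: powr_add)
  have s1: "1 <= sqrt D" using D(3) by (intro real_sqrt_ge_one) simp
  have zzD: "z * z <= D"
  proof -
   have "sqrt D * 1 <= sqrt D * sqrt D" using s1 by (intro mult_left_mono) auto
   then show ?thesis using D0 by (simp add: zz)
  qed
  have y3: "1 <= y powr (3 * \<nu>)" using y \<nu> by (intro ge_one_powr_ge_zero) auto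
  have A1: "1 <= A" using mult_mono[OF K y3] K by (simp add: A_def)
  have A0: "0 < A" using A1 by simp
  have Y0: "Y > 0" using y by (simp add: Y_def)
  have lev: "C0 ^ j * real n powr (i * \<nu>) <= A" if n: "0 < n" "real n <= 2 * D" and i: "0 <= i" "i <= 3" and j: "j <= 7" for n i j
  proof -
   have "real n powr (i * \<nu>) <= real n powr (3 * \<nu>)" using n i \<nu> by (intro powr_mono mult_right_mono) auto
   also have "... <= (4 * y) powr (3 * \<nu>)" using n D \<nu> by (intro powr_mono2) auto
   also have "... = 4 powr (3 * \<nu>) * y powr (3 * \<nu>)" by (rule powr_mult)
   finally have "C0 ^ j * real n powr (i * \<nu>) <= C0 ^ 7 * (4 powr (3 * \<nu>) * y powr (3 * \<nu>))"
    using C0(1) j by (intro mult_mono power_increasing) auto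
   then show ?thesis by (simp add: A_def K_def mult.assoc)
  qed
  define one where "one = (%_::nat. 1::real)"
  define P where "P = cut_le z moebius2"
  define R where "R = cut_gt z moebius2"
  define p where "p = dconv P P"
  define lp where "lp = cut_le z p"
  define q where "q = dconv lp (cut_le z one)"
  have b0: "\<bar>moebius2 n\<bar> <= C0 * real n powr \<nu>" if "0 < n" for n using abs_moebius2_le[OF that] C0(2)[OF that] by simp
  have b1: "\<bar>P n\<bar> <= C0 * real n powr \<nu>" "\<bar>R n\<bar> <= C0 * real n powr \<nu>" "\<bar>ones2 n\<bar> <= C0 * real n powr \<nu>"
   "\<bar>one n\<bar> <= C0 * real n powr \<nu>" if n: "0 < n" for n
  proof -
   show "\<bar>P n\<bar> <= C0 * real n powr \<nu>" "\<bar>R n\<bar> <= C0 * real n powr \<nu>"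
    using abs_cut_le[of z moebius2 n] b0[OF n] by (auto simp: P_def R_def)
   have "ones2 = ndiv" by (simp add: ones2_def ndiv_def)
   then show "\<bar>ones2 n\<bar> <= C0 * real n powr \<nu>" using C0(2)[OF n] ndiv_nonneg[of n] by simp
   have "1 * 1 <= C0 * real n powr \<nu>" using C0(1) n \<nu> by (intro mult_mono ge_one_powr_ge_zero) auto
   then show "\<bar>one n\<bar> <= C0 * real n powr \<nu>" by (simp add: one_def)
  qed
  have b2: "\<bar>dconv f g n\<bar> <= C0 ^ 3 * real n powr (2 * \<nu>)"
   if "!!k. 0 < k ==> \<bar>f k\<bar> <= C0 * real k powr \<nu>" "!!k. 0 < k ==> \<bar>g k\<bar> <= C0 * real k powr \<nu>" "0 < n" for f g n
  proof -
   have "\<bar>dconv f g n\<bar> <= C0 * C0 * C0 * real n powr (\<nu> + \<nu>)"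
    by (rule dconv_bound[OF that(1,2) C0(2) that(3)]) (use C0(1) in simp_all)
   moreover have "C0 * C0 * C0 = C0 ^ 3" "\<nu> + \<nu> = 2 * \<nu>" by (simp_all add: power3_eq_cube)
   ultimately show ?thesis by (simp only:)
  qed
  have b3: "\<bar>dconv f g n\<bar> <= C0 ^ 7 * real n powr (3 * \<nu>)"
   if "!!k. 0 < k ==> \<bar>f k\<bar> <= C0 ^ 3 * real k powr (2 * \<nu>)" "!!k. 0 < k ==> \<bar>g k\<bar> <= C0 ^ 3 * real k powr (2 * \<nu>)" "0 < n" for f g n
  proof -
   have "\<bar>dconv f g n\<bar> <= C0 ^ 3 * C0 ^ 3 * C0 * real n powr (2 * \<nu> + \<nu>)"
    by (rule dconv_bound[OF that(1,2) C0(2) that(3)]) (use C0(1) in simp_all)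
   moreover have "C0 ^ 3 * C0 ^ 3 * C0 = C0 ^ 7" "2 * \<nu> + \<nu> = 3 * \<nu>" by (simp_all add: eval_nat_numeral)
   ultimately show ?thesis by (simp only:)
  qed
  have up: "v <= C0 ^ 3 * real n powr (2 * \<nu>)" if "v <= C0 * real n powr \<nu>" "0 < n" for v n
  proof -
   have "C0 * real n powr \<nu> <= C0 ^ 3 * real n powr (2 * \<nu>)"
    using C0(1) that(2) \<nu> self_le_power[of C0 3] by (intro mult_mono powr_mono) auto
   then show ?thesis using that by linarith
  qed
  have l1: "v <= A" if "v <= C0 * real n powr \<nu>" "0 < n" "real n <= 2 * D" for v n
   using lev[OF that(2,3), of 1 1] that(1) by simp
  have l2: "v <= A" if "v <= C0 ^ 3 * real n powr (2 * \<nu>)" "0 < n" "real n <= 2 * D" for v n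
   using lev[OF that(2,3), of 2 3] that(1) by simp
  have l3: "v <= A" if "v <= C0 ^ 7 * real n powr (3 * \<nu>)" "0 < n" "real n <= 2 * D" for v n
   using lev[OF that(2,3), of 3 7] that(1) by simp
  have bp: "\<bar>p n\<bar> <= C0 ^ 3 * real n powr (2 * \<nu>)" if "0 < n" for n unfolding p_def by (rule b2[OF b1(1) b1(1) that])
  have bRo: "\<bar>dconv R ones2 n\<bar> <= C0 ^ 3 * real n powr (2 * \<nu>)" if "0 < n" for n by (rule b2[OF b1(2) b1(3) that])
  have bone: "\<bar>one n\<bar> <= C0 ^ 3 * real n powr (2 * \<nu>)" if "0 < n" for n by (rule up[OF b1(4)[OF that] that])
  have cp: "\<bar>cut_le z p n\<bar> <= C0 ^ 3 * real n powr (2 * \<nu>)" "\<bar>cut_gt z p n\<bar> <= C0 ^ 3 * real n powr (2 * \<nu>)" if "0 < n" for n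
   using abs_cut_le[of z p n] bp[OF that] by linarith+
  have co: "\<bar>cut_le z one n\<bar> <= C0 ^ 3 * real n powr (2 * \<nu>)" "\<bar>cut_gt z one n\<bar> <= C0 ^ 3 * real n powr (2 * \<nu>)" if "0 < n" for n
   using abs_cut_le[of z one n] bone[OF that] by linarith+
  have bq: "\<bar>q n\<bar> <= C0 ^ 7 * real n powr (3 * \<nu>)" if "0 < n" for n
   unfolding q_def lp_def by (rule b3[OF cp(1) co(1) that])
  have bl: "\<bar>dconv lp (cut_gt z one) n\<bar> <= C0 ^ 7 * real n powr (3 * \<nu>)" if "0 < n" for n
   unfolding lp_def by (rule b3[OF cp(1) co(2) that])
  have cq: "\<bar>cut_le z q n\<bar> <= C0 ^ 7 * real n powr (3 * \<nu>)" "\<bar>cut_gt z q n\<bar> <= C0 ^ 7 * real n powr (3 * \<nu>)" if "0 < n" for n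
   using abs_cut_le[of z q n] bq[OF that] by linarith+
  have sq: "2 * sqrt D >= z * z" unfolding zz using s1 by simp
  have II: "wsum kp X D dl (dconv f g) J <= C1 * A^2 * Y"
   if "!!n. 0 < n ==> real n <= 2 * D ==> \<bar>f n\<bar> <= A" "!!n. 0 < n ==> real n <= 2 * D ==> \<bar>g n\<bar> <= A"
    "!!n. f n ~= 0 ==> z < real n \<and> real n <= 2 * sqrt D" for f g J
   unfolding X_def dl_def T_def Y_def by (rule C1(2)[OF y D A0 that(1,2)]) (use that(3) in \<open>simp_all add: z_def\<close>)
  \<comment> \<open>Two factors above 2 sqrt D would have a product above 4D, outside the block.
    Hence one of them lies in (z, 2 sqrt D] and takes the part of the short variable.\<close>
  have II2: "wsum kp X D dl (dconv f g) J <= 2 * (C1 * A^2 * Y)"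
   if f: "!!n. 0 < n ==> real n <= 2 * D ==> \<bar>f n\<bar> <= A" and g: "!!n. 0 < n ==> real n <= 2 * D ==> \<bar>g n\<bar> <= A"
    and fz: "!!n. f n ~= 0 ==> z < real n" and gz: "!!n. g n ~= 0 ==> z < real n" for f g J
  proof -
   let ?W = "2 * sqrt D"
   have "wsum kp X D dl (dconv f g) J = wsum kp X D dl (%d. dconv (cut_le ?W f) g d + dconv (cut_le ?W g) (cut_gt ?W f) d) J"
   proof (rule wsum_cong)
    fix d assume d: "D < real d" "real d <= 2 * D"
    have "dconv (cut_gt ?W f) (cut_gt ?W g) d = 0"
    proof (rule ccontr)
     assume "dconv (cut_gt ?W f) (cut_gt ?W g) d ~= 0"
     then obtain a b where ab: "a * b = d" "cut_gt ?W f a ~= 0" "cut_gt ?W g b ~= 0" by (rule dconv_nonzeroE)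
     then have "?W < real a" "?W < real b" by (auto simp: cut_gt_def split: if_splits)
     then have "?W * ?W < real a * real b" using s1 by (intro mult_strict_mono) linarith+
     moreover have "?W * ?W = 4 * D" using D0 by simp
     moreover have "real a * real b = real d" using ab(1) by auto
     ultimately show False using d D0 by linarith
    qed
    moreover have "dconv (cut_gt ?W f) (cut_le ?W g) d = dconv (cut_le ?W g) (cut_gt ?W f) d" by (rule dconv_commute)
    ultimately show "dconv f g d = dconv (cut_le ?W f) g d + dconv (cut_le ?W g) (cut_gt ?W f) d"
     using dconv_cut_left[of f g d ?W] dconv_cut_right[of "cut_gt ?W f" g d ?W] by linarith
   qed
   also have "... <= wsum kp X D dl (dconv (cut_le ?W f) g) J + wsum kp X D dl (dconv (cut_le ?W g) (cut_gt ?W f)) J"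
    by (rule wsum_add_le[OF dl])
   also have "wsum kp X D dl (dconv (cut_le ?W f) g) J <= C1 * A^2 * Y"
   proof (rule II[OF _ g])
    show "\<bar>cut_le ?W f n\<bar> <= A" if "0 < n" "real n <= 2 * D" for n using abs_cut_le(1)[of ?W f n] f[OF that] by linarith
    show "z < real n \<and> real n <= ?W" if "cut_le ?W f n ~= 0" for n using that fz[of n] by (auto simp: cut_le_def split: if_splits)
   qed
   also have "wsum kp X D dl (dconv (cut_le ?W g) (cut_gt ?W f)) J <= C1 * A^2 * Y"
   proof (rule II)
    show "\<bar>cut_le ?W g n\<bar> <= A" if "0 < n" "real n <= 2 * D" for n using abs_cut_le(1)[of ?W g n] g[OF that] by linarith
    show "\<bar>cut_gt ?W f n\<bar> <= A" if "0 < n" "real n <= 2 * D" for n using abs_cut_le(2)[of ?W f n] f[OF that] by linarith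
    show "z < real n \<and> real n <= ?W" if "cut_le ?W g n ~= 0" for n using that gz[of n] by (auto simp: cut_le_def split: if_splits)
   qed
   finally show ?thesis by linarith
  qed
  have I: "wsum kp X D dl (dconv r one) J <= C2 * u * Y"
   if "0 < u" "!!n. 0 < n ==> real n <= 2 * D ==> \<bar>r n\<bar> <= u" "!!n. 0 < n ==> r n ~= 0 ==> real n <= z" for r u J
   unfolding X_def dl_def T_def Y_def one_def by (rule C2(2)[OF y D(1,2) that(1,2)]) (use that(3) in \<open>simp_all add: z_def\<close>)
  have cg: "z < real n" if "cut_gt z f n ~= 0" for f n using that by (auto simp: cut_gt_def split: if_splits)
  have cl: "real n <= z" if "cut_le z f n ~= 0" for f n using that by (auto simp: cut_le_def split: if_splits)
  have psupp: "real n <= 2 * sqrt D" if "p n ~= 0" for n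
   using dconv_support_le[of P P n z z] that cl[of moebius2] z1 sq by (auto simp: p_def P_def)
  have qsupp: "real n <= 2 * sqrt D" if "q n ~= 0" for n
   using dconv_support_le[of lp "cut_le z one" n z z] that cl[of p] cl[of one] z1 sq by (auto simp: q_def lp_def)
  have csupp: "z < real n \<and> real n <= 2 * sqrt D" if "cut_gt z f n ~= 0" "!!n. f n ~= 0 ==> real n <= 2 * sqrt D" for f n
   using cg[OF that(1)] that by (auto simp: cut_gt_def split: if_splits)
  have W: "wsum kp X D dl moebius2 J <= (7 * C1 + 2 * C2) * A^2 * Y" for J
  proof -
   define g1 g2 g3 g4 g5 g6 where "g1 = dconv R (dconv R ones2)" and "g2 = dconv (cut_gt z p) ones2"
    and "g3 = dconv (dconv lp (cut_gt z one)) (cut_gt z one)" and "g4 = dconv (cut_gt z q) one"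
    and "g5 = dconv (cut_gt z q) (cut_gt z one)" and "g6 = dconv (cut_le z q) one"
   have "wsum kp X D dl moebius2 J = wsum kp X D dl (%d. g1 d + ((-1) * g2 d + ((-1) * g3 d + ((-1) * g4 d + ((-1) * g5 d + (-2) * g6 d))))) J"
   proof (rule wsum_cong)
    fix d assume d: "D < real d" "real d <= 2 * D"
    then have "z * z < real d" using zzD by simp
    from moebius2_decomposition[OF z1 this]
    show "moebius2 d = g1 d + ((-1) * g2 d + ((-1) * g3 d + ((-1) * g4 d + ((-1) * g5 d + (-2) * g6 d))))"
     by (simp add: g1_def g2_def g3_def g4_def g5_def g6_def R_def p_def P_def lp_def q_def one_def)
   qed
   also have "... <= wsum kp X D dl g1 J + (1 * wsum kp X D dl g2 J + (1 * wsum kp X D dl g3 J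
     + (1 * wsum kp X D dl g4 J + (1 * wsum kp X D dl g5 J + 2 * wsum kp X D dl g6 J))))"
   proof -
    have s: "wsum kp X D dl (%d. (-1) * f d) J = 1 * wsum kp X D dl f J" "wsum kp X D dl (%d. (-2) * f d) J = 2 * wsum kp X D dl f J" for f
     using wsum_scale[of kp X D dl "-1" f J] wsum_scale[of kp X D dl "-2" f J] by simp_all
    show ?thesis unfolding s[symmetric]
     by (intro order_trans[OF wsum_add_le[OF dl]] add_left_mono order_refl)
   qed
   also have "... <= 2 * (C1 * A^2 * Y) + (1 * (C1 * A^2 * Y) + (1 * (2 * (C1 * A^2 * Y)) + (1 * (C1 * A^2 * Y) + (1 * (C1 * A^2 * Y) + 2 * (C2 * A * Y)))))"
   proof (intro add_mono mult_left_mono)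
    show "wsum kp X D dl g1 J <= 2 * (C1 * A^2 * Y)"
     unfolding g1_def
    proof (rule II2)
     show "\<bar>R n\<bar> <= A" "\<bar>dconv R ones2 n\<bar> <= A" if "0 < n" "real n <= 2 * D" for n
      by (rule l1[OF b1(2)[OF that(1)] that], rule l2[OF bRo[OF that(1)] that])
     show "z < real n" if "R n ~= 0" for n using that cg by (simp add: R_def)
     then show "z < real n" if "dconv R ones2 n ~= 0" for n by (rule dconv_support_gt[OF that])
    qed
    show "wsum kp X D dl g2 J <= C1 * A^2 * Y"
     unfolding g2_def by (rule II[OF l2[OF cp(2)] l1[OF b1(3)] csupp[OF _ psupp]])
    show "wsum kp X D dl g3 J <= 2 * (C1 * A^2 * Y)"
     unfolding g3_def
    proof (rule II2)
     show "\<bar>dconv lp (cut_gt z one) n\<bar> <= A" "\<bar>cut_gt z one n\<bar> <= A" if "0 < n" "real n <= 2 * D" for n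
      by (rule l3[OF bl[OF that(1)] that], rule l2[OF co(2)[OF that(1)] that])
     show "z < real n" if "cut_gt z one n ~= 0" for n by (rule cg[OF that])
     show "z < real n" if "dconv lp (cut_gt z one) n ~= 0" for n
     proof (rule dconv_support_gt)
      show "dconv (cut_gt z one) lp n ~= 0" using that by (simp add: dconv_commute)
     qed (rule cg)
    qed
    show "wsum kp X D dl g4 J <= C1 * A^2 * Y"
     unfolding g4_def by (rule II[OF l3[OF cq(2)] l1[OF b1(4)] csupp[OF _ qsupp]])
    show "wsum kp X D dl g5 J <= C1 * A^2 * Y"
     unfolding g5_def by (rule II[OF l3[OF cq(2)] l2[OF co(2)] csupp[OF _ qsupp]])
    show "wsum kp X D dl g6 J <= C2 * A * Y"
     unfolding g6_def by (rule I[OF A0 l3[OF cq(1)] cl])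
   qed simp_all
   also have "... = 7 * (C1 * A^2 * Y) + 2 * C2 * A * Y" by simp
   also have "... <= 7 * (C1 * A^2 * Y) + 2 * C2 * A^2 * Y"
    using C2(1) Y0 A1 self_le_power[of A 2] by (intro add_left_mono mult_right_mono mult_left_mono) auto
   also have "... = (7 * C1 + 2 * C2) * A^2 * Y" by (simp add: algebra_simps)
   finally show ?thesis .
  qed
  \<comment> \<open>The unweighted sum is the type I sum whose coefficient is concentrated at
    1.\<close>
  have W1: "wsum kp X D dl one J <= C2 * Y" for J
  proof -
   have "wsum kp X D dl one J = wsum kp X D dl (dconv dunit one) J"
   proof (rule wsum_cong)
    fix d assume "D < real d"
    then have "0 < d" using D0 by (auto intro!: Nat.gr0I)
    then show "one d = dconv dunit one d" using dconv_dunit_right[of d one] by (simp add: dconv_commute)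
   qed
   also have "... <= C2 * 1 * Y"
    by (rule I) (use z1 in \<open>auto simp: dunit_def\<close>)
   finally show ?thesis by simp
  qed
  define S where "S = {d::nat. D < real d \<and> real d <= 2 * D}"
  have cS: "real (card S) <= 3 * D"
  proof -
   have "S \<subseteq> {..nat \<lfloor>2 * D\<rfloor>}" by (auto simp: S_def le_nat_floor)
   from card_mono[OF _ this] have "card S <= Suc (nat \<lfloor>2 * D\<rfloor>)" by simp
   then show ?thesis using D by linarith
  qed
  have "\<bar>\<Sum>d\<in>S. moebius2 d * sawt (X * real d powr -kp)\<bar>
   <= 2 * A * dl * real (card S) + (7 * C1 + 2 * C2) * A^2 * Y + 2 * A * (C2 * Y)"
  proof (rule floor_sum_bound[OF dl])
   show "\<bar>moebius2 d\<bar> <= A" if "d \<in> S" for d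
   proof -
    have "0 < d" using that D0 by (auto simp: S_def intro!: Nat.gr0I)
    then show ?thesis using l1[OF b0[OF \<open>0 < d\<close>] \<open>0 < d\<close>] that by (simp add: S_def)
   qed
   show "(\<Sum>h<J. min (1 / real (Suc h)) (1 / ((real (Suc h))^2 * dl)) * cmod (\<Sum>d\<in>S. moebius2 d * ecis (real (Suc h) * (X * real d powr -kp))))
    <= (7 * C1 + 2 * C2) * A^2 * Y" for J
    using W[of J] by (simp add: wsum_def hweight_def esum_def S_def mult.assoc del: of_nat_Suc)
   show "(\<Sum>h<J. min (1 / real (Suc h)) (1 / ((real (Suc h))^2 * dl)) * cmod (\<Sum>d\<in>S. ecis (real (Suc h) * (X * real d powr -kp))))
    <= C2 * Y" for J
    using W1[of J] by (simp add: wsum_def hweight_def esum_def S_def one_def mult.assoc del: of_nat_Suc)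
  qed (use A0 in simp)
  also have "... <= 12 * A^2 * Y + (7 * C1 + 2 * C2) * A^2 * Y + 2 * C2 * A^2 * Y"
  proof (intro add_mono)
   have AA: "A <= A^2" using A1 self_le_power[of A 2] by simp
   have "dl * real (card S) <= dl * (3 * D)" using dl cS by (intro mult_left_mono) auto
   also have "... = 3 * T" using D0 by (simp add: dl_def)
   also have "... <= 3 * Y" using y eta by (simp add: T_def Y_def powr_mono)
   finally have "A * (dl * real (card S)) <= A^2 * (3 * Y)" by (rule mult_mono[OF AA]) (use A0 dl in auto)
   moreover have "2 * A * dl * real (card S) = 2 * (A * (dl * real (card S)))" "12 * A^2 * Y = 4 * (A^2 * (3 * Y))" by simp_all
   moreover have "0 <= A^2 * (3 * Y)" using Y0 by simp
   ultimately show "2 * A * dl * real (card S) <= 12 * A^2 * Y" by linarith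
   have "2 * A * (C2 * Y) <= 2 * A^2 * (C2 * Y)" using AA C2(1) Y0 by (intro mult_right_mono mult_left_mono) auto
   then show "2 * A * (C2 * Y) <= 2 * C2 * A^2 * Y" by (simp add: mult_ac)
  qed simp
  also have "... = (12 + (7 * C1 + 2 * C2) + 2 * C2) * (A^2 * Y)" by (simp add: algebra_simps)
  finally have fin: "\<bar>\<Sum>d\<in>S. moebius2 d * sawt (X * real d powr -kp)\<bar>
   <= (12 + (7 * C1 + 2 * C2) + 2 * C2) * (A^2 * Y)" .
  have "A^2 * Y = K^2 * (y powr (3 * \<nu>) * y powr (3 * \<nu>) * Y)" by (simp add: A_def power2_eq_square)
  also have "y powr (3 * \<nu>) * y powr (3 * \<nu>) * Y = y powr (6 * \<nu> + (7/8 + et / 2))" unfolding Y_def powr_add[symmetric] by simp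
  also have "... <= y powr (7/8 + et)" using y eta by (intro powr_mono) (auto simp: \<nu>_def)
  finally have AY: "A^2 * Y <= K^2 * y powr (7/8 + et)" by (simp add: mult_left_mono)
  show "\<bar>\<Sum>d | D < real d \<and> real d <= 2 * D. moebius2 d * sawt (y powr (kp + 3/4) * real d powr -kp)\<bar>
   <= B * y powr (7/8 + et)"
  proof -
   have "(12 + (7 * C1 + 2 * C2) + 2 * C2) * (A^2 * Y) <= (12 + (7 * C1 + 2 * C2) + 2 * C2) * (K^2 * y powr (7/8 + et))"
    by (rule mult_left_mono[OF AY]) (use C1(1) C2(1) in simp)
   from order_trans[OF fin this] show ?thesis by (simp add: S_def X_def B_def mult.assoc)
  qed
 qed
qed

text \<open>The interval is halved repeatedly until its end is of order y^(7/8), where the trivial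
  bound suffices. The number of blocks is logarithmic and is absorbed into y^(et/2).\<close>

theorem floor_moebius2_sum_bound:
 assumes k: "1 < kp" "kp <= 9/2" and eta: "0 < et" "et <= 1/2"
 obtains C where "C > 0" "!!y u. 1 <= y ==> u <= 2 * y ==>
  \<bar>\<Sum>d | 0 < d \<and> real d <= u. moebius2 d * sawt (y powr (kp + 3/4) * real d powr -kp)\<bar>
   <= C * y powr (7/8 + et)"
proof -
 define s where "s = et / 2"
 have s: "0 < s" "s <= 1/2" using eta by (auto simp: s_def)
 obtain C1 where C1: "C1 > 0" "!!y D. 1 <= y ==> y powr (7/8) <= D ==> D <= 2 * y ==> 4 <= D ==>
  \<bar>\<Sum>d | D < real d \<and> real d <= 2 * D. moebius2 d * sawt (y powr (kp + 3/4) * real d powr -kp)\<bar>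
   <= C1 * y powr (7/8 + s)"
  by (rule block_bound[OF k s]) blast
 obtain C0 where C0: "C0 >= 1" "!!n. n > 0 ==> ndiv n <= C0 * real n powr s" using divisor_bound[OF s(1)] by blast
 define c2 where "c2 = 8 * (C0 * 8)"
 define c3 where "c3 = 2 + 2 / s"
 have c3: "c3 > 0" using s by (simp add: c3_def add_pos_pos)
 define B where "B = c2 + c3 * C1"
 have B: "B > 0" using C0 c3 C1(1) by (simp add: B_def c2_def add_pos_pos)
 show ?thesis
 proof (rule that[OF B])
  fix y u :: real assume y: "1 <= y" and u: "u <= 2 * y"
  define f where "f d = moebius2 d * sawt (y powr (kp + 3/4) * real d powr -kp)" for d
  define S where "S v = (\<Sum>d | 0 < d \<and> real d <= v. f d)" for v
  \<comment> \<open>The factor 8 ensures that a block (v/2, v] with v > U has v/2 >= 4, as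
    \<open>block_bound\<close> demands, and v/2 >= y^(7/8).\<close>
  define U where "U = 8 * y powr (7/8)"
  have y7: "1 <= y powr (7/8)" using y by (intro ge_one_powr_ge_zero) auto
  have ys: "1 <= y powr s" using y s by (intro ge_one_powr_ge_zero) auto
  have fin: "finite {d::nat. 0 < d \<and> real d <= v}" for v
   by (rule finite_subset[of _ "{..nat \<lfloor>v\<rfloor>}"]) (auto simp: le_nat_floor)
  define M where "M = c2 * y powr (7/8 + s)"
  define N where "N = C1 * y powr (7/8 + s)"
  have N0: "N >= 0" using C1(1) by (simp add: N_def)
  have fl: "\<bar>of_int \<lfloor>t\<rfloor> - t + 1/2\<bar> <= (1::real)" for t using floor_correct[of t] by linarith
  have triv: "\<bar>S v\<bar> <= M" if v: "v <= U" for v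
  proof -
   have "\<bar>S v\<bar> <= (\<Sum>d | 0 < d \<and> real d <= v. C0 * (8 * y powr s))"
    unfolding S_def
   proof (rule order_trans[OF sum_abs sum_mono])
    fix d assume "d \<in> {d. 0 < d \<and> real d <= v}"
    then have d: "0 < d" "real d <= U" using v by auto
    have "real d powr s <= (8 * y) powr s"
    proof (intro powr_mono2)
     have "y powr (7/8) <= y powr 1" using y by (intro powr_mono) auto
     then show "real d <= 8 * y" using d y by (simp add: U_def)
    qed (use s in auto)
    also have "... = 8 powr s * y powr s" by (rule powr_mult)
    also have "... <= 8 * y powr s" using s powr_mono[of s 1 "8::real"] by (intro mult_right_mono) auto
    finally have "C0 * real d powr s <= C0 * (8 * y powr s)" using C0(1) by (intro mult_left_mono) auto
    then have "\<bar>moebius2 d\<bar> <= C0 * (8 * y powr s)" using abs_moebius2_le[OF d(1)] C0(2)[OF d(1)] by linarith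
    then have "\<bar>f d\<bar> <= (C0 * (8 * y powr s)) * 1"
     unfolding f_def abs_mult using fl C0(1) by (intro mult_mono) auto
    then show "\<bar>f d\<bar> <= C0 * (8 * y powr s)" by simp
   qed
   also have "... = real (card {d::nat. 0 < d \<and> real d <= v}) * (C0 * (8 * y powr s))" by simp
   also have "... <= U * (C0 * (8 * y powr s))"
   proof (rule mult_right_mono)
    have "{d::nat. 0 < d \<and> real d <= v} \<subseteq> {1..nat \<lfloor>U\<rfloor>}" using v by (auto simp: le_nat_floor)
    from card_mono[OF _ this] have "card {d::nat. 0 < d \<and> real d <= v} <= nat \<lfloor>U\<rfloor>" by simp
    then show "real (card {d::nat. 0 < d \<and> real d <= v}) <= U" using y7 unfolding U_def by linarith
   qed (use C0(1) in auto)
   also have "... = c2 * (y powr (7/8) * y powr s)" by (simp add: U_def c2_def)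
   also have "y powr (7/8) * y powr s = y powr (7/8 + s)" by (simp add: powr_add)
   finally show ?thesis by (simp add: M_def)
  qed
  have ind: "v <= 2 ^ j * U ==> v <= 2 * y ==> \<bar>S v\<bar> <= M + real j * N" for j v
  proof (induction j arbitrary: v)
   case 0
   then show ?case using triv[of v] by simp
  next
   case (Suc j)
   show ?case
   proof (cases "v <= U")
    case True
    then have "\<bar>S v\<bar> <= M" by (rule triv)
    moreover have "0 <= real (Suc j) * N" using N0 by simp
    ultimately show ?thesis by linarith
   next
    case False
    define D where "D = v / 2"
    have D: "y powr (7/8) <= D" "4 <= D" "D <= 2 * y" "v = 2 * D"
     using False Suc.prems(2) y7 y by (simp_all add: D_def U_def)
    have spl: "{d::nat. 0 < d \<and> real d <= v} = {d. 0 < d \<and> real d <= D} \<union> {d. D < real d \<and> real d <= 2 * D}"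
     using D by auto
    have "S v = S D + (\<Sum>d | D < real d \<and> real d <= 2 * D. f d)"
     unfolding S_def spl by (rule sum.union_disjoint) (use fin finite_block in auto)
    moreover have "\<bar>S D\<bar> <= M + real j * N"
     by (rule Suc.IH) (use Suc.prems D in auto)
    moreover have "\<bar>\<Sum>d | D < real d \<and> real d <= 2 * D. f d\<bar> <= N"
     unfolding f_def N_def by (rule C1(2)[OF y D(1,3,2)])
    ultimately show ?thesis by (simp add: distrib_right)
   qed
  qed
  define j where "j = nat \<lceil>log 2 y\<rceil>"
  have lg: "0 <= log 2 y" using y by simp
  have "y = 2 powr (log 2 y)" using y by simp
  also have "... <= 2 powr (real j)" unfolding j_def by (intro powr_mono real_nat_ceiling_ge) auto
  also have "... = 2 ^ j" by (simp add: powr_realpow)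
  finally have "2 * y <= 2 ^ j * 2" by simp
  also have "... <= 2 ^ j * U" using y7 by (intro mult_left_mono) (auto simp: U_def)
  finally have "\<bar>S u\<bar> <= M + real j * N" using u by (intro ind) auto
  also have "real j * N <= (c3 * y powr s) * N"
  proof (rule mult_right_mono[OF _ N0])
   have l2: "1/2 <= ln (2::real)" using ln2_ge_two_thirds by simp
   have "real j <= log 2 y + 1" unfolding j_def using lg by linarith
   also have "log 2 y = ln y / ln 2" by (simp add: log_def)
   also have "... <= ln y / (1/2)" using l2 y by (intro divide_left_mono) auto
   also have "... <= 2 * ((1 / s) * y powr s)" using log_growth[OF s(1) y] by simp
   finally have "real j <= (2 / s) * y powr s + 1" by simp
   also have "... <= (2 / s) * y powr s + 2 * y powr s" using ys by simp
   finally show "real j <= c3 * y powr s" by (simp add: c3_def algebra_simps)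
  qed
  also have "(c3 * y powr s) * N = c3 * C1 * (y powr s * y powr (7/8 + s))" by (simp add: N_def)
  also have "y powr s * y powr (7/8 + s) = y powr (7/8 + et)"
   unfolding powr_add[symmetric] by (rule arg_cong[where f = "(powr) y"]) (simp add: s_def)
  also have "M <= c2 * y powr (7/8 + et)" unfolding M_def
   using y s C0(1) by (intro mult_left_mono powr_mono) (auto simp: c2_def s_def)
  finally have "\<bar>S u\<bar> <= B * y powr (7/8 + et)" by (simp add: B_def distrib_right)
  then show "\<bar>\<Sum>d | 0 < d \<and> real d <= u. moebius2 d * sawt (y powr (kp + 3/4) * real d powr -kp)\<bar>
   <= B * y powr (7/8 + et)" by (simp add: S_def f_def)
 qed
qed

section \<open>Estimates for complex binomial coefficients\<close>

lemma gbinomial_norm_le: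
 fixes w :: complex
 shows "cmod (w gchoose k) <= pochhammer (cmod w) k / fact k"
proof -
 have "cmod (w gchoose k) = (\<Prod>i<k. cmod (w - of_nat i)) / fact k"
  by (simp add: gbinomial_prod_rev atLeast0LessThan norm_divide prod_norm)
 also have "... <= (\<Prod>i<k. (cmod w + real i)) / fact k"
  by (intro divide_right_mono prod_mono conjI norm_ge_zero order_trans[OF norm_triangle_ineq4]) auto
 also have "(\<Prod>i<k. (cmod w + real i)) = pochhammer (cmod w) k"
  by (simp add: pochhammer_prod atLeast0LessThan)
 finally show ?thesis .
qed

text \<open>These are the terms of the binomial series of (1 - 1/2)^(-B).\<close>

lemma summable_pochhammer_half:
 fixes B :: real
 shows "summable (%k. pochhammer B k / fact k * (1/2) ^ k)"
proof -
 have "summable (%k. ((- of_real B :: complex) gchoose k) * of_real (-1/2) ^ k)"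
  using gen_binomial_complex[of "of_real (-1/2)" "- of_real B"] by (auto simp: sums_iff)
 moreover have "((- of_real B :: complex) gchoose k) * of_real (-1/2) ^ k = of_real (pochhammer B k / fact k * (1/2) ^ k)" for k
 proof -
  have "((- of_real B :: complex) gchoose k) = (-1) ^ k * pochhammer (of_real B) k / fact k"
   by (simp add: gbinomial_pochhammer)
  moreover have "(of_real (-1/2) :: complex) ^ k = (-1) ^ k * of_real ((1/2) ^ k)"
   by (simp add: power_divide power_minus' flip: power_mult_distrib)
  moreover have "(-1::complex) ^ k * (-1) ^ k = 1" by (simp flip: power_mult_distrib)
  ultimately show ?thesis by (simp add: pochhammer_of_real mult_ac)
 qed
 ultimately have "summable (%k. complex_of_real (pochhammer B k / fact k * (1/2) ^ k))" by simp
 then show ?thesis by (subst (asm) summable_of_real_iff)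
qed

lemma pochhammer_nonneg_real: "0 <= B ==> 0 <= pochhammer (B::real) k"
 by (simp add: pochhammer_prod prod_nonneg)

section \<open>The zeta function\<close>

text \<open>The remainder of (n + 2)^(1 - s) after the terms k <= K of its binomial expansion about
  n + 1.\<close>

definition zrem :: "nat => nat => complex => complex" where
 "zrem K n s = of_nat (n + 2) powr (1 - s) - (\<Sum>k\<le>K. ((1 - s) gchoose k) * of_nat (n + 1) powr (1 - s - of_nat k))"

text \<open>The remainder is the tail of a series in powers of 1/(n + 1). For n >= 1 this ratio is
  at most 1/2, so the tail is compared with the series at 1/2, uniformly in |1 - s| <= B, after
  taking out the leading power of n + 1.\<close>

lemma zrem_norm_le:
 assumes B: "cmod (1 - s) <= B" and n: "n >= 1"
 shows "cmod (zrem K n s) <= 2 ^ Suc K * (\<Sum>k. pochhammer B k / fact k * (1/2) ^ k) * real (n + 1) powr (- Re s - real K)"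
proof -
 define N where "N = real (n + 1)"
 define w where "w = 1 - s"
 define P where "P k = pochhammer B k / fact k * (1/2) ^ k" for k
 have N: "N >= 2" using n by (simp add: N_def)
 have B0: "0 <= B" using B norm_ge_zero order_trans by blast
 have sumP: "summable P" unfolding P_def by (rule summable_pochhammer_half)
 have P0: "0 <= P k" for k using B0 by (simp add: P_def pochhammer_nonneg_real)
 have "(%k. (w gchoose k) * (of_real (1 / N)) ^ k) sums (1 + of_real (1 / N)) powr w"
  using N by (intro gen_binomial_complex) (simp add: norm_divide)
 from sums_mult[OF this, of "of_real N powr w"]
 have A2: "(%k. of_real N powr w * ((w gchoose k) * (of_real (1 / N)) ^ k)) sums (of_real N powr w * (1 + of_real (1 / N)) powr w)" .
 have "(%k. (w gchoose k) * (of_real N powr (w - of_nat k))) sums (of_real N powr w * (1 + of_real (1 / N)) powr w)"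
 proof -
  have "of_real N powr w * ((w gchoose k) * (of_real (1 / N)) ^ k) = (w gchoose k) * (of_real N powr (w - of_nat k))" for k
   using N by (simp add: powr_diff powr_nat' power_divide)
  then show ?thesis using A2 by (simp only:)
 qed
 moreover have "of_real N powr w * (1 + of_real (1 / N)) powr w = of_real (N + 1) powr w"
 proof -
  have "(1 + complex_of_real (1 / N)) = of_real (1 + 1 / N)" by simp
  then have "of_real N powr w * (1 + of_real (1 / N)) powr w = (of_real N * of_real (1 + 1 / N)) powr w"
   using N by (simp only:) (intro powr_times_real[symmetric], auto)
  also have "of_real N * of_real (1 + 1 / N) = complex_of_real (N + 1)"
   using N by (simp add: field_simps flip: of_real_mult)
  finally show ?thesis .
 qed
 ultimately have S: "(%k. (w gchoose k) * (of_real N powr (w - of_nat k))) sums (of_real (N + 1) powr w)" by simp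
 have z: "zrem K n s = (\<Sum>k. (w gchoose (k + Suc K)) * (of_real N powr (w - of_nat (k + Suc K))))"
 proof -
  have "(\<Sum>k. (w gchoose (k + Suc K)) * (of_real N powr (w - of_nat (k + Suc K))))
   = of_real (N + 1) powr w - (\<Sum>k<Suc K. (w gchoose k) * (of_real N powr (w - of_nat k)))"
   using suminf_minus_initial_segment[OF sums_summable[OF S], of "Suc K"] S by (simp add: sums_iff)
  moreover have "of_nat (n + 2) = complex_of_real (N + 1)" "of_nat (n + 1) = complex_of_real N" by (simp_all add: N_def)
  ultimately show ?thesis unfolding zrem_def w_def by (simp only: lessThan_Suc_atMost)
 qed
 have bnd: "cmod ((w gchoose (k + Suc K)) * (of_real N powr (w - of_nat (k + Suc K)))) <= 2 ^ Suc K * N powr (- Re s - real K) * P (k + Suc K)" for k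
 proof -
  have "cmod (w gchoose (k + Suc K)) <= pochhammer (cmod w) (k + Suc K) / fact (k + Suc K)" by (rule gbinomial_norm_le)
  also have "... <= pochhammer B (k + Suc K) / fact (k + Suc K)"
   unfolding pochhammer_prod using B B0 by (intro divide_right_mono prod_mono) (auto simp: w_def)
  also have "... = P (k + Suc K) * 2 ^ (k + Suc K)" by (simp add: P_def power_divide)
  finally have 1: "cmod (w gchoose (k + Suc K)) <= P (k + Suc K) * 2 ^ (k + Suc K)" .
  have "cmod (of_real N powr (w - of_nat (k + Suc K))) = N powr (Re w - real (k + Suc K))"
   using N by (subst norm_powr_real_powr) auto
  also have "Re w - real (k + Suc K) = (- Re s - real K) + (- real k)" by (simp add: w_def)
  also have "N powr ... = N powr (- Re s - real K) * N powr (- real k)" by (rule powr_add)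
  also have "N powr (- real k) <= 2 powr (- real k)" using N by (intro powr_mono2') auto
  also have "2 powr (- real k) = 1 / 2 ^ k" by (simp add: powr_minus powr_realpow divide_inverse)
  finally have 2: "cmod (of_real N powr (w - of_nat (k + Suc K))) <= N powr (- Re s - real K) * (1 / 2 ^ k)"
   by (simp add: mult_left_mono)
  have "cmod (w gchoose (k + Suc K)) * cmod (of_real N powr (w - of_nat (k + Suc K))) <= (P (k + Suc K) * 2 ^ (k + Suc K)) * (N powr (- Re s - real K) * (1 / 2 ^ k))"
   using P0[of "k + Suc K"] by (intro mult_mono 1 2) auto
  also have "... = 2 ^ Suc K * N powr (- Re s - real K) * P (k + Suc K)" by (simp add: power_add)
  finally show ?thesis by (simp only: norm_mult)
 qed
 have sumP': "summable (%k. P (k + Suc K))" using sumP by (rule summable_ignore_initial_segment)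
 have "cmod (zrem K n s) <= (\<Sum>k. 2 ^ Suc K * N powr (- Re s - real K) * P (k + Suc K))"
  unfolding z by (rule norm_suminf_le[OF bnd]) (intro summable_mult sumP')
 also have "... = 2 ^ Suc K * N powr (- Re s - real K) * (\<Sum>k. P (k + Suc K))"
  by (rule suminf_mult[OF sumP'])
 also have "... <= 2 ^ Suc K * N powr (- Re s - real K) * (\<Sum>k. P k)"
  using suminf_split_initial_segment[OF sumP, of "Suc K"] sum_nonneg[of "{..<Suc K}" P] P0
  by (intro mult_left_mono) auto
 finally show ?thesis by (simp add: P_def[abs_def] N_def mult_ac)
qed

lemma powr_holo: "n > 0 ==> f holomorphic_on A ==> (%s. of_nat n powr f s) holomorphic_on A"
 by (intro holomorphic_intros) auto

lemma zrem_holo: "zrem K n holomorphic_on A"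
 unfolding zrem_def[abs_def] gbinomial_prod_rev
 by (intro holomorphic_intros powr_holo) auto

lemma summable_powr_neg: "a > 1 ==> summable (%n. real (Suc n) powr -a)"
 using summable_Suc_iff[of "%n. real n powr -a"] summable_real_powr_iff[of "-a"] by simp

lemma uniform_limit_zrem:
 fixes S :: "complex set"
 assumes "bounded S" and \<sigma>: "\<sigma> > 1 - real K" "!!s. s \<in> S ==> \<sigma> <= Re s"
 shows "uniform_limit S (%m s. \<Sum>n<m. zrem K n s) (%s. \<Sum>n. zrem K n s) sequentially"
proof -
 obtain B0 where B0: "!!s. s \<in> S ==> cmod s <= B0" using assms(1) by (auto simp: bounded_iff)
 define c where "c = 2 ^ Suc K * (\<Sum>k. pochhammer (1 + B0) k / fact k * (1/2) ^ k)"
 show ?thesis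
 proof (rule Weierstrass_m_test_ev)
  show "summable (%n. c * real (Suc n) powr (-(\<sigma> + real K)))"
   using \<sigma> by (intro summable_mult summable_powr_neg) auto
  show "\<forall>\<^sub>F n in sequentially. \<forall>s\<in>S. norm (zrem K n s) <= c * real (Suc n) powr (-(\<sigma> + real K))"
   using eventually_ge_at_top[of 1]
  proof eventually_elim
   case (elim n)
   show ?case
   proof
    fix s assume s: "s \<in> S"
    have "cmod (1 - s) <= 1 + B0" using B0[OF s] norm_triangle_ineq4[of 1 s] by simp
    then have "cmod (zrem K n s) <= c * real (n + 1) powr (- Re s - real K)"
     unfolding c_def using elim by (rule zrem_norm_le)
    also have "... <= c * real (Suc n) powr (-(\<sigma> + real K))"
    proof (intro mult_left_mono)
     show "real (n + 1) powr (- Re s - real K) <= real (Suc n) powr (-(\<sigma> + real K))"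
      using \<sigma>(2)[OF s] by (simp add: powr_mono)
     have "0 <= 1 + B0" using order_trans[OF norm_ge_zero B0[OF s]] by simp
     then show "0 <= c" unfolding c_def
      by (intro mult_nonneg_nonneg suminf_nonneg summable_pochhammer_half) (auto simp: pochhammer_nonneg_real)
    qed
    finally show "norm (zrem K n s) <= c * real (Suc n) powr (-(\<sigma> + real K))" .
   qed
  qed
 qed
qed

lemma suminf_zrem_holo: "(%s. \<Sum>n. zrem K n s) holomorphic_on {s. Re s > 1 - real K}"
proof (rule holomorphic_uniform_sequence)
 show "open {s. Re s > 1 - real K}" by (rule open_halfspace_Re_gt)
 show "(%s. \<Sum>n<m. zrem K n s) holomorphic_on {s. Re s > 1 - real K}" for m
  by (intro holomorphic_on_sum zrem_holo)
 fix s :: complex assume s: "s \<in> {s. Re s > 1 - real K}"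
 define d where "d = (Re s - (1 - real K)) / 2"
 have d: "d > 0" using s by (simp add: d_def)
 have in': "1 - real K + d <= Re z" if "z \<in> cball s d" for z
 proof -
  have "\<bar>Re s - Re z\<bar> <= d" using that abs_Re_le_cmod[of "s - z"] by (simp add: dist_norm)
  moreover have "Re s = 1 - real K + 2 * d" by (simp add: d_def field_simps)
  ultimately show ?thesis by linarith
 qed
 show "\<exists>d>0. cball s d \<subseteq> {s. Re s > 1 - real K} \<and> uniform_limit (cball s d) (%m s. \<Sum>n<m. zrem K n s) (%s. \<Sum>n. zrem K n s) sequentially"
 proof (intro exI[of _ d] conjI d)
  show "cball s d \<subseteq> {s. Re s > 1 - real K}" using in' d by force
  show "uniform_limit (cball s d) (%m s. \<Sum>n<m. zrem K n s) (%s. \<Sum>n. zrem K n s) sequentially"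
   by (rule uniform_limit_zrem[where \<sigma> = "1 - real K + d"]) (use d in' in auto)
 qed
qed

lemma norm_nat_powr: "n > 0 ==> cmod (of_nat n powr w) = real n powr Re w"
 by (simp add: powr_def norm_exp_eq_Re Ln_of_nat)

lemma sums_powr_neg:
 assumes "Re s > 1"
 shows "(%n. of_nat (Suc n) powr (-s)) sums (\<Sum>n. of_nat (Suc n) powr (-s) :: complex)"
proof (rule summable_sums, rule summable_norm_cancel)
 show "summable (%n. norm (of_nat (Suc n) powr (-s) :: complex))"
  unfolding norm_nat_powr[OF zero_less_Suc] uminus_complex.sel by (rule summable_powr_neg[OF assms])
qed

text \<open>The Dirichlet series of zeta as a total function; its values are meaningful for Re s >
  1.\<close>

definition dz :: "complex => complex" where "dz s = (\<Sum>n. of_nat (Suc n) powr (-s))"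

lemma powr_Suc_tendsto_0:
 assumes "Re w < 0" shows "(%n. of_nat (Suc n) powr w :: complex) \<longlonglongrightarrow> 0"
proof (rule tendsto_norm_zero_cancel)
 have "(%n. real n powr (Re w)) \<longlonglongrightarrow> 0"
  by (rule tendsto_neg_powr[OF assms filterlim_real_sequentially])
 from LIMSEQ_Suc[OF this] show "(%n. norm (of_nat (Suc n) powr w :: complex)) \<longlonglongrightarrow> 0"
  unfolding norm_nat_powr[OF zero_less_Suc] .
qed

text \<open>Summing the binomial expansion of \<open>(n + 1)\<^bsup>1 - s\<^esup>\<close> over all \<open>n\<close> telescopes.\<close>

lemma dz_recursion:
 assumes s: "Re s > 1" and K: "K >= 1"
 shows "(s - 1) * dz s = 1 + (\<Sum>n. zrem K n s) + (\<Sum>k\<in>{2..K}. ((1 - s) gchoose k) * dz (s + of_nat k - 1))"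
proof -
 have tel: "(%n. of_nat (n + 2) powr (1 - s) - of_nat (n + 1) powr (1 - s)) sums (0 - 1 :: complex)"
  using telescope_sums[of "%n. of_nat (Suc n) powr (1 - s) :: complex" 0] powr_Suc_tendsto_0[of "1 - s"] s
  by simp
 have "(%n. \<Sum>k\<in>{1..K}. ((1 - s) gchoose k) * of_nat (Suc n) powr (-(s + of_nat k - 1)))
   sums (\<Sum>k\<in>{1..K}. ((1 - s) gchoose k) * dz (s + of_nat k - 1))"
  unfolding dz_def using s by (intro sums_sum sums_mult sums_powr_neg) auto
 moreover have "zrem K n s = (of_nat (n + 2) powr (1 - s) - of_nat (n + 1) powr (1 - s))
   - (\<Sum>k\<in>{1..K}. ((1 - s) gchoose k) * of_nat (Suc n) powr (-(s + of_nat k - 1)))" for n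
 proof -
  have "{..K} = insert 0 {1..K}" by auto
  then show ?thesis unfolding zrem_def by (simp add: algebra_simps)
 qed
 ultimately have "(%n. zrem K n s) sums ((0 - 1) - (\<Sum>k\<in>{1..K}. ((1 - s) gchoose k) * dz (s + of_nat k - 1)))"
  using sums_diff[OF tel] by simp
 moreover have "{1..K} = insert 1 {2..K}" using K by auto
 ultimately have "(\<Sum>n. zrem K n s) = - 1 - ((1 - s) * dz s + (\<Sum>k\<in>{2..K}. ((1 - s) gchoose k) * dz (s + of_nat k - 1)))"
  by (simp add: sums_iff)
 then show ?thesis by (simp add: algebra_simps)
qed

text \<open>The factor s + k - 2 that is split off equals s' - 1 at s' = s + k - 1. It turns dz s'
  into (s' - 1) dz s', the function that has already been continued.\<close>

lemma gbinomial_absorb: "((1 - s) gchoose k) = - (((1 - s) gchoose (k - 1)) / of_nat k) * (s + of_nat k - 2)"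
 if k1: "k >= 1" for s :: complex
proof -
 obtain j where k: "k = Suc j" using k1 by (cases k) auto
 have "of_nat (Suc j) * ((1 - s) gchoose (Suc j)) = ((1 - s) - of_nat j) * ((1 - s) gchoose j)"
  using gbinomial_absorb_comp[of "1 - s" j] gbinomial_absorption[of j "1 - s"] gbinomial_mult_1[of "1 - s" j] by (simp add: algebra_simps)
 moreover have "(of_nat (Suc j) :: complex) ~= 0" by (simp only: of_nat_eq_0_iff)
 ultimately have "((1 - s) gchoose (Suc j)) = ((1 - s) - of_nat j) * ((1 - s) gchoose j) / of_nat (Suc j)"
  by (simp add: field_simps del: of_nat_Suc)
 then show ?thesis by (simp add: k field_simps del: of_nat_Suc) (simp add: algebra_simps)
qed

text \<open>The pole is multiplied away from the outset by continuing (s - 1) dz s. The recursion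
  expresses this function at s through its values at s + 1, s + 2, ... and a convergent remainder,
  so every step gains a strip of width 1.\<close>

lemma continuation_step:
 "\<exists>G. G holomorphic_on {s. Re s > 1 - real m} \<and> (\<forall>s. Re s > 1 \<longrightarrow> G s = (s - 1) * dz s)" 
proof (induction m)
 case 0
 have "(%s. 1 + (\<Sum>n. zrem 1 n s)) holomorphic_on {s. Re s > 1 - real 0}"
  by (intro holomorphic_intros holomorphic_on_subset[OF suminf_zrem_holo]) auto
 moreover have "1 + (\<Sum>n. zrem 1 n s) = (s - 1) * dz s" if "Re s > 1" for s
  using dz_recursion[OF that, of 1] by simp
 ultimately show ?case by (intro exI[of _ "%s. 1 + (\<Sum>n. zrem 1 n s)"]) auto
next
 case (Suc m)
 then obtain G where G: "G holomorphic_on {s. Re s > 1 - real m}" "!!s. Re s > 1 ==> G s = (s - 1) * dz s" by auto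
 define K where "K = Suc m"
 define G' where "G' s = 1 + (\<Sum>n. zrem K n s) - (\<Sum>k\<in>{2..K}. ((1 - s) gchoose (k - 1)) / of_nat k * G (s + of_nat k - 1))" for s
 have "G' holomorphic_on {s. Re s > 1 - real (Suc m)}"
  unfolding G'_def
 proof (intro holomorphic_intros)
  show "(%s. \<Sum>n. zrem K n s) holomorphic_on {s. Re s > 1 - real (Suc m)}" using suminf_zrem_holo[of K] by (simp add: K_def)
  fix k assume k: "k \<in> {2..K}"
  show "(%s. (1 - s) gchoose (k - 1)) holomorphic_on {s. Re s > 1 - real (Suc m)}"
   unfolding gbinomial_prod_rev by (intro holomorphic_intros) auto
  have "(G \<circ> (%s. s + of_nat k - 1)) holomorphic_on {s. Re s > 1 - real (Suc m)}"
  proof (rule holomorphic_on_compose_gen[OF _ G(1)])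
   show "(%s. s + of_nat k - 1) ` {s. Re s > 1 - real (Suc m)} \<subseteq> {s. Re s > 1 - real m}" using k by auto
  qed (intro holomorphic_intros)
  then show "(%s. G (s + of_nat k - 1)) holomorphic_on {s. Re s > 1 - real (Suc m)}" by (simp add: o_def)
 qed auto
 moreover have "G' s = (s - 1) * dz s" if s: "Re s > 1" for s
 proof -
  have "((1 - s) gchoose (k - 1)) / of_nat k * G (s + of_nat k - 1) = - (((1 - s) gchoose k) * dz (s + of_nat k - 1))"
   if k: "k \<in> {2..K}" for k
  proof -
   have "G (s + of_nat k - 1) = (s + of_nat k - 2) * dz (s + of_nat k - 1)"
    using G(2)[of "s + of_nat k - 1"] s k by (simp add: algebra_simps)
   then show ?thesis using gbinomial_absorb[of k s] k by simp
  qed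
  then have "(\<Sum>k\<in>{2..K}. ((1 - s) gchoose (k - 1)) / of_nat k * G (s + of_nat k - 1)) = - (\<Sum>k\<in>{2..K}. ((1 - s) gchoose k) * dz (s + of_nat k - 1))"
   unfolding sum_negf[symmetric] by (intro sum.cong refl) auto
  then show ?thesis using dz_recursion[OF s, of K] by (simp add: G'_def K_def)
 qed
 ultimately show ?case by blast
qed

lemma half_planes_agree:
 assumes f: "f holomorphic_on {s. Re s > a}" and g: "g holomorphic_on {s. Re s > b}"
  and eq: "!!s. Re s > c ==> f s = g s" and z: "Re z > a" "Re z > b"
 shows "f z = g z"
proof -
 define M M' where "M = max a b" and "M' = max M c"
 let ?U = "{s. Re s > M}"
 have "f z - g z = 0"
 proof (rule analytic_continuation[of "%s. f s - g s" ?U "{s. Re s > M'}" "of_real (M' + 1)"])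
  show "(%s. f s - g s) holomorphic_on ?U"
   by (intro holomorphic_intros holomorphic_on_subset[OF f] holomorphic_on_subset[OF g]) (auto simp: M_def)
  show "open ?U" by (rule open_halfspace_Re_gt)
  show "connected ?U" by (intro convex_connected convex_halfspace_Re_gt)
  have "open {s. Re s > M'}" by (rule open_halfspace_Re_gt)
  then show "of_real (M' + 1) islimpt {s. Re s > M'}"
   by (intro interior_limit_point) (simp add: interior_open)
 qed (use eq z in \<open>auto simp: M_def M'_def\<close>)
 then show ?thesis by simp
qed

text \<open>The half plane used at s is selected by rounding Re s. The continuations agree wherever
  two of them are defined, so near every point the glued function is a single one of them.\<close>

theorem continuation_exists:
 "\<exists>G. G holomorphic_on UNIV \<and> (\<forall>s. Re s > 1 \<longrightarrow> G s = (s - 1) * dz s)"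
proof -
 obtain F where F: "!!m. F m holomorphic_on {s. Re s > 1 - real m}" "!!m s. Re s > 1 ==> F m s = (s - 1) * dz s"
  using continuation_step by metis
 define G where "G s = F (nat \<lceil>2 - Re s\<rceil>) s" for s
 have GF: "G s = F m s" if "Re s > 1 - real m" for m s
 proof -
  have "Re s > 1 - real (nat \<lceil>2 - Re s\<rceil>)" by linarith
  then show ?thesis unfolding G_def
   using half_planes_agree[OF F(1) F(1), of 1] F(2) that by metis
 qed
 have "G holomorphic_on UNIV"
 proof (rule holomorphic_onI)
  fix s :: complex
  define m where "m = nat \<lceil>2 - Re s\<rceil>"
  have m: "Re s > 1 - real m" unfolding m_def by linarith
  have o: "open {s. Re s > 1 - real m}" by (rule open_halfspace_Re_gt)
  have "F m field_differentiable at s"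
   using F(1)[of m] o m by (meson holomorphic_on_imp_differentiable_at mem_Collect_eq)
  then obtain d where d: "(F m has_field_derivative d) (at s)" unfolding field_differentiable_def by blast
  have "(G has_field_derivative d) (at s)"
   by (rule has_field_derivative_transform_within_open[OF d o]) (use m GF in auto)
  then show "G field_differentiable at s within UNIV" by (auto simp: field_differentiable_def)
 qed
 moreover have "G s = (s - 1) * dz s" if "Re s > 1" for s
  using GF[of 0 s] F(2)[OF that] that by simp
 ultimately show ?thesis by blast
qed

text \<open>The entire function (s - 1) zeta s. The two properties in its description are all that
  is used of the choice.\<close>

definition entz :: "complex => complex" where
 "entz = (SOME G. G holomorphic_on UNIV \<and> (\<forall>s. Re s > 1 \<longrightarrow> G s = (s - 1) * dz s))"

lemma entz_holo: "entz holomorphic_on A" and entz_eq: "Re s > 1 ==> entz s = (s - 1) * dz s"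
 using someI_ex[OF continuation_exists] holomorphic_on_subset[of _ UNIV A] unfolding entz_def by auto

text \<open>The quotient satisfies the description of \<open>zeta\<close>; any other candidate
  agrees with it for Re s > 1 and hence on the connected set of all s other than 1. At 1 division by
  zero supplies the dummy value 0.\<close>

lemma zeta_eq: "zeta s = entz s / (s - 1)"
proof -
 define f where "f s = entz s / (s - 1)" for s
 have "zeta = f"
  unfolding zeta_def
 proof (rule the_equality, intro conjI allI impI)
  show "f holomorphic_on - {1}" unfolding f_def by (intro holomorphic_intros entz_holo) auto
  show "(%n. of_nat (Suc n) powr - s) sums f s" if "Re s > 1" for s
  proof -
   have "s ~= 1" using that by auto
   then have "f s = dz s" using entz_eq[OF that] by (simp add: f_def)
   then show ?thesis using sums_powr_neg[OF that] by (simp add: dz_def)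
  qed
  show "f 1 = 0" by (simp add: f_def)
 next
  fix g :: "complex => complex"
  assume "g holomorphic_on - {1} \<and> (\<forall>s. 1 < Re s \<longrightarrow> (%n. of_nat (Suc n) powr - s) sums g s) \<and> g 1 = 0"
  then have g: "g holomorphic_on - {1}" "!!s. 1 < Re s ==> (%n. of_nat (Suc n) powr - s) sums g s" "g 1 = 0" by auto
  have "g z = f z" if z: "z ~= 1" for z
  proof -
   have "g z - f z = 0"
   proof (rule analytic_continuation[of "%s. g s - f s" "- {1}" "{s. Re s > 1}" 2])
    show "(%s. g s - f s) holomorphic_on - {1}" unfolding f_def by (intro holomorphic_intros g entz_holo) auto
    show "open (- {1::complex})" by auto
    show "connected (- {1::complex})" using connected_punctured_universe[of "1::complex"] by (simp add: Compl_eq_Diff_UNIV)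
    show "2 islimpt {s. Re s > 1}"
     by (rule interior_limit_point) (auto simp: interior_open open_halfspace_Re_gt)
    fix s assume "s \<in> {s. Re s > 1}"
    then have s: "Re s > 1" by simp
    then have "s ~= 1" by auto
    then have "f s = dz s" using entz_eq[OF s] by (simp add: f_def)
    moreover have "g s = dz s" using g(2)[OF s] by (simp add: sums_iff dz_def)
    ultimately show "g s - f s = 0" by simp
   qed (use z in auto)
   then show ?thesis by simp
  qed
  moreover have "g 1 = f 1" using g(3) by (simp add: f_def)
  ultimately have "g z = f z" for z by (cases "z = 1") simp_all
  then show "g = f" by (rule ext)
 qed
 then have "zeta s = f s" by (rule fun_cong)
 then show ?thesis unfolding f_def .
qed

lemma zeta_eq_dz: "Re s > 1 ==> zeta s = dz s"
proof -
 assume s: "Re s > 1"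
 then have "s ~= 1" by auto
 then show ?thesis using entz_eq[OF s] by (simp add: zeta_eq)
qed

lemma entz_formula: "Re s > 0 ==> entz s = 1 + (\<Sum>n. zrem 1 n s)"
proof (rule half_planes_agree[where f = entz and g = "%s. 1 + (\<Sum>n. zrem 1 n s)" and a = 0 and b = 0 and c = 1])
 show "entz holomorphic_on {s. 0 < Re s}" by (rule entz_holo)
 show "(%s. 1 + (\<Sum>n. zrem 1 n s)) holomorphic_on {s. 0 < Re s}"
  using suminf_zrem_holo[of 1] by (auto intro!: holomorphic_intros)
 show "entz s = 1 + (\<Sum>n. zrem 1 n s)" if "Re s > 1" for s
  using dz_recursion[OF that, of 1] entz_eq[OF that] by simp
qed auto

text \<open>Taylor's formula for z^(1 - s) on [N, N + 1]. In contrast to \<open>zrem_norm_le\<close>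
  the dependence on s is explicit, which yields polynomial growth of \<open>entz\<close>.\<close>

lemma zrem_1_norm_le:
 assumes s: "Re s >= 1/2"
 shows "cmod (zrem 1 n s) <= cmod (1 - s) * cmod s * real (Suc n) powr (-(3/2))"
proof -
 define N where "N = real (Suc n)"
 have N: "N >= 1" by (simp add: N_def)
 define S where "S = closed_segment (of_real N) (complex_of_real (N + 1))"
 define f where "f i z = (if i = 0 then z powr (1 - s) else if i = 1 then (1 - s) * z powr (-s) else (1 - s) * (-s) * z powr (-s - 1))" for i :: nat and z :: complex
 have S: "Re z >= N \<and> Im z = 0" if "z \<in> S" for z
  using that N unfolding S_def by (auto simp: closed_segment_def algebra_simps)
 have nr: "z \<notin> \<real>\<^sub>\<le>\<^sub>0" if "z \<in> S" for z using S[OF that] N by (auto simp: complex_nonpos_Reals_iff)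
 have "cmod (f 0 (of_real (N + 1)) - (\<Sum>i\<le>1. f i (of_real N) * (of_real (N + 1) - of_real N) ^ i / fact i))
   <= (cmod (1 - s) * cmod s * N powr (-(3/2))) * cmod (complex_of_real (N + 1) - of_real N) ^ Suc 1 / fact 1"
 proof (rule complex_Taylor)
  show "convex S" by (simp add: S_def)
  show "of_real N \<in> S" "complex_of_real (N + 1) \<in> S" by (auto simp: S_def)
  show "(f i has_field_derivative f (Suc i) z) (at z within S)" if z: "z \<in> S" "i <= 1" for i z
  proof -
   consider "i = 0" | "i = 1" using z(2) by linarith
   then show ?thesis
   proof cases
    case 1
    show ?thesis unfolding 1 f_def using nr[OF z(1)]
     by (auto intro!: derivative_eq_intros has_field_derivative_powr)
   next
    case 2
    show ?thesis unfolding 2 f_def using nr[OF z(1)]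
     by (auto intro!: derivative_eq_intros has_field_derivative_powr)
   qed
  qed
  fix z assume z: "z \<in> S"
  have zr: "z = of_real (Re z)" using S[OF z] by (simp add: complex_eq_iff)
  have "cmod (z powr (-s - 1)) = Re z powr (- Re s - 1)"
   using norm_powr_real_powr[of z "-s - 1"] S[OF z] N by (simp add: complex_is_Real_iff)
  also have "... <= N powr (- Re s - 1)" using S[OF z] N s by (intro powr_mono2') auto
  also have "... <= N powr (-(3/2))" using N s by (intro powr_mono) auto
  finally show "cmod (f (Suc 1) z) <= cmod (1 - s) * cmod s * N powr (-(3/2))"
   by (simp add: f_def norm_mult mult_left_mono)
 qed
 moreover have "f 0 (of_real (N + 1)) - (\<Sum>i\<le>1. f i (of_real N) * (of_real (N + 1) - of_real N) ^ i / fact i) = zrem 1 n s"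
  by (simp add: f_def zrem_def N_def algebra_simps)
 ultimately show ?thesis by (simp add: N_def)
qed

lemma entz_growth:
 obtains C where "C > 0" "!!s. Re s >= 1/2 ==> cmod (entz s) <= C * (1 + cmod s)^2"
proof -
 define c where "c = (\<Sum>n. real (Suc n) powr (-(3/2)))"
 have sm: "summable (%n. real (Suc n) powr (-(3/2)))" by (rule summable_powr_neg) simp
 have c: "c >= 0" unfolding c_def by (intro suminf_nonneg sm) auto
 show ?thesis
 proof (rule that[of "1 + c"])
  fix s assume s: "Re s >= 1/2"
  have sm': "summable (%n. cmod (1 - s) * cmod s * real (Suc n) powr (-(3/2)))" by (intro summable_mult sm)
  have "cmod (entz s) <= 1 + cmod (\<Sum>n. zrem 1 n s)"
   using s norm_triangle_ineq[of 1 "\<Sum>n. zrem 1 n s"] by (simp add: entz_formula)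
  also have "cmod (\<Sum>n. zrem 1 n s) <= (\<Sum>n. cmod (1 - s) * cmod s * real (Suc n) powr (-(3/2)))"
   by (rule norm_suminf_le[OF zrem_1_norm_le[OF s] sm'])
  also have "... = cmod (1 - s) * cmod s * c" unfolding c_def by (rule suminf_mult[OF sm])
  also have "... <= (1 + cmod s) * (1 + cmod s) * c"
   using c norm_triangle_ineq4[of 1 s] by (intro mult_right_mono mult_mono) auto
  also have "1 + (1 + cmod s) * (1 + cmod s) * c <= (1 + c) * (1 + cmod s)^2"
   using c by (simp add: power2_eq_square algebra_simps)
  finally show "cmod (entz s) <= (1 + c) * (1 + cmod s)^2" by simp
 qed (use c in auto)
qed

section \<open>Dirichlet series and the coefficients of zeta^(-2)\<close>

definition dterm :: "(nat => real) => complex => nat => complex" where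
 "dterm f s n = of_real (f n) * of_nat n powr (-s)"

text \<open>Absolute summability without an order on the positive integers, as products of series
  are rearranged along the fibres of multiplication.\<close>

definition dabs :: "(nat => real) => complex => bool" where
 "dabs f s \<longleftrightarrow> (%n. norm (dterm f s n)) summable_on {0<..}"

definition dser :: "(nat => real) => complex => complex" where
 "dser f s = infsum (dterm f s) {0<..}"

lemma norm_dterm: "n > 0 ==> cmod (dterm f s n) = \<bar>f n\<bar> * real n powr - Re s"
 by (simp add: dterm_def norm_mult norm_nat_powr)

lemma summable_on_powr_neg:
 assumes "a > 1" shows "(%n::nat. real n powr -a) summable_on {0<..}"
proof -
 have "summable (%n. real n powr -a)" using assms by (simp add: summable_real_powr_iff)
 then have "(%n::nat. real n powr -a) summable_on UNIV"
  by (intro norm_summable_imp_summable_on) simp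
 then show ?thesis by (rule summable_on_subset_banach) auto
qed

lemma dabs_of_bound:
 assumes f: "!!n. n > 0 ==> \<bar>f n\<bar> <= A * real n powr ep" and s: "Re s > 1 + ep"
 shows "dabs f s"
 unfolding dabs_def
proof (rule Infinite_Sum.abs_summable_on_comparison_test')
 show "(%n::nat. A * real n powr - (Re s - ep)) summable_on {0<..}"
  using s by (intro summable_on_cmult_right summable_on_powr_neg) auto
 fix n :: nat assume n: "n \<in> {0<..}"
 have "\<bar>f n\<bar> * real n powr - Re s <= A * real n powr ep * real n powr - Re s"
  using n by (intro mult_right_mono f) auto
 also have "... = A * real n powr - (Re s - ep)" by (simp add: powr_add[symmetric])
 finally show "cmod (dterm f s n) <= A * real n powr - (Re s - ep)" using n by (simp add: norm_dterm)
qed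

lemma dterm_mult: "dterm f s a * dterm g s b = of_real (f a * g b) * of_nat (a * b) powr (-s)"
proof -
 have "(of_nat (a * b) :: complex) powr (-s) = of_nat a powr (-s) * of_nat b powr (-s)"
  unfolding of_nat_mult by (rule powr_times_real) auto
 then show ?thesis by (simp add: dterm_def)
qed

text \<open>The products of terms are absolutely summable over all pairs (a, b). They may thus be
  summed along the fibres a b = n or as a product of two series.\<close>

lemma dser_dconv:
 assumes f: "dabs f s" and g: "dabs g s"
 shows "dabs (dconv f g) s" "dser (dconv f g) s = dser f s * dser g s"
proof -
 let ?A = "{0::nat<..}"
 define F where "F p = dterm f s (fst p) * dterm g s (snd p)" for p
 define B where "B n = {(a, b). a * b = (n::nat)}" for n
 have finB: "finite (B n)" if "n \<in> ?A" for n using finite_factorizations[of n] that by (simp add: B_def)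
 have FA: "(%p. norm (F p)) summable_on ?A \<times> ?A"
  unfolding Infinite_Sum.abs_summable_on_Sigma_iff
 proof (intro conjI ballI)
  fix a :: nat
  show "(%y. norm (F (a, y))) summable_on ?A"
   using g unfolding F_def dabs_def by (simp add: norm_mult summable_on_cmult_right)
 next
  have "infsum (%y. norm (F (a, y))) ?A = norm (dterm f s a) * infsum (%y. norm (dterm g s y)) ?A" for a
   using g unfolding F_def dabs_def by (simp add: norm_mult infsum_cmult_right)
  then show "(%x. norm (infsum (%y. norm (F (x, y))) ?A)) summable_on ?A"
   using f unfolding dabs_def by (simp add: abs_mult summable_on_cmult_left)
 qed
 have bij: "bij_betw snd (SIGMA n:?A. B n) (?A \<times> ?A)"
 proof (rule bij_betwI')
  fix x y assume "x \<in> (SIGMA n:?A. B n)" "y \<in> (SIGMA n:?A. B n)"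
  then show "(snd x = snd y) = (x = y)" by (auto simp: B_def)
 next
  fix x assume "x \<in> (SIGMA n:?A. B n)"
  then show "snd x \<in> ?A \<times> ?A" by (auto simp: B_def)
 next
  fix y assume "y \<in> ?A \<times> ?A"
  then have "(fst y * snd y, y) \<in> (SIGMA n:?A. B n)" by (auto simp: B_def)
  then show "\<exists>x\<in>(SIGMA n:?A. B n). y = snd x" by force
 qed
 have FS: "(%p. norm (F (snd p))) summable_on (SIGMA n:?A. B n)"
  using FA summable_on_reindex_bij_betw[OF bij, of "%p. norm (F p)"] by simp
 have fib: "(\<Sum>p\<in>B n. F p) = dterm (dconv f g) s n" if "n \<in> ?A" for n
 proof -
  have "(\<Sum>p\<in>B n. F p) = (\<Sum>p\<in>B n. of_real (f (fst p) * g (snd p)) * of_nat n powr (-s))"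
   by (intro sum.cong refl) (auto simp: F_def dterm_mult B_def simp del: of_nat_mult)
  also have "... = dterm (dconv f g) s n"
   by (simp add: dterm_def dconv_def B_def case_prod_beta sum_distrib_right)
  finally show ?thesis .
 qed
 have "(%n. norm (infsum (%p. norm (F p)) (B n))) summable_on ?A"
  using FS unfolding Infinite_Sum.abs_summable_on_Sigma_iff by simp
 then show "dabs (dconv f g) s"
  unfolding dabs_def
 proof (rule Infinite_Sum.abs_summable_on_comparison_test)
  fix n assume n: "n \<in> ?A"
  have "norm (dterm (dconv f g) s n) <= (\<Sum>p\<in>B n. norm (F p))"
   unfolding fib[OF n, symmetric] by (rule norm_sum)
  then show "norm (dterm (dconv f g) s n) <= norm (infsum (%p. norm (F p)) (B n))"
   using finB[OF n] by (simp add: sum_nonneg)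
 qed
 have "dser (dconv f g) s = infsum (%n. infsum (%p. F (snd (n, p))) (B n)) ?A"
  unfolding dser_def by (intro infsum_cong) (simp add: fib finB)
 also have "... = infsum (%p. F (snd p)) (SIGMA n:?A. B n)"
  by (rule infsum_Sigma_banach[OF Infinite_Sum.abs_summable_summable[OF FS]])
 also have "... = infsum F (?A \<times> ?A)" by (rule infsum_reindex_bij_betw[OF bij])
 also have "... = infsum (%a. infsum (%b. F (a, b)) ?A) ?A"
  by (rule infsum_Sigma_banach[OF Infinite_Sum.abs_summable_summable[OF FA], symmetric])
 also have "... = dser f s * dser g s"
  using Infinite_Sum.abs_summable_summable[OF f[unfolded dabs_def]] Infinite_Sum.abs_summable_summable[OF g[unfolded dabs_def]]
  unfolding F_def dser_def by (simp add: infsum_cmult_right infsum_cmult_left)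
 finally show "dser (dconv f g) s = dser f s * dser g s" .
qed

lemma dser_sums:
 assumes "dabs f s"
 shows "(%n. dterm f s (Suc n)) sums dser f s"
proof -
 have "(dterm f s has_sum dser f s) {0<..}"
  using Infinite_Sum.abs_summable_summable[OF assms[unfolded dabs_def]] unfolding dser_def by (rule has_sum_infsum)
 moreover have "bij_betw Suc UNIV {0<..}" by (rule bij_betwI[of _ _ _ "%n. n - 1"]) auto
 ultimately have "((%n. dterm f s (Suc n)) has_sum dser f s) UNIV"
  using has_sum_reindex_bij_betw[of Suc UNIV "{0<..}" "dterm f s"] by simp
 then show ?thesis by (rule has_sum_imp_sums)
qed

lemma dabs_one: "Re s > 1 ==> dabs (%_. 1) s"
 by (rule dabs_of_bound[of _ 1 0]) auto

lemma dser_one: "Re s > 1 ==> dser (%_. 1) s = zeta s"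
 using dser_sums[OF dabs_one] by (simp add: zeta_eq_dz dz_def sums_iff dterm_def)

lemma dabs_moebius: "Re s > 1 ==> dabs moebius s"
 by (rule dabs_of_bound[of _ 1 0]) (use abs_moebius_le in auto)

lemma dser_moebius_zeta: assumes "Re s > 1" shows "dser moebius s * zeta s = 1"
proof -
 have "dser moebius s * zeta s = dser (dconv moebius (%_. 1)) s"
  using dser_dconv(2)[OF dabs_moebius dabs_one] assms by (simp add: dser_one)
 also have "... = infsum (dterm dunit s) {0<..}"
  unfolding dser_def by (intro infsum_cong) (simp add: dterm_def dconv_moebius_one)
 also have "... = infsum (dterm dunit s) {1}"
  by (rule infsum_cong_neutral) (auto simp: dterm_def dunit_def)
 also have "... = 1" by (simp add: dterm_def dunit_def)
 finally show ?thesis .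
qed

lemma zeta_nonzero_gt_1: "Re s > 1 ==> zeta s ~= 0"
 using dser_moebius_zeta[of s] by auto

lemma dabs_moebius2: "Re s > 1 ==> dabs moebius2 s"
 and dser_moebius2: "Re s > 1 ==> dser moebius2 s = 1 / zeta s ^ 2"
proof -
 assume s: "Re s > 1"
 show "dabs moebius2 s" unfolding moebius2_def by (rule dser_dconv(1)) (intro dabs_moebius s)+
 have "dser moebius2 s = dser moebius s * dser moebius s"
  unfolding moebius2_def by (rule dser_dconv(2)) (intro dabs_moebius s)+
 moreover have "dser moebius s = 1 / zeta s"
  using dser_moebius_zeta[OF s] zeta_nonzero_gt_1[OF s] by (simp add: field_simps)
 ultimately show "dser moebius2 s = 1 / zeta s ^ 2" by (simp add: power2_eq_square)
qed

text \<open>If all earlier coefficients vanish, the term with index N + 1 equals minus the sum of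
  the later ones, which is smaller by a factor ((N + 1)/(N + 2))^\<sigma>; then \<sigma> tends to
  infinity. Convergence at s = 2 alone gives coefficients O(n^2), so the comparison starts at
  \<sigma> = 4.\<close>

lemma dirichlet_series_unique:
 fixes e :: "nat => complex"
 assumes S: "!!s. Re s > 1 ==> (%n. e (Suc n) * of_nat (Suc n) powr (-s)) sums 0"
 shows "e (Suc n) = 0"
proof (induction n rule: less_induct)
 case (less N)
 have "summable (%n. e (Suc n) * of_nat (Suc n) powr (-2))" using S[of 2] by (simp add: sums_iff)
 then have "(%n. e (Suc n) * of_nat (Suc n) powr (-2)) \<longlonglongrightarrow> 0" by (rule summable_LIMSEQ_zero)
 then have "Bseq (%n. e (Suc n) * of_nat (Suc n) powr (-2))" by (meson convergentI convergent_imp_Bseq)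
 then obtain B where B: "B > 0" "!!n. cmod (e (Suc n) * of_nat (Suc n) powr (-2)) <= B" by (auto simp: Bseq_def)
 have eb: "cmod (e (Suc n)) <= B * real (Suc n) powr 2" for n
 proof -
  have "cmod (e (Suc n)) * real (Suc n) powr (-2) <= B"
   using B(2)[of n] unfolding norm_mult norm_nat_powr[OF zero_less_Suc] by simp
  then have "cmod (e (Suc n)) * real (Suc n) powr (-2) * real (Suc n) powr 2 <= B * real (Suc n) powr 2"
   by (intro mult_right_mono) auto
  moreover have "real (Suc n) powr (-2) * real (Suc n) powr 2 = 1"
   by (simp only: powr_add[symmetric]) (simp del: of_nat_Suc)
  ultimately show ?thesis by (simp only: mult.assoc mult_1_right)
 qed
 define c where "c = (\<Sum>n. real (Suc n) powr (-2))"
 have sm2: "summable (%n. real (Suc n) powr (-2))" by (rule summable_powr_neg) simp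
 have key: "cmod (e (Suc N)) <= (B * c * real (N + 2) powr 4) * (real (N + 1) / real (N + 2)) powr \<sigma>" if \<sigma>: "\<sigma> >= 4" for \<sigma> :: real
 proof -
  define t where "t n = e (Suc n) * of_nat (Suc n) powr (- of_real \<sigma>)" for n
  have t: "t sums 0" unfolding t_def using S[of "of_real \<sigma>"] \<sigma> by simp
  have "(\<Sum>n<Suc N. t n) = t N" using less.IH by (simp add: t_def)
  then have "(%n. t (n + Suc N)) sums (0 - t N)"
   using sums_split_initial_segment[OF t, of "Suc N"] by simp
  then have "t N = - (\<Sum>n. t (n + Suc N))" by (simp add: sums_iff)
  then have "cmod (t N) = cmod (\<Sum>n. t (n + Suc N))" by simp
  also have "... <= (\<Sum>n. B * real (N + 2) powr (4 - \<sigma>) * real (Suc n) powr (-2))"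
  proof (rule norm_suminf_le)
   show "summable (%n. B * real (N + 2) powr (4 - \<sigma>) * real (Suc n) powr (-2))" by (intro summable_mult sm2)
   fix n
   let ?m = "real (Suc (n + Suc N))"
   have "cmod (t (n + Suc N)) = cmod (e (Suc (n + Suc N))) * ?m powr (-\<sigma>)"
    unfolding t_def norm_mult norm_nat_powr[OF zero_less_Suc] by simp
   also have "... <= B * ?m powr 2 * ?m powr (-\<sigma>)" by (intro mult_right_mono eb) auto
   also have "... = B * (?m powr (4 - \<sigma>) * ?m powr (-2))"
    by (simp only: mult.assoc powr_add[symmetric]) simp
   also have "... <= B * (real (N + 2) powr (4 - \<sigma>) * real (Suc n) powr (-2))"
    using \<sigma> B(1) by (intro mult_left_mono mult_mono powr_mono2') auto
   finally show "cmod (t (n + Suc N)) <= B * real (N + 2) powr (4 - \<sigma>) * real (Suc n) powr (-2)" by (simp only: mult.assoc)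
  qed
  also have "... = B * real (N + 2) powr (4 - \<sigma>) * c" unfolding c_def by (rule suminf_mult[OF sm2])
  also have "cmod (t N) = cmod (e (Suc N)) * real (N + 1) powr (-\<sigma>)"
   unfolding t_def norm_mult norm_nat_powr[OF zero_less_Suc] by simp
  finally have "cmod (e (Suc N)) * real (N + 1) powr (-\<sigma>) * real (N + 1) powr \<sigma> <= B * real (N + 2) powr (4 - \<sigma>) * c * real (N + 1) powr \<sigma>"
   by (intro mult_right_mono) auto
  moreover have "real (N + 1) powr (-\<sigma>) * real (N + 1) powr \<sigma> = 1" by (simp only: powr_add[symmetric]) simp
  moreover have "B * real (N + 2) powr (4 - \<sigma>) * c * real (N + 1) powr \<sigma> = (B * c * real (N + 2) powr 4) * (real (N + 1) / real (N + 2)) powr \<sigma>"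
   by (simp add: powr_diff powr_divide)
  ultimately show ?thesis by (simp only: mult.assoc mult_1_right)
 qed
 have "((%\<sigma>. (real (N + 1) / real (N + 2)) powr \<sigma>) \<longlongrightarrow> 0) at_top"
 proof -
  have "((%\<sigma>. exp (ln (real (N + 1) / real (N + 2)) * \<sigma>)) \<longlongrightarrow> 0) at_top"
  proof (rule filterlim_compose[OF exp_at_bot])
   have "ln (real (N + 1) / real (N + 2)) < 0" by (subst ln_less_zero_iff) auto
   then show "filterlim (%\<sigma>. ln (real (N + 1) / real (N + 2)) * \<sigma>) at_bot at_top"
    by (intro filterlim_tendsto_neg_mult_at_bot[OF tendsto_const _ filterlim_ident])
  qed
  then show ?thesis by (simp add: powr_def mult.commute)
 qed
 from tendsto_mult[OF tendsto_const this, of "B * c * real (N + 2) powr 4"]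
 have lim: "((%\<sigma>. (B * c * real (N + 2) powr 4) * (real (N + 1) / real (N + 2)) powr \<sigma>) \<longlongrightarrow> 0) at_top" by simp
 have "cmod (e (Suc N)) <= 0"
 proof (rule tendsto_lowerbound[OF lim])
  show "\<forall>\<^sub>F \<sigma> in at_top. cmod (e (Suc N)) <= (B * c * real (N + 2) powr 4) * (real (N + 1) / real (N + 2)) powr \<sigma>"
   by (rule eventually_mono[OF eventually_ge_at_top[of 4]]) (rule key)
 qed simp
 then show ?case by simp
qed

lemma mu2_eq: "mu2 = (%n. of_real (moebius2 n))"
 unfolding mu2_def
proof (rule the_equality, intro conjI allI impI)
 show "complex_of_real (moebius2 0) = 0" by (simp add: moebius2_def)
 show "(%n. complex_of_real (moebius2 (Suc n)) * of_nat (Suc n) powr - s) sums (1 / zeta s ^ 2)" if "Re s > 1" for s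
  using dser_sums[OF dabs_moebius2[OF that]] dser_moebius2[OF that] by (simp add: dterm_def)
next
 fix m :: "nat => complex"
 assume m: "m 0 = 0 \<and> (\<forall>s. Re s > 1 \<longrightarrow> (%n. m (Suc n) * of_nat (Suc n) powr - s) sums (1 / zeta s ^ 2))"
 have "m (Suc n) - of_real (moebius2 (Suc n)) = 0" for n
 proof (rule dirichlet_series_unique)
  fix s :: complex assume s: "Re s > 1"
  have "(%n. m (Suc n) * of_nat (Suc n) powr - s - complex_of_real (moebius2 (Suc n)) * of_nat (Suc n) powr - s) sums (1 / zeta s ^ 2 - 1 / zeta s ^ 2)"
   using m dser_sums[OF dabs_moebius2[OF s]] dser_moebius2[OF s] s by (intro sums_diff) (auto simp: dterm_def)
  then show "(%n. (m (Suc n) - complex_of_real (moebius2 (Suc n))) * of_nat (Suc n) powr - s) sums 0"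
   by (simp add: left_diff_distrib)
 qed
 then show "m = (%n. of_real (moebius2 n))"
  using m by (intro ext) (metis eq_iff_diff_eq_0 moebius2_def dconv_0 not0_implies_Suc of_real_0)
qed

section \<open>Nonvanishing of zeta on the line Re s = 1\<close>

lemma ln_bound_powr: "0 < ep ==> n > 0 ==> \<bar>ln (real n)\<bar> <= (1 / ep) * real n powr ep"
 using ln_powr_bound[of "real n" ep] by simp

lemma dabs_ln: "Re s > 1 ==> dabs (%n. ln (real n)) s"
proof -
 assume s: "Re s > 1"
 define ep where "ep = (Re s - 1) / 2"
 have "ep > 0" "Re s > 1 + ep" using s by (simp_all add: ep_def field_simps)
 then show ?thesis by (intro dabs_of_bound[of _ "1 / ep" ep] ln_bound_powr)
qed

lemma dabs_mangoldt: "Re s > 1 ==> dabs mangoldt s"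
proof -
 assume s: "Re s > 1"
 define ep where "ep = (Re s - 1) / 2"
 have e: "ep > 0" "Re s > 1 + ep" using s by (simp_all add: ep_def field_simps)
 show ?thesis
 proof (rule dabs_of_bound[of _ "1 / ep" ep])
  fix n :: nat assume n: "n > 0"
  have "\<bar>mangoldt n :: real\<bar> <= \<bar>ln (real n)\<bar>" using mangoldt_le[OF n] mangoldt_nonneg[of n] by simp
  also have "... <= 1 / ep * real n powr ep" by (rule ln_bound_powr[OF e(1) n])
  finally show "\<bar>mangoldt n :: real\<bar> <= 1 / ep * real n powr ep" .
 qed (rule e)
qed

lemma zeta_differentiable: "s ~= 1 ==> zeta field_differentiable (at s)"
proof -
 assume s: "s ~= 1"
 have "(%s. entz s / (s - 1)) holomorphic_on - {1}" by (intro holomorphic_intros entz_holo) auto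
 then have "zeta holomorphic_on - {1}" by (simp add: zeta_eq[abs_def])
 then show ?thesis using s by (auto intro!: holomorphic_on_imp_differentiable_at[of _ "- {1}"])
qed

lemma zeta_has_derivative:
 assumes s: "Re s > 1"
 shows "(zeta has_field_derivative - dser (%n. ln (real n)) s) (at s)"
proof -
 define S where "S = {s. Re s > 1}"
 define f where "f n s = (of_nat (Suc n) powr (-s) :: complex)" for n s
 define f' where "f' n s = - (of_real (ln (real (Suc n))) * of_nat (Suc n) powr (-s) :: complex)" for n s
 have "\<exists>g g'. \<forall>x \<in> S. ((%n. f n x) sums g x) \<and> ((%n. f' n x) sums g' x) \<and> (g has_field_derivative g' x) (at x)"
 proof (rule series_and_derivative_comparison_complex)
  show "open S" unfolding S_def by (rule open_halfspace_Re_gt)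
  show "(f n has_field_derivative f' n x) (at x)" for n x
  proof -
   have "f n = (%s. exp (- s * of_real (ln (real (Suc n)))))"
    by (simp add: f_def powr_def fun_eq_iff Ln_of_nat del: of_nat_Suc)
   moreover have "f' n x = - (of_real (ln (real (Suc n))) * exp (- x * of_real (ln (real (Suc n)))))"
    by (simp add: f'_def powr_def Ln_of_nat del: of_nat_Suc)
   ultimately show ?thesis by (auto intro!: derivative_eq_intros)
  qed
  fix x assume x: "x \<in> S"
  define d where "d = (Re x - 1) / 2"
  have d: "d > 0" using x by (simp add: d_def S_def)
  show "\<exists>d h. 0 < d \<and> summable h \<and> range h \<subseteq> \<real>\<^sub>\<ge>\<^sub>0 \<and> (\<forall>\<^sub>F n in sequentially. \<forall>y\<in>ball x d \<inter> S. cmod(f n y) <= cmod (h n))"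
  proof (intro exI conjI)
   show "0 < d" by (rule d)
   have "summable (%n. real (Suc n) powr - (1 + d))" by (rule summable_powr_neg) (use d in simp)
   then show "summable (%n. complex_of_real (real (Suc n) powr - (1 + d)))" by (rule summable_of_real)
   show "range (%n. complex_of_real (real (Suc n) powr - (1 + d))) \<subseteq> \<real>\<^sub>\<ge>\<^sub>0" by auto
   show "\<forall>\<^sub>F n in sequentially. \<forall>y\<in>ball x d \<inter> S. cmod (f n y) <= cmod (complex_of_real (real (Suc n) powr - (1 + d)))"
   proof (intro always_eventually allI ballI)
    fix n y assume y: "y \<in> ball x d \<inter> S"
    have "\<bar>Re x - Re y\<bar> < d" using y abs_Re_le_cmod[of "x - y"] by (simp add: dist_norm)
    moreover have "Re x = 1 + 2 * d" by (simp add: d_def field_simps)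
    ultimately have "Re y >= 1 + d" by linarith
    then have "real (Suc n) powr - Re y <= real (Suc n) powr - (1 + d)" by (intro powr_mono) auto
    then show "cmod (f n y) <= cmod (complex_of_real (real (Suc n) powr - (1 + d)))"
     unfolding f_def norm_nat_powr[OF zero_less_Suc] by simp
   qed
  qed
 qed
 then obtain g g' where g: "!!x. x \<in> S ==> (%n. f n x) sums g x" "!!x. x \<in> S ==> (%n. f' n x) sums g' x"
  "!!x. x \<in> S ==> (g has_field_derivative g' x) (at x)" by blast
 have gz: "g x = zeta x" if "x \<in> S" for x
  using g(1)[OF that] that by (simp add: S_def zeta_eq_dz dz_def f_def sums_iff)
 have "g' s = - dser (%n. ln (real n)) s"
 proof -
  have "(%n. dterm (%n. ln (real n)) s (Suc n)) sums dser (%n. ln (real n)) s" by (rule dser_sums[OF dabs_ln[OF s]])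
  from sums_minus[OF this] have "(%n. f' n s) sums (- dser (%n. ln (real n)) s)"
   by (simp add: f'_def dterm_def del: of_nat_Suc)
  then show ?thesis using g(2)[of s] s by (auto simp: S_def dest: sums_unique2)
 qed
 moreover have "(zeta has_field_derivative g' s) (at s)"
  by (rule has_field_derivative_transform_within_open[OF g(3), of s S])
   (use s gz in \<open>auto simp: S_def open_halfspace_Re_gt\<close>)
 ultimately show ?thesis by simp
qed

lemma dser_ln_eq: "Re s > 1 ==> dser (%n. ln (real n)) s = dser mangoldt s * zeta s"
proof -
 assume s: "Re s > 1"
 have "dser mangoldt s * zeta s = dser (dconv mangoldt (%_. 1)) s"
  using dser_dconv(2)[OF dabs_mangoldt[OF s] dabs_one[OF s]] by (simp add: dser_one s)
 also have "... = dser (%n. ln (real n)) s"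
  unfolding dser_def by (intro infsum_cong) (simp add: dterm_def dconv_one mangoldt_sum)
 finally show ?thesis by simp
qed

lemma zeta_log_derivative:
 "Re s > 1 ==> (zeta has_field_derivative zeta s * (- dser mangoldt s)) (at s)"
 using zeta_has_derivative[of s] by (simp add: dser_ln_eq mult.commute)

text \<open>Termwise from 3 + 4 cos x + cos 2x = 2 (1 + cos x)^2 and the nonnegativity of
  \<open>mangoldt\<close>.\<close>

lemma mangoldt_341:
 assumes \<sigma>: "\<sigma> > 1"
 shows "0 <= Re (3 * dser mangoldt (of_real \<sigma>) + 4 * dser mangoldt (of_real \<sigma> + \<i> * of_real t) + dser mangoldt (of_real \<sigma> + 2 * \<i> * of_real t))"
proof -
 let ?s = "%k. of_real \<sigma> + of_real (k * t) * \<i>"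
 have S: "(%n. Re (dterm mangoldt (?s k) (Suc n))) sums Re (dser mangoldt (?s k))" for k
  by (intro sums_Re dser_sums dabs_mangoldt) (use \<sigma> in simp)
 have D: "Re (dterm mangoldt (?s k) n) = mangoldt n * real n powr -\<sigma> * cos (k * (t * ln (real n)))" if "n > 0" for k n
 proof -
  have "of_nat n powr (- ?s k) = exp (of_real (- (\<sigma> * ln (real n))) + \<i> * of_real (- (k * (t * ln (real n)))))"
   using that by (simp add: powr_def algebra_simps)
  then have "Re (of_nat n powr (- ?s k)) = real n powr -\<sigma> * cos (k * (t * ln (real n)))"
   using that by (simp add: Re_exp powr_def)
  moreover have "dterm mangoldt (?s k) n = of_real (mangoldt n) * of_nat n powr (- ?s k)" by (simp only: dterm_def)
  ultimately show ?thesis by (simp only: Re_complex_of_real Im_complex_of_real times_complex.sel mult_zero_left diff_zero mult.assoc)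
 qed
 have "0 <= 3 * Re (dser mangoldt (?s 0)) + 4 * Re (dser mangoldt (?s 1)) + Re (dser mangoldt (?s 2))"
 proof (rule sums_le[OF _ sums_zero])
  show "(%n. 3 * Re (dterm mangoldt (?s 0) (Suc n)) + 4 * Re (dterm mangoldt (?s 1) (Suc n)) + Re (dterm mangoldt (?s 2) (Suc n)))
   sums (3 * Re (dser mangoldt (?s 0)) + 4 * Re (dser mangoldt (?s 1)) + Re (dser mangoldt (?s 2)))"
   using sums_add[OF sums_add[OF sums_mult[OF S[of 0], of 3] sums_mult[OF S[of 1], of 4]] S[of 2]] .
  fix n
  define x where "x = t * ln (real (Suc n))"
  have "3 + 4 * cos x + cos (2 * x) = 2 * (1 + cos x)^2"
   using cos_double_cos[of x] by (simp add: power2_eq_square algebra_simps)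
  then have "0 <= 3 + 4 * cos x + cos (2 * x)" by simp
  then have "0 <= (mangoldt (Suc n) * real (Suc n) powr -\<sigma>) * (3 + 4 * cos x + cos (2 * x))"
   by (intro mult_nonneg_nonneg mangoldt_nonneg) auto
  then show "0 <= 3 * Re (dterm mangoldt (?s 0) (Suc n)) + 4 * Re (dterm mangoldt (?s 1) (Suc n)) + Re (dterm mangoldt (?s 2) (Suc n))"
   unfolding D[OF zero_less_Suc] x_def[symmetric] by (simp add: algebra_simps)
 qed
 then show ?thesis by (simp add: mult_ac)
qed

text \<open>Let P be the product of zeta^3 at \<sigma>, zeta^4 at \<sigma> + it and zeta at \<sigma>
  + 2it. By the preceding inequality the squared modulus h of P has nonpositive derivative for
  \<sigma> > 1, so it stays above its positive value at 2. A zero at 1 + it would set a zero of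
  order four against a pole of order three and force P to 0.\<close>

theorem zeta_nonzero_Re_1:
 assumes t: "t ~= 0"
 shows "zeta (1 + \<i> * of_real t) ~= 0"
proof
 assume z0: "zeta (1 + \<i> * of_real t) = 0"
 define P where "P z = zeta z ^ 3 * zeta (z + \<i> * of_real t) ^ 4 * zeta (z + 2 * \<i> * of_real t)" for z
 define L where "L z = - (3 * dser mangoldt z + 4 * dser mangoldt (z + \<i> * of_real t) + dser mangoldt (z + 2 * \<i> * of_real t))" for z
 have dP: "(P has_field_derivative P z * L z) (at z)" if z: "Re z > 1" for z
 proof -
  have 1: "((%z. zeta (z + w)) has_field_derivative zeta (z + w) * (- dser mangoldt (z + w))) (at z)" if "Re w = 0" for w
  proof -
   have "(zeta has_field_derivative zeta (z + w) * (- dser mangoldt (z + w))) (at (z + w))"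
    by (rule zeta_log_derivative) (use z that in simp)
   then show ?thesis by (simp only: DERIV_shift)
  qed
  have 0: "(zeta has_field_derivative zeta z * (- dser mangoldt z)) (at z)" by (rule zeta_log_derivative[OF z])
  show ?thesis unfolding P_def[abs_def]
   by (rule derivative_eq_intros 0 1 refl | simp)+
    (simp add: L_def P_def power4_eq_xxxx power3_eq_cube power2_eq_square algebra_simps)
 qed
 define h where "h \<sigma> = (Re (P (of_real \<sigma>)))^2 + (Im (P (of_real \<sigma>)))^2" for \<sigma>
 have dh: "DERIV h \<sigma> :> 2 * h \<sigma> * Re (L (of_real \<sigma>))" if \<sigma>: "\<sigma> > 1" for \<sigma>
 proof -
  have "((%x. P (of_real x)) has_vector_derivative P (of_real \<sigma>) * L (of_real \<sigma>)) (at \<sigma>)"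
   using has_vector_derivative_real_field[OF dP[of "of_real \<sigma>"]] \<sigma> by simp
  then have r: "((%x. Re (P (of_real x))) has_real_derivative Re (P (of_real \<sigma>) * L (of_real \<sigma>))) (at \<sigma>)"
   and i: "((%x. Im (P (of_real x))) has_real_derivative Im (P (of_real \<sigma>) * L (of_real \<sigma>))) (at \<sigma>)"
   by (auto simp: has_vector_derivative_complex_iff)
  from DERIV_add[OF DERIV_power[OF r, of 2] DERIV_power[OF i, of 2]]
  show ?thesis unfolding h_def[abs_def]
   by (rule DERIV_cong) (simp add: power2_eq_square algebra_simps)
 qed
 have mono: "h 2 <= h \<sigma>" if \<sigma>: "1 < \<sigma>" "\<sigma> <= 2" for \<sigma>
 proof (rule DERIV_nonpos_imp_nonincreasing[OF \<sigma>(2)])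
  fix x assume x: "\<sigma> <= x" "x <= 2"
  have "Re (L (of_real x)) <= 0" using mangoldt_341[of x t] x \<sigma> by (simp add: L_def)
  moreover have "0 <= h x" by (simp add: h_def)
  ultimately have "2 * h x * Re (L (of_real x)) <= 0" by (simp add: mult_nonneg_nonpos)
  then show "\<exists>y. DERIV h x :> y \<and> y <= 0" using dh[of x] x \<sigma> by auto
 qed
 have "P 2 ~= 0" using zeta_nonzero_gt_1 by (simp add: P_def)
 then have h2: "h 2 > 0" by (simp add: h_def complex_eq_iff sum_power2_gt_zero_iff)
 define R where "R e = (zeta (1 + \<i> * of_real t + of_real e) - zeta (1 + \<i> * of_real t)) / of_real e" for e :: real
 have ne: "1 + \<i> * of_real t ~= 1" using t by simp
 obtain d where "(zeta has_field_derivative d) (at (1 + \<i> * of_real t))"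
  using zeta_differentiable[OF ne] unfolding field_differentiable_def by blast
 then have "((%h. (zeta (1 + \<i> * of_real t + h) - zeta (1 + \<i> * of_real t)) / h) \<longlongrightarrow> d) (at 0)"
  by (simp add: DERIV_def)
 moreover have "filterlim (%e::real. complex_of_real e) (at 0) (at_right 0)"
  by (auto simp: filterlim_at eventually_at_filter intro!: tendsto_eq_intros)
 ultimately have R: "(R \<longlongrightarrow> d) (at_right 0)" unfolding R_def by (rule filterlim_compose)
 have cont: "((%e. f (w + of_real e)) \<longlongrightarrow> f w) (at_right 0)" if "isCont f w" for f :: "complex => complex" and w
 proof (rule isCont_tendsto_compose[OF that])
  show "((%e. w + of_real e) \<longlongrightarrow> w) (at_right 0)" by (auto intro!: tendsto_eq_intros)
 qed
 have "isCont entz 1" by (meson entz_holo holomorphic_on_imp_continuous_on continuous_on_eq_continuous_at open_UNIV UNIV_I)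
 moreover have "isCont zeta (1 + 2 * \<i> * of_real t)"
 proof -
  have "1 + 2 * \<i> * of_real t ~= 1" using t by simp
  then show ?thesis using zeta_differentiable field_differentiable_imp_continuous_at by blast
 qed
 \<comment> \<open>P at 1 + e in product form: the cube of zeta contributes e^(-3) and a bounded
   factor, the fourth power contributes e^4 times a difference quotient, and one factor e is left
   over.\<close>
 ultimately have lim: "((%e. of_real e * (entz (1 + of_real e) ^ 3 * R e ^ 4 * zeta (1 + 2 * \<i> * of_real t + of_real e))) \<longlongrightarrow> 0 * (entz 1 ^ 3 * d ^ 4 * zeta (1 + 2 * \<i> * of_real t))) (at_right 0)"
  by (intro tendsto_intros cont R) (auto intro!: tendsto_eq_intros)
 have "((%e. P (1 + of_real e)) \<longlongrightarrow> 0) (at_right 0)"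
 proof (rule Lim_transform_eventually)
  show "((%e. of_real e * (entz (1 + of_real e) ^ 3 * R e ^ 4 * zeta (1 + 2 * \<i> * of_real t + of_real e))) \<longlongrightarrow> 0) (at_right 0)"
   using lim by simp
  have "of_real e * (entz (1 + of_real e) ^ 3 * R e ^ 4 * zeta (1 + 2 * \<i> * of_real t + of_real e)) = P (1 + of_real e)" if e: "e > 0" for e :: real
  proof -
   have e0: "complex_of_real e ~= 0" using e by simp
   have "entz (1 + of_real e) = of_real e * zeta (1 + of_real e)" using e by (simp add: zeta_eq)
   moreover have "zeta (1 + \<i> * of_real t + of_real e) = of_real e * R e" using e0 z0 by (simp add: R_def)
   moreover have "R e = zeta (1 + \<i> * of_real t + of_real e) / of_real e" using z0 by (simp add: R_def)
   moreover have "1 + of_real e + \<i> * of_real t = 1 + \<i> * of_real t + of_real e" "1 + of_real e + 2 * \<i> * of_real t = 1 + 2 * \<i> * of_real t + of_real e"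
    by simp_all
   ultimately show ?thesis unfolding P_def using e0
    by (simp only: power_mult_distrib power_divide) (simp add: power4_eq_xxxx power3_eq_cube)
  qed
  then show "\<forall>\<^sub>F e in at_right 0. of_real e * (entz (1 + of_real e) ^ 3 * R e ^ 4 * zeta (1 + 2 * \<i> * of_real t + of_real e)) = P (1 + of_real e)"
   by (auto simp: eventually_at_filter)
 qed
 then have "((%e. (Re (P (1 + of_real e)))^2 + (Im (P (1 + of_real e)))^2) \<longlongrightarrow> (Re 0)^2 + (Im 0)^2) (at_right 0)"
  by (intro tendsto_intros)
 then have "((%e. h (1 + e)) \<longlongrightarrow> 0) (at_right 0)" by (simp add: h_def)
 moreover have "\<forall>\<^sub>F e in at_right 0. h 2 <= h (1 + e)"
  unfolding eventually_at_right_field by (rule exI[of _ 1]) (auto intro!: mono)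
 ultimately have "h 2 <= 0" by (rule tendsto_lowerbound) simp
 then show False using h2 by simp
qed

section \<open>Growth of zeta and 1/zeta under the Riemann Hypothesis\<close>

lemma entz_1: "entz 1 = 1"
proof -
 have "zrem 1 n 1 = 0" for n
 proof -
  have "(of_nat (n + 2) :: complex) ~= 0" "(of_nat (n + 1) :: complex) ~= 0" by (simp_all only: of_nat_eq_0_iff)
  then show ?thesis by (simp add: zrem_def del: of_nat_add of_nat_Suc)
 qed
 then show ?thesis using entz_formula[of 1] by simp
qed

lemma entz_nonzero:
 assumes RH: riemann_hypothesis and s: "Re s > 1/2"
 shows "entz s ~= 0"
proof (cases "s = 1")
 case True
 then show ?thesis by (simp add: entz_1)
next
 case False
 have "zeta s ~= 0"
 proof (cases "Re s" "1::real" rule: linorder_cases)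
  case less
  then show ?thesis using RH s unfolding riemann_hypothesis_def by (auto dest!: spec[of _ s])
 next
  case equal
  then have "s = 1 + \<i> * of_real (Im s)" by (simp add: complex_eq_iff)
  moreover from this False have "Im s ~= 0" by auto
  ultimately show ?thesis using zeta_nonzero_Re_1[of "Im s"] by simp
 next
  case greater
  then show ?thesis by (rule zeta_nonzero_gt_1)
 qed
 then show ?thesis using False by (auto simp: zeta_eq)
qed

text \<open>Since Re g < A, the function g/(2A - g) maps the unit disc into itself and vanishes at
  0; the Schwarz lemma bounds it, and solving for g gives the claim.\<close>

lemma borel_caratheodory:
 assumes f: "f holomorphic_on ball z0 R" and R: "0 < R" and f0: "f z0 = 0"
  and A: "!!z. z \<in> ball z0 R ==> Re (f z) < A"
  and z: "dist z0 z <= r" "r < R"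
 shows "cmod (f z) <= 2 * A * r / (R - r)"
proof -
 define g where "g w = f (z0 + of_real R * w)" for w
 define \<phi> where "\<phi> w = g w / (2 * of_real A - g w)" for w
 have inb: "z0 + of_real R * w \<in> ball z0 R" if "cmod w < 1" for w
  using that R by (simp add: dist_norm norm_mult)
 have A0: "0 < A" using A[of z0] R by (simp add: f0)
 have reg: "Re (g w) < A" if "cmod w < 1" for w using A[OF inb[OF that]] by (simp add: g_def)
 have g: "g holomorphic_on ball 0 1"
 proof -
  have "(f \<circ> (%w. z0 + of_real R * w)) holomorphic_on ball 0 1"
   by (rule holomorphic_on_compose_gen[OF _ f]) (use inb in \<open>auto intro!: holomorphic_intros\<close>)
  then show ?thesis by (simp add: g_def[abs_def] o_def)
 qed
 have nz: "2 * of_real A - g w ~= 0" if "cmod w < 1" for w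
 proof
  assume "2 * of_real A - g w = 0"
  then have "Re (g w) = 2 * A" by (simp add: complex_eq_iff)
  then show False using reg[OF that] A0 by simp
 qed
 have less: "cmod (g w) < cmod (2 * of_real A - g w)" if "cmod w < 1" for w
 proof -
  have "(Re (g w))^2 < (2 * A - Re (g w))^2"
  proof -
   have "(2 * A - Re (g w))^2 - (Re (g w))^2 = 4 * A * (A - Re (g w))" by (simp add: power2_eq_square algebra_simps)
   moreover have "0 < 4 * A * (A - Re (g w))" using A0 reg[OF that] by simp
   ultimately show ?thesis by linarith
  qed
  then have "(cmod (g w))^2 < (cmod (2 * of_real A - g w))^2" by (simp add: cmod_power2)
  then show ?thesis by (rule power2_less_imp_less) simp
 qed
 define w where "w = (z - z0) / of_real R"
 have w: "cmod w <= r / R" "cmod w < 1"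
  using z R by (auto simp: w_def norm_divide dist_norm norm_minus_commute field_simps)
 have "cmod (\<phi> w) <= cmod w"
 proof (rule Schwarz_Lemma(1))
  show "\<phi> holomorphic_on ball 0 1" unfolding \<phi>_def[abs_def] by (intro holomorphic_intros g) (use nz in auto)
  show "\<phi> 0 = 0" by (simp add: \<phi>_def g_def f0)
  show "cmod (\<phi> u) < 1" if "cmod u < 1" for u
   using less[OF that] nz[OF that] by (simp add: \<phi>_def norm_divide)
  show "cmod w < 1" by (rule w)
 qed
 then have "cmod (g w) <= cmod w * cmod (2 * of_real A - g w)"
  using nz[OF w(2)] by (simp add: \<phi>_def norm_divide divide_le_eq)
 also have "... <= (r / R) * (2 * A + cmod (g w))"
 proof (intro mult_mono w)
  have "cmod (2 * of_real A - g w) <= cmod (2 * of_real A) + cmod (g w)" by (rule norm_triangle_ineq4)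
  then show "cmod (2 * of_real A - g w) <= 2 * A + cmod (g w)" using A0 by (simp add: norm_mult)
  show "0 <= r / R" using order_trans[OF norm_ge_zero w(1)] .
 qed simp
 finally have "cmod (g w) * R <= r * (2 * A + cmod (g w))" using R by (simp add: field_simps)
 then have "cmod (g w) * (R - r) <= 2 * A * r" by (simp add: algebra_simps)
 then have "cmod (g w) <= 2 * A * r / (R - r)" using z by (simp add: field_simps)
 moreover have "g w = f z" using R by (simp add: g_def w_def)
 ultimately show ?thesis by simp
qed

text \<open>
 A substitute for the three circles theorem: the low Taylor coefficients are estimated on the small
 circle and the high ones on the large circle.
\<close>

lemma taylor_two_circles:
 assumes f: "f holomorphic_on ball c R" and r: "0 < r1" "r1 < r2" "r2 < r3" "r3 < R"
  and M1: "!!z. dist c z = r1 ==> cmod (f z) <= M1" and M3: "!!z. dist c z = r3 ==> cmod (f z) <= M3"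
  and z: "dist c z <= r2"
 shows "cmod (f z) <= M1 * (\<Sum>n<N. (r2 / r1) ^ n) + M3 * ((r2 / r3) ^ N / (1 - r2 / r3))"
proof -
 define a where "a n = (deriv ^^ n) f c / fact n" for n
 define q where "q = r2 / r3"
 have q: "0 < q" "q < 1" using r by (auto simp: q_def)
 have ab: "cmod (a n) <= M / r ^ n" if "0 < r" "r < R" "!!z. dist c z = r ==> cmod (f z) <= M" for r M n
 proof -
  have "cmod ((deriv ^^ n) f c) <= fact n * M / r ^ n"
  proof (rule Cauchy_inequality)
   show "f holomorphic_on ball c r" using that by (intro holomorphic_on_subset[OF f]) auto
   show "continuous_on (cball c r) f"
    using that by (intro holomorphic_on_imp_continuous_on holomorphic_on_subset[OF f]) auto
  qed (use that in \<open>auto simp: dist_norm\<close>)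
  then show ?thesis by (simp add: a_def norm_divide field_simps)
 qed
 have M30: "0 <= M3"
 proof -
  have "dist c (c + of_real r3) = r3" using r by (simp add: dist_norm)
  from order_trans[OF norm_ge_zero M3[OF this]] show ?thesis .
 qed
 have S: "(%n. a n * (z - c) ^ n) sums f z"
  unfolding a_def by (rule holomorphic_power_series[OF f]) (use z r in auto)
 have zc: "cmod (z - c) <= r2" using z by (simp add: dist_norm norm_minus_commute)
 have t1: "cmod (a n * (z - c) ^ n) <= M1 * (r2 / r1) ^ n" for n
 proof -
  have "cmod (a n) * cmod (z - c) ^ n <= (M1 / r1 ^ n) * r2 ^ n"
   using zc r by (intro mult_mono ab M1 power_mono order_trans[OF norm_ge_zero ab]) auto
  then show ?thesis by (simp add: norm_mult norm_power power_divide)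
 qed
 have t3: "cmod (a n * (z - c) ^ n) <= M3 * q ^ n" for n
 proof -
  have "cmod (a n) * cmod (z - c) ^ n <= (M3 / r3 ^ n) * r2 ^ n"
   using zc r M30 by (intro mult_mono ab M3 power_mono) auto
  then show ?thesis by (simp add: norm_mult norm_power power_divide q_def)
 qed
 have "f z = (\<Sum>n. a (n + N) * (z - c) ^ (n + N)) + (\<Sum>n<N. a n * (z - c) ^ n)"
  using suminf_split_initial_segment[OF sums_summable[OF S], of N] S by (simp add: sums_iff)
 also have "cmod ... <= cmod (\<Sum>n. a (n + N) * (z - c) ^ (n + N)) + cmod (\<Sum>n<N. a n * (z - c) ^ n)"
  by (rule norm_triangle_ineq)
 also have "cmod (\<Sum>n. a (n + N) * (z - c) ^ (n + N)) <= (\<Sum>n. M3 * q ^ N * q ^ n)"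
 proof (rule norm_suminf_le)
  show "cmod (a (n + N) * (z - c) ^ (n + N)) <= M3 * q ^ N * q ^ n" for n
   using t3[of "n + N"] by (simp add: power_add mult_ac)
  show "summable (%n. M3 * q ^ N * q ^ n)" using q by (intro summable_mult) (simp add: summable_geometric_iff)
 qed
 also have "... = M3 * q ^ N * (1 / (1 - q))"
  using q by (subst suminf_mult) (auto simp: summable_geometric_iff suminf_geometric)
 also have "cmod (\<Sum>n<N. a n * (z - c) ^ n) <= (\<Sum>n<N. M1 * (r2 / r1) ^ n)" by (rule sum_norm_le[OF t1])
 finally show ?thesis by (simp add: sum_distrib_left q_def add.commute)
qed

lemma zeta_bounded_gt_1:
 assumes "\<sigma> > 1"
 obtains Z where "Z >= 1" "!!s. Re s >= \<sigma> ==> cmod (zeta s) <= Z" "!!s. Re s >= \<sigma> ==> cmod (1 / zeta s) <= Z"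
proof -
 define Z where "Z = (\<Sum>n. real (Suc n) powr -\<sigma>)"
 have sm: "summable (%n. real (Suc n) powr -\<sigma>)" by (rule summable_powr_neg[OF assms])
 have b: "cmod (dser f s) <= Z" if f: "!!n. \<bar>f n\<bar> <= 1" and d: "dabs f s" and s: "Re s >= \<sigma>" for f s
 proof -
  have "cmod (\<Sum>n. dterm f s (Suc n)) <= Z"
   unfolding Z_def
  proof (rule norm_suminf_le[OF _ sm])
   fix n
   have "\<bar>f (Suc n)\<bar> * real (Suc n) powr - Re s <= 1 * real (Suc n) powr -\<sigma>"
    using s by (intro mult_mono f powr_mono) auto
   then show "cmod (dterm f s (Suc n)) <= real (Suc n) powr -\<sigma>" unfolding norm_dterm[OF zero_less_Suc] by simp
  qed
  then show ?thesis using dser_sums[OF d] by (simp add: sums_iff)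
 qed
 have Z1: "Z >= 1"
  using sum_le_suminf[OF sm, of "{0}"] by (simp add: Z_def)
 show ?thesis
 proof (rule that[OF Z1])
  fix s assume s: "Re s >= \<sigma>"
  then have s1: "Re s > 1" using assms by linarith
  show "cmod (zeta s) <= Z" using b[of "%_. 1" s] dabs_one[OF s1] s by (simp add: dser_one s1)
  have "1 / zeta s = dser moebius s" using dser_moebius_zeta[OF s1] zeta_nonzero_gt_1[OF s1] by (simp add: field_simps)
  then show "cmod (1 / zeta s) <= Z" using b[of moebius s] dabs_moebius[OF s1] s abs_moebius_le by simp
 qed
qed

text \<open>Let L be the logarithm of \<open>entz\<close>, normalised to vanish at c = 2 + it. On
  the circle of radius \<open>r3\<close> it is O(log T) by polynomial growth and the
  Borel-Caratheodory bound. On the circle of radius 1/2 it is bounded independently of t, because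
  zeta and 1/zeta are bounded there. The interpolation then leaves |L| <= K + ep log T in between,
  and a bound for |Re L| controls \<open>entz\<close> from both sides at once. The factor 1 + it is
  c - 1, that is, \<open>entz c\<close> without zeta.\<close>

theorem rh_log_bound:
 assumes RH: riemann_hypothesis and d: "0 < dl" "dl < 1" and e: "0 < ep"
 obtains C where "C >= 1" "!!s. 1/2 + dl <= Re s ==> Re s <= 2 ==>
  cmod (entz s) <= C * (5 + \<bar>Im s\<bar>) powr ep * cmod (1 + \<i> * of_real (Im s)) \<and>
  cmod (1 + \<i> * of_real (Im s)) <= C * (5 + \<bar>Im s\<bar>) powr ep * cmod (entz s)"
proof -
 obtain Z where Z: "Z >= 1" "!!s. Re s >= 5/4 ==> cmod (zeta s) <= Z" "!!s. Re s >= 5/4 ==> cmod (1 / zeta s) <= Z"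
  using zeta_bounded_gt_1[of "5/4"] by auto
 obtain Cg where Cg: "Cg > 0" "!!s. Re s >= 1/2 ==> cmod (entz s) <= Cg * (1 + cmod s)^2"
  using entz_growth by blast
 define U where "U = {s. Re s > 1/2}"
 obtain g where g: "g holomorphic_on U" "!!s. s \<in> U ==> exp (g s) = entz s"
 proof (rule holomorphic_logarithm_exists[of U entz 2])
  show "convex U" unfolding U_def by (rule convex_halfspace_Re_gt)
  show "open U" unfolding U_def by (rule open_halfspace_Re_gt)
 qed (use entz_nonzero[OF RH] in \<open>auto simp: U_def entz_holo\<close>)
 \<comment> \<open>From the centre 2 + it the line Re s = 1/2 + dl is at distance \<open>r2\<close>;
   \<open>r3\<close> is midway between this radius and the critical line.\<close>
 define r2 r3 where "r2 = 3/2 - dl" and "r3 = 3/2 - dl/2"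
 have r: "1/2 < r2" "r2 < r3" "r3 < 3/2" using d by (auto simp: r2_def r3_def)
 define q where "q = r2 / r3"
 have q: "0 < q" "q < 1" using r by (auto simp: q_def)
 define B where "B = 6 / dl * 2 / (1 - q)"
 have B: "B > 0" using d q by (simp add: B_def)
 \<comment> \<open>The number of low coefficients is fixed here, before t: it makes the geometric
   tail, multiplied by the O(log T) bound, at most ep log T. The low coefficients then contribute a
   constant.\<close>
 obtain N where N: "q ^ N < ep / B"
  using real_arch_pow_inv[of "ep / B" q] q e B by auto
 define A0 where "A0 = \<bar>ln (Cg * Z)\<bar> + 1"
 define A1 where "A1 = ln (2 * Z * Z) + 1"
 define S where "S = (\<Sum>n<N. (r2 / (1/2)) ^ n)"
 define K where "K = 4 * A1 * S + 6 / dl * A0 * (q ^ N / (1 - q))"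
 define C where "C = exp \<bar>K\<bar> * Z"
 have C: "C >= 1" using Z mult_mono[of 1 "exp \<bar>K\<bar>" 1 Z] by (simp add: C_def)
 show ?thesis
 proof (rule that[OF C])
  fix s assume s: "1/2 + dl <= Re s" "Re s <= 2"
  define t where "t = Im s"
  define c where "c = Complex 2 t"
  define E where "E = cmod (1 + \<i> * of_real t)"
  have cU: "c \<in> U" by (simp add: c_def U_def)
  have Re_ball: "2 - \<rho> <= Re z" "\<bar>Im z - t\<bar> <= \<rho>" if "dist c z <= \<rho>" for z \<rho>
  proof -
   have "\<bar>Re (c - z)\<bar> <= \<rho>" "\<bar>Im (c - z)\<bar> <= \<rho>"
    using that abs_Re_le_cmod[of "c - z"] abs_Im_le_cmod[of "c - z"] by (auto simp: dist_norm)
   then show "2 - \<rho> <= Re z" "\<bar>Im z - t\<bar> <= \<rho>" by (auto simp: c_def)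
  qed
  have ballU: "ball c (3/2) \<subseteq> U"
  proof
   fix z assume z: "z \<in> ball c (3/2)"
   then show "z \<in> U" using Re_ball(1)[of z "dist c z"] by (simp add: U_def)
  qed
  have E1: "1 <= E" using abs_Re_le_cmod[of "1 + \<i> * of_real t"] by (simp add: E_def)
  have c1: "c - 1 = 1 + \<i> * of_real t" by (simp add: c_def complex_eq_iff)
  have ec: "entz c = (1 + \<i> * of_real t) * zeta c"
  proof -
   have "c ~= 1" by (auto simp: c_def complex_eq_iff)
   then show ?thesis using c1 by (simp add: zeta_eq field_simps)
  qed
  have zc: "zeta c ~= 0" by (rule zeta_nonzero_gt_1) (simp add: c_def)
  have nc: "cmod (entz c) <= E * Z" "E <= Z * cmod (entz c)"
  proof -
   have "cmod (zeta c) <= Z" "cmod (1 / zeta c) <= Z" using Z by (auto simp: c_def)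
   then have h: "cmod (zeta c) <= Z" "1 <= Z * cmod (zeta c)" using zc by (auto simp: norm_divide field_simps)
   show "cmod (entz c) <= E * Z" using h(1) E1 by (simp add: ec norm_mult E_def[symmetric] mult_left_mono)
   have "E * 1 <= E * (Z * cmod (zeta c))" using h(2) E1 by (intro mult_left_mono) auto
   then show "E <= Z * cmod (entz c)" by (simp add: ec norm_mult E_def[symmetric] mult_ac)
  qed
  have ec0: "0 < cmod (entz c)" using zc E1 by (auto simp: ec E_def)
  define L where "L z = g z - g c" for z
  have L: "L holomorphic_on ball c (3/2)"
   unfolding L_def[abs_def] by (intro holomorphic_intros holomorphic_on_subset[OF g(1) ballU])
  have eL: "cmod (entz z) = cmod (entz c) * exp (Re (L z))" if "z \<in> U" for z
  proof -
   have "entz z = entz c * exp (L z)" using g(2)[OF that] g(2)[OF cU] ec0 by (simp add: L_def exp_diff)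
   then show ?thesis by (simp only: norm_mult norm_exp_eq_Re)
  qed
  have ReL: "Re (L z) = ln (cmod (entz z) / cmod (entz c))" if "z \<in> U" for z
   using eL[OF that] ec0 by simp
  define T where "T = 5 + \<bar>t\<bar>"
  have T: "T >= 5" by (simp add: T_def)
  \<comment> \<open>The term 2 ln T reflects the quadratic growth of \<open>entz\<close>.\<close>
  define At where "At = A0 + 2 * ln T"
  have big: "Re (L z) < At" if z: "z \<in> ball c (3/2)" for z
  proof -
   have zU: "z \<in> U" using z ballU by auto
   have zz: "1/2 <= Re z" "Re z <= 7/2" "\<bar>Im z\<bar> <= \<bar>t\<bar> + 3/2"
   proof -
    have "\<bar>Re (c - z)\<bar> < 3/2" using z abs_Re_le_cmod[of "c - z"] by (simp add: dist_norm)
    then have "\<bar>2 - Re z\<bar> < 3/2" by (simp add: c_def)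
    then show "1/2 <= Re z" "Re z <= 7/2" by linarith+
    have "\<bar>Im z - t\<bar> <= 3/2" using Re_ball(2)[of z "3/2"] z by simp
    then show "\<bar>Im z\<bar> <= \<bar>t\<bar> + 3/2" by linarith
   qed
   have "cmod z <= cmod c + 3/2"
    using z norm_triangle_ineq2[of z c] by (simp add: dist_norm norm_minus_commute)
   also have "cmod c <= 2 + \<bar>t\<bar>" using cmod_le[of c] by (simp add: c_def)
   finally have "1 + cmod z <= T" by (simp add: T_def)
   then have "(1 + cmod z)^2 <= T^2" by (intro power_mono) auto
   then have "cmod (entz z) <= Cg * T^2" using Cg(2)[OF zz(1)] Cg(1) by (meson mult_left_mono order_trans less_imp_le)
   have "1 <= Z * cmod (entz c)" using nc(2) E1 by linarith
   then have "0 <= Cg * T^2 * (Z * cmod (entz c) - 1)" using Cg(1) by (intro mult_nonneg_nonneg) auto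
   then have "Cg * T^2 <= Cg * T^2 * (Z * cmod (entz c))" by (simp add: right_diff_distrib)
   with \<open>cmod (entz z) <= Cg * T^2\<close> have "cmod (entz z) <= Cg * T^2 * (Z * cmod (entz c))" by (rule order_trans)
   then have "cmod (entz z) / cmod (entz c) <= Cg * T^2 * Z"
    using ec0 by (simp add: divide_le_eq mult.assoc)
   moreover have "0 < cmod (entz z) / cmod (entz c)" using ec0 eL[OF zU] by simp
   ultimately have "Re (L z) <= ln (Cg * Z * T^2)"
    unfolding ReL[OF zU] by (subst ln_le_cancel_iff) (auto simp: mult_ac)
   also have "... = ln (Cg * Z) + 2 * ln T" using Cg Z T by (simp add: ln_mult ln_realpow)
   also have "... < At" by (simp add: At_def A0_def)
   finally show ?thesis .
  qed
  have small: "Re (L z) < A1" if z: "z \<in> ball c (3/4)" for z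
  proof -
   have zU: "z \<in> U" using z ballU by auto
   have zr: "Re z >= 5/4" using Re_ball(1)[of z "3/4"] z by auto
   then have "z ~= 1" by auto
   then have "entz z = (z - 1) * zeta z" by (simp add: zeta_eq)
   then have "cmod (entz z) <= cmod (z - 1) * Z" using Z(2)[OF zr] by (simp add: norm_mult mult_left_mono)
   also have "cmod (z - 1) <= 2 * E"
   proof -
    have "cmod (z - 1) <= cmod (z - c) + cmod (c - 1)" using norm_triangle_ineq[of "z - c" "c - 1"] by simp
    moreover have "cmod (z - c) <= 1" using z by (simp add: dist_norm norm_minus_commute)
    ultimately show ?thesis using E1 by (simp add: c1 E_def)
   qed
   finally have "cmod (entz z) <= 2 * E * Z" using Z by (simp add: mult_right_mono)
   also have "... <= 2 * (Z * cmod (entz c)) * Z" using nc(2) Z by (intro mult_right_mono mult_left_mono) auto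
   finally have "cmod (entz z) / cmod (entz c) <= 2 * Z * Z" using ec0 by (simp add: field_simps)
   moreover have "0 < cmod (entz z) / cmod (entz c)" using ec0 eL[OF zU] by simp
   ultimately have "Re (L z) <= ln (2 * Z * Z)" unfolding ReL[OF zU] by (subst ln_le_cancel_iff) auto
   then show ?thesis by (simp add: A1_def)
  qed
  have Lc: "L c = 0" by (simp add: L_def)
  have M3: "cmod (L z) <= 6 / dl * At" if "dist c z = r3" for z
  proof -
   have "cmod (L z) <= 2 * At * r3 / (3/2 - r3)"
    by (rule borel_caratheodory[OF L _ Lc big]) (use that r in auto)
   also have "... = 4 * At * r3 / dl" using d by (simp add: r3_def)
   also have "... <= 4 * At * (3/2) / dl"
   proof -
    have "0 <= At" using big[of c] Lc by simp
    then show ?thesis using r d by (intro divide_right_mono mult_left_mono) auto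
   qed
   finally show ?thesis by simp
  qed
  have M1: "cmod (L z) <= 4 * A1" if "dist c z = 1/2" for z
  proof -
   have "L holomorphic_on ball c (3/4)" by (rule holomorphic_on_subset[OF L]) auto
   then have "cmod (L z) <= 2 * A1 * (1/2) / (3/4 - 1/2)"
    
    using borel_caratheodory[of L c "3/4" A1 z "1/2"] Lc small that by auto
   then show ?thesis by simp
  qed
  have "dist c s <= r2"
  proof -
   have "c - s = of_real (2 - Re s)" by (simp add: c_def t_def complex_eq_iff)
   then have "dist c s = \<bar>2 - Re s\<bar>" by (simp only: dist_norm norm_of_real)
   then show ?thesis using s by (simp add: r2_def)
  qed
  then have "cmod (L s) <= 4 * A1 * (\<Sum>n<N. (r2 / (1/2)) ^ n) + 6 / dl * At * ((r2 / r3) ^ N / (1 - r2 / r3))"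
   by (intro taylor_two_circles[OF L _ _ _ _ M1 M3]) (use r in auto)
  also have "... = K + (6 / dl * 2 * ln T) * (q ^ N / (1 - q))"
   by (simp add: K_def S_def q_def At_def distrib_left distrib_right add_divide_distrib)
  also have "(6 / dl * 2 * ln T) * (q ^ N / (1 - q)) = ln T * (B * q ^ N)"
   by (simp add: B_def)
  also have "... <= ln T * ep"
  proof (rule mult_left_mono)
   show "B * q ^ N <= ep" using N B by (simp add: field_simps)
  qed (use T in simp)
  finally have Ls: "cmod (L s) <= K + ep * ln T" by (simp add: mult.commute)
  then have "\<bar>Re (L s)\<bar> <= \<bar>K\<bar> + ep * ln T" using abs_Re_le_cmod[of "L s"] by linarith
  then have ex: "exp (Re (L s)) <= exp \<bar>K\<bar> * T powr ep" "exp (- Re (L s)) <= exp \<bar>K\<bar> * T powr ep"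
   using T by (auto simp: powr_def mult_exp_exp abs_le_iff)
  have sU: "s \<in> U" using s d by (simp add: U_def)
  have "cmod (entz s) <= (E * Z) * (exp \<bar>K\<bar> * T powr ep)"
   unfolding eL[OF sU] using nc(1) ex(1) E1 Z by (intro mult_mono) auto
  moreover have "E <= C * T powr ep * cmod (entz s)"
  proof -
   have "cmod (entz c) = cmod (entz s) * exp (- Re (L s))" unfolding eL[OF sU] by (simp add: exp_minus)
   also have "... <= cmod (entz s) * (exp \<bar>K\<bar> * T powr ep)" using ex(2) by (intro mult_left_mono) auto
   finally have "Z * cmod (entz c) <= Z * (cmod (entz s) * (exp \<bar>K\<bar> * T powr ep))" using Z by (intro mult_left_mono) auto
   then show ?thesis using nc(2) by (simp add: C_def mult_ac)
  qed
  ultimately show "cmod (entz s) <= C * (5 + \<bar>Im s\<bar>) powr ep * cmod (1 + \<i> * of_real (Im s)) \<and>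
    cmod (1 + \<i> * of_real (Im s)) <= C * (5 + \<bar>Im s\<bar>) powr ep * cmod (entz s)"
   by (simp add: C_def E_def T_def t_def mult_ac)
 qed
qed

definition zi2 :: "complex => complex" where "zi2 s = 1 / zeta s ^ 2"

text \<open>At s = 1 the dummy value 0 of zeta makes \<open>zi2\<close> equal to 1/0 = 0, which is
  the correct value at the double zero of zeta^(-2). The formula is therefore valid everywhere and
  exhibits holomorphy at 1.\<close>

lemma zi2_eq: "zi2 s = ((s - 1) / entz s)^2"
 by (simp add: zi2_def zeta_eq power_divide)

lemma zi2_holo:
 assumes RH: riemann_hypothesis
 shows "zi2 holomorphic_on {s. Re s > 1/2}"
 unfolding zi2_eq[abs_def] using entz_nonzero[OF RH] by (intro holomorphic_intros entz_holo) auto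

lemma five_powr_le:
 assumes "0 < ep" shows "(5 + \<bar>t\<bar>) powr ep <= 5 powr ep * (1 + \<bar>t::real\<bar>) powr ep"
proof -
 have "(5 + \<bar>t\<bar>) powr ep <= (5 * (1 + \<bar>t\<bar>)) powr ep" using assms by (intro powr_mono2) auto
 also have "... = 5 powr ep * (1 + \<bar>t\<bar>) powr ep" by (rule powr_mult)
 finally show ?thesis .
qed

text \<open>The logarithmic bound is used for Re s <= 2 and boundedness beyond. At distance at least
  1/4 from the pole, 1 + |t| is at most 5 |s - 1|, which removes the factor s - 1 from
  \<open>entz\<close>. The exponent ep/2 leaves room for squaring 1/zeta.\<close>

theorem zeta_bounds_RH:
 assumes RH: riemann_hypothesis and d: "0 < dl" "dl < 1" and e: "0 < ep"
 obtains C where "C >= 1" "!!s. 1/2 + dl <= Re s ==> cmod (zi2 s) <= C * ht s powr ep"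
  "!!s. 1/2 + dl <= Re s ==> 1/4 <= cmod (s - 1) ==> cmod (zeta s) <= C * ht s powr ep"
proof -
 have e2: "0 < ep / 2" using e by simp
 obtain C where C: "C >= 1" "!!s. 1/2 + dl <= Re s ==> Re s <= 2 ==>
  cmod (entz s) <= C * (5 + \<bar>Im s\<bar>) powr (ep / 2) * cmod (1 + \<i> * of_real (Im s)) \<and>
  cmod (1 + \<i> * of_real (Im s)) <= C * (5 + \<bar>Im s\<bar>) powr (ep / 2) * cmod (entz s)"
  using rh_log_bound[OF RH d e2] by blast
 obtain Z where Z: "Z >= 1" "!!s. Re s >= 2 ==> cmod (zeta s) <= Z" "!!s. Re s >= 2 ==> cmod (1 / zeta s) <= Z"
  using zeta_bounded_gt_1[of 2] by auto
 define K where "K = 5 * (C * 5 powr (ep / 2)) + Z"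
 have K: "K >= 1" using C Z by (simp add: K_def add_increasing)
 have T1: "1 <= (1 + \<bar>t::real\<bar>) powr u" if "0 <= u" for t u using that by (intro ge_one_powr_ge_zero) auto
 have CT: "C * (5 + \<bar>t\<bar>) powr (ep / 2) <= (C * 5 powr (ep / 2)) * (1 + \<bar>t\<bar>) powr (ep / 2)" for t :: real
  using mult_left_mono[OF five_powr_le[OF e2], of C t] C by (simp add: mult_ac)
 have 1: "cmod (1 / zeta s) <= K * ht s powr (ep / 2)" if s: "1/2 + dl <= Re s" for s
 proof (cases "Re s <= 2")
  case True
  have en: "entz s ~= 0" using entz_nonzero[OF RH, of s] s d by auto
  have "cmod (s - 1) <= cmod (1 + \<i> * of_real (Im s))"
  proof -
   have "\<bar>Re s - 1\<bar> <= 1" using True s d by auto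
   then have "(Re s - 1)\<^sup>2 <= 1" by (simp add: abs_square_le_1)
   then show ?thesis by (simp add: cmod_def)
  qed
  also have "... <= C * (5 + \<bar>Im s\<bar>) powr (ep / 2) * cmod (entz s)" using C(2)[OF s True] by simp
  finally have "cmod (1 / zeta s) <= C * (5 + \<bar>Im s\<bar>) powr (ep / 2)"
   using en by (simp add: zeta_eq norm_divide divide_le_eq)
  also have "... <= (C * 5 powr (ep / 2)) * ht s powr (ep / 2)" by (rule CT)
  also have "... <= K * ht s powr (ep / 2)"
   using C Z by (intro mult_right_mono) (auto simp: K_def)
  finally show ?thesis .
 next
  case False
  have "cmod (1 / zeta s) <= Z * 1" using Z(3)[of s] False by simp
  also have "... <= K * ht s powr (ep / 2)" using Z C T1 e by (intro mult_mono) (auto simp: K_def)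
  finally show ?thesis .
 qed
 have 2: "cmod (zi2 s) <= K^2 * ht s powr ep" if s: "1/2 + dl <= Re s" for s
 proof -
  have "cmod (zi2 s) = (cmod (1 / zeta s))^2" by (simp add: zi2_def norm_divide norm_power power_divide)
  also have "... <= (K * ht s powr (ep / 2))^2" by (intro power_mono 1 s) auto
  also have "... = K^2 * ht s powr ep"
   by (simp add: power_mult_distrib power2_eq_square flip: powr_add)
  finally show ?thesis .
 qed
 have 3: "cmod (zeta s) <= K * ht s powr ep" if s: "1/2 + dl <= Re s" "1/4 <= cmod (s - 1)" for s
 proof (cases "Re s <= 2")
  case True
  have "cmod (1 + \<i> * of_real (Im s)) <= 1 + \<bar>Im s\<bar>"
   by (rule order_trans[OF norm_triangle_ineq]) (simp add: norm_mult)
  also have "... <= 5 * cmod (s - 1)" using abs_Im_le_cmod[of "s - 1"] s by simp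
  finally have "C * (5 + \<bar>Im s\<bar>) powr (ep / 2) * cmod (1 + \<i> * of_real (Im s)) <= C * (5 + \<bar>Im s\<bar>) powr (ep / 2) * (5 * cmod (s - 1))"
   using C by (intro mult_left_mono) auto
  then have "cmod (entz s) <= C * (5 + \<bar>Im s\<bar>) powr (ep / 2) * (5 * cmod (s - 1))" using C(2)[OF s(1) True] by linarith
  moreover have "0 < cmod (s - 1)" using s by linarith
  ultimately have "cmod (zeta s) <= 5 * (C * (5 + \<bar>Im s\<bar>) powr (ep / 2))"
   by (simp add: zeta_eq norm_divide divide_le_eq mult_ac)
  also have "... <= 5 * ((C * 5 powr (ep / 2)) * ht s powr (ep / 2))" by (intro mult_left_mono CT) auto
  also have "... = (5 * (C * 5 powr (ep / 2))) * ht s powr (ep / 2)" by simp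
  also have "... <= K * ht s powr ep"
   using C Z e by (intro mult_mono powr_mono) (auto simp: K_def)
  finally show ?thesis .
 next
  case False
  have "cmod (zeta s) <= Z * 1" using Z(2)[of s] False by simp
  also have "... <= K * ht s powr ep" using Z C T1 e by (intro mult_mono) (auto simp: K_def)
  finally show ?thesis .
 qed
 have KK: "K <= K^2" using K by (simp add: power2_eq_square)
 show ?thesis
 proof (rule that[of "K^2"])
  show "1 <= K^2" using K by (simp add: one_le_power)
  show "cmod (zi2 s) <= K^2 * ht s powr ep" if "1/2 + dl <= Re s" for s by (rule 2[OF that])
  show "cmod (zeta s) <= K^2 * ht s powr ep" if "1/2 + dl <= Re s" "1/4 <= cmod (s - 1)" for s
   using 3[OF that] mult_right_mono[OF KK, of "ht s powr ep"] by simp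
 qed
qed

section \<open>The Perron formula\<close>

definition vint :: "(complex => complex) => real => real => complex" where
 "vint f x T = contour_integral (linc x (-T) x T) f"

definition hint :: "(complex => complex) => real => real => real => complex" where
 "hint f a b y = contour_integral (linc a y b y) f"

lemma rectpath_integral:
 assumes T: "0 <= T" and f: "continuous_on (path_image (rpath a b T)) f" and ab: "a <= b"
 shows "contour_integral (rpath a b T) f = hint f a b (-T) + vint f b T - hint f a b T - vint f a T"
proof -
 have sub: "continuous_on (segc a (-T) b (-T)) f"
  "continuous_on (segc b (-T) b T) f"
  "continuous_on (segc b T a T) f"
  "continuous_on (segc a T a (-T)) f"
  by (rule continuous_on_subset[OF f], simp add: rectpath_def Let_def path_image_join subset_eq)+
 note int = sub[THEN contour_integrable_continuous_linepath]
 have r: "contour_integral (linc b T a T) f = - hint f a b T"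
  "contour_integral (linc a T a (-T)) f = - vint f a T"
  unfolding hint_def vint_def using sub(3,4) by (simp_all add: contour_integral_reverse_linepath)
 show ?thesis
  unfolding rectpath_def Let_def
  using int r by (simp add: hint_def vint_def)
qed

lemma norm_vint_le:
 assumes "continuous_on (segc x (-T) x T) f" "0 <= T" "0 <= B"
  and "!!v. \<bar>v\<bar> <= T ==> cmod (f (Complex x v)) <= B"
 shows "cmod (vint f x T) <= B * (2 * T)"
proof -
 have "cmod (vint f x T) <= B * cmod (Complex x T - Complex x (-T))"
  unfolding vint_def
 proof (rule contour_integral_bound_linepath[OF contour_integrable_continuous_linepath[OF assms(1)] assms(3)])
  fix w assume "w \<in> segc x (-T) x T"
  then have "w = Complex x (Im w)" "\<bar>Im w\<bar> <= T" using assms(2)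
   by (auto simp: closed_segment_same_Re closed_segment_eq_real_ivl complex_eq_iff)
  then show "cmod (f w) <= B" using assms(4)[of "Im w"] by simp
 qed
 also have "Complex x T - Complex x (-T) = \<i> * of_real (2 * T)" by (simp add: complex_eq_iff)
 also have "cmod ... = 2 * T" using assms(2) by (simp add: norm_mult del: of_real_mult)
 finally show ?thesis .
qed

lemma norm_hint_le:
 assumes "continuous_on (segc a y b y) f" "a <= b" "0 <= B"
  and "!!u. a <= u ==> u <= b ==> cmod (f (Complex u y)) <= B"
 shows "cmod (hint f a b y) <= B * (b - a)"
proof -
 have "cmod (hint f a b y) <= B * cmod (Complex b y - Complex a y)"
  unfolding hint_def
 proof (rule contour_integral_bound_linepath[OF contour_integrable_continuous_linepath[OF assms(1)] assms(3)])
  fix w assume "w \<in> segc a y b y"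
  then have "w = Complex (Re w) y" "a <= Re w" "Re w <= b" using assms(2)
   by (auto simp: closed_segment_same_Im closed_segment_eq_real_ivl complex_eq_iff)
  then show "cmod (f w) <= B" using assms(4)[of "Re w"] by simp
 qed
 also have "Complex b y - Complex a y = of_real (b - a)" by (simp add: complex_eq_iff)
 also have "cmod ... = b - a" using assms(2) by (simp only: norm_of_real)
 finally show ?thesis .
qed

lemma rectpath_segments:
 assumes "a <= b" "0 <= T"
 shows "segc a (-T) b (-T) \<subseteq> path_image (rpath a b T)"
  "segc b (-T) b T \<subseteq> path_image (rpath a b T)"
  "segc a T b T \<subseteq> path_image (rpath a b T)"
  "segc a (-T) a T \<subseteq> path_image (rpath a b T)"
 by (auto simp: rectpath_def Let_def path_image_join closed_segment_commute)

lemma rectpath_image_cases: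
 assumes "w \<in> path_image (rpath a b T)" "a <= b" "0 <= T"
 shows "(Re w = a \<or> Re w = b) \<and> \<bar>Im w\<bar> <= T \<or> (Im w = T \<or> Im w = -T) \<and> a <= Re w \<and> Re w <= b"
 using assms by (auto simp: path_image_rectpath)

text \<open>The kernel of the first Riesz mean. It decays quadratically, so the truncated integral
  has an error O(1/T).\<close>

definition pker :: "real => complex => complex" where
 "pker z w = of_real z powr w / (w * (w + 1))"

lemma norm_pker_le:
 assumes "z > 0" "A > 0" "cmod w >= A" "cmod (w + 1) >= A" "z powr Re w <= P"
 shows "cmod (pker z w) <= P / A^2"
proof -
 have "cmod (of_real z powr w) = z powr Re w" using assms(1) by (simp add: norm_powr_real_powr)
 then have "cmod (pker z w) = z powr Re w / (cmod w * cmod (w + 1))" by (simp add: pker_def norm_divide norm_mult)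
 also have "... <= P / (A * A)" using assms by (intro frac_le mult_mono order_trans[OF powr_ge_zero assms(5)]) auto
 finally show ?thesis by (simp add: power2_eq_square)
qed

lemma pker_continuous: "z > 0 ==> 0 \<notin> S ==> -1 \<notin> S ==> continuous_on S (pker z)"
 unfolding pker_def[abs_def]
 by (intro continuous_intros) (auto simp: add_eq_0_iff2)

text \<open>For z < 1 the contour is closed to the right, where the kernel is holomorphic; for z >=
  1 it is closed to the left and picks up the residues 1 at 0 and -1/z at -1. The far side is at a
  distance of order T, so that each of the three extra sides is O(z^b/T).\<close>

lemma perron_kernel:
 assumes b: "0 < b" and T: "1 <= T" and z: "0 < z"
 shows "cmod (vint (pker z) b T - 2 * pi * \<i> * of_real (max 0 (1 - 1 / z))) <= (2 * b + 8) * z powr b / T"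
proof (cases "z < 1")
 case True
 define R where "R = b + T"
 let ?r = "rpath b R T"
 have bR: "b <= R" using T by (simp add: R_def)
 have pos: "Re w > 0" if "w \<in> path_image ?r" for w
  using rectpath_image_cases[OF that bR] b T bR by auto
 have cont: "continuous_on (path_image ?r) (pker z)"
  by (rule pker_continuous[OF z]) (use pos in force)+
 note seg = rectpath_segments[OF bR, of T]
 have c: "continuous_on (segc b (-T) R (-T)) (pker z)"
  "continuous_on (segc R (-T) R T) (pker z)"
  "continuous_on (segc b T R T) (pker z)"
  using seg T by (auto intro: continuous_on_subset[OF cont])
 have "(pker z has_contour_integral 0) ?r"
 proof (rule Cauchy_theorem_convex_simple)
  show "pker z holomorphic_on {w. Re w > 0}"
   unfolding pker_def[abs_def]
  proof (intro holomorphic_intros)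
   fix w assume "w \<in> {w. Re w > 0}"
   then have "w ~= 0" "w ~= -1" by auto
   then show "w * (w + 1) ~= 0" by (auto simp: add_eq_0_iff2)
  qed
  show "convex {w. Re w > 0}" by (rule convex_halfspace_Re_gt)
 qed (use pos in auto)
 then have eq: "0 = hint (pker z) b R (-T) + vint (pker z) R T - hint (pker z) b R T - vint (pker z) b T"
  using rectpath_integral[OF _ cont bR] T by (simp add: contour_integral_unique)
 have zb: "z powr u <= z powr b" if "b <= u" for u using that z True by (intro powr_mono') auto
 have h: "cmod (hint (pker z) b R y) <= z powr b / T^2 * (R - b)" if y: "y = T \<or> y = -T" for y
 proof (rule norm_hint_le)
  show "continuous_on (segc b y R y) (pker z)" using y c by auto
  fix u assume u: "b <= u" "u <= R"
  show "cmod (pker z (Complex u y)) <= z powr b / T^2"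
  proof (rule norm_pker_le[OF z])
   show "T <= cmod (Complex u y)" "T <= cmod (Complex u y + 1)"
    using abs_Im_le_cmod[of "Complex u y"] abs_Im_le_cmod[of "Complex u y + 1"] y T by auto
  qed (use T zb u in auto)
 qed (use bR z in auto)
 have v: "cmod (vint (pker z) R T) <= z powr b / T^2 * (2 * T)"
 proof (rule norm_vint_le[OF c(2)])
  fix v assume "\<bar>v\<bar> <= T"
  show "cmod (pker z (Complex R v)) <= z powr b / T^2"
  proof (rule norm_pker_le[OF z])
   show "T <= cmod (Complex R v)" "T <= cmod (Complex R v + 1)"
    using abs_Re_le_cmod[of "Complex R v"] abs_Re_le_cmod[of "Complex R v + 1"] b T by (auto simp: R_def)
  qed (use T zb bR in auto)
 qed (use T z in auto)
 have "vint (pker z) b T = hint (pker z) b R (-T) + vint (pker z) R T - hint (pker z) b R T" using eq by (simp add: algebra_simps)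
 then have "cmod (vint (pker z) b T) <= cmod (hint (pker z) b R (-T)) + cmod (vint (pker z) R T) + cmod (hint (pker z) b R T)"
  by (simp only:) (intro order_trans[OF norm_triangle_ineq4] add_mono norm_triangle_ineq order_refl)
 also have "... <= z powr b / T^2 * T + z powr b / T^2 * (2 * T) + z powr b / T^2 * T"
  using h[of T] h[of "-T"] v by (intro add_mono) (auto simp: R_def)
 also have "... = 4 * z powr b / T" using T by (simp add: power2_eq_square field_simps)
 also have "... <= (2 * b + 8) * z powr b / T" using b T by (intro divide_right_mono mult_right_mono) auto
 finally show ?thesis using True z by (simp add: max_def)
next
 case False
 define R where "R = T + 1"
 let ?r = "rpath (-R) b T"
 have Rb: "-R <= b" using T b by (simp add: R_def)
 have ne: "w ~= 0 \<and> w ~= -1" if "w \<in> path_image ?r" for w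
  using rectpath_image_cases[OF that Rb] b T by (auto simp: R_def)
 have cont: "continuous_on (path_image ?r) (pker z)"
  by (rule pker_continuous[OF z]) (use ne in force)+
 note seg = rectpath_segments[OF Rb, of T]
 have c: "continuous_on (segc (-R) (-T) b (-T)) (pker z)"
  "continuous_on (segc (-R) (-T) (-R) T) (pker z)"
  "continuous_on (segc (-R) T b T) (pker z)"
  using seg T by (auto intro: continuous_on_subset[OF cont])
 \<comment> \<open>By partial fractions the kernel is z^w/w - z^w/(w + 1), so Cauchy's integral
   formula at 0 and at -1 gives both residues.\<close>
 have I: "((%w. of_real z powr w / (w - a)) has_contour_integral (2 * pi * \<i> * of_real z powr a)) ?r" if a: "a = 0 \<or> a = -1" for a :: complex
 proof -
  have "((%w. of_real z powr w / (w - a)) has_contour_integral (2 * pi * \<i> * winding_number ?r a * of_real z powr a)) ?r"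
  proof (rule Cauchy_integral_formula_convex_simple[of UNIV])
   show "(%w. of_real z powr w) holomorphic_on UNIV" using z by (intro holomorphic_intros) auto
  qed (use ne a in auto)
  moreover have "winding_number ?r a = 1"
   by (rule winding_number_rectpath) (use a T b in \<open>auto simp: in_box_complex_iff R_def\<close>)
  ultimately show ?thesis by simp
 qed
 have "(pker z has_contour_integral (2 * pi * \<i> * of_real z powr 0 - 2 * pi * \<i> * of_real z powr (-1))) ?r"
 proof (rule has_contour_integral_eq[OF has_contour_integral_diff[OF I[of 0] I[of "-1"]]])
  fix w assume "w \<in> path_image ?r"
  then have w: "w ~= 0" "w + 1 ~= 0" using ne by (auto simp: add_eq_0_iff2)
  then show "of_real z powr w / (w - 0) - of_real z powr w / (w - -1) = pker z w"
   by (simp add: pker_def field_simps)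
 qed auto
 moreover have "2 * pi * \<i> * of_real z powr 0 - 2 * pi * \<i> * of_real z powr (-1) = 2 * pi * \<i> * of_real (max 0 (1 - 1 / z))"
 proof -
  have "complex_of_real z powr (-1) = of_real (1 / z)" using z by (simp add: powr_minus_divide)
  moreover have "max 0 (1 - 1 / z) = 1 - 1 / z" using False z by (simp add: field_simps)
  ultimately show ?thesis unfolding \<open>max 0 (1 - 1 / z) = 1 - 1 / z\<close> using z by (simp add: algebra_simps)
 qed
 ultimately have eq: "2 * pi * \<i> * of_real (max 0 (1 - 1 / z)) = hint (pker z) (-R) b (-T) + vint (pker z) b T - hint (pker z) (-R) b T - vint (pker z) (-R) T"
  using rectpath_integral[OF _ cont Rb] T by (simp add: contour_integral_unique)
 have zb: "z powr u <= z powr b" if "u <= b" for u using that z False by (intro powr_mono) auto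
 have h: "cmod (hint (pker z) (-R) b y) <= z powr b / T^2 * (b - -R)" if y: "y = T \<or> y = -T" for y
 proof (rule norm_hint_le)
  show "continuous_on (segc (-R) y b y) (pker z)" using y c by auto
  fix u assume u: "-R <= u" "u <= b"
  show "cmod (pker z (Complex u y)) <= z powr b / T^2"
  proof (rule norm_pker_le[OF z])
   show "T <= cmod (Complex u y)" "T <= cmod (Complex u y + 1)"
    using abs_Im_le_cmod[of "Complex u y"] abs_Im_le_cmod[of "Complex u y + 1"] y T by auto
  qed (use T zb u in auto)
 qed (use Rb z in auto)
 have v: "cmod (vint (pker z) (-R) T) <= z powr b / T^2 * (2 * T)"
 proof (rule norm_vint_le[OF c(2)])
  fix v assume "\<bar>v\<bar> <= T"
  show "cmod (pker z (Complex (-R) v)) <= z powr b / T^2"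
  proof (rule norm_pker_le[OF z])
   show "T <= cmod (Complex (-R) v)" "T <= cmod (Complex (-R) v + 1)"
    using abs_Re_le_cmod[of "Complex (-R) v"] abs_Re_le_cmod[of "Complex (-R) v + 1"] b T by (auto simp: R_def)
  qed (use T zb Rb in auto)
 qed (use T z in auto)
 have "vint (pker z) b T - 2 * pi * \<i> * of_real (max 0 (1 - 1 / z)) = hint (pker z) (-R) b T + vint (pker z) (-R) T - hint (pker z) (-R) b (-T)"
  unfolding eq by (simp add: algebra_simps)
 then have "cmod (vint (pker z) b T - 2 * pi * \<i> * of_real (max 0 (1 - 1 / z))) <= cmod (hint (pker z) (-R) b T) + cmod (vint (pker z) (-R) T) + cmod (hint (pker z) (-R) b (-T))"
  by (simp only:) (intro order_trans[OF norm_triangle_ineq4] add_mono norm_triangle_ineq order_refl)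
 also have "... <= z powr b / T^2 * (b + T + 1) + z powr b / T^2 * (2 * T) + z powr b / T^2 * (b + T + 1)"
 proof -
  have "b - -R = b + T + 1" by (simp add: R_def)
  have h': "cmod (hint (pker z) (-R) b y) <= z powr b / T^2 * (b + T + 1)" if "y = T \<or> y = -T" for y
   using h[OF that] unfolding \<open>b - -R = b + T + 1\<close> .
  show ?thesis by (intro add_mono h' v) auto
 qed
 also have "... = z powr b * (2 * b + 4 * T + 2) / T^2" by (simp add: field_simps add_divide_distrib)
 also have "... <= z powr b * ((2 * b + 8) * T) / T^2"
 proof (intro divide_right_mono mult_left_mono)
  have "2 * b * 1 <= 2 * b * T" using b T by (intro mult_left_mono) auto
  then show "2 * b + 4 * T + 2 <= (2 * b + 8) * T" using T by (simp add: distrib_right)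
 qed auto
 also have "... = (2 * b + 8) * z powr b / T" using T by (simp add: power2_eq_square)
 finally show ?thesis .
qed

section \<open>Riesz means of Dirichlet series and shifting the line\<close>

text \<open>For x1 <= x2 this is x2 - x1 for n <= x1, decreases linearly, and is 0 from x2 on. It
  covers the smooth weight (x1 = y, x2 = 2y) as well as a sharp cutoff at an integer (x2 = x1 +
  1).\<close>

definition riesz_diff :: "real => real => nat => real" where
 "riesz_diff x1 x2 n = max 0 (x2 - real n) - max 0 (x1 - real n)"

definition riesz_kernel :: "real => real => complex => complex" where
 "riesz_kernel x1 x2 w = (of_real x2 powr (w + 1) - of_real x1 powr (w + 1)) / (w * (w + 1))"

lemma riesz_kernel_term:
 assumes "0 < x1" "0 < x2"
 shows "of_nat (Suc n) powr (-w) * riesz_kernel x1 x2 w = of_real x2 * pker (x2 / real (Suc n)) w - of_real x1 * pker (x1 / real (Suc n)) w"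
proof -
 have e: "of_nat (Suc n) powr (-w) * of_real x powr (w + 1) = of_real x * of_real (x / real (Suc n)) powr w" if x: "0 < x" for x
 proof -
  have 1: "complex_of_real x powr (w + 1) = of_real x * of_real x powr w" using x by (simp add: powr_add)
  have "complex_of_real (x / real (Suc n)) powr w = (of_real x * of_real (1 / real (Suc n))) powr w" by (simp add: field_simps)
  also have "... = of_real x powr w * of_real (1 / real (Suc n)) powr w" using x by (intro powr_times_real) auto
  also have "complex_of_real (1 / real (Suc n)) powr w = of_nat (Suc n) powr (-w)"
  proof -
   have "Ln (complex_of_real (1 / real (Suc n))) = - Ln (of_nat (Suc n))"
    by (simp add: Ln_of_real ln_div Ln_of_nat del: of_nat_Suc of_real_divide)
   then show ?thesis by (simp add: powr_def del: of_nat_Suc)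
  qed
  finally show ?thesis unfolding 1 by (simp add: mult_ac)
 qed
 show ?thesis
  unfolding riesz_kernel_def pker_def
  using e[OF assms(1)] e[OF assms(2)]
  by (simp add: diff_divide_distrib right_diff_distrib del: of_nat_Suc)
qed

text \<open>On each segment the series converges uniformly and may be integrated termwise; the
  errors of the truncated kernel formula are summable with total O(1/T).\<close>

theorem perron_series:
 fixes m :: "nat => complex"
 assumes b: "0 < b" and m: "summable (%n. cmod (m n) * real (Suc n) powr -b)" and x: "0 < x1" "0 < x2"
 defines "g \<equiv> %w. (\<Sum>n. m n * of_nat (Suc n) powr (-w)) * riesz_kernel x1 x2 w"
 shows "((%T. vint g b T) \<longlongrightarrow> 2 * pi * \<i> * (\<Sum>n. m n * of_real (riesz_diff x1 x2 (Suc n)))) at_top"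
  and "summable (%n. m n * of_real (riesz_diff x1 x2 (Suc n)))"
proof -
 define D where "D n = riesz_diff x1 x2 (Suc n)" for n
 define A where "A = (2 * b + 8) * (x2 * x2 powr b + x1 * x1 powr b)"
 define M where "M n = cmod (m n) * real (Suc n) powr -b" for n
 have mS: "summable M" using m unfolding M_def[abs_def] .
 have nN: "cmod (of_nat (Suc n) powr (-w)) = real (Suc n) powr -b" if "Re w = b" for w n
  using norm_powr_real_powr[of "of_nat (Suc n)" "-w"] that by (simp del: of_nat_Suc)
 have seg: "Re w = b" if "w \<in> segc b (-T) b T" for w T
  using that by (auto simp: closed_segment_same_Re)
 have contk: "continuous_on (segc b (-T) b T) (pker z)" if "z > 0" for z T
  by (rule pker_continuous[OF that]) (use seg b in force)+
 define f where "f n w = m n * (of_nat (Suc n) powr (-w) * riesz_kernel x1 x2 w)" for n w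
 have fk: "f n = (%w. m n * (of_real x2 * pker (x2 / real (Suc n)) w - of_real x1 * pker (x1 / real (Suc n)) w))" for n
  unfolding f_def[abs_def] riesz_kernel_term[OF x] ..
 have contf: "continuous_on (segc b (-T) b T) (f n)" for n T
  unfolding fk by (intro continuous_intros contk) (use x in auto)
 define c where "c T n = contour_integral (linc b (-T) b T) (f n)" for T n
 have c: "cmod (c T n - m n * (2 * pi * \<i> * of_real (D n))) <= A / T * M n" if T: "1 <= T" for T n
 proof -
  let ?N = "real (Suc n)"
  have ci: "pker z contour_integrable_on linc b (-T) b T" if "z > 0" for z
   by (intro contour_integrable_continuous_linepath contk that)
  have "c T n = m n * (of_real x2 * vint (pker (x2 / ?N)) b T - of_real x1 * vint (pker (x1 / ?N)) b T)"
   unfolding c_def fk vint_def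
   using ci[of "x2 / ?N"] ci[of "x1 / ?N"] x
   by (simp add: contour_integral_lmul contour_integral_diff contour_integrable_lmul contour_integrable_diff del: of_nat_Suc)
  moreover have "of_real (D n) = complex_of_real x2 * of_real (max 0 (1 - 1 / (x2 / ?N))) - of_real x1 * of_real (max 0 (1 - 1 / (x1 / ?N)))"
  proof -
   have mx: "y * max 0 (1 - 1 / (y / ?N)) = max 0 (y - ?N)" if "y > 0" for y
    using that by (auto simp: max_def field_simps)
   have "D n = x2 * max 0 (1 - 1 / (x2 / ?N)) - x1 * max 0 (1 - 1 / (x1 / ?N))"
    unfolding mx[OF x(1)] mx[OF x(2)] D_def riesz_diff_def ..
   then show ?thesis by (simp only: of_real_diff of_real_mult)
  qed
  ultimately have "c T n - m n * (2 * pi * \<i> * of_real (D n))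
   = m n * (of_real x2 * (vint (pker (x2 / ?N)) b T - 2 * pi * \<i> * of_real (max 0 (1 - 1 / (x2 / ?N))))
     - of_real x1 * (vint (pker (x1 / ?N)) b T - 2 * pi * \<i> * of_real (max 0 (1 - 1 / (x1 / ?N)))))"
   by (simp only:) (simp only: algebra_simps)
  also have "cmod ... <= cmod (m n) * (x2 * ((2 * b + 8) * (x2 / ?N) powr b / T) + x1 * ((2 * b + 8) * (x1 / ?N) powr b / T))"
  proof -
   have pk: "cmod (of_real y * (vint (pker (y / ?N)) b T - 2 * pi * \<i> * of_real (max 0 (1 - 1 / (y / ?N)))))
     <= y * ((2 * b + 8) * (y / ?N) powr b / T)" if "0 < y" for y
   proof -
    have "0 < y / ?N" using that by simp
    from mult_left_mono[OF perron_kernel[OF b T this], of y] that show ?thesis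
     by (simp add: norm_mult del: of_nat_Suc divide_divide_eq_right)
   qed
   show ?thesis
    unfolding norm_mult[of "m n"]
    by (intro mult_left_mono order_trans[OF norm_triangle_ineq4] add_mono pk x norm_ge_zero)
  qed
  also have "... = A / T * M n"
  proof -
   have pd: "(y / ?N) powr b = y powr b * ?N powr -b" if "y > 0" for y
    using that by (simp add: powr_divide powr_minus_divide del: of_nat_Suc)
   show ?thesis unfolding pd[OF x(1)] pd[OF x(2)] A_def M_def
    by (simp add: divide_inverse algebra_simps del: of_nat_Suc)
  qed
  finally show ?thesis .
 qed
 have sumf: "summable (%n. m n * of_real (D n))"
 proof (rule summable_finite)
  show "finite {n. real n <= x1 + x2}" by (rule finite_subset[of _ "{..nat \<lfloor>x1 + x2\<rfloor>}"]) (auto simp: le_nat_floor)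
  fix n assume "n \<notin> {n. real n <= x1 + x2}"
  then show "m n * of_real (D n) = 0" using x by (auto simp: D_def riesz_diff_def)
 qed
 then show "summable (%n. m n * of_real (riesz_diff x1 x2 (Suc n)))" by (simp add: D_def)
 have vg: "(%n. c T n) sums vint g b T" for T
 proof -
  define Km where "Km = (x2 powr (b + 1) + x1 powr (b + 1)) / (b * b)"
  have u: "uniform_limit (segc b (-T) b T) (%N w. \<Sum>n<N. f n w) (%w. \<Sum>n. f n w) sequentially"
  proof (rule Weierstrass_m_test)
   show "summable (%n. M n * Km)" by (intro summable_mult2 mS)
   fix n w assume w: "w \<in> segc b (-T) b T"
   have Rw: "Re w = b" by (rule seg[OF w])
   have "cmod (riesz_kernel x1 x2 w) <= Km"
   proof -
    have "cmod (of_real x2 powr (w + 1) - of_real x1 powr (w + 1)) <= x2 powr (b + 1) + x1 powr (b + 1)"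
     by (rule order_trans[OF norm_triangle_ineq4]) (use x Rw in \<open>simp add: norm_powr_real_powr\<close>)
    moreover have "b <= cmod w" "b <= cmod (w + 1)"
     using abs_Re_le_cmod[of w] abs_Re_le_cmod[of "w + 1"] Rw b by auto
    ultimately show ?thesis unfolding riesz_kernel_def Km_def norm_divide norm_mult
     using b by (intro frac_le mult_mono) auto
   qed
   then show "cmod (f n w) <= M n * Km"
    unfolding f_def norm_mult nN[OF Rw] M_def mult.assoc[symmetric] by (intro mult_left_mono) auto
  qed
  obtain J where J: "((%w. \<Sum>n. f n w) has_contour_integral J) (linc b (-T) b T)" "(%n. c T n) sums J"
   unfolding c_def by (rule contour_integral_sums_linepath[OF u contf])
  have "vint g b T = J"
   unfolding vint_def
  proof (rule contour_integral_unique, rule has_contour_integral_eq[OF J(1)])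
   fix w assume "w \<in> path_image (linc b (-T) b T)"
   then have Rw: "Re w = b" using seg by simp
   have "summable (%n. m n * of_nat (Suc n) powr (-w))"
   proof (rule summable_norm_cancel)
    show "summable (%n. cmod (m n * of_nat (Suc n) powr (-w)))" unfolding norm_mult nN[OF Rw] by (rule m)
   qed
   from suminf_mult2[OF this, of "riesz_kernel x1 x2 w"] show "(\<Sum>n. f n w) = g w"
    by (simp add: g_def f_def mult.assoc)
  qed
  then show ?thesis using J(2) by simp
 qed
 have bnd: "cmod (vint g b T - 2 * pi * \<i> * (\<Sum>n. m n * of_real (D n))) <= A * (\<Sum>n. M n) / T" if T: "1 <= T" for T
 proof -
  have S: "(%n. c T n - m n * (2 * pi * \<i> * of_real (D n))) sums (vint g b T - 2 * pi * \<i> * (\<Sum>n. m n * of_real (D n)))"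
  proof (rule sums_diff[OF vg])
   show "(%n. m n * (2 * pi * \<i> * of_real (D n))) sums (2 * pi * \<i> * (\<Sum>n. m n * of_real (D n)))"
    using sums_mult[OF summable_sums[OF sumf], of "2 * pi * \<i>"] by (simp add: mult_ac)
  qed
  have "cmod (\<Sum>n. c T n - m n * (2 * pi * \<i> * of_real (D n))) <= (\<Sum>n. A / T * M n)"
   by (rule norm_suminf_le[OF c[OF T]]) (intro summable_mult mS)
  also have "... = A / T * (\<Sum>n. M n)" by (rule suminf_mult[OF mS])
  finally show ?thesis using S by (simp add: sums_iff)
 qed
 have "((%T. vint g b T - 2 * pi * \<i> * (\<Sum>n. m n * of_real (D n))) \<longlongrightarrow> 0) at_top"
 proof (rule Lim_null_comparison)
  show "\<forall>\<^sub>F T in at_top. cmod (vint g b T - 2 * pi * \<i> * (\<Sum>n. m n * of_real (D n))) <= A * (\<Sum>n. M n) / T"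
   by (rule eventually_mono[OF eventually_ge_at_top[of 1]]) (rule bnd)
  show "((%T. A * (\<Sum>n. M n) / T) \<longlongrightarrow> 0) at_top"
   by (rule tendsto_divide_0[OF tendsto_const]) (rule filterlim_at_top_imp_at_infinity[OF filterlim_ident])
 qed
 then show "((%T. vint g b T) \<longlongrightarrow> 2 * pi * \<i> * (\<Sum>n. m n * of_real (riesz_diff x1 x2 (Suc n)))) at_top"
  by (simp add: LIM_zero_iff D_def)
qed

lemma integral_decay_le:
 fixes et T :: real
 assumes e: "0 < et" and T: "0 <= T"
 shows "(%v. (1 + \<bar>v\<bar>) powr (-1 - et)) integrable_on {-T..T}" "integral {-T..T} (%v. (1 + \<bar>v\<bar>) powr (-1 - et)) <= 2 / et"
proof -
 let ?f = "%v. (1 + \<bar>v\<bar>) powr (-1 - et)"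
 have d: "((%x. (1 + \<sigma> * x) powr (-et) / et) has_real_derivative - \<sigma> * (1 + \<sigma> * x) powr (-1 - et)) (at x within S)"
  if "0 < 1 + \<sigma> * x" for \<sigma> x :: real and S
 proof -
  have "((%x. 1 + \<sigma> * x) has_real_derivative \<sigma>) (at x within S)" by (auto intro!: derivative_eq_intros)
  from DERIV_cdivide[OF DERIV_chain'[OF this has_real_derivative_powr[OF that, of "-et"]], of et]
  have "((%x. (1 + \<sigma> * x) powr (-et) / et) has_real_derivative (-et * (1 + \<sigma> * x) powr (-et - 1) * \<sigma>) / et) (at x within S)"
   by (simp only: mult_ac)
  moreover have "-et - 1 = -1 - et" by simp
  ultimately show ?thesis using e by (simp add: mult_ac)
 qed
 have "(?f has_integral (- ((1 + T) powr (-et) / et) - (- ((1 + 0) powr (-et) / et)))) {0..T}"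
 proof (rule fundamental_theorem_of_calculus[where f = "%x::real. - ((1 + x) powr (-et) / et)"])
  fix x assume x: "x \<in> {0..T}"
  have "((%x. - ((1 + x) powr (-et) / et)) has_real_derivative (1 + x) powr (-1 - et)) (at x within {0..T})"
   using DERIV_minus[OF d[of 1 x "{0..T}"]] x by simp
  then show "((%x. - ((1 + x) powr (-et) / et)) has_vector_derivative ?f x) (at x within {0..T})"
   using x by (simp add: has_real_derivative_iff_has_vector_derivative)
 qed (use T in simp)
 moreover have "(?f has_integral ((1 - 0) powr (-et) / et - (1 - - T) powr (-et) / et)) {-T..0}"
 proof (rule fundamental_theorem_of_calculus[where f = "%x::real. (1 - x) powr (-et) / et"])
  fix x assume x: "x \<in> {-T..0}"
  have "((%x. (1 - x) powr (-et) / et) has_real_derivative (1 - x) powr (-1 - et)) (at x within {-T..0})"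
   using d[of "-1" x "{-T..0}"] x by simp
  then show "((%x. (1 - x) powr (-et) / et) has_vector_derivative ?f x) (at x within {-T..0})"
   using x by (simp add: has_real_derivative_iff_has_vector_derivative)
 qed (use T in simp)
 ultimately have I: "(?f has_integral (((1 - 0) powr (-et) / et - (1 - - T) powr (-et) / et) + (- ((1 + T) powr (-et) / et) - (- ((1 + 0) powr (-et) / et))))) {-T..T}"
  using T by (intro has_integral_combine[of "-T" 0 T]) auto
 then show "?f integrable_on {-T..T}" by (rule has_integral_integrable)
 have "integral {-T..T} ?f = 2 / et - 2 * (1 + T) powr (-et) / et" using I by (simp add: integral_unique field_simps)
 then show "integral {-T..T} ?f <= 2 / et" using e by simp
qed

text \<open>H continues series times kernel to the left and has to be holomorphic there, so poles
  must have been cancelled beforehand. The horizontal sides are O(1/T) and disappear in the limit;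
  on the left line the integral converges absolutely.\<close>

theorem perron_shift_bound:
 fixes m :: "nat => complex"
 assumes b: "0 < b" and m: "summable (%n. cmod (m n) * real (Suc n) powr -b)" and x: "0 < x1" "0 < x2"
  and bt: "bt0 < bt" "bt <= b" and H: "H holomorphic_on {w. Re w > bt0}"
  and HF: "!!w. Re w = b ==> H w = (\<Sum>n. m n * of_nat (Suc n) powr (-w)) * riesz_kernel x1 x2 w"
  and hor: "!!w. bt <= Re w ==> Re w <= b ==> 1 <= \<bar>Im w\<bar> ==> cmod (H w) <= B / \<bar>Im w\<bar>"
  and left: "!!v. cmod (H (Complex bt v)) <= J * (1 + \<bar>v\<bar>) powr (-1 - et)" and eta: "0 < et"
 shows "cmod (\<Sum>n. m n * of_real (riesz_diff x1 x2 (Suc n))) <= J / et"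
proof -
 let ?S = "\<Sum>n. m n * of_real (riesz_diff x1 x2 (Suc n))"
 have J0: "0 <= J" using order_trans[OF norm_ge_zero left[of 0]] by simp
 have B0: "0 <= B" using order_trans[OF norm_ge_zero hor[of "Complex b 1"]] bt by simp
 have contH: "continuous_on S H" if "S \<subseteq> {w. Re w > bt0}" for S
  by (intro holomorphic_on_imp_continuous_on holomorphic_on_subset[OF H that])
 have seg: "Re w = c" if "w \<in> segc c (-T) c T" for w c T
  using that by (auto simp: closed_segment_same_Re)
 have vb: "cmod (vint H b T) <= 2 * J / et + 2 * (b - bt) * B / T" if T: "1 <= T" for T
 proof -
  let ?r = "rpath bt b T"
  have pos: "Re w > bt0" if "w \<in> path_image ?r" for w
   using rectpath_image_cases[OF that bt(2)] bt T by auto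
  have cont: "continuous_on (path_image ?r) H" by (rule contH) (use pos in auto)
  note sg = rectpath_segments[OF bt(2), of T]
  have "(H has_contour_integral 0) ?r"
   by (rule Cauchy_theorem_convex_simple[OF H]) (use pos in \<open>auto intro: convex_halfspace_Re_gt\<close>)
  then have eq: "0 = hint H bt b (-T) + vint H b T - hint H bt b T - vint H bt T"
   using rectpath_integral[OF _ cont bt(2)] T by (simp add: contour_integral_unique)
  have h: "cmod (hint H bt b y) <= B / T * (b - bt)" if y: "y = T \<or> y = -T" for y
  proof (rule norm_hint_le)
   show "continuous_on (segc bt y b y) H"
    using y sg T by (auto intro: continuous_on_subset[OF cont])
   show "cmod (H (Complex u y)) <= B / T" if "bt <= u" "u <= b" for u
    using hor[of "Complex u y"] that y T by auto
  qed (use bt B0 T in auto)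
  have v: "cmod (vint H bt T) <= 2 * J / et"
  proof -
   have "vint H bt T = \<i> * integral {-T..T} (%v. H (Complex bt v))"
    unfolding vint_def by (rule contour_integral_linepath_same_Re) (use T in auto)
   then have "cmod (vint H bt T) = cmod (integral {-T..T} (%v. H (Complex bt v)))" by (simp add: norm_mult)
   also have "... <= integral {-T..T} (%v. J * (1 + \<bar>v\<bar>) powr (-1 - et))"
   proof (rule integral_norm_bound_integral)
    have "continuous_on {-T..T} (%v. H (Complex bt v))"
     by (rule continuous_on_compose2[OF contH[of "{w. Re w > bt0}"]])
       (use bt in \<open>auto simp: Complex_eq intro!: continuous_intros\<close>)
    then show "(%v. H (Complex bt v)) integrable_on {-T..T}" by (rule integrable_continuous_real)
    show "(%v. J * (1 + \<bar>v\<bar>) powr (-1 - et)) integrable_on {-T..T}"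
     using integral_decay_le(1)[OF eta, of T] T by (intro integrable_on_mult_right) auto
   qed (rule left)
   also have "... = J * integral {-T..T} (%v. (1 + \<bar>v\<bar>) powr (-1 - et))" by simp
   also have "... <= J * (2 / et)" using integral_decay_le(2)[OF eta, of T] T J0 by (intro mult_left_mono) auto
   finally show ?thesis by (simp add: mult_ac)
  qed
  have "vint H b T = hint H bt b T + vint H bt T - hint H bt b (-T)" using eq by (simp add: algebra_simps)
  then have "cmod (vint H b T) <= cmod (hint H bt b T) + cmod (vint H bt T) + cmod (hint H bt b (-T))"
   by (simp only:) (intro order_trans[OF norm_triangle_ineq4] add_mono norm_triangle_ineq order_refl)
  also have "... <= B / T * (b - bt) + 2 * J / et + B / T * (b - bt)" by (intro add_mono h v) auto
  also have "... = 2 * J / et + 2 * (b - bt) * B / T" by (simp add: field_simps)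
  finally show ?thesis .
 qed
 define g where "g w = (\<Sum>n. m n * of_nat (Suc n) powr (-w)) * riesz_kernel x1 x2 w" for w
 have vg: "vint H b T = vint g b T" for T
  unfolding vint_def
  by (rule contour_integral_eq) (use HF seg in \<open>auto simp: g_def\<close>)
 have lim: "((%T. cmod (vint H b T)) \<longlongrightarrow> cmod (2 * pi * \<i> * ?S)) at_top"
  using perron_series(1)[OF b m x] unfolding vg g_def by (rule tendsto_norm)
 have lim2: "((%T. 2 * J / et + 2 * (b - bt) * B / T) \<longlongrightarrow> 2 * J / et + 0) at_top"
  by (intro tendsto_add tendsto_const tendsto_divide_0[OF tendsto_const] filterlim_at_top_imp_at_infinity filterlim_ident)
 have "cmod (2 * pi * \<i> * ?S) <= 2 * J / et + 0"
 proof (rule tendsto_le[OF _ lim2 lim])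
  show "\<forall>\<^sub>F T in at_top. cmod (vint H b T) <= 2 * J / et + 2 * (b - bt) * B / T"
   by (rule eventually_mono[OF eventually_ge_at_top[of 1] vb])
 qed simp
 then have "2 * pi * cmod ?S <= 2 * (J / et)" by (simp add: norm_mult)
 then have "pi * cmod ?S <= J / et" by simp
 moreover have "1 * cmod ?S <= pi * cmod ?S" using pi_ge_two by (intro mult_right_mono) auto
 ultimately show ?thesis by simp
qed

text \<open>The numerator of the kernel vanishes at w = -1, so the kernel is G w/w with an entire G
  and has its only pole at 0. This matters when the line is moved beyond -1. The first bound for G
  gains the length x2 - x1 by integrating the derivative; the second gains decay in w.\<close>

lemma powr_difference_quotient:
 assumes x: "0 < x1" "x1 <= x2"
 obtains G where "G holomorphic_on UNIV"
  "!!w. w ~= 0 ==> w ~= -1 ==> riesz_kernel x1 x2 w = G w / w"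
  "!!w. cmod (G w) <= (x2 - x1) * max (x1 powr Re w) (x2 powr Re w)"
  "!!w. w ~= -1 ==> cmod (G w) <= (x1 powr (Re w + 1) + x2 powr (Re w + 1)) / cmod (w + 1)"
proof -
 define f where "f w = complex_of_real x2 powr (w + 1) - of_real x1 powr (w + 1)" for w
 have x2: "0 < x2" using x by simp
 have f1: "f (-1) = 0" using x x2 by (simp add: f_def)
 define G where "G w = (if w = -1 then deriv f (-1) else (f w - f (-1)) / (w - (-1)))" for w
 have fh: "f holomorphic_on UNIV" unfolding f_def[abs_def] using x x2 by (intro holomorphic_intros) auto
 have 1: "G holomorphic_on UNIV"
  unfolding G_def[abs_def] by (rule pole_lemma_open[OF fh]) auto
 have Gn: "G w = f w / (w + 1)" if "w ~= -1" for w using that by (simp add: G_def f1)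
 have 2: "riesz_kernel x1 x2 w = G w / w" if "w ~= 0" "w ~= -1" for w
  using that by (simp add: riesz_kernel_def Gn f_def mult.commute)
 have 3: "cmod (G w) <= (x2 - x1) * max (x1 powr Re w) (x2 powr Re w)" for w
 proof (cases "w = -1")
  case True
  have "(f has_field_derivative of_real (ln x2) - of_real (ln x1)) (at (-1))"
  proof -
   have p: "((%z. complex_of_real u powr (z + 1)) has_field_derivative of_real (ln u)) (at (-1))" if "u > 0" for u
   proof -
    have a: "((%z::complex. z + 1) has_field_derivative 1) (at (-1))" by (auto intro!: derivative_eq_intros)
    have "complex_of_real u ~= 0" using that by simp
    from DERIV_chain'[OF a has_field_derivative_powr_right[OF this]] show ?thesis
     using that by (simp add: Ln_of_real)
   qed
   show ?thesis unfolding f_def[abs_def] by (rule DERIV_diff[OF p[OF x2] p[OF x(1)]])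
  qed
  then have "G w = of_real (ln x2 - ln x1)" using True by (simp add: G_def DERIV_imp_deriv)
  then have "cmod (G w) = ln x2 - ln x1" using x x2 by (simp only: norm_of_real) simp
  also have "... = ln (x2 / x1)" using x x2 by (simp add: ln_div)
  also have "... <= x2 / x1 - 1" using x x2 by (intro ln_le_minus_one) simp
  also have "... = (x2 - x1) * x1 powr Re w" using True x by (simp add: powr_minus field_simps)
  also have "... <= (x2 - x1) * max (x1 powr Re w) (x2 powr Re w)" using x by (intro mult_left_mono) auto
  finally show ?thesis .
 next
  case False
  have "cmod (complex_of_real x2 powr (w + 1) - of_real x1 powr (w + 1))
    <= cmod (w + 1) * max (x1 powr Re w) (x2 powr Re w) * cmod (of_real x2 - of_real x1)"
  proof (rule field_differentiable_bound[where S = "closed_segment (of_real x1) (of_real x2)"])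
   fix z :: complex assume "z \<in> closed_segment (of_real x1) (of_real x2)"
   then obtain t where t: "z = of_real t" "x1 <= t" "t <= x2"
    using x by (auto simp: closed_segment_of_real closed_segment_eq_real_ivl)
   then have t0: "t > 0" using x by simp
   then have "z \<notin> \<real>\<^sub>\<le>\<^sub>0" using t by auto
   then show "((%z. z powr (w + 1)) has_field_derivative (w + 1) * z powr w) (at z within closed_segment (of_real x1) (of_real x2))"
    using has_field_derivative_powr[of z "w + 1"] by (auto intro: has_field_derivative_at_within)
   have "t powr Re w <= max (x1 powr Re w) (x2 powr Re w)"
   proof (cases "Re w >= 0")
    case True
    then have "t powr Re w <= x2 powr Re w" using t t0 by (intro powr_mono2) auto
    then show ?thesis by simp
   next
    case False
    then have "t powr Re w <= x1 powr Re w" using t x by (intro powr_mono2') auto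
    then show ?thesis by simp
   qed
   then show "cmod ((w + 1) * z powr w) <= cmod (w + 1) * max (x1 powr Re w) (x2 powr Re w)"
    using t0 unfolding norm_mult t(1) by (intro mult_left_mono) (auto simp: norm_powr_real_powr)
  qed auto
  also have "cmod (of_real x2 - of_real x1) = x2 - x1" using x by (simp flip: of_real_diff)
  finally have "cmod (f w) <= cmod (w + 1) * max (x1 powr Re w) (x2 powr Re w) * (x2 - x1)" by (simp add: f_def)
  moreover have "cmod (w + 1) > 0" using False by (auto simp: add_eq_0_iff2)
  ultimately show ?thesis using False by (simp add: Gn norm_divide divide_le_eq mult_ac)
 qed
 have 4: "cmod (G w) <= (x1 powr (Re w + 1) + x2 powr (Re w + 1)) / cmod (w + 1)" if "w ~= -1" for w
 proof -
  have "cmod (f w) <= x2 powr (Re w + 1) + x1 powr (Re w + 1)"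
   unfolding f_def by (rule order_trans[OF norm_triangle_ineq4]) (use x x2 in \<open>simp add: norm_powr_real_powr\<close>)
  then show ?thesis using that by (simp add: Gn norm_divide divide_right_mono add.commute)
 qed
 show ?thesis using that[OF 1 2 3 4] .
qed

text \<open>The form w Q w of the series cancels the pole of the kernel at 0. The two bounds for G,
  of sizes A1 and A2/(1 + |v|), are interpolated with weights 1 - \<theta> and \<theta>, and the
  resulting (1 + |v|)^(-\<theta>) makes the integral converge. For a smooth weight \<theta> = 1
  costs nothing; for a sharp cutoff A2 exceeds A1 by a factor of order x, and a small \<theta> loses
  only x^\<theta>.\<close>

theorem perron_riesz_bound:
 fixes m :: "nat => complex"
 assumes b: "0 < b" and m: "summable (%n. cmod (m n) * real (Suc n) powr -b)" and x: "0 < x1" "x1 <= x2"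
  and bt: "bt0 < bt" "bt <= b" and Q: "Q holomorphic_on {w. Re w > bt0}"
  and QF: "!!w. Re w = b ==> (\<Sum>n. m n * of_nat (Suc n) powr (-w)) = w * Q w"
  and hor: "!!w. bt <= Re w ==> Re w <= b ==> 1 <= \<bar>Im w\<bar> ==> cmod (Q w) <= B"
  and left: "!!v. cmod (Q (Complex bt v)) <= L * (1 + \<bar>v\<bar>) powr (-1 + \<theta> / 2)" and \<theta>: "0 < \<theta>" "\<theta> <= 1"
  and A: "(x2 - x1) * max (x1 powr bt) (x2 powr bt) <= A1" "x1 powr (bt + 1) + x2 powr (bt + 1) <= A2" "A1 <= A2"
 shows "cmod (\<Sum>n. m n * of_real (riesz_diff x1 x2 (Suc n))) <= 4 * L * A1 powr (1 - \<theta>) * A2 powr \<theta> / \<theta>"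
proof -
 obtain G where G: "G holomorphic_on UNIV"
  "!!w. w ~= 0 ==> w ~= -1 ==> riesz_kernel x1 x2 w = G w / w"
  "!!w. cmod (G w) <= (x2 - x1) * max (x1 powr Re w) (x2 powr Re w)"
  "!!w. w ~= -1 ==> cmod (G w) <= (x1 powr (Re w + 1) + x2 powr (Re w + 1)) / cmod (w + 1)"
  using powr_difference_quotient[OF x] by blast
 have x2: "0 < x2" using x by simp
 have L0: "0 <= L" using order_trans[OF norm_ge_zero left[of 0]] by simp
 have B0: "0 <= B" using order_trans[OF norm_ge_zero hor[of "Complex b 1"]] bt by simp
 have A10: "0 <= A1" using A(1) x by (meson order_trans mult_nonneg_nonneg diff_ge_0_iff_ge powr_ge_zero max.coboundedI1)
 have A20: "0 < A2" using A(2) x by (intro less_le_trans[OF _ A(2)] add_pos_nonneg) auto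
 define A3 where "A3 = x1 powr (bt + 1) + x1 powr (b + 1) + x2 powr (bt + 1) + x2 powr (b + 1)"
 define J where "J = L * (A1 powr (1 - \<theta>) * (2 * A2) powr \<theta>)"
 have mono: "y powr (u + 1) <= y powr (bt + 1) + y powr (b + 1)" if "bt <= u" "u <= b" "0 < y" for u y :: real
 proof (cases "y >= 1")
  case True
  then have "y powr (u + 1) <= y powr (b + 1)" using that by (intro powr_mono) auto
  then show ?thesis using powr_ge_zero[of y "bt + 1"] by linarith
 next
  case False
  then have "y powr (u + 1) <= y powr (bt + 1)" using that by (intro powr_mono') auto
  then show ?thesis using powr_ge_zero[of y "b + 1"] by linarith
 qed
 have "cmod (\<Sum>n. m n * of_real (riesz_diff x1 x2 (Suc n))) <= J / (\<theta> / 2)"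
 proof (rule perron_shift_bound[OF b m x(1) x2 bt, where H = "%w. Q w * G w" and B = "B * A3"])
  show "(%w. Q w * G w) holomorphic_on {w. Re w > bt0}"
   by (intro holomorphic_intros Q holomorphic_on_subset[OF G(1)]) auto
  show "Q w * G w = (\<Sum>n. m n * of_nat (Suc n) powr (-w)) * riesz_kernel x1 x2 w" if w: "Re w = b" for w
  proof -
   have "w ~= 0" "w ~= -1" using w b by auto
   then show ?thesis using QF[OF w] G(2)[of w] by simp
  qed
  show "cmod (Q w * G w) <= B * A3 / \<bar>Im w\<bar>" if w: "bt <= Re w" "Re w <= b" "1 <= \<bar>Im w\<bar>" for w
  proof -
   have ne: "w ~= -1" using w by auto
   have "cmod (G w) <= (x1 powr (Re w + 1) + x2 powr (Re w + 1)) / cmod (w + 1)" by (rule G(4)[OF ne])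
   also have "... <= A3 / \<bar>Im w\<bar>"
   proof (rule frac_le)
    show "x1 powr (Re w + 1) + x2 powr (Re w + 1) <= A3"
     using mono[OF w(1,2) x(1)] mono[OF w(1,2) x2] by (simp add: A3_def)
    show "\<bar>Im w\<bar> <= cmod (w + 1)" using abs_Im_le_cmod[of "w + 1"] by simp
   qed (use w in \<open>auto simp: A3_def\<close>)
   finally have "cmod (Q w) * cmod (G w) <= B * (A3 / \<bar>Im w\<bar>)" using hor[OF w] B0 by (intro mult_mono) auto
   then show ?thesis by (simp add: norm_mult)
  qed
  show "cmod (Q (Complex bt v) * G (Complex bt v)) <= J * (1 + \<bar>v\<bar>) powr (-1 - \<theta> / 2)" for v
  proof -
   have Ga: "cmod (G (Complex bt v)) <= A1" using G(3)[of "Complex bt v"] A(1) by simp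
   have "cmod (G (Complex bt v)) <= A1 powr (1 - \<theta>) * (2 * A2 / (1 + \<bar>v\<bar>)) powr \<theta>"
   proof -
    have Gb: "cmod (G (Complex bt v)) <= 2 * A2 / (1 + \<bar>v\<bar>)"
    proof (cases "\<bar>v\<bar> <= 1")
     case True
     have "A1 * (1 + \<bar>v\<bar>) <= A2 * 2" using A(3) A10 True by (intro mult_mono) auto
     then have "A1 <= 2 * A2 / (1 + \<bar>v\<bar>)" by (subst pos_le_divide_eq) (auto simp: mult.commute)
     then show ?thesis using Ga by simp
    next
     case False
     have ne: "Complex bt v ~= -1" using False by (auto simp: complex_eq_iff)
     have "cmod (G (Complex bt v)) <= (x1 powr (bt + 1) + x2 powr (bt + 1)) / cmod (Complex bt v + 1)"
      using G(4)[OF ne] by simp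
     also have "... <= A2 / ((1 + \<bar>v\<bar>) / 2)"
      using abs_Im_le_cmod[of "Complex bt v + 1"] False A(2) A20 by (intro frac_le) auto
     finally show ?thesis by (simp add: mult.commute)
    qed
    show ?thesis
    proof (cases "cmod (G (Complex bt v)) = 0")
     case False
     then have g: "0 < cmod (G (Complex bt v))" by simp
     then have "cmod (G (Complex bt v)) = cmod (G (Complex bt v)) powr (1 - \<theta>) * cmod (G (Complex bt v)) powr \<theta>"
      by (simp flip: powr_add)
     also have "... <= A1 powr (1 - \<theta>) * (2 * A2 / (1 + \<bar>v\<bar>)) powr \<theta>"
      using Ga Gb \<theta> by (intro mult_mono powr_mono2) auto
     finally show ?thesis .
    qed simp
   qed
   also have "(2 * A2 / (1 + \<bar>v\<bar>)) powr \<theta> = (2 * A2) powr \<theta> * (1 + \<bar>v\<bar>) powr -\<theta>"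
    using A20 by (simp add: powr_divide powr_minus_divide)
   finally have "cmod (Q (Complex bt v)) * cmod (G (Complex bt v))
     <= (L * (1 + \<bar>v\<bar>) powr (-1 + \<theta> / 2)) * (A1 powr (1 - \<theta>) * ((2 * A2) powr \<theta> * (1 + \<bar>v\<bar>) powr -\<theta>))"
    using left[of v] L0 by (intro mult_mono) auto
   also have "... = J * ((1 + \<bar>v\<bar>) powr (-1 + \<theta> / 2) * (1 + \<bar>v\<bar>) powr -\<theta>)" by (simp add: J_def mult_ac)
   also have "(1 + \<bar>v\<bar>) powr (-1 + \<theta> / 2) * (1 + \<bar>v\<bar>) powr -\<theta> = (1 + \<bar>v\<bar>) powr (-1 - \<theta> / 2)"
    unfolding powr_add[symmetric] by (rule arg_cong[where f = "(powr) (1 + \<bar>v\<bar>)"]) simp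
   finally show ?thesis by (simp add: norm_mult)
  qed
 qed (use \<theta> in auto)
 also have "J / (\<theta> / 2) <= 4 * L * A1 powr (1 - \<theta>) * A2 powr \<theta> / \<theta>"
 proof -
  have "(2 * A2) powr \<theta> = 2 powr \<theta> * A2 powr \<theta>" using A20 by (simp add: powr_mult)
  also have "... <= 2 * A2 powr \<theta>" using \<theta> powr_mono[of \<theta> 1 2] by (intro mult_right_mono) auto
  finally have "L * (A1 powr (1 - \<theta>) * (2 * A2) powr \<theta>) <= L * (A1 powr (1 - \<theta>) * (2 * A2 powr \<theta>))"
   using L0 by (intro mult_left_mono) auto
  then have "J * 2 / \<theta> <= (L * (A1 powr (1 - \<theta>) * (2 * A2 powr \<theta>))) * 2 / \<theta>"
   unfolding J_def using \<theta> by (intro divide_right_mono mult_right_mono) auto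
  then show ?thesis by (simp add: mult_ac)
 qed
 finally show ?thesis .
qed

section \<open>Smoothed sums of the coefficients\<close>

text \<open>Written through \<open>riesz_diff\<close> so that weighted sums are accessible to the
  Perron formula.\<close>

definition tent :: "real => nat => real" where
 "tent y n = riesz_diff y (2 * y) n / y"

lemma tent_eq_1: "0 < y ==> real n <= y ==> tent y n = 1"
 by (simp add: tent_def riesz_diff_def)

lemma tent_eq_0: "0 < y ==> 2 * y <= real n ==> tent y n = 0"
 by (simp add: tent_def riesz_diff_def)

lemma tent_bounds: "0 < y ==> 0 <= tent y n" "0 < y ==> tent y n <= 1"
 by (auto simp: tent_def riesz_diff_def field_simps max_def)

definition smooth_sum :: "real => complex => complex" where
 "smooth_sum y s = (\<Sum>n | 0 < n \<and> real n <= 2 * y. of_real (tent y n * moebius2 n) * of_nat n powr (-s))"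

lemma finite_pos_le: "finite {n::nat. 0 < n \<and> real n <= x}"
 by (rule finite_subset[of _ "{..nat \<lfloor>x\<rfloor>}"]) (auto simp: le_nat_floor)

lemma smooth_sum_holo: "smooth_sum y holomorphic_on A"
 unfolding smooth_sum_def[abs_def] by (intro holomorphic_intros) auto

text \<open>The constant c is subtracted from the coefficient of n = 1, which has index 0 here and
  weight 1. With c = zi2 s the generating series becomes zi2(s + w) - zi2 s and vanishes at w = 0,
  where the kernel has its pole.\<close>

lemma smooth_sum_riesz:
 assumes y: "1 <= y"
 shows "(%n. (dterm moebius2 s (Suc n) - (if n = 0 then c else 0)) * of_real (riesz_diff y (2 * y) (Suc n)))
  sums (of_real y * (smooth_sum y s - c))"
proof -
 define N where "N = {n. real (Suc n) <= 2 * y}"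
 have fin: "finite N" unfolding N_def
  by (rule finite_subset[of _ "{..nat \<lfloor>2 * y\<rfloor>}"]) (auto simp: le_nat_floor)
 have t: "riesz_diff y (2 * y) n = y * tent y n" for n using y by (simp add: tent_def)
 have "(%n. (dterm moebius2 s (Suc n) - (if n = 0 then c else 0)) * of_real (riesz_diff y (2 * y) (Suc n)))
   sums (\<Sum>n\<in>N. (dterm moebius2 s (Suc n) - (if n = 0 then c else 0)) * of_real (riesz_diff y (2 * y) (Suc n)))"
 proof (rule sums_finite[OF fin])
  fix n assume "n \<notin> N"
  then have "riesz_diff y (2 * y) (Suc n) = 0" using y tent_eq_0[of y "Suc n"] unfolding t by (simp add: N_def)
  then show "(dterm moebius2 s (Suc n) - (if n = 0 then c else 0)) * of_real (riesz_diff y (2 * y) (Suc n)) = 0" by simp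
 qed
 also have "(\<Sum>n\<in>N. (dterm moebius2 s (Suc n) - (if n = 0 then c else 0)) * of_real (riesz_diff y (2 * y) (Suc n)))
   = (\<Sum>n\<in>N. of_real y * (of_real (tent y (Suc n) * moebius2 (Suc n)) * of_nat (Suc n) powr (-s)))
    - (\<Sum>n\<in>N. if n = 0 then c * of_real (riesz_diff y (2 * y) (Suc n)) else 0)"
  unfolding sum_subtractf[symmetric] t
  by (intro sum.cong refl) (auto simp: dterm_def algebra_simps simp del: of_nat_Suc)
 also have "(\<Sum>n\<in>N. if n = 0 then c * of_real (riesz_diff y (2 * y) (Suc n)) else 0) = c * of_real y"
 proof -
  have "0 \<in> N" using y by (simp add: N_def)
  moreover have "riesz_diff y (2 * y) (Suc 0) = y" using y tent_eq_1[of y "Suc 0"] by (simp add: t)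
  ultimately show ?thesis using fin by (simp add: sum.delta)
 qed
 also have "(\<Sum>n\<in>N. of_real y * (of_real (tent y (Suc n) * moebius2 (Suc n)) * of_nat (Suc n) powr (-s)))
   = of_real y * smooth_sum y s"
  unfolding smooth_sum_def sum_distrib_left[symmetric]
  by (intro arg_cong2[where f = "(*)"] refl sum.reindex_bij_witness[of _ "%n. n - 1" Suc]) (auto simp: N_def of_nat_diff)
 finally show ?thesis by (simp add: algebra_simps)
qed

lemma dabs_summable:
 assumes "dabs f s" shows "summable (%n. cmod (dterm f s (Suc n)))"
proof -
 have "(%n. norm (dterm f s n)) summable_on (Suc ` UNIV)"
  using assms by (simp add: dabs_def greaterThan_0)
 then have "(%n. norm (dterm f s (Suc n))) summable_on UNIV"
  by (subst (asm) summable_on_reindex) (auto simp: o_def)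
 then show ?thesis by (simp add: summable_on_UNIV_nonneg_real_iff)
qed

lemma dterm_shift: "dterm f s n * of_nat n powr (-w) = dterm f (s + w) n"
 by (cases "n = 0") (simp_all add: dterm_def powr_add powr_minus powr_diff divide_inverse)

lemma moebius2_series_perturbed:
 assumes s: "Re s + b > 1"
 shows "summable (%n. cmod (dterm moebius2 s (Suc n) - (if n = 0 then c else 0)) * real (Suc n) powr -b)"
  and "Re w = b ==> (\<Sum>n. (dterm moebius2 s (Suc n) - (if n = 0 then c else 0)) * of_nat (Suc n) powr (-w)) = zi2 (s + w) - c"
proof -
 have d: "dabs moebius2 (s + w)" if "Re w = b" for w using s that by (intro dabs_moebius2) simp
 have ns: "cmod (dterm moebius2 s (Suc n)) * real (Suc n) powr -b = cmod (dterm moebius2 (s + of_real b) (Suc n))" for n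
  by (simp add: norm_dterm powr_diff powr_minus divide_inverse mult.assoc flip: powr_add del: of_nat_Suc)
 have fs: "(%n. if n = 0 then a else 0) sums a" for a :: "'a::real_normed_vector"
  using sums_If_finite_set[of "{0::nat}" "%_. a"] by simp
 show "summable (%n. cmod (dterm moebius2 s (Suc n) - (if n = 0 then c else 0)) * real (Suc n) powr -b)"
 proof (rule summable_comparison_test'[where N = 0])
  show "summable (%n. cmod (dterm moebius2 (s + of_real b) (Suc n)) + (if n = 0 then cmod c else 0))"
   by (intro summable_add dabs_summable d sums_summable[OF fs]) simp
  fix n :: nat
  have "cmod (dterm moebius2 s (Suc n) - (if n = 0 then c else 0)) * real (Suc n) powr -b
    <= (cmod (dterm moebius2 s (Suc n)) + cmod (if n = 0 then c else 0)) * real (Suc n) powr -b"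
   by (intro mult_right_mono norm_triangle_ineq4) auto
  also have "... = cmod (dterm moebius2 (s + of_real b) (Suc n)) + (if n = 0 then cmod c else 0)"
   unfolding distrib_right ns by simp
  finally show "norm (cmod (dterm moebius2 s (Suc n) - (if n = 0 then c else 0)) * real (Suc n) powr -b)
    <= cmod (dterm moebius2 (s + of_real b) (Suc n)) + (if n = 0 then cmod c else 0)" by simp
 qed
 assume w: "Re w = b"
 have r: "1 < Re (s + w)" using s w by simp
 have "(%n. dterm moebius2 (s + w) (Suc n) - (if n = 0 then c else 0)) sums (dser moebius2 (s + w) - c)"
  by (intro sums_diff dser_sums d w fs)
 moreover have "(dterm moebius2 s (Suc n) - (if n = 0 then c else 0)) * of_nat (Suc n) powr (-w)
   = dterm moebius2 (s + w) (Suc n) - (if n = 0 then c else 0)" for n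
  unfolding left_diff_distrib dterm_shift by simp
 ultimately show "(\<Sum>n. (dterm moebius2 s (Suc n) - (if n = 0 then c else 0)) * of_nat (Suc n) powr (-w)) = zi2 (s + w) - c"
  unfolding zi2_def using dser_moebius2[OF r] by (simp add: sums_iff)
qed

lemma tent_kernel_bounds:
 fixes y bt :: real
 assumes y: "1 <= y" and bt: "bt <= 1"
 shows "(2 * y - y) * max (y powr bt) ((2 * y) powr bt) <= 9 * y powr (1 + bt)"
  "y powr (bt + 1) + (2 * y) powr (bt + 1) <= 9 * y powr (1 + bt)"
proof -
 have 2: "(2::real) powr bt <= 2" "(2::real) powr (bt + 1) <= 4"
  using powr_mono[of bt 1 "2::real"] powr_mono[of "bt + 1" 2 "2::real"] bt by auto
 have m: "(2 * y) powr bt = 2 powr bt * y powr bt" "(2 * y) powr (bt + 1) = 2 powr (bt + 1) * y powr (bt + 1)"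
  by (rule powr_mult)+
 have "(2 * y) powr bt <= 2 * y powr bt" unfolding m using 2 by (intro mult_right_mono) auto
 then have "max (y powr bt) ((2 * y) powr bt) <= 9 * y powr bt" using powr_ge_zero[of y bt] by linarith
 then have "y * max (y powr bt) ((2 * y) powr bt) <= y * (9 * y powr bt)" using y by (intro mult_left_mono) auto
 also have "... = 9 * y powr (1 + bt)" using y by (simp add: powr_add)
 finally show "(2 * y - y) * max (y powr bt) ((2 * y) powr bt) <= 9 * y powr (1 + bt)" by simp
 have "(2 * y) powr (bt + 1) <= 4 * y powr (bt + 1)" unfolding m using 2 by (intro mult_right_mono) auto
 moreover have "0 <= y powr (bt + 1)" by simp
 ultimately have "y powr (bt + 1) + (2 * y) powr (bt + 1) <= 9 * y powr (bt + 1)" by linarith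
 then show "y powr (bt + 1) + (2 * y) powr (bt + 1) <= 9 * y powr (1 + bt)" by (simp add: add.commute)
qed

lemma one_plus_abs_powr_add:
 assumes "0 <= ep" shows "(1 + \<bar>t + v\<bar>) powr ep <= (1 + \<bar>t\<bar>) powr ep * (1 + \<bar>v::real\<bar>) powr ep"
proof -
 have "1 + \<bar>t + v\<bar> <= (1 + \<bar>t\<bar>) * (1 + \<bar>v\<bar>)"
 proof -
  have "(1 + \<bar>t\<bar>) * (1 + \<bar>v\<bar>) = 1 + \<bar>t\<bar> + \<bar>v\<bar> + \<bar>t\<bar> * \<bar>v\<bar>" by (simp add: algebra_simps)
  moreover have "0 <= \<bar>t\<bar> * \<bar>v\<bar>" by simp
  ultimately show ?thesis using abs_triangle_ineq[of t v] by linarith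
 qed
 then have "(1 + \<bar>t + v\<bar>) powr ep <= ((1 + \<bar>t\<bar>) * (1 + \<bar>v\<bar>)) powr ep" using assms by (intro powr_mono2) auto
 also have "... = (1 + \<bar>t\<bar>) powr ep * (1 + \<bar>v\<bar>) powr ep" by (rule powr_mult)
 finally show ?thesis .
qed

text \<open>The line of integration is moved to Re(s + w) = 1/2 + dl, that is to Re w =
  \<open>bt\<close> <= -dl, across the pole of the kernel at w = 0. Its residue is the main term zi2
  s, and subtracting zi2 s from the first coefficient removes the pole instead of evaluating
  it.\<close>

theorem smooth_tail_bound:
 assumes RH: riemann_hypothesis and d: "0 < dl" "dl < 1" and e: "0 < ep" "ep <= 1/2"
 obtains C where "C >= 1" "!!y s. 1 <= y ==> 1/2 + 2 * dl <= Re s ==>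
  cmod (zi2 s - smooth_sum y s) <= C * y powr (1/2 + dl - Re s) * ht s powr ep"
proof -
 obtain C where C: "C >= 1" "!!s. 1/2 + dl <= Re s ==> cmod (zi2 s) <= C * ht s powr ep"
  by (rule zeta_bounds_RH[OF RH d e(1)]) blast
 define K where "K = 4 * (4 * C / dl) * 9"
 have K: "K >= 1" using C d unfolding K_def by (simp add: field_simps)
 show ?thesis
 proof (rule that[OF K])
  fix y :: real and s assume y: "1 <= y" and s: "1/2 + 2 * dl <= Re s"
  define F where "F w = zi2 (s + w)" for w
  \<comment> \<open>The difference quotient with its removable singularity at 0 filled in.\<close>
  define Q where "Q w = (if w = 0 then deriv F 0 else (F w - F 0) / (w - 0))" for w
  define bt where "bt = 1/2 + dl - Re s"
  define L where "L = 4 * C / dl * ht s powr ep"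
  have bt: "bt <= - dl" using s by (simp add: bt_def)
  have Fh: "F holomorphic_on {w. Re w > 1/2 - Re s}"
  proof -
   have "(zi2 \<circ> (%w. s + w)) holomorphic_on {w. Re w > 1/2 - Re s}"
    by (rule holomorphic_on_compose_gen[OF _ zi2_holo[OF RH]]) (auto intro!: holomorphic_intros)
   then show ?thesis by (simp add: F_def[abs_def] o_def)
  qed
  have Qh: "Q holomorphic_on {w. Re w > 1/2 - Re s}"
   unfolding Q_def[abs_def] by (rule pole_lemma_open[OF Fh open_halfspace_Re_gt])
  have Fb: "cmod (F w - F 0) <= 2 * C * ht s powr ep * ht w powr ep" if "bt <= Re w" for w
  proof -
   have "cmod (F w) <= C * (1 + \<bar>Im s + Im w\<bar>) powr ep" using C(2)[of "s + w"] that by (simp add: F_def bt_def)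
   also have "... <= C * (ht s powr ep * ht w powr ep)"
    using C e by (intro mult_left_mono one_plus_abs_powr_add) auto
   finally have 1: "cmod (F w) <= C * ht s powr ep * ht w powr ep" by (simp add: mult.assoc)
   have "cmod (F 0) <= C * ht s powr ep * 1" using C(2)[of s] s d by (simp add: F_def)
   also have "... <= C * ht s powr ep * ht w powr ep"
    using C e by (intro mult_left_mono ge_one_powr_ge_zero) auto
   finally show ?thesis using 1 norm_triangle_ineq4[of "F w" "F 0"] by linarith
  qed
  have "cmod (\<Sum>n. (dterm moebius2 s (Suc n) - (if n = 0 then zi2 s else 0)) * of_real (riesz_diff y (2 * y) (Suc n)))
   <= 4 * L * (9 * y powr (1 + bt)) powr (1 - 1) * (9 * y powr (1 + bt)) powr 1 / 1"
  proof (rule perron_riesz_bound[where b = 2 and Q = Q and ?bt0.0 = "1/2 - Re s" and bt = bt and B = "4 * C * ht s powr ep"])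
   show "summable (%n. cmod (dterm moebius2 s (Suc n) - (if n = 0 then zi2 s else 0)) * real (Suc n) powr -2)"
    by (rule moebius2_series_perturbed(1)) (use s d in simp)
   show "(\<Sum>n. (dterm moebius2 s (Suc n) - (if n = 0 then zi2 s else 0)) * of_nat (Suc n) powr (-w)) = w * Q w" if w: "Re w = 2" for w
   proof -
    have "w ~= 0" using w by auto
    moreover have "Re s + 2 > 1" using s d by simp
    ultimately show ?thesis using moebius2_series_perturbed(2)[of s 2 w "zi2 s"] w by (simp add: Q_def F_def)
   qed
   show "cmod (Q w) <= 4 * C * ht s powr ep" if w: "bt <= Re w" "Re w <= 2" "1 <= \<bar>Im w\<bar>" for w
   proof -
    have ne: "w ~= 0" using w by auto
    have "ht w powr ep <= ht w powr 1" using e by (intro powr_mono) auto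
    also have "... <= 2 * cmod w" using w abs_Im_le_cmod[of w] by simp
    finally have "2 * C * ht s powr ep * ht w powr ep <= 2 * C * ht s powr ep * (2 * cmod w)"
     using C by (intro mult_left_mono) auto
    also have "... = 4 * C * ht s powr ep * cmod w" by simp
    finally have "cmod (F w - F 0) <= 4 * C * ht s powr ep * cmod w" by (rule order_trans[OF Fb[OF w(1)]])
    then show ?thesis using ne by (simp add: Q_def norm_divide divide_le_eq)
   qed
   show "cmod (Q (Complex bt v)) <= L * (1 + \<bar>v\<bar>) powr (-1 + 1 / 2)" for v
   proof -
    have ne: "Complex bt v ~= 0" using bt d by (auto simp: complex_eq_iff)
    have w: "dl * (1 + \<bar>v\<bar>) / 2 <= cmod (Complex bt v)"
    proof -
     have "dl <= cmod (Complex bt v)" "\<bar>v\<bar> <= cmod (Complex bt v)"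
      using abs_Re_le_cmod[of "Complex bt v"] abs_Im_le_cmod[of "Complex bt v"] bt d by auto
     moreover have "dl * \<bar>v\<bar> <= 1 * \<bar>v\<bar>" using d by (intro mult_right_mono) auto
     ultimately show ?thesis by (simp add: distrib_left)
    qed
    have w0: "0 < dl * (1 + \<bar>v\<bar>) / 2" using d by simp
    have "cmod (Q (Complex bt v)) = cmod (F (Complex bt v) - F 0) / cmod (Complex bt v)" using ne by (simp add: Q_def norm_divide)
    also have "... <= 2 * C * ht s powr ep * (1 + \<bar>v\<bar>) powr ep / (dl * (1 + \<bar>v\<bar>) / 2)"
     using Fb[of "Complex bt v"] w w0 C by (intro frac_le) auto
    also have "... = L * ((1 + \<bar>v\<bar>) powr ep / (1 + \<bar>v\<bar>) powr 1)" using d by (simp add: L_def)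
    also have "(1 + \<bar>v\<bar>) powr ep / (1 + \<bar>v\<bar>) powr 1 = (1 + \<bar>v\<bar>) powr (ep - 1)" by (simp add: powr_diff)
    also have "L * (1 + \<bar>v\<bar>) powr (ep - 1) <= L * (1 + \<bar>v\<bar>) powr (-1 + 1 / 2)"
     using C d e by (intro mult_left_mono powr_mono) (auto simp: L_def)
    finally show ?thesis .
   qed
   show "(2 * y - y) * max (y powr bt) ((2 * y) powr bt) <= 9 * y powr (1 + bt)"
    "y powr (bt + 1) + (2 * y) powr (bt + 1) <= 9 * y powr (1 + bt)"
    by (rule tent_kernel_bounds[OF y]; use bt d in simp)+
  qed (use y bt d Qh in \<open>auto simp: bt_def\<close>)
  also have "... = y * (K * y powr bt * ht s powr ep)"
   using y by (simp add: L_def K_def powr_add)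
  finally have "y * cmod (smooth_sum y s - zi2 s) <= y * (K * y powr bt * ht s powr ep)"
   using y by (simp add: sums_unique[OF smooth_sum_riesz[OF y], symmetric] norm_mult)
  then show "cmod (zi2 s - smooth_sum y s) <= K * y powr (1/2 + dl - Re s) * ht s powr ep"
   using y by (simp add: bt_def norm_minus_commute)
 qed
qed

text \<open>At s = 0 the line Re w = 1/2 + dl remains to the right of the pole at w = 0, so no main
  term has to be subtracted.\<close>

theorem smooth_sum_0_bound:
 assumes RH: riemann_hypothesis and d: "0 < dl" "dl <= 1/2"
 obtains C where "C >= 1" "!!y. 1 <= y ==> cmod (smooth_sum y 0) <= C * y powr (1/2 + dl)"
proof -
 obtain C where C: "C >= 1" "!!s. 1/2 + dl <= Re s ==> cmod (zi2 s) <= C * ht s powr (1/2)"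
 proof -
  have "dl < 1" "(0::real) < 1/2" using d by auto
  then show ?thesis
  proof (rule zeta_bounds_RH[OF RH d(1)])
   fix C :: real
   assume "1 <= C" "!!s. 1/2 + dl <= Re s ==> cmod (zi2 s) <= C * ht s powr (1/2)"
   then show ?thesis by (rule that)
  qed
 qed
 define K where "K = 4 * (4 * C) * 9"
 have K: "K >= 1" using C unfolding K_def by simp
 show ?thesis
 proof (rule that[OF K])
  fix y :: real assume y: "1 <= y"
  define bt where "bt = 1/2 + dl"
  define Q where "Q w = zi2 w / w" for w
  have Qh: "Q holomorphic_on {w. Re w > 1/2}"
   unfolding Q_def[abs_def] using zi2_holo[OF RH] by (intro holomorphic_intros) auto
  have Qb: "cmod (Q w) <= 4 * C * ht w powr (-1 + 1 / 2)" if w: "bt <= Re w" for w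
  proof -
   have c: "ht w / 4 <= cmod w"
    using abs_Re_le_cmod[of w] abs_Im_le_cmod[of w] w d by (simp add: bt_def)
   have "cmod (Q w) <= C * ht w powr (1/2) / (ht w / 4)"
    unfolding Q_def norm_divide using c C(2)[of w] w C(1) by (intro frac_le) (auto simp: bt_def)
   also have "... = 4 * C * (ht w powr (1/2) / ht w powr 1)" by simp
   also have "ht w powr (1/2) / ht w powr 1 = ht w powr (1/2 - 1)" by (simp only: powr_diff)
   finally show ?thesis by simp
  qed
  have "cmod (\<Sum>n. (dterm moebius2 0 (Suc n) - (if n = 0 then 0 else 0)) * of_real (riesz_diff y (2 * y) (Suc n)))
   <= 4 * (4 * C) * (9 * y powr (1 + bt)) powr (1 - 1) * (9 * y powr (1 + bt)) powr 1 / 1"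
  proof (rule perron_riesz_bound[where b = 2 and Q = Q and ?bt0.0 = "1/2" and bt = bt and B = "4 * C"])
   show "summable (%n. cmod (dterm moebius2 0 (Suc n) - (if n = 0 then 0 else 0)) * real (Suc n) powr -2)"
    by (rule moebius2_series_perturbed(1)) simp
   show "(\<Sum>n. (dterm moebius2 0 (Suc n) - (if n = 0 then 0 else 0)) * of_nat (Suc n) powr (-w)) = w * Q w" if w: "Re w = 2" for w
   proof -
    have "w ~= 0" using w by auto
    then show ?thesis using moebius2_series_perturbed(2)[of 0 2 w 0] w by (simp add: Q_def)
   qed
   show "cmod (Q w) <= 4 * C" if w: "bt <= Re w" "Re w <= 2" "1 <= \<bar>Im w\<bar>" for w
   proof -
    have "ht w powr (-1 + 1/2) <= ht w powr 0" by (intro powr_mono) auto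
    also have "... = 1" using abs_ge_zero[of "Im w"] by (simp del: abs_ge_zero)
    finally have "4 * C * ht w powr (-1 + 1/2) <= 4 * C * 1" using C by (intro mult_left_mono) auto
    then show ?thesis using Qb[OF w(1)] by simp
   qed
   show "cmod (Q (Complex bt v)) <= 4 * C * (1 + \<bar>v\<bar>) powr (-1 + 1 / 2)" for v
    using Qb[of "Complex bt v"] by simp
   show "(2 * y - y) * max (y powr bt) ((2 * y) powr bt) <= 9 * y powr (1 + bt)"
    "y powr (bt + 1) + (2 * y) powr (bt + 1) <= 9 * y powr (1 + bt)"
    by (rule tent_kernel_bounds[OF y]; use d in \<open>simp add: bt_def\<close>)+
  qed (use y d Qh in \<open>auto simp: bt_def\<close>)
  also have "... = y * (K * y powr bt)"
   using y by (simp add: K_def powr_add)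
  finally have "y * cmod (smooth_sum y 0) <= y * (K * y powr bt)"
   using sums_unique[OF smooth_sum_riesz[OF y, of 0 0], symmetric] y by (simp add: norm_mult)
  then show "cmod (smooth_sum y 0) <= K * y powr (1/2 + dl)"
   using y by (simp add: bt_def)
 qed
qed

section \<open>The contribution of the large divisors\<close>

text \<open>For k > 0 the sum has at most one term: the values of f are moved to the k-th powers.
  The Dirichlet series becomes that of f at k s, and the condition l^a d^c = n becomes a Dirichlet
  convolution.\<close>

definition psup :: "nat => (nat => real) => nat => real" where
 "psup k f n = (\<Sum>d | 0 < d \<and> d ^ k = n. f d)"

abbreviation "pw a \<equiv> psup a (%_. 1)"

lemma psup_power: "0 < k ==> 0 < d ==> psup k f (d ^ k) = f d"
proof -
 assume k: "0 < k" and d: "0 < d"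
 have "{e. 0 < e \<and> e ^ k = d ^ k} = {d}" using k d by (auto simp: power_eq_iff_eq_base)
 then show ?thesis by (simp add: psup_def)
qed

lemma psup_eq_0: "n \<notin> (%d. d ^ k) ` {0<..} ==> psup k f n = 0"
 unfolding psup_def by (rule sum.neutral) auto

lemma of_nat_power_powr:
 assumes "0 < d" shows "of_nat (d ^ k) powr s = (of_nat d powr (of_nat k * s) :: complex)"
proof -
 have "Ln (of_nat (d ^ k)) = (of_real (ln (real (d ^ k))) :: complex)" by (rule Ln_of_nat) (use assms in simp)
 also have "ln (real (d ^ k)) = real k * ln (real d)" using assms by (simp add: ln_realpow)
 also have "complex_of_real ... = of_nat k * Ln (of_nat d)" using assms by (simp add: Ln_of_nat)
 finally show ?thesis using assms by (simp add: powr_def mult_ac del: of_nat_power)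
qed

lemma dser_psup:
 assumes k: "0 < k" and f: "dabs f (of_nat k * s)"
 shows "dabs (psup k f) s" "dser (psup k f) s = dser f (of_nat k * s)"
proof -
 let ?p = "%d::nat. d ^ k"
 have inj: "inj_on ?p {0<..}" using k by (auto simp: inj_on_def power_eq_iff_eq_base)
 have t: "dterm (psup k f) s (?p d) = dterm f (of_nat k * s) d" if "0 < d" for d
  using of_nat_power_powr[OF that, of k "-s"] psup_power[OF k that] by (simp add: dterm_def del: of_nat_power)
 have z: "dterm (psup k f) s n = 0" if "n \<notin> ?p ` {0<..}" for n using psup_eq_0[OF that] by (simp add: dterm_def)
 have sub: "?p ` {0<..} \<subseteq> {0<..}" by auto
 have "(%d. norm (dterm (psup k f) s (?p d))) summable_on {0<..}"
  using f unfolding dabs_def by (subst summable_on_cong[of _ _ "%d. norm (dterm f (of_nat k * s) d)"]) (simp_all add: t)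
 then have "(%n. norm (dterm (psup k f) s n)) summable_on ?p ` {0<..}"
  by (subst summable_on_reindex[OF inj]) (simp add: o_def)
 moreover have "(%n. norm (dterm (psup k f) s n)) summable_on {0<..} \<longleftrightarrow> (%n. norm (dterm (psup k f) s n)) summable_on ?p ` {0<..}"
  by (rule summable_on_cong_neutral) (use sub z in auto)
 ultimately show "dabs (psup k f) s" by (simp add: dabs_def)
 have "dser (psup k f) s = infsum (dterm (psup k f) s) (?p ` {0<..})"
  unfolding dser_def by (rule infsum_cong_neutral) (use sub z in auto)
 also have "... = infsum (%d. dterm (psup k f) s (?p d)) {0<..}" by (subst infsum_reindex[OF inj]) (simp add: o_def)
 also have "... = dser f (of_nat k * s)" unfolding dser_def by (rule infsum_cong) (simp add: t)
 finally show "dser (psup k f) s = dser f (of_nat k * s)" .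
qed

definition tailmu :: "real => nat => real" where
 "tailmu y d = (1 - tent y d) * moebius2 d"

abbreviation "tconv a c y \<equiv> dconv (pw a) (psup c (tailmu y))"

text \<open>The Dirichlet series of \<open>tailmu y\<close> where Re s > 2. In this form it
  continues to Re s > 1/2 under the Riemann Hypothesis.\<close>

definition tailzi :: "real => complex => complex" where
 "tailzi y s = zi2 s - smooth_sum y s"

lemma dabs_tailmu: "1 <= y ==> Re s > 2 ==> dabs (tailmu y) s"
proof -
 assume y: "1 <= y" and s: "Re s > 2"
 obtain C where C: "C >= 1" "!!n. n > 0 ==> ndiv n <= C * real n powr 1" using divisor_bound[of 1] by auto
 show ?thesis
 proof (rule dabs_of_bound)
  fix n :: nat assume n: "n > 0"
  have "\<bar>tailmu y n\<bar> <= 1 * \<bar>moebius2 n\<bar>"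
   unfolding tailmu_def abs_mult using tent_bounds[of y n] y by (intro mult_right_mono) auto
  then show "\<bar>tailmu y n\<bar> <= C * real n powr 1" using abs_moebius2_le[OF n] C(2)[OF n] by simp
 qed (use s in simp)
qed

lemma dser_tailmu: "1 <= y ==> Re s > 2 ==> dser (tailmu y) s = tailzi y s"
proof -
 assume y: "1 <= y" and s: "Re s > 2"
 have s1: "Re s > 1" using s by simp
 have 1: "(%n. dterm moebius2 s (Suc n)) sums zi2 s"
  using dser_sums[OF dabs_moebius2[OF s1]] dser_moebius2[OF s1] by (simp add: zi2_def)
 have "(%n. dterm moebius2 s (Suc n) * of_real (riesz_diff y (2 * y) (Suc n))) sums (of_real y * smooth_sum y s)"
  using smooth_sum_riesz[OF y, of s 0] by simp
 from sums_divide[OF this, of "of_real y"]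
 have 2: "(%n. dterm moebius2 s (Suc n) * of_real (tent y (Suc n))) sums smooth_sum y s"
  using y by (simp add: tent_def)
 have "(%n. dterm (tailmu y) s (Suc n)) sums (zi2 s - smooth_sum y s)"
 proof (rule sums_cong[THEN iffD1, OF _ sums_diff[OF 1 2]])
  show "dterm moebius2 s (Suc n) - dterm moebius2 s (Suc n) * of_real (tent y (Suc n)) = dterm (tailmu y) s (Suc n)" for n
   by (simp add: dterm_def tailmu_def algebra_simps del: of_nat_Suc)
 qed
 from sums_unique2[OF dser_sums[OF dabs_tailmu[OF y s]] this] show ?thesis by (simp add: tailzi_def)
qed

text \<open>The generating series is zeta(a w) D(w) with D(w) = tailzi y (c w). The pole at w = 1/a
  is cancelled by subtracting D(1/a) zeta(a w), which on the side of the coefficients is the term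
  with \<open>pw a n\<close>. To the right of Re w = 1/(2a) one has c Re w >= \<kappa>/2, so D is
  O(y^(1/2 + dl - \<kappa>/2)) up to small powers of w, and zeta(a w) is bounded by a small power as
  well. The line Re w = 1/(2a) + dl then accounts for x^(1/(2a)).\<close>

theorem tail_sum_bound:
 fixes a c :: nat
 assumes RH: riemann_hypothesis and ac: "1 <= a" "a < c" and d: "0 < dl" "dl <= 1 / (4 * real a)" "1/2 + 2 * dl <= real c / real a / 2"
 obtains C where "C >= 1" "!!x y. 1 <= x ==> 1 <= y ==>
  cmod (\<Sum>n | 0 < n \<and> real n <= x. of_real (tconv a c y n)
    - tailzi y (of_real (real c / real a)) * of_real (pw a n))
   <= C * x powr (1 / (2 * real a) + 5 * dl) * y powr (1/2 + dl - real c / real a / 2)"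
proof -
 define kp where "kp = real c / real a"
 have a0: "0 < real a" "1 <= real a" "0 < a" using ac by auto
 have c0: "0 < real c" "2 <= real c" "0 < c" using ac by auto
 have d4: "dl <= 1/4"
 proof -
  have "1 / (4 * real a) <= 1 / 4" using a0 by (simp add: field_simps)
  then show ?thesis using d by simp
 qed
 have ad: "real a * dl <= 1/4" using d(2) a0 by (simp add: field_simps)
 have kp1: "1/2 + 2 * dl <= kp / 2" using d(3) by (simp add: kp_def)
 have dd: "0 < dl" "dl < 1" "0 < dl" "dl <= 1/2" using d d4 by auto
 obtain C1 where C1: "C1 >= 1" "!!s. 1/2 + dl <= Re s ==> 1/4 <= cmod (s - 1) ==> cmod (zeta s) <= C1 * ht s powr dl"
  by (rule zeta_bounds_RH[OF RH dd(1-3)]) blast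
 obtain C2 where C2: "C2 >= 1" "!!y s. 1 <= y ==> 1/2 + 2 * dl <= Re s ==>
  cmod (tailzi y s) <= C2 * y powr (1/2 + dl - Re s) * ht s powr dl"
  unfolding tailzi_def by (rule smooth_tail_bound[OF RH dd]) blast
 define K where "K = C1 * real a powr dl * (2 * C2 * real c powr dl) * (4 * real a)"
 have K0: "K > 0" using C1 C2 a0 c0 by (simp add: K_def)
 define bt where "bt = 1 / (2 * real a) + dl"
 have bt0: "0 < bt" "bt <= 1" "1 / (2 * real a) < bt"
  using a0 d d4 by (auto simp: bt_def field_simps add_pos_pos)
 define CC where "CC = 4 * K * 2 * 8 / (4 * dl) + 1"
 have CC: "CC >= 1" using K0 d by (simp add: CC_def)
 show ?thesis
 proof (rule that[OF CC])
  fix x y :: real assume x: "1 <= x" and y: "1 <= y"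
  define Y where "Y = y powr (1/2 + dl - kp / 2)"
  define D where "D w = tailzi y (of_nat c * w)" for w
  define p where "p = complex_of_real (1 / real a)"
  define q where "q w = (if w = p then deriv D p else (D w - D p) / (w - p))" for w
  \<comment> \<open>Away from p this is zeta(a w)(D w - D p)/w; written with \<open>entz\<close> and
    \<open>q\<close> it is visibly holomorphic at p.\<close>
  define Q where "Q w = entz (of_nat a * w) * q w / (of_nat a * w)" for w
  have Dp: "D p = tailzi y (of_real (real c / real a))" by (simp add: D_def p_def)
  define S where "S = {w. Re w > 1 / (2 * real a)}"
  have opS: "open S" unfolding S_def by (rule open_halfspace_Re_gt)
  have Sc: "Re (of_nat c * w) > 1/2" if "w \<in> S" for w
  proof -
   have "1 / (2 * real a) < Re w" using that by (simp add: S_def)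
   from mult_strict_left_mono[OF this c0(1)]
   have "real c * (1 / (2 * real a)) < real c * Re w" .
   moreover have "1/2 < real c * (1 / (2 * real a))" using ac by (simp add: field_simps)
   ultimately show ?thesis by simp
  qed
  have S0: "w ~= 0" if "w \<in> S" for w
   using that a0 by (auto simp: S_def)
  have Dh: "D holomorphic_on S"
  proof -
   have "(tailzi y) holomorphic_on {s. Re s > 1/2}"
    unfolding tailzi_def[abs_def] by (intro holomorphic_intros zi2_holo RH smooth_sum_holo)
   then have "(tailzi y \<circ> (%w. of_nat c * w)) holomorphic_on S"
    by (rule holomorphic_on_compose_gen[rotated]) (use Sc in \<open>auto intro!: holomorphic_intros\<close>)
   then show ?thesis by (simp add: D_def[abs_def] o_def)
  qed
  have qh: "q holomorphic_on S" unfolding q_def[abs_def] by (rule pole_lemma_open[OF Dh opS])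
  have eh: "(%w. entz (of_nat a * w)) holomorphic_on S"
  proof -
   have "(entz \<circ> (%w. of_nat a * w)) holomorphic_on S"
    by (rule holomorphic_on_compose_gen[of _ _ _ UNIV]) (auto intro!: holomorphic_intros entz_holo)
   then show ?thesis by (simp add: o_def)
  qed
  have Qh: "Q holomorphic_on S"
   unfolding Q_def[abs_def] using S0 a0 by (intro holomorphic_intros eh qh) auto
  have Qeq: "Q w = zeta (of_nat a * w) * (D w - D p) / w" if w: "w ~= p" for w
  proof -
   have e: "of_nat a * w - 1 = of_nat a * (w - p)" using a0 by (simp add: p_def field_simps)
   have "zeta (of_nat a * w) = entz (of_nat a * w) / (of_nat a * (w - p))" unfolding zeta_eq e ..
   then show ?thesis using w by (simp add: Q_def q_def)
  qed
  \<comment> \<open>The bound for zeta requires distance 1/4 from its pole. This is available on the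
    line itself, where a Re w is 1/2 + a dl <= 3/4, and at height at least 1.\<close>
  have Qb: "cmod (Q w) <= K * Y * ht w powr (-1 + 2 * dl)"
   if w: "bt <= Re w" and w': "Re w = bt \<or> 1 <= \<bar>Im w\<bar>" for w
  proof -
   have far: "1/4 <= cmod (of_nat a * w - 1)"
    using w'
   proof
    assume "Re w = bt"
    then have "Re (of_nat a * w - 1) = real a * dl - 1/2" using a0 by (simp add: bt_def field_simps)
    then show ?thesis using abs_Re_le_cmod[of "of_nat a * w - 1"] ad by simp
   next
    assume "1 <= \<bar>Im w\<bar>"
    then have "1 * 1 <= real a * \<bar>Im w\<bar>" using a0 by (intro mult_mono) auto
    then show ?thesis using abs_Im_le_cmod[of "of_nat a * w - 1"] by (simp add: abs_mult)
   qed
   have "of_nat a * p = 1" using a0 by (simp add: p_def)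
   then have wp: "w ~= p" using far by auto
   have sc: "(1 + \<bar>k * Im w\<bar>) powr dl <= k powr dl * ht w powr dl" if "1 <= k" for k
   proof -
    have "(1 + \<bar>k * Im w\<bar>) powr dl <= (k * ht w) powr dl"
     using that d by (intro powr_mono2) (auto simp: abs_mult distrib_left)
    also have "... = k powr dl * ht w powr dl" by (rule powr_mult)
    finally show ?thesis .
   qed
   have z: "cmod (zeta (of_nat a * w)) <= C1 * (real a powr dl * ht w powr dl)"
   proof -
    have "1/2 + dl <= real a * Re w"
    proof -
     have "1/2 + dl <= 1/2 + real a * dl" using a0 d mult_right_mono[of 1 "real a" dl] by simp
     also have "... = real a * bt" using a0 by (simp add: bt_def field_simps)
     also have "... <= real a * Re w" using w a0 by (intro mult_left_mono) auto
     finally show ?thesis .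
    qed
    then have "cmod (zeta (of_nat a * w)) <= C1 * (1 + \<bar>real a * Im w\<bar>) powr dl" using C1(2)[OF _ far] by simp
    also have "... <= C1 * (real a powr dl * ht w powr dl)" using C1 a0 by (intro mult_left_mono sc) auto
    finally show ?thesis .
   qed
   have dY: "y powr (1/2 + dl - u) <= Y" if "kp / 2 <= u" for u
    unfolding Y_def using that y by (intro powr_mono) auto
   have Dw: "cmod (D w) <= C2 * Y * (real c powr dl * ht w powr dl)"
   proof -
    have "kp / 2 <= real c * Re w"
    proof -
     have "kp / 2 = real c * (1 / (2 * real a))" by (simp add: kp_def)
     also have "... <= real c * Re w" using w bt0 c0 by (intro mult_left_mono) auto
     finally show ?thesis .
    qed
    then have "cmod (D w) <= C2 * y powr (1/2 + dl - real c * Re w) * (1 + \<bar>real c * Im w\<bar>) powr dl"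
     using C2(2)[OF y, of "of_nat c * w"] kp1 by (simp add: D_def)
    also have "... <= C2 * Y * (real c powr dl * ht w powr dl)"
     using C2 c0 \<open>kp / 2 <= real c * Re w\<close> by (intro mult_mono mult_left_mono sc dY) (auto simp: Y_def)
    finally show ?thesis .
   qed
   have "cmod (D p) <= C2 * Y * (real c powr dl * ht w powr dl)"
   proof -
    have k: "kp / 2 <= kp" using kp1 d by simp
    have "cmod (D p) <= C2 * y powr (1/2 + dl - kp) * 1"
     using C2(2)[OF y, of "of_real kp"] kp1 d k unfolding Dp by (simp add: kp_def)
    also have "... <= C2 * Y * (real c powr dl * ht w powr dl)"
    proof (intro mult_mono mult_left_mono dY k)
     have "1 * 1 <= real c powr dl * ht w powr dl"
      using c0 d by (intro mult_mono ge_one_powr_ge_zero) auto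
     then show "1 <= real c powr dl * ht w powr dl" by simp
    qed (use C2 in \<open>auto simp: Y_def\<close>)
    finally show ?thesis .
   qed
   then have dif: "cmod (D w - D p) <= 2 * C2 * Y * (real c powr dl * ht w powr dl)"
    using Dw norm_triangle_ineq4[of "D w" "D p"] by linarith
   have wl: "ht w / (4 * real a) <= cmod w"
   proof -
    have 1: "1 / (2 * real a) <= cmod w" using abs_Re_le_cmod[of w] w bt0 by linarith
    have "\<bar>Im w\<bar> / (2 * real a) <= \<bar>Im w\<bar> / 1" using a0 by (intro divide_left_mono) auto
    then have 2: "\<bar>Im w\<bar> / (2 * real a) <= cmod w" using abs_Im_le_cmod[of w] by simp
    have "ht w / (4 * real a) = (1 / (2 * real a) + \<bar>Im w\<bar> / (2 * real a)) / 2" by (simp add: add_divide_distrib)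
    moreover have "(A + B) / 2 <= C" if "A <= C" "B <= C" for A B C :: real using that by simp
    ultimately show ?thesis using 1 2 by metis
   qed
   have "cmod (Q w) = cmod (zeta (of_nat a * w)) * cmod (D w - D p) / cmod w" unfolding Qeq[OF wp] by (simp add: norm_mult norm_divide)
   also have "... <= (C1 * (real a powr dl * ht w powr dl)) * (2 * C2 * Y * (real c powr dl * ht w powr dl)) / (ht w / (4 * real a))"
    using z dif wl a0 C1 C2 by (intro frac_le mult_mono) (auto simp: Y_def)
   also have "... = K * Y * (ht w powr dl * ht w powr dl / ht w powr 1)" by (simp add: K_def)
   also have "ht w powr dl * ht w powr dl / ht w powr 1 = ht w powr (dl + dl - 1)" by (simp only: powr_diff powr_add)
   also have "dl + dl - 1 = -1 + 2 * dl" by simp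
   finally show ?thesis .
  qed
  define m where "m n = of_real (tconv a c y (Suc n)) - D p * of_real (pw a (Suc n))" for n
  \<comment> \<open>The Riesz difference between n0 and n0 + 1 is 1 at integers up to n0 and 0 at
    all larger ones: a sharp cutoff at x.\<close>
  define n0 where "n0 = nat \<lfloor>x\<rfloor>"
  have n0: "1 <= real n0" "real n0 <= x" "real n0 + 1 <= 2 * x"
   using x by (auto simp: n0_def le_nat_floor) linarith+
  have da: "dabs (pw a) w" "dser (pw a) w = zeta (of_nat a * w)" if "Re w = 2" for w
  proof -
   have "Re (of_nat a * w) > 1" using that a0 by simp
   then show "dabs (pw a) w" "dser (pw a) w = zeta (of_nat a * w)"
    using dser_psup[OF a0(3), of "%_. 1" w] dabs_one dser_one by auto
  qed
  have dc: "dabs (psup c (tailmu y)) w" "dser (psup c (tailmu y)) w = D w" if "Re w = 2" for w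
  proof -
   have "Re (of_nat c * w) > 2" using that c0 by simp
   then show "dabs (psup c (tailmu y)) w" "dser (psup c (tailmu y)) w = D w"
    using dser_psup[OF c0(3), of "tailmu y" w] dabs_tailmu[OF y] dser_tailmu[OF y] by (auto simp: D_def)
  qed
  have mt: "m n * of_nat (Suc n) powr (-w) = dterm (tconv a c y) w (Suc n) - D p * dterm (pw a) w (Suc n)" for n w
   by (simp add: m_def dterm_def algebra_simps del: of_nat_Suc)
  define Sm where "Sm = (\<Sum>n. m n * of_real (riesz_diff (real n0) (real n0 + 1) (Suc n)))"
  have "cmod Sm <= 4 * (K * Y) * ((2 * x) powr bt) powr (1 - 4 * dl) * (2 * (2 * x) powr (bt + 1)) powr (4 * dl) / (4 * dl)"
   unfolding Sm_def
  proof (rule perron_riesz_bound[where b = 2 and Q = Q and ?bt0.0 = "1 / (2 * real a)" and bt = bt and B = "K * Y"])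
   show "summable (%n. cmod (m n) * real (Suc n) powr -2)"
   proof (rule summable_comparison_test'[where N = 0])
    have w: "Re (2::complex) = 2" by simp
    show "summable (%n. cmod (dterm (tconv a c y) 2 (Suc n)) + cmod (D p) * cmod (dterm (pw a) 2 (Suc n)))"
     by (intro summable_add summable_mult dabs_summable dser_dconv(1) da(1)[OF w] dc(1)[OF w])
    fix n :: nat
    have "cmod (m n) * real (Suc n) powr -2 = cmod (m n * of_nat (Suc n) powr (-2))"
     using norm_nat_powr[of "Suc n" "-2"] by (simp add: norm_mult del: of_nat_Suc)
    also have "... <= cmod (dterm (tconv a c y) 2 (Suc n)) + cmod (D p) * cmod (dterm (pw a) 2 (Suc n))"
     unfolding mt norm_mult[symmetric] by (rule norm_triangle_ineq4)
    finally show "norm (cmod (m n) * real (Suc n) powr -2) <= cmod (dterm (tconv a c y) 2 (Suc n)) + cmod (D p) * cmod (dterm (pw a) 2 (Suc n))"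
     by simp
   qed
   show "(\<Sum>n. m n * of_nat (Suc n) powr (-w)) = w * Q w" if w: "Re w = 2" for w
   proof -
    have "(%n. m n * of_nat (Suc n) powr (-w)) sums (zeta (of_nat a * w) * D w - D p * zeta (of_nat a * w))"
     unfolding mt da(2)[OF w, symmetric] dc(2)[OF w, symmetric] dser_dconv(2)[OF da(1)[OF w] dc(1)[OF w], symmetric]
     by (intro sums_diff sums_mult dser_sums dser_dconv(1) da(1)[OF w] dc(1)[OF w])
    moreover have "Re p ~= 2" using a0 by (simp add: p_def field_simps)
    then have "w ~= p" "w ~= 0" using w by auto
    then have "w * Q w = zeta (of_nat a * w) * (D w - D p)" by (simp add: Qeq)
    then have "zeta (of_nat a * w) * D w - D p * zeta (of_nat a * w) = w * Q w"
     by (simp add: right_diff_distrib mult.commute)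
    ultimately show ?thesis by (simp only: sums_iff)
   qed
   show "cmod (Q w) <= K * Y" if w: "bt <= Re w" "Re w <= 2" "1 <= \<bar>Im w\<bar>" for w
   proof -
    have "ht w powr (-1 + 2 * dl) <= ht w powr 0" using d4 by (intro powr_mono) auto
    also have "... = 1" using w by simp
    finally have "K * Y * ht w powr (-1 + 2 * dl) <= K * Y * 1" using K0 by (intro mult_left_mono) (auto simp: Y_def)
    then show ?thesis using Qb[OF w(1)] w by simp
   qed
   show "cmod (Q (Complex bt v)) <= K * Y * (1 + \<bar>v\<bar>) powr (-1 + 4 * dl / 2)" for v
    using Qb[of "Complex bt v"] by simp
   show "Q holomorphic_on {w. Re w > 1 / (2 * real a)}" using Qh by (simp add: S_def)
   have m1: "real n0 powr bt <= (2 * x) powr bt" "(real n0 + 1) powr bt <= (2 * x) powr bt"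
    "real n0 powr (bt + 1) <= (2 * x) powr (bt + 1)" "(real n0 + 1) powr (bt + 1) <= (2 * x) powr (bt + 1)"
    using n0 x bt0 by (auto intro!: powr_mono2)
   show "(real n0 + 1 - real n0) * max (real n0 powr bt) ((real n0 + 1) powr bt) <= (2 * x) powr bt"
    using m1 by simp
   show "real n0 powr (bt + 1) + (real n0 + 1) powr (bt + 1) <= 2 * (2 * x) powr (bt + 1)"
    using m1 by linarith
   have "(2 * x) powr bt <= (2 * x) powr (bt + 1)" using x by (intro powr_mono) auto
   then show "(2 * x) powr bt <= 2 * (2 * x) powr (bt + 1)" using powr_ge_zero[of "2 * x" "bt + 1"] by linarith
  qed (use n0 bt0 d d4 in auto)
  also have "... <= CC * x powr (1 / (2 * real a) + 5 * dl) * Y"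
  proof -
   have "((2 * x) powr bt) powr (1 - 4 * dl) * (2 * (2 * x) powr (bt + 1)) powr (4 * dl)
     = 2 powr (4 * dl) * ((2 * x) powr (bt * (1 - 4 * dl)) * (2 * x) powr ((bt + 1) * (4 * dl)))"
    unfolding powr_mult[of 2 "(2 * x) powr (bt + 1)"] powr_powr by (simp only: mult_ac)
   also have "(2 * x) powr (bt * (1 - 4 * dl)) * (2 * x) powr ((bt + 1) * (4 * dl)) = (2 * x) powr (bt + 4 * dl)"
    unfolding powr_add[symmetric] by (simp add: algebra_simps)
   also have "... = 2 powr (bt + 4 * dl) * x powr (bt + 4 * dl)" by (rule powr_mult)
   also have "2 powr (4 * dl) * (2 powr (bt + 4 * dl) * x powr (bt + 4 * dl)) <= 2 * (8 * x powr (bt + 4 * dl))"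
    using powr_mono[of "4 * dl" 1 "2::real"] powr_mono[of "bt + 4 * dl" 3 "2::real"] d4 bt0 by (intro mult_mono mult_right_mono) auto
   finally have 1: "((2 * x) powr bt) powr (1 - 4 * dl) * (2 * (2 * x) powr (bt + 1)) powr (4 * dl) <= 2 * (8 * x powr (bt + 4 * dl))" .
   have "4 * (K * Y) * ((2 * x) powr bt) powr (1 - 4 * dl) * (2 * (2 * x) powr (bt + 1)) powr (4 * dl) / (4 * dl)
     = 4 * (K * Y) / (4 * dl) * (((2 * x) powr bt) powr (1 - 4 * dl) * (2 * (2 * x) powr (bt + 1)) powr (4 * dl))" by simp
   also have "... <= 4 * (K * Y) / (4 * dl) * (2 * (8 * x powr (bt + 4 * dl)))"
    using K0 d by (intro mult_left_mono 1) (auto simp: Y_def)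
   also have "... = (CC - 1) * (x powr (bt + 4 * dl) * Y)" by (simp add: CC_def)
   also have "... <= CC * (x powr (bt + 4 * dl) * Y)" by (intro mult_right_mono) (auto simp: Y_def)
   also have "bt + 4 * dl = 1 / (2 * real a) + 5 * dl" by (simp add: bt_def)
   finally show ?thesis by (simp add: mult.assoc)
  qed
  finally have B: "cmod Sm <= CC * x powr (1 / (2 * real a) + 5 * dl) * Y" .
  have "Sm = (\<Sum>n\<in>{n. real (Suc n) <= x}. m n)"
  proof -
   have fin: "finite {n. real (Suc n) <= x}"
    by (rule finite_subset[of _ "{..nat \<lfloor>x\<rfloor>}"]) (auto simp: le_nat_floor)
   have le: "real (Suc n) <= x \<longleftrightarrow> Suc n <= n0" for n
   proof -
    have "Suc n <= n0 \<longleftrightarrow> int (Suc n) <= \<lfloor>x\<rfloor>" unfolding n0_def by linarith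
    then show ?thesis by (simp add: le_floor_iff)
   qed
   have rd: "riesz_diff (real n0) (real n0 + 1) (Suc n) = (if real (Suc n) <= x then 1 else 0)" for n
    unfolding le by (auto simp: riesz_diff_def)
   have "(%n. m n * of_real (riesz_diff (real n0) (real n0 + 1) (Suc n))) sums (\<Sum>n\<in>{n. real (Suc n) <= x}. m n * of_real (riesz_diff (real n0) (real n0 + 1) (Suc n)))"
    by (rule sums_finite[OF fin]) (auto simp: rd)
   also have "(\<Sum>n\<in>{n. real (Suc n) <= x}. m n * of_real (riesz_diff (real n0) (real n0 + 1) (Suc n))) = (\<Sum>n\<in>{n. real (Suc n) <= x}. m n)"
    by (intro sum.cong refl) (auto simp: rd)
   finally show ?thesis by (simp add: Sm_def sums_iff)
  qed
  also have "... = (\<Sum>n | 0 < n \<and> real n <= x. of_real (tconv a c y n) - D p * of_real (pw a n))"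
   by (rule sum.reindex_bij_witness[of _ "%n. n - 1" Suc]) (auto simp: m_def of_nat_diff)
  finally show "cmod (\<Sum>n | 0 < n \<and> real n <= x. of_real (tconv a c y n)
    - tailzi y (of_real (real c / real a)) * of_real (pw a n))
   <= CC * x powr (1 / (2 * real a) + 5 * dl) * y powr (1/2 + dl - real c / real a / 2)"
   using B unfolding Dp Y_def kp_def by simp
 qed
qed

section \<open>Counting with floors and the final assembly\<close>

lemma abel_monotone_bound:
 fixes w a :: "nat => real"
 assumes w: "!!n. w (Suc n) <= w n" "!!n. 0 <= w n"
  and S: "!!N. \<bar>\<Sum>d=1..N. a d\<bar> <= M"
 shows "\<bar>\<Sum>d=1..N. w d * a d\<bar> <= w 0 * M"
proof -
 have M0: "0 <= M" using S[of 0] by simp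
 have "\<bar>(\<Sum>d=1..N. w d * a d) - w N * (\<Sum>d=1..N. a d)\<bar> <= (w 0 - w N) * M"
 proof (induction N)
  case (Suc N)
  have "(\<Sum>d=1..Suc N. w d * a d) - w (Suc N) * (\<Sum>d=1..Suc N. a d)
   = ((\<Sum>d=1..N. w d * a d) - w N * (\<Sum>d=1..N. a d)) + (w N - w (Suc N)) * (\<Sum>d=1..N. a d)"
   by (simp add: algebra_simps)
  also have "\<bar>...\<bar> <= (w 0 - w N) * M + (w N - w (Suc N)) * M"
  proof (rule order_trans[OF abs_triangle_ineq add_mono[OF Suc]])
   show "\<bar>(w N - w (Suc N)) * (\<Sum>d=1..N. a d)\<bar> <= (w N - w (Suc N)) * M"
    using w(1)[of N] S[of N] by (simp add: abs_mult mult_left_mono)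
  qed
  finally show ?case by (simp add: algebra_simps)
 qed simp
 moreover have "\<bar>w N * (\<Sum>d=1..N. a d)\<bar> <= w N * M"
  using w(2)[of N] S[of N] by (simp add: abs_mult mult_left_mono)
 ultimately have "\<bar>\<Sum>d=1..N. w d * a d\<bar> <= (w 0 - w N) * M + w N * M" by linarith
 then show ?thesis by (simp add: algebra_simps)
qed

lemma tent_antimono:
 assumes y: "0 < y" shows "tent y (Suc n) <= tent y n"
 unfolding tent_def riesz_diff_def using y by (intro divide_right_mono) (auto simp: max_def)

lemma pos_le_eq_atLeastAtMost: "{n::nat. 0 < n \<and> real n <= x} = {1..nat \<lfloor>x\<rfloor>}"
proof -
 have "0 < n \<and> real n <= x \<longleftrightarrow> 1 <= n \<and> n <= nat \<lfloor>x\<rfloor>" for n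
 proof (cases "n = 0")
  case False
  then have "n <= nat \<lfloor>x\<rfloor> \<longleftrightarrow> int n <= \<lfloor>x\<rfloor>" by linarith
  then show ?thesis using False by (simp add: le_floor_iff Suc_le_eq)
 qed simp
 then show ?thesis by (intro set_eqI) (simp only: mem_Collect_eq atLeastAtMost_iff)
qed

lemma dconv_psup:
 assumes n: "0 < n" and ac: "0 < a" "0 < c"
 shows "dconv (psup a f) (psup c g) n = (\<Sum>(l, d)\<in>{(l, d). 0 < l \<and> 0 < d \<and> l ^ a * d ^ c = n}. f l * g d)"
proof -
 have fr: "finite {d. 0 < d \<and> d ^ k = (A::nat)}" if "0 < k" for k A
 proof (rule finite_subset)
  show "{d. 0 < d \<and> d ^ k = A} \<subseteq> {..A}"
  proof
   fix d assume "d \<in> {d. 0 < d \<and> d ^ k = A}"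
   then have "d <= d ^ k" "d ^ k = A" using that by (auto intro!: self_le_power)
   then show "d \<in> {..A}" by simp
  qed
 qed simp
 let ?F = "{(A, B). A * B = n}"
 let ?G = "%p. {l. 0 < l \<and> l ^ a = fst p} \<times> {d. 0 < d \<and> d ^ c = snd p}"
 have "dconv (psup a f) (psup c g) n = (\<Sum>p\<in>?F. \<Sum>q\<in>?G p. f (fst q) * g (snd q))"
  unfolding dconv_def psup_def by (intro sum.cong refl) (auto simp: sum_product sum.cartesian_product case_prod_beta)
 also have "... = (\<Sum>(p, q)\<in>(SIGMA p:?F. ?G p). f (fst q) * g (snd q))"
  using finite_factorizations[OF n] fr ac by (intro sum.Sigma) auto
 also have "... = (\<Sum>q\<in>{(l, d). 0 < l \<and> 0 < d \<and> l ^ a * d ^ c = n}. f (fst q) * g (snd q))"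
  by (rule sum.reindex_bij_witness[of _ "%q. ((fst q ^ a, snd q ^ c), q)" snd]) auto
 finally show ?thesis by (simp add: case_prod_beta)
qed

lemma u2_eq:
 assumes "0 < n" "0 < a" "0 < c"
 shows "u2 a c n = of_real (dconv (pw a) (psup c moebius2) n)"
 unfolding dconv_psup[OF assms] u2_def mu2_eq of_real_sum by (intro sum.cong) auto

text \<open>For fixed d the admissible l are the positive integers up to x^(1/a) d^(-c/a), so the
  inner count is a floor. \<open>ds\<close> is any finite set outside which g vanishes; it is used
  for the smooth part of the coefficients and for \<open>dunit\<close>.\<close>

lemma hyperbola_sum:
 fixes a c :: nat
 assumes ac: "0 < a" "0 < c" and x: "0 < x" and fin: "finite ds" and ds: "!!d. d \<in> ds ==> 0 < d"
  and g: "!!d. 0 < d ==> d \<notin> ds ==> g d = 0"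
 shows "(\<Sum>n | 0 < n \<and> real n <= x. dconv (pw a) (psup c g) n)
  = (\<Sum>d\<in>ds. g d * of_int \<lfloor>x powr (1 / real a) * real d powr -(real c / real a)\<rfloor>)"
proof -
 let ?N = "{n. 0 < n \<and> real n <= x}"
 let ?Q = "%n. {(l, d). 0 < l \<and> 0 < d \<and> l ^ a * d ^ c = (n::nat)}"
 let ?P = "{(l, d). 0 < l \<and> 0 < d \<and> real (l ^ a * d ^ c) <= x}"
 have fN: "finite ?N" by (rule finite_pos_le)
 have big: "l <= l ^ a * d ^ c" "d <= l ^ a * d ^ c" if "0 < l" "0 < d" for l d :: nat
 proof -
  have 1: "l <= l ^ a" "d <= d ^ c" "1 <= l ^ a" "1 <= d ^ c" using that ac by (auto intro: self_le_power simp: Suc_le_eq)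
  have "l * 1 <= l ^ a * d ^ c" "1 * d <= l ^ a * d ^ c" using 1 by (intro mult_le_mono; simp)+
  then show "l <= l ^ a * d ^ c" "d <= l ^ a * d ^ c" by simp_all
 qed
 have fQ: "finite (?Q n)" for n
  by (rule finite_subset[of _ "{..n} \<times> {..n}"]) (use big in auto)
 have fP: "finite ?P"
 proof (rule finite_subset)
  show "?P \<subseteq> {n. 0 < n \<and> real n <= x} \<times> {n. 0 < n \<and> real n <= x}"
  proof
   fix p assume "p \<in> ?P"
   then obtain l d where p: "p = (l, d)" "0 < l" "0 < d" "real (l ^ a * d ^ c) <= x" by auto
   have "real l <= real (l ^ a * d ^ c)" "real d <= real (l ^ a * d ^ c)"
    using big[OF p(2,3)] by (simp_all only: of_nat_le_iff)
   then have "real l <= x" "real d <= x" using p(4) by linarith+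
   then show "p \<in> {n. 0 < n \<and> real n <= x} \<times> {n. 0 < n \<and> real n <= x}" using p by simp
  qed
 qed (use fN in simp)
 have "(\<Sum>n\<in>?N. dconv (pw a) (psup c g) n) = (\<Sum>n\<in>?N. \<Sum>q\<in>?Q n. g (snd q))"
  by (intro sum.cong refl) (auto simp: dconv_psup[OF _ ac] case_prod_beta)
 also have "... = (\<Sum>(n, q)\<in>(SIGMA n:?N. ?Q n). g (snd q))" using fN fQ by (intro sum.Sigma) auto
 also have "... = (\<Sum>q\<in>?P. g (snd q))"
  by (rule sum.reindex_bij_witness[of _ "%q. (fst q ^ a * snd q ^ c, q)" snd]) auto
 also have "... = (\<Sum>q\<in>{q \<in> ?P. snd q \<in> ds}. g (snd q))"
 proof (rule sum.mono_neutral_right[OF fP])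
  show "\<forall>q\<in>?P - {q \<in> ?P. snd q \<in> ds}. g (snd q) = 0"
  proof
   fix q assume "q \<in> ?P - {q \<in> ?P. snd q \<in> ds}"
   then have "0 < snd q" "snd q \<notin> ds" by (auto simp: case_prod_beta)
   then show "g (snd q) = 0" by (rule g)
  qed
 qed blast
 also have "... = (\<Sum>(d, l)\<in>(SIGMA d:ds. {l. 0 < l \<and> real (l ^ a * d ^ c) <= x}). g d)"
  by (rule sum.reindex_bij_witness[of _ prod.swap prod.swap]) (use ds in auto)
 also have "... = (\<Sum>d\<in>ds. \<Sum>l | 0 < l \<and> real (l ^ a * d ^ c) <= x. g d)"
 proof (subst sum.Sigma[OF fin])
  show "\<forall>d\<in>ds. finite {l. 0 < l \<and> real (l ^ a * d ^ c) <= x}"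
  proof
   fix d assume "d \<in> ds"
   then have "{l. 0 < l \<and> real (l ^ a * d ^ c) <= x} \<subseteq> fst ` ?P" using ds by force
   then show "finite {l. 0 < l \<and> real (l ^ a * d ^ c) <= x}" using fP by (auto intro: finite_subset)
  qed
 qed simp
 also have "... = (\<Sum>d\<in>ds. g d * of_int \<lfloor>x powr (1 / real a) * real d powr -(real c / real a)\<rfloor>)"
 proof (intro sum.cong refl)
  fix d assume "d \<in> ds"
  then have d: "0 < d" by (rule ds)
  define t where "t = x powr (1 / real a) * real d powr -(real c / real a)"
  have t0: "0 < t" using x d by (simp add: t_def)
  have tp: "t ^ a = x / real d ^ c"
  proof -
   have "t ^ a = t powr real a" using t0 by (simp add: powr_realpow)
   also have "... = (x powr (1 / real a)) powr real a * (real d powr -(real c / real a)) powr real a"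
    unfolding t_def by (rule powr_mult)
   also have "... = x * real d powr - real c" using x ac by (simp add: powr_powr)
   also have "... = x / real d ^ c" using d by (simp add: powr_minus powr_realpow divide_inverse)
   finally show ?thesis .
  qed
  have "real (l ^ a * d ^ c) <= x \<longleftrightarrow> real l <= t" for l
  proof -
   have "real (l ^ a * d ^ c) <= x \<longleftrightarrow> real l ^ a <= t ^ a" unfolding tp using d by (simp add: pos_le_divide_eq)
   also have "... \<longleftrightarrow> real l <= t" using ac t0 by (intro power_mono_iff) auto
   finally show ?thesis .
  qed
  then have "{l. 0 < l \<and> real (l ^ a * d ^ c) <= x} = {1..nat \<lfloor>t\<rfloor>}"
   using pos_le_eq_atLeastAtMost[of t] by simp
  then show "(\<Sum>l | 0 < l \<and> real (l ^ a * d ^ c) <= x. g d) = g d * of_int \<lfloor>x powr (1 / real a) * real d powr -(real c / real a)\<rfloor>"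
   using t0 by (simp add: t_def[symmetric])
 qed
 finally show ?thesis .
qed

lemma psup_dunit: "0 < k ==> psup k dunit n = dunit n"
proof -
 assume k: "0 < k"
 show "psup k dunit n = dunit n"
 proof (cases "n = 1")
  case True
  then show ?thesis using psup_power[OF k, of 1 dunit] by simp
 next
  case False
  then have "psup k dunit n = 0" unfolding psup_def by (intro sum.neutral) (auto simp: dunit_def)
  then show ?thesis using False by (simp add: dunit_def)
 qed
qed

theorem theorem5:
  fixes a c :: nat and \<epsilon> :: real
  assumes "riemann_hypothesis"
    and "1 \<le> a" and "a < c" and "real c \<le> 9 * real a / 2"
    and "\<epsilon> > 0"
  shows "\<exists>C. \<forall>x\<ge>2. cmod (Delta2 a c x) \<le> C * x powr (7 / (8 * real c + 6 * real a) + \<epsilon>)"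
proof -
 note RH = assms(1)
 define \<kappa> where "\<kappa> = real c / real a"
 define Q where "Q = 8 * real c + 6 * real a"
 have a0: "0 < a" "0 < real a" "0 < c" "0 < real c" "1 <= real a" "2 <= real c" using assms by auto
 have k: "1 < \<kappa>" "\<kappa> <= 9/2" using assms a0 by (auto simp: \<kappa>_def field_simps)
 have Q: "8 <= Q" using a0 by (simp add: Q_def)
 define \<eta> where "\<eta> = min \<epsilon> (1/2)"
 have eta: "0 < \<eta>" "\<eta> <= 1/2" "\<eta> <= \<epsilon>" using assms by (auto simp: \<eta>_def)
 \<comment> \<open>The three entries serve the total loss 5 \<delta> + \<delta> in the exponent of
   x, the distance from the pole of zeta(a w), and the condition that c Re w >= \<kappa>/2 lies in
   the range of the smooth tail bound.\<close>
 define \<delta> where "\<delta> = min (min (\<epsilon> / 6) (1 / (4 * real a))) ((\<kappa> - 1) / 4)"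
 have d: "0 < \<delta>" "\<delta> <= 1 / (4 * real a)" "1/2 + 2 * \<delta> <= \<kappa> / 2" "6 * \<delta> <= \<epsilon>"
 proof -
  have 1: "\<delta> <= \<epsilon> / 6" unfolding \<delta>_def by (rule min.coboundedI1, rule min.cobounded1)
  have 2: "\<delta> <= 1 / (4 * real a)" unfolding \<delta>_def by (rule min.coboundedI1, rule min.cobounded2)
  have 3: "\<delta> <= (\<kappa> - 1) / 4" unfolding \<delta>_def by (rule min.cobounded2)
  show "\<delta> <= 1 / (4 * real a)" by (rule 2)
  show "1/2 + 2 * \<delta> <= \<kappa> / 2" using 3 by (simp add: field_simps)
  show "6 * \<delta> <= \<epsilon>" using 1 by simp
  have "0 < \<epsilon> / 6" "0 < 1 / (4 * real a)" "0 < (\<kappa> - 1) / 4" using assms(5) a0 k by simp_all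
  then show "0 < \<delta>" by (simp add: \<delta>_def)
 qed
 have "1 / (4 * real a) <= 1 / 4" using a0 by (simp add: field_simps)
 then have d4: "\<delta> <= 1/4" "\<delta> < 1" "\<delta> <= 1/2" using d by auto
 obtain C1 where C1: "C1 > 0" "!!y u. 1 <= y ==> u <= 2 * y ==>
  \<bar>\<Sum>d | 0 < d \<and> real d <= u. moebius2 d * sawt (y powr (\<kappa> + 3/4) * real d powr -\<kappa>)\<bar>
   <= C1 * y powr (7/8 + \<eta>)"
  by (rule floor_moebius2_sum_bound[OF k eta(1,2)]) blast
 obtain C2 where C2: "C2 >= 1" "!!y. 1 <= y ==> cmod (smooth_sum y 0) <= C2 * y powr (1/2 + \<delta>)"
  by (rule smooth_sum_0_bound[OF RH d(1) d4(3)]) blast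
 obtain C3 where C3: "C3 >= 1" "!!x y. 1 <= x ==> 1 <= y ==>
  cmod (\<Sum>n | 0 < n \<and> real n <= x. of_real (tconv a c y n)
    - tailzi y (of_real (real c / real a)) * of_real (pw a n))
   <= C3 * x powr (1 / (2 * real a) + 5 * \<delta>) * y powr (1/2 + \<delta> - real c / real a / 2)"
  by (rule tail_sum_bound[OF RH assms(2,3) d(1,2) d(3)[unfolded \<kappa>_def]]) blast
 have half: "(0::real) < 1/2" "(1/2::real) <= 1/2" by simp_all
 obtain C4 where C4: "C4 >= 1" "!!y s. 1 <= y ==> 1/2 + 2 * \<delta> <= Re s ==>
  cmod (zi2 s - smooth_sum y s) <= C4 * y powr (1/2 + \<delta> - Re s) * ht s powr (1/2)"
  by (rule smooth_tail_bound[OF RH d(1) d4(2) half]) blast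
 show ?thesis
 proof (intro exI allI impI)
  fix x :: real assume x2: "2 <= x"
  have x: "1 <= x" "0 < x" using x2 by auto
  define y where "y = x powr (8 / Q)"
  define X where "X = x powr (1 / real a)"
  define E where "E = x powr (7 / Q + \<epsilon>)"
  have y: "1 <= y" using x Q by (auto simp: y_def intro: ge_one_powr_ge_zero)
  have y0: "0 < y" using y by simp
  have yp: "y powr u = x powr (8 / Q * u)" for u by (simp add: y_def powr_powr)
  have Q0: "Q ~= 0" using Q by simp
  have Xy: "X = y powr (\<kappa> + 3/4)"
  proof -
   have "\<kappa> + 3/4 = Q / (8 * real a)" using a0 by (simp add: \<kappa>_def Q_def field_simps)
   then have "8 / Q * (\<kappa> + 3/4) = 1 / real a" using Q0 by simp
   then show ?thesis by (simp add: X_def yp)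
  qed
  have X0: "0 < X" using x by (simp add: X_def)
  have E1: "1 <= E" unfolding E_def using x Q assms(5) by (intro ge_one_powr_ge_zero) auto
  define tm where "tm d = tent y d * moebius2 d" for d
  define N where "N = {d::nat. 0 < d \<and> real d <= 2 * y}"
  define \<psi> where "\<psi> d = of_int \<lfloor>X * real d powr -\<kappa>\<rfloor> - X * real d powr -\<kappa> + 1/2" for d
  have finN: "finite N" unfolding N_def by (rule finite_pos_le)
  have e1: "y powr (7/8 + \<eta>) <= E"
  proof -
   have "8 / Q * (7/8 + \<eta>) = 7 / Q + 8 / Q * \<eta>" by (simp add: distrib_left)
   also have "... <= 7 / Q + 1 * \<epsilon>" using Q eta by (intro add_left_mono mult_mono) auto
   finally show ?thesis unfolding yp E_def using x by (intro powr_mono) auto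
  qed
  have e2: "y powr (1/2 + \<delta>) <= E"
   using e1 powr_mono[of "1/2 + \<delta>" "7/8 + \<eta>" y] d4 eta y by linarith
  have e3: "x powr (1 / (2 * real a) + 5 * \<delta>) * y powr (1/2 + \<delta> - real c / real a / 2) <= E"
  proof -
   \<comment> \<open>The balance of exponents that determines y: the large divisors give 7/Q, just
     as y^(7/8) does.\<close>
   have "1 / (2 * real a) + 8 / Q * (1/2 - real c / real a / 2) = 7 / Q"
   proof -
    have 1: "1 / (2 * real a) = Q / (2 * real a * Q)" using Q0 by simp
    have 2: "8 / Q * (1/2 - real c / real a / 2) = 8 * (real a - real c) / (2 * real a * Q)"
    proof -
     have "1/2 - real c / real a / 2 = (real a - real c) / (2 * real a)" using a0 by (simp add: diff_divide_distrib)
     then show ?thesis by (simp add: mult_ac)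
    qed
    have 3: "7 / Q = (14 * real a) / (2 * real a * Q)" using a0 by simp
    have 4: "Q + 8 * (real a - real c) = 14 * real a" by (simp add: Q_def)
    show ?thesis unfolding 1 2 3 add_divide_distrib[symmetric] 4 ..
   qed
   moreover have "8 / Q * (1/2 + \<delta> - real c / real a / 2) = 8 / Q * (1/2 - real c / real a / 2) + 8 / Q * \<delta>"
    unfolding distrib_left[symmetric] by (rule arg_cong[where f = "(*) (8 / Q)"]) simp
   ultimately have "1 / (2 * real a) + 5 * \<delta> + 8 / Q * (1/2 + \<delta> - real c / real a / 2) = 7 / Q + 5 * \<delta> + 8 / Q * \<delta>"
    by linarith
   also have "... <= 7 / Q + 5 * \<delta> + 1 * \<delta>" using Q d by (intro add_left_mono mult_right_mono) auto
   also have "... <= 7 / Q + \<epsilon>" using d(4) by simp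
   finally show ?thesis unfolding yp powr_add[symmetric] E_def using x by (intro powr_mono) auto
  qed
  have t1: "\<bar>\<Sum>d\<in>N. tm d * \<psi> d\<bar> <= C1 * E"
  proof -
   have "\<bar>\<Sum>d=1..nat \<lfloor>2 * y\<rfloor>. tent y d * (moebius2 d * \<psi> d)\<bar> <= tent y 0 * (C1 * y powr (7/8 + \<eta>))"
   proof -
    \<comment> \<open>Weights and coefficients are set to 0 beyond 2y because partial summation asks
      for a bound on all partial sums, while the floor sum is bounded only up to 2y.\<close>
    have "\<bar>\<Sum>d=1..nat \<lfloor>2 * y\<rfloor>. (if d <= nat \<lfloor>2 * y\<rfloor> then tent y d else 0) * (if d <= nat \<lfloor>2 * y\<rfloor> then moebius2 d * \<psi> d else 0)\<bar>
     <= (if 0 <= nat \<lfloor>2 * y\<rfloor> then tent y 0 else 0) * (C1 * y powr (7/8 + \<eta>))"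
    proof (rule abel_monotone_bound)
     show "(if Suc n <= nat \<lfloor>2 * y\<rfloor> then tent y (Suc n) else 0) <= (if n <= nat \<lfloor>2 * y\<rfloor> then tent y n else 0)" for n
      using tent_antimono[OF y0, of n] tent_bounds(1)[OF y0, of n] by auto
     show "0 <= (if n <= nat \<lfloor>2 * y\<rfloor> then tent y n else 0)" for n using tent_bounds(1)[OF y0] by auto
     fix M
     have "(\<Sum>d=1..M. if d <= nat \<lfloor>2 * y\<rfloor> then moebius2 d * \<psi> d else 0) = (\<Sum>d=1..min M (nat \<lfloor>2 * y\<rfloor>). moebius2 d * \<psi> d)"
      by (rule sum.mono_neutral_cong_right) auto
     also have "{1..min M (nat \<lfloor>2 * y\<rfloor>)} = {d. 0 < d \<and> real d <= min (real M) (2 * y)}"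
      unfolding pos_le_eq_atLeastAtMost[symmetric, of "2 * y"] using pos_le_eq_atLeastAtMost[of "2 * y"] by (auto simp: set_eq_iff Suc_le_eq)
     finally show "\<bar>\<Sum>d=1..M. if d <= nat \<lfloor>2 * y\<rfloor> then moebius2 d * \<psi> d else 0\<bar> <= C1 * y powr (7/8 + \<eta>)"
      using C1(2)[OF y, of "min (real M) (2 * y)"] by (simp add: \<psi>_def Xy)
    qed
    then show ?thesis by simp
   qed
   also have "... <= 1 * (C1 * E)"
    using tent_bounds[OF y0, of 0] C1(1) e1 by (intro mult_mono mult_left_mono) auto
   finally show ?thesis by (simp add: N_def pos_le_eq_atLeastAtMost tm_def mult.assoc)
  qed
  have s0: "smooth_sum y 0 = of_real (\<Sum>d\<in>N. tm d)"
   unfolding smooth_sum_def N_def[symmetric] of_real_sum by (intro sum.cong refl) (auto simp: N_def tm_def)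
  have sk: "smooth_sum y (of_real \<kappa>) = of_real (\<Sum>d\<in>N. tm d * real d powr -\<kappa>)"
   unfolding smooth_sum_def N_def[symmetric] of_real_sum
   by (intro sum.cong refl) (auto simp: N_def tm_def powr_of_real[symmetric])
  define Z where "Z = tailzi y (of_real \<kappa>)"
  define Se where "Se = (\<Sum>n | 0 < n \<and> real n <= x. of_real (tconv a c y n)
    - tailzi y (of_real (real c / real a)) * of_real (pw a n))"
  have psum: "(\<Sum>n | 0 < n \<and> real n <= x. pw a n) = of_int \<lfloor>X\<rfloor>"
  proof -
   have "(\<Sum>n | 0 < n \<and> real n <= x. pw a n) = (\<Sum>n | 0 < n \<and> real n <= x. dconv (pw a) (psup c dunit) n)"
    using dconv_dunit_right[of _ "pw a"] psup_dunit[OF a0(3), abs_def] by (intro sum.cong) auto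
   also have "... = (\<Sum>d\<in>{1}. dunit d * of_int \<lfloor>x powr (1 / real a) * real d powr -(real c / real a)\<rfloor>)"
    by (rule hyperbola_sum) (use a0 x in \<open>auto simp: dunit_def\<close>)
   finally show ?thesis by (simp add: dunit_def X_def)
  qed
  have tail: "of_real (\<Sum>n | 0 < n \<and> real n <= x. tconv a c y n) = Se + Z * of_int \<lfloor>X\<rfloor>"
  proof -
   have "Se = of_real (\<Sum>n | 0 < n \<and> real n <= x. tconv a c y n)
    - Z * of_real (\<Sum>n | 0 < n \<and> real n <= x. pw a n)"
    unfolding Se_def Z_def \<kappa>_def sum_subtractf of_real_sum sum_distrib_left ..
   then show ?thesis by (simp add: psum)
  qed
  have smooth: "(\<Sum>n | 0 < n \<and> real n <= x. dconv (pw a) (psup c tm) n) = (\<Sum>d\<in>N. tm d * of_int \<lfloor>X * real d powr -\<kappa>\<rfloor>)"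
   unfolding X_def \<kappa>_def
  proof (rule hyperbola_sum)
   show "tm d = 0" if "0 < d" "d \<notin> N" for d
    using that tent_eq_0[OF y0, of d] by (auto simp: tm_def N_def)
  qed (use a0 x finN in \<open>auto simp: N_def\<close>)
  \<comment> \<open>The floor is \<psi> plus X d^(-\<kappa>) minus 1/2. The second part yields the
    main term and the constant yields \<open>smooth_sum y 0\<close>.\<close>
  have smooth2: "(\<Sum>d\<in>N. tm d * of_int \<lfloor>X * real d powr -\<kappa>\<rfloor>)
    = (\<Sum>d\<in>N. tm d * \<psi> d) + X * (\<Sum>d\<in>N. tm d * real d powr -\<kappa>) - (\<Sum>d\<in>N. tm d) / 2"
   unfolding sum_distrib_left sum_divide_distrib sum.distrib[symmetric] sum_subtractf[symmetric]
   by (intro sum.cong refl) (simp add: \<psi>_def algebra_simps)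
  have "(\<Sum>n \<in> {n. 1 <= n \<and> real n <= x}. u2 a c n) = of_real (\<Sum>n | 0 < n \<and> real n <= x. dconv (pw a) (psup c moebius2) n)"
   unfolding of_real_sum by (intro sum.cong) (auto simp: u2_eq a0)
  also have "(\<Sum>n | 0 < n \<and> real n <= x. dconv (pw a) (psup c moebius2) n)
   = (\<Sum>n | 0 < n \<and> real n <= x. dconv (pw a) (psup c tm) n) + (\<Sum>n | 0 < n \<and> real n <= x. tconv a c y n)"
  proof -
   have "psup c moebius2 = (%n. psup c tm n + psup c (tailmu y) n)"
    unfolding psup_def sum.distrib[symmetric] by (intro ext sum.cong refl) (simp add: tm_def tailmu_def algebra_simps)
   then show ?thesis by (simp add: dconv_add_right sum.distrib)
  qed
  finally have main: "(\<Sum>n \<in> {n. 1 <= n \<and> real n <= x}. u2 a c n)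
    = of_real (\<Sum>d\<in>N. tm d * \<psi> d) + of_real X * smooth_sum y (of_real \<kappa>) - smooth_sum y 0 / 2 + (Se + Z * of_int \<lfloor>X\<rfloor>)"
   unfolding of_real_add tail smooth smooth2 s0 sk by simp
  have "Delta2 a c x = (\<Sum>n \<in> {n. 1 <= n \<and> real n <= x}. u2 a c n) - of_real X * (Z + smooth_sum y (of_real \<kappa>))"
   unfolding Delta2_def X_def[symmetric] \<kappa>_def[symmetric] Z_def tailzi_def by (simp add: zi2_def)
  \<comment> \<open>The part X Z of the main term is missing from the smooth sum, but the tail
    supplies Z times the floor of X; only Z times a fractional part survives.\<close>
  then have D: "Delta2 a c x = of_real (\<Sum>d\<in>N. tm d * \<psi> d) - smooth_sum y 0 / 2 + Se + Z * of_real (of_int \<lfloor>X\<rfloor> - X)"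
   unfolding main by (simp add: algebra_simps)
  have "cmod (Delta2 a c x) <= cmod (of_real (\<Sum>d\<in>N. tm d * \<psi> d)) + cmod (smooth_sum y 0 / 2) + cmod Se + cmod (Z * of_real (of_int \<lfloor>X\<rfloor> - X))"
   unfolding D by (intro order_trans[OF norm_triangle_ineq] add_right_mono norm_triangle_ineq4)
  also have "... <= C1 * E + C2 * E + C3 * E + C4 * E"
  proof (intro add_mono)
   show "cmod (of_real (\<Sum>d\<in>N. tm d * \<psi> d)) <= C1 * E" using t1 by (simp only: norm_of_real)
   have "cmod (smooth_sum y 0) <= C2 * E"
    using C2(2)[OF y] mult_left_mono[OF e2, of C2] C2(1) by linarith
   then show "cmod (smooth_sum y 0 / 2) <= C2 * E" using norm_ge_zero[of "smooth_sum y 0"] unfolding norm_divide norm_numeral by linarith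
   show "cmod Se <= C3 * E"
    unfolding Se_def
    by (rule order_trans[OF C3(2)[OF x(1) y, unfolded mult.assoc] mult_left_mono[OF e3]]) (use C3(1) in simp)
   have "cmod Z <= C4 * y powr (1/2 + \<delta> - \<kappa>)"
    using C4(2)[OF y, of "of_real \<kappa>"] d k by (simp add: Z_def tailzi_def)
   also have "... <= C4 * y powr 0" using C4(1) y d k by (intro mult_left_mono powr_mono) auto
   finally have "cmod Z <= C4" using y by simp
   moreover have "\<bar>of_int \<lfloor>X\<rfloor> - X\<bar> <= 1" using floor_correct[of X] by linarith
   ultimately have "cmod Z * \<bar>of_int \<lfloor>X\<rfloor> - X\<bar> <= C4 * 1" using C4(1) by (intro mult_mono) auto
   also have "... <= C4 * E" using C4(1) E1 by (intro mult_left_mono) auto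
   finally show "cmod (Z * of_real (of_int \<lfloor>X\<rfloor> - X)) <= C4 * E" unfolding norm_mult norm_of_real .
  qed
  also have "... = (C1 + C2 + C3 + C4) * E" by (simp add: algebra_simps)
  finally show "cmod (Delta2 a c x) <= (C1 + C2 + C3 + C4) * x powr (7 / (8 * real c + 6 * real a) + \<epsilon>)"
   by (simp add: E_def Q_def)
 qed
qed

end
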